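(* Let $c=0$ (i.e. $\alpha=\pi/2$) and $0<\kappa\le1$. Then for every $g\in SO(3)$ there is an optimal decomposition of $g$ (so the infimum of Problem 1 is attained) which is a subword of one of the following patterns or of a pattern obtained from one of them by a symmetry in the group $(X,Y)\mapsto\{\pm X,\pm Y\}$: (I) $R(t_XX)\,R(t_YY)\,R(-t_XX)\,R(-t_YY)$, where $0<t_X,t_Y\le\pi$ and $\tan(t_X/2)=\kappa\tan(t_Y/2)$; (II) $R(\pi X)\,R(tW_+)\,R(\pi X)$ with $t\ge0$; (III) $R(\pi X)\,R(tW_+)\,R(-\pi Y)$ with $t\ge 0$.
   Context: Fix unit vectors $X,Y\in\mathbb R^3$ with angle $\alpha\in(0,\pi/2]$, $c=\cos\alpha\in[0,1)$, and $\kappa\in[0,1]$. For a unit vector $v$, $R(tv)\in SO(3)$ is rotation by angle $t$ about $v$ (counterclockwise viewed from the tip): $R(tv)=\cos t\,I+\sin t\,[v]_\times+(1-\cos t)vv^T$, $[v]_\times w=v\times w$; for nonzero non-unit $v$, $R(tv):=R((t|v|)\,v/|v|)$. For nonzero $C=aX+bY$, $\mathrm{cost}(C)=|a|+\kappa|b|$. A decomposition of $g\in SO(3)$ is a finite product $g=R(\tau_1C_1)\cdots R(\tau_nC_n)$ with $\tau_j\ge0$, $C_j$ nonzero in $\mathrm{span}\{X,Y\}$ (a factor $R(-\tau C)$, $\tau\ge0$, means $R(\tau(-C))$), with cost $\sum\tau_j\mathrm{cost}(C_j)$. Problem 1: minimize the cost over all decompositions of $g$; a decomposition is optimal if its cost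 equals the infimum. Set $W_+=(1+\kappa c)X-(\kappa+c)Y$, $W_-=(1-\kappa c)X+(\kappa-c)Y$. Subword: for a word $R(\tau_1C_1)\cdots R(\tau_nC_n)$ ($\tau_j\ge0$), a subword is $R(\tau_k'C_k)R(\tau_{k+1}C_{k+1})\cdots R(\tau_{m-1}C_{m-1})R(\tau_m'C_m)$ with $1\le k\le m\le n$, $0\le\tau_k'\le\tau_k$, $0\le\tau_m'\le\tau_m$ (for $k=m$ a single factor $R(\tau'C_k)$, $0\le\tau'\le\tau_k$). Symmetries of patterns: labels are $\pm X,\pm Y,\pm W_+,\pm W_-$; define label maps, each extended by $\sigma(-C)=-\sigma(C)$: $\nu:C\mapsto -C$; $\rho: X\mapsto X,\ Y\mapsto -Y,\ W_+\mapsto W_-,\ W_-\mapsto W_+$; $\varsigma: X\mapsto Y,\ Y\mapsto X,\ W_+\mapsto -W_+,\ W_-\mapsto W_-$. Applying $\nu$ or $\rho$ to a pattern replaces each label by its image and keeps the times. Applying $\varsigma$ replaces each label by its image and additionally interchanges $t_X\leftrightarrow t_Y$ (and $\hat t_X\leftrightarrow\hat t_Y$ where present), times $\pi$ and free parameters $t$ unchanged, so that factors labelled $\pm X$ carry the $X$-time and factors labelled $\pm Y$ carry the $Y$-time; stated relations and ranges (e.g. $\tan(t_X/2)=\kappa\tan(t_Y/2)$, $0<t_X,t_Y\le\pi$) are kept verbatim. "Symmetric under $(X,Y)\mapsto\{\pm X,\pm Y\}$" means images under the 8-element group generated by $\nu,\rho,\varsigma$. *)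

theory Defs
  imports "HOL-Analysis.Analysis"
begin

definition SO3 :: "(real^3^3) set" where
  "SO3 = {g. orthogonal_matrix g \<and> det g = 1}"

definition rot_unit :: "real \<Rightarrow> real^3 \<Rightarrow> real^3^3" where
  "rot_unit t u = cos t *\<^sub>R mat 1 + sin t *\<^sub>R matrix (\<lambda>w. cross3 u w)
                  + (1 - cos t) *\<^sub>R matrix (\<lambda>w. (u \<bullet> w) *\<^sub>R u)"

definition rot :: "real \<Rightarrow> real^3 \<Rightarrow> real^3^3" where
  "rot t v = rot_unit (t * norm v) ((1 / norm v) *\<^sub>R v)"

definition cost :: "real^3 \<Rightarrow> real^3 \<Rightarrow> real \<Rightarrow> real^3 \<Rightarrow> real" where
  "cost X Y \<kappa> C = (THE r. \<exists>a b. C = a *\<^sub>R X + b *\<^sub>R Y \<and> r = \<bar>a\<bar> + \<kappa> * \<bar>b\<bar>)"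

definition word_prod :: "(real \<times> (real^3)) list \<Rightarrow> real^3^3" where
  "word_prod w = foldr (\<lambda>(\<tau>, C) acc. rot \<tau> C ** acc) w (mat 1)"

definition word_cost :: "real^3 \<Rightarrow> real^3 \<Rightarrow> real \<Rightarrow> (real \<times> (real^3)) list \<Rightarrow> real" where
  "word_cost X Y \<kappa> w = sum_list (map (\<lambda>(\<tau>, C). \<tau> * cost X Y \<kappa> C) w)"

definition is_decomposition ::
  "real^3 \<Rightarrow> real^3 \<Rightarrow> real^3^3 \<Rightarrow> (real \<times> (real^3)) list \<Rightarrow> bool" where
  "is_decomposition X Y g w \<longleftrightarrow>
     (\<forall>(\<tau>, C) \<in> set w. 0 \<le> \<tau> \<and> C \<noteq> 0 \<and> C \<in> span {X, Y}) \<and> word_prod w = g"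

definition is_optimal ::
  "real^3 \<Rightarrow> real^3 \<Rightarrow> real \<Rightarrow> real^3^3 \<Rightarrow> (real \<times> (real^3)) list \<Rightarrow> bool" where
  "is_optimal X Y \<kappa> g w \<longleftrightarrow> is_decomposition X Y g w \<and>
     word_cost X Y \<kappa> w = Inf {word_cost X Y \<kappa> w' | w'. is_decomposition X Y g w'}"

definition is_subword :: "(real \<times> (real^3)) list \<Rightarrow> (real \<times> (real^3)) list \<Rightarrow> bool" where
  "is_subword v w \<longleftrightarrow>
     (\<exists>k m \<tau>1 \<tau>2. k \<le> m \<and> m < length w \<and>
        0 \<le> \<tau>1 \<and> \<tau>1 \<le> fst (w ! k) \<and> 0 \<le> \<tau>2 \<and> \<tau>2 \<le> fst (w ! m) \<and>
        v = (if k = m then [(\<tau>1, snd (w ! k))]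
             else [(\<tau>1, snd (w ! k))] @ drop (Suc k) (take m w) @ [(\<tau>2, snd (w ! m))]))"

datatype base_label = LX | LY | LWp | LWm

text \<open>A label is a sign (True = +, False = -) and a base label.\<close>
type_synonym label = "bool \<times> base_label"

datatype time_sym = TX | TY | TPi | TT

type_synonym pattern = "(time_sym \<times> label) list"

definition Wplus :: "real^3 \<Rightarrow> real^3 \<Rightarrow> real \<Rightarrow> real^3" where
  "Wplus X Y \<kappa> = (let c = X \<bullet> Y in (1 + \<kappa> * c) *\<^sub>R X - (\<kappa> + c) *\<^sub>R Y)"

definition Wminus :: "real^3 \<Rightarrow> real^3 \<Rightarrow> real \<Rightarrow> real^3" where
  "Wminus X Y \<kappa> = (let c = X \<bullet> Y in (1 - \<kappa> * c) *\<^sub>R X + (\<kappa> - c) *\<^sub>R Y)"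

fun base_vec :: "real^3 \<Rightarrow> real^3 \<Rightarrow> real \<Rightarrow> base_label \<Rightarrow> real^3" where
  "base_vec X Y \<kappa> LX = X"
| "base_vec X Y \<kappa> LY = Y"
| "base_vec X Y \<kappa> LWp = Wplus X Y \<kappa>"
| "base_vec X Y \<kappa> LWm = Wminus X Y \<kappa>"

definition label_vec :: "real^3 \<Rightarrow> real^3 \<Rightarrow> real \<Rightarrow> label \<Rightarrow> real^3" where
  "label_vec X Y \<kappa> l = (if fst l then base_vec X Y \<kappa> (snd l) else - base_vec X Y \<kappa> (snd l))"

fun time_val :: "real \<times> real \<times> real \<Rightarrow> time_sym \<Rightarrow> real" where
  "time_val (tX, tY, t) TX = tX"
| "time_val (tX, tY, t) TY = tY"
| "time_val (tX, tY, t) TPi = pi"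
| "time_val (tX, tY, t) TT = t"

definition pattern_word ::
  "real^3 \<Rightarrow> real^3 \<Rightarrow> real \<Rightarrow> real \<times> real \<times> real \<Rightarrow> pattern \<Rightarrow> (real \<times> (real^3)) list" where
  "pattern_word X Y \<kappa> p P = map (\<lambda>(ts, l). (time_val p ts, label_vec X Y \<kappa> l)) P"

definition nu_lab :: "label \<Rightarrow> label" where
  "nu_lab l = (\<not> fst l, snd l)"

fun rho_base :: "base_label \<Rightarrow> label" where
  "rho_base LX = (True, LX)"
| "rho_base LY = (False, LY)"
| "rho_base LWp = (True, LWm)"
| "rho_base LWm = (True, LWp)"

fun vsig_base :: "base_label \<Rightarrow> label" where
  "vsig_base LX = (True, LY)"
| "vsig_base LY = (True, LX)"
| "vsig_base LWp = (False, LWp)"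
| "vsig_base LWm = (True, LWm)"

definition ext_lab :: "(base_label \<Rightarrow> label) \<Rightarrow> label \<Rightarrow> label" where
  "ext_lab f l = (let m = f (snd l) in if fst l then m else nu_lab m)"

fun swap_time :: "time_sym \<Rightarrow> time_sym" where
  "swap_time TX = TY"
| "swap_time TY = TX"
| "swap_time TPi = TPi"
| "swap_time TT = TT"

datatype gen = Gnu | Grho | Gvsig

fun apply_gen :: "gen \<Rightarrow> pattern \<Rightarrow> pattern" where
  "apply_gen Gnu P = map (\<lambda>(ts, l). (ts, nu_lab l)) P"
| "apply_gen Grho P = map (\<lambda>(ts, l). (ts, ext_lab rho_base l)) P"
| "apply_gen Gvsig P = map (\<lambda>(ts, l). (swap_time ts, ext_lab vsig_base l)) P"

text \<open>Images of a pattern under the (finite) group generated by nu, rho, varsigma: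
  all finite compositions of generators.\<close>
definition sym_images :: "pattern \<Rightarrow> pattern set" where
  "sym_images P = {foldr apply_gen gs P | gs. True}"

definition patI :: pattern where
  "patI = [(TX, (True, LX)), (TY, (True, LY)), (TX, (False, LX)), (TY, (False, LY))]"

definition patII :: pattern where
  "patII = [(TPi, (True, LX)), (TT, (True, LWp)), (TPi, (True, LX))]"

definition patIII :: pattern where
  "patIII = [(TPi, (True, LX)), (TT, (True, LWp)), (TPi, (False, LY))]"

text \<open>Admissible parameter values (t_X, t_Y, t) for each pattern (kept verbatim
  under the symmetries).\<close>
definition paramsI :: "real \<Rightarrow> (real \<times> real \<times> real) set" where
  "paramsI \<kappa> = {(tX, tY, t). 0 < tX \<and> tX \<le> pi \<and> 0 < tY \<and> tY \<le> pi \<and>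
                             tan (tX / 2) = \<kappa> * tan (tY / 2)}"

definition paramsII :: "(real \<times> real \<times> real) set" where
  "paramsII = {(tX, tY, t). 0 \<le> t}"

definition thm21_words :: "real^3 \<Rightarrow> real^3 \<Rightarrow> real \<Rightarrow> (real \<times> (real^3)) list set" where
  "thm21_words X Y \<kappa> =
     {pattern_word X Y \<kappa> p P | p P. P \<in> sym_images patI \<and> p \<in> paramsI \<kappa>} \<union>
     {pattern_word X Y \<kappa> p P | p P. P \<in> sym_images patII \<and> p \<in> paramsII} \<union>
     {pattern_word X Y \<kappa> p P | p P. P \<in> sym_images patIII \<and> p \<in> paramsII}"

end

theory Submission
  imports Defs
begin

text \<open>A rotation lifts to a unit quaternion \<open>\<plusminus>(w, x, y, z)\<close> in the frame \<open>X, Y, X \<times> Y\<close>. Flipping the signs of \<open>X\<close> and \<open>Y\<close> and reversing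
  words preserves the cost, so the minimal cost depends only on the absolute values of the coordinates. On this folded chamber there is an explicit
  candidate for it, \<open>value_fun\<close>: where \<open>x y \<le> w z\<close> it is the cheapest word of pattern (I), otherwise the cost of a word of pattern (II) or (III),
  where the three kinds of words \<open>XWX\<close>, \<open>YWY\<close>, \<open>XWY\<close> occupy three regions and agree on the interfaces.

  The candidate is a calibration: it is lower semicontinuous and touched from above by smooth functions whose derivative along \<open>a X + b Y\<close> is
  at most \<open>|a| + \<kappa> |b|\<close>. By a Dini argument it grows at most at the rate of the cost along every path that avoids the edges, i.e. the points with two
  vanishing coordinates. The edges span finitely many planes in dimension four, so the starting points from which a given word meets them are negligible,
  and a start arbitrarily close to \<open>1\<close> avoids them. Since the set of pairs (endpoint, cost) of candidate words is compact, the limit yields, for every word, a candidate word with the same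
  endpoint that is not more expensive; compactness also gives the minimum. Undoing the folding turns the candidate into a subword of a pattern.\<close>

section \<open>Gradient bounds\<close>

text \<open>The bound |a| + \<kappa> |b| says that the slopes of the candidate along X and Y never
  exceed 1 and \<kappa> in absolute value; a word is a path, so its cost bounds the growth of the
  candidate along it. Three obstacles shape the argument. The cost of the words of pattern (I) is
  not given by one closed formula: it is a minimum over the length of the first letter, and freezing
  the minimiser at one point gives a smooth function that touches from above nearby. Stationarity in
  that length is exactly the relation tan (t_X / 2) = \<kappa> tan (t_Y / 2), which is where pattern
  (I) comes from. At interfaces of regions and at creases of the folding a derivative may be
  missing; but only growth to the right has to be bounded from above, so finitely many smooth
  functions, one of which dominates at each nearby point, do the work of a derivative. Finally, the
  identity itself lies on the edges, so no path can start there; starting nearby costs an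
  arbitrarily small amount, and the limit restores the identity.\<close>

text \<open>The velocities are those of right multiplication (\<open>\<sigma> = 1\<close>) and left multiplication (\<open>\<sigma> = -1\<close>)
  of a quaternion \<open>(w, x, y, z)\<close> by \<open>exp (t (a X + b Y) / 2)\<close>. Both are needed because passing to absolute values of
  the coordinates may turn the one motion into the other.\<close>

definition grad_bounded :: "real \<Rightarrow> (real \<Rightarrow> real \<Rightarrow> real \<Rightarrow> real \<Rightarrow> real) \<Rightarrow> real \<Rightarrow> real \<Rightarrow> real \<Rightarrow> real \<Rightarrow> bool" where
  "grad_bounded \<kappa> G w x y z \<longleftrightarrow> (\<forall>\<sigma> a b cw cx cy cz t. \<sigma> \<in> {1, -1} \<longrightarrow>
     cw t = w \<longrightarrow> cx t = x \<longrightarrow> cy t = y \<longrightarrow> cz t = z \<longrightarrow>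
     (cw has_real_derivative (- a * x - b * y) / 2) (at t) \<longrightarrow>
     (cx has_real_derivative (a * w - \<sigma> * b * z) / 2) (at t) \<longrightarrow>
     (cy has_real_derivative (\<sigma> * a * z + b * w) / 2) (at t) \<longrightarrow>
     (cz has_real_derivative (\<sigma> * b * x - \<sigma> * a * y) / 2) (at t) \<longrightarrow>
     (\<exists>D. ((\<lambda>s. G (cw s) (cx s) (cy s) (cz s)) has_real_derivative D) (at t) \<and> D \<le> \<bar>a\<bar> + \<kappa> * \<bar>b\<bar>))"

text \<open>Exchanging X and Y while keeping z reverses the orientation of the frame, so right
  multiplication becomes left multiplication and the hypothesis is applied with
  \<open>- \<sigma>\<close>. Through this symmetry every bound for a formula also holds for the
  formula with the roles of X and Y exchanged.\<close>

lemma grad_bounded_swap: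
  assumes "grad_bounded (1 / \<kappa>) G w y x z" "0 < \<kappa>"
  shows "grad_bounded \<kappa> (\<lambda>w x y z. \<kappa> * G w y x z) w x y z"
  unfolding grad_bounded_def
proof (intro allI impI)
  fix \<sigma> a b :: real and cw cx cy cz :: "real \<Rightarrow> real" and t :: real
  assume s: "\<sigma> \<in> {1, -1}" and v: "cw t = w" "cx t = x" "cy t = y" "cz t = z"
    and dw: "(cw has_real_derivative (- a * x - b * y) / 2) (at t)"
    and dx: "(cx has_real_derivative (a * w - \<sigma> * b * z) / 2) (at t)"
    and dy: "(cy has_real_derivative (\<sigma> * a * z + b * w) / 2) (at t)"
    and dz: "(cz has_real_derivative (\<sigma> * b * x - \<sigma> * a * y) / 2) (at t)"
  have s': "- \<sigma> \<in> {1, -1}" using s by auto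
  have dw': "(cw has_real_derivative (- b * y - a * x) / 2) (at t)"
    by (rule DERIV_cong[OF dw]) algebra
  have dy': "(cy has_real_derivative (b * w - (- \<sigma>) * a * z) / 2) (at t)"
    by (rule DERIV_cong[OF dy]) (simp add: algebra_simps)
  have dx': "(cx has_real_derivative ((- \<sigma>) * b * z + a * w) / 2) (at t)"
    by (rule DERIV_cong[OF dx]) (simp add: algebra_simps)
  have dz': "(cz has_real_derivative ((- \<sigma>) * a * y - (- \<sigma>) * b * x) / 2) (at t)"
    by (rule DERIV_cong[OF dz]) (simp add: algebra_simps)
  obtain D where D: "((\<lambda>s. G (cw s) (cy s) (cx s) (cz s)) has_real_derivative D) (at t)"
    "D \<le> \<bar>b\<bar> + (1 / \<kappa>) * \<bar>a\<bar>"
    using assms(1)[unfolded grad_bounded_def, rule_format, OF s' v(1) v(3) v(2) v(4) dw' dy' dx' dz'] by auto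
  have "((\<lambda>s. \<kappa> * G (cw s) (cy s) (cx s) (cz s)) has_real_derivative \<kappa> * D) (at t)"
    by (rule DERIV_cmult[OF D(1)])
  moreover have "\<kappa> * D \<le> \<bar>a\<bar> + \<kappa> * \<bar>b\<bar>"
  proof -
    have "\<kappa> * D \<le> \<kappa> * (\<bar>b\<bar> + (1 / \<kappa>) * \<bar>a\<bar>)" using D(2) assms(2) by (intro mult_left_mono) auto
    also have "\<dots> = \<kappa> * \<bar>b\<bar> + \<bar>a\<bar>" using assms(2) by (simp add: distrib_left)
    finally show ?thesis by simp
  qed
  ultimately show "\<exists>D. ((\<lambda>s. \<kappa> * G (cw s) (cy s) (cx s) (cz s)) has_real_derivative D) (at t) \<and> D \<le> \<bar>a\<bar> + \<kappa> * \<bar>b\<bar>"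
    by blast
qed

text \<open>For \<open>\<phi> \<le> \<psi>\<close>, this is the cost \<open>2 \<psi> + 2 \<kappa> \<theta>\<close> of the word \<open>exp (a X) exp (\<theta> Y) exp (- \<alpha> X)\<close>, where
  \<open>a + \<alpha> = \<psi>\<close>, \<open>a - \<alpha> = \<phi>\<close> and \<open>(w, x, y, z) = (cos \<theta> cos \<phi>, cos \<theta> sin \<phi>, sin \<theta> cos \<psi>, sin \<theta> sin \<psi>)\<close>.\<close>

definition euler_cost :: "real \<Rightarrow> real \<Rightarrow> real \<Rightarrow> real \<Rightarrow> real \<Rightarrow> real" where
  "euler_cost \<kappa> w x y z = 2 * (pi / 2 - arctan (y / z)) + 2 * \<kappa> * arctan (sqrt ((y\<^sup>2 + z\<^sup>2) / (w\<^sup>2 + x\<^sup>2)))"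

text \<open>With r = cos \<theta> and p = sin \<theta> the two terms are the derivatives of 2 \<psi>
  and of 2 \<kappa> \<theta>. The velocity is only required to be tangent to the sphere
  (\<open>o\<close>), so that one formula serves both the motions and the shift by \<beta>.\<close>

lemma euler_cost_deriv:
  assumes v: "cw t = w" "cx t = x" "cy t = y" "cz t = z"
    and d: "(cw has_real_derivative w') (at t)" "(cx has_real_derivative x') (at t)"
    "(cy has_real_derivative y') (at t)" "(cz has_real_derivative z') (at t)"
    and u: "w\<^sup>2 + x\<^sup>2 + y\<^sup>2 + z\<^sup>2 = 1" and o: "w * w' + x * x' + y * y' + z * z' = 0"
    and z: "0 < z" and r: "r\<^sup>2 = w\<^sup>2 + x\<^sup>2" "0 < r" and p: "p\<^sup>2 = y\<^sup>2 + z\<^sup>2" "0 < p"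
  shows "((\<lambda>s. euler_cost \<kappa> (cw s) (cx s) (cy s) (cz s)) has_real_derivative
     2 * (y * z' - z * y') / p\<^sup>2 + 2 * \<kappa> * (y * y' + z * z') / (p * r)) (at t)"
proof -
  have rp: "r\<^sup>2 + p\<^sup>2 = 1" using u r p by simp
  have s: "sqrt (p\<^sup>2 / r\<^sup>2) = p / r" using r(2) p(2) by (simp add: real_sqrt_divide)
  have 1: "((\<lambda>s. arctan (cy s / cz s)) has_real_derivative (z * y' - y * z') / p\<^sup>2) (at t)"
  proof -
    have "((\<lambda>s. cy s / cz s) has_real_derivative (y' * z - y * z') / (z * z)) (at t)"
      using DERIV_divide[OF d(3,4)] v z by simp
    from DERIV_chain2[OF DERIV_arctan this]
    have "((\<lambda>s. arctan (cy s / cz s)) has_real_derivative inverse (1 + (y / z)\<^sup>2) * ((y' * z - y * z') / (z * z))) (at t)"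
      using v by simp
    moreover have "1 + (y / z)\<^sup>2 = p\<^sup>2 / z\<^sup>2" using z p by (simp add: field_simps)
    ultimately show ?thesis using z by (simp add: power2_eq_square mult.commute)
  qed
  have 2: "((\<lambda>s. ((cy s)\<^sup>2 + (cz s)\<^sup>2) / ((cw s)\<^sup>2 + (cx s)\<^sup>2)) has_real_derivative
     2 * (y * y' + z * z') / r ^ 4) (at t)"
  proof -
    have "((\<lambda>s. ((cy s)\<^sup>2 + (cz s)\<^sup>2) / ((cw s)\<^sup>2 + (cx s)\<^sup>2)) has_real_derivative
     ((2 * y * y' + 2 * z * z') * r\<^sup>2 - p\<^sup>2 * (2 * w * w' + 2 * x * x')) / (r\<^sup>2 * r\<^sup>2)) (at t)"
      apply (rule derivative_eq_intros d | use v r in force)+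
      using v p r by (simp add: algebra_simps)
    moreover have "(2 * y * y' + 2 * z * z') * r\<^sup>2 - p\<^sup>2 * (2 * w * w' + 2 * x * x') = 2 * (y * y' + z * z') * (r\<^sup>2 + p\<^sup>2)"
      using o by algebra
    ultimately show ?thesis using rp by (simp add: power4_eq_xxxx power2_eq_square mult.assoc)
  qed
  have pos: "((cy t)\<^sup>2 + (cz t)\<^sup>2) / ((cw t)\<^sup>2 + (cx t)\<^sup>2) > 0" using v r p by (metis divide_pos_pos zero_less_power)
  have 3: "((\<lambda>s. arctan (sqrt (((cy s)\<^sup>2 + (cz s)\<^sup>2) / ((cw s)\<^sup>2 + (cx s)\<^sup>2)))) has_real_derivative
     (y * y' + z * z') / (p * r)) (at t)"
  proof -
    have "((\<lambda>s. sqrt (((cy s)\<^sup>2 + (cz s)\<^sup>2) / ((cw s)\<^sup>2 + (cx s)\<^sup>2))) has_real_derivative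
      inverse (p / r) / 2 * (2 * (y * y' + z * z') / r ^ 4)) (at t)"
      using DERIV_chain2[OF DERIV_real_sqrt[OF pos] 2] v r p s by (simp add: mult.assoc)
    note ch = DERIV_chain2[OF DERIV_arctan this]
    have st: "sqrt (((cy t)\<^sup>2 + (cz t)\<^sup>2) / ((cw t)\<^sup>2 + (cx t)\<^sup>2)) = p / r" using s v r(1) p(1) by simp
    have "((\<lambda>s. arctan (sqrt (((cy s)\<^sup>2 + (cz s)\<^sup>2) / ((cw s)\<^sup>2 + (cx s)\<^sup>2)))) has_real_derivative
      inverse (1 + (p / r)\<^sup>2) * (inverse (p / r) / 2 * (2 * (y * y' + z * z') / r ^ 4))) (at t)"
      using ch unfolding st .
    moreover have "1 + (p / r)\<^sup>2 = 1 / r\<^sup>2" using rp r(2) by (simp add: field_simps)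
    moreover have "inverse (1 / r\<^sup>2) * (inverse (p / r) / 2 * (2 * (y * y' + z * z') / r ^ 4)) = (y * y' + z * z') / (p * r)"
      using r(2) p(2) by (simp add: field_simps power4_eq_xxxx power2_eq_square)
    ultimately show ?thesis by simp
  qed
  have "((\<lambda>s. 2 * (pi / 2 - arctan (cy s / cz s)) + 2 * \<kappa> * arctan (sqrt (((cy s)\<^sup>2 + (cz s)\<^sup>2) / ((cw s)\<^sup>2 + (cx s)\<^sup>2))))
    has_real_derivative 2 * (0 - (z * y' - y * z') / p\<^sup>2) + 2 * \<kappa> * ((y * y' + z * z') / (p * r))) (at t)"
    by (intro DERIV_add DERIV_cmult DERIV_diff DERIV_const 1 3)
  then show ?thesis unfolding euler_cost_def by (simp add: algebra_simps diff_divide_distrib)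
qed

text \<open>Half the derivative of \<open>shift_cost\<close> below.\<close>

definition shift_slope :: "real \<Rightarrow> real \<Rightarrow> real \<Rightarrow> real \<Rightarrow> real \<Rightarrow> real" where
  "shift_slope \<kappa> w x y z = (let r = sqrt (w\<^sup>2 + x\<^sup>2); p = sqrt (y\<^sup>2 + z\<^sup>2) in
     \<kappa> * (y * w - z * x) / (p * r) - (x * y + w * z) / p\<^sup>2 + \<kappa>)"

text \<open>The quantity is the coefficient of b in the derivative of \<open>euler_cost\<close>.
  From above, the first term is at most 0 because \<open>x * y \<le> w * z\<close>, and the second
  is at most \<kappa> by Cauchy-Schwarz. From below, \<sigma> = -1 is the worst sign, and for it the
  bound is the sign condition on \<open>shift_slope\<close>.\<close>

lemma Y_slope_bounds:
  assumes nn: "0 \<le> w" "0 \<le> x" "0 \<le> y" "0 < z" and k: "0 < \<kappa>" and le: "x * y \<le> w * z"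
    and r: "r\<^sup>2 = w\<^sup>2 + x\<^sup>2" "0 < r" and p: "p\<^sup>2 = y\<^sup>2 + z\<^sup>2" "0 < p"
    and b: "0 \<le> shift_slope \<kappa> w x y z"
    and s: "\<sigma> \<in> {1, -1}"
  shows "\<bar>(\<sigma> * x * y - w * z) / p\<^sup>2 + \<kappa> * (y * w + \<sigma> * z * x) / (p * r)\<bar> \<le> \<kappa>"
proof -
  have [simp]: "sqrt (w\<^sup>2 + x\<^sup>2) = r" "sqrt (y\<^sup>2 + z\<^sup>2) = p" using r p by (metis less_imp_le real_sqrt_unique)+
  have b': "- \<kappa> \<le> (- x * y - w * z) / p\<^sup>2 + \<kappa> * (y * w - z * x) / (p * r)"
  proof -
    have "(- x * y - w * z) / p\<^sup>2 = - ((x * y + w * z) / p\<^sup>2)" using p(2) by (simp add: field_simps)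
    then show ?thesis using b by (simp add: shift_slope_def Let_def)
  qed
  have xy: "0 \<le> x * y" "0 \<le> z * x" "0 \<le> y * w" using nn by auto
  have m: "- x * y \<le> \<sigma> * x * y" "- (z * x) \<le> \<sigma> * z * x" "\<sigma> * x * y \<le> w * z" using s xy le by auto
  have 1: "(- x * y - w * z) / p\<^sup>2 \<le> (\<sigma> * x * y - w * z) / p\<^sup>2"
    using m by (intro divide_right_mono) auto
  have 2: "\<kappa> * (y * w - z * x) / (p * r) \<le> \<kappa> * (y * w + \<sigma> * z * x) / (p * r)"
    using m(2) k p(2) r(2) by (intro divide_right_mono mult_left_mono) auto
  have 3: "(\<sigma> * x * y - w * z) / p\<^sup>2 \<le> 0" using m(3) p by (simp add: divide_nonpos_nonneg)
  have "(y * w + z * x)\<^sup>2 \<le> (r * p)\<^sup>2"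
  proof -
    have "(r * p)\<^sup>2 - (y * w + z * x)\<^sup>2 = (w * z - x * y)\<^sup>2" unfolding power_mult_distrib r p by algebra
    then show ?thesis by (smt (verit) zero_le_power2)
  qed
  then have "y * w + z * x \<le> r * p" by (rule power2_le_imp_le) (simp add: r(2) p(2) less_imp_le)
  moreover have "\<sigma> * z * x \<le> z * x" using s xy by auto
  ultimately have "y * w + \<sigma> * z * x \<le> r * p" by linarith
  then have "\<kappa> * (y * w + \<sigma> * z * x) / (p * r) \<le> \<kappa>"
    using mult_left_mono[of "y * w + \<sigma> * z * x" "r * p" \<kappa>] k r(2) p(2) by (simp add: pos_divide_le_eq mult_ac)
  moreover have "B \<le> \<kappa> \<Longrightarrow> - \<kappa> \<le> A' + B' \<Longrightarrow> A' \<le> A \<Longrightarrow> B' \<le> B \<Longrightarrow> A \<le> 0 \<Longrightarrow> \<bar>A + B\<bar> \<le> \<kappa>"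
    for A B A' B' :: real by linarith
  ultimately show ?thesis using b' 1 2 3 by blast
qed

lemma linear_form_bound: "\<bar>A\<bar> \<le> 1 \<Longrightarrow> \<bar>B\<bar> \<le> \<kappa> \<Longrightarrow> a * A + b * B \<le> \<bar>a\<bar> + \<kappa> * \<bar>b::real\<bar>"
proof -
  assume A: "\<bar>A\<bar> \<le> 1" and B: "\<bar>B\<bar> \<le> \<kappa>"
  have "a * A \<le> \<bar>a\<bar> * \<bar>A\<bar>" by (metis abs_ge_self abs_mult)
  also have "\<dots> \<le> \<bar>a\<bar> * 1" using A by (intro mult_left_mono) auto
  finally have 1: "a * A \<le> \<bar>a\<bar>" by simp
  have "b * B \<le> \<bar>b\<bar> * \<bar>B\<bar>" by (metis abs_ge_self abs_mult)
  also have "\<dots> \<le> \<bar>b\<bar> * \<kappa>" using B by (intro mult_left_mono) auto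
  finally show ?thesis using 1 by (simp add: mult.commute)
qed

lemma grad_bounded_euler_cost:
  assumes nn: "0 \<le> w" "0 \<le> x" "0 \<le> y" "0 < z" and k: "0 < \<kappa>" and le: "x * y \<le> w * z"
    and u: "w\<^sup>2 + x\<^sup>2 + y\<^sup>2 + z\<^sup>2 = 1" and wx: "0 < w\<^sup>2 + x\<^sup>2"
    and b: "0 \<le> shift_slope \<kappa> w x y z"
  shows "grad_bounded \<kappa> (euler_cost \<kappa>) w x y z"
  unfolding grad_bounded_def
proof (intro allI impI)
  fix \<sigma> a b :: real and cw cx cy cz :: "real \<Rightarrow> real" and t :: real
  assume s: "\<sigma> \<in> {1, -1}" and v: "cw t = w" "cx t = x" "cy t = y" "cz t = z"
    and dw: "(cw has_real_derivative (- a * x - b * y) / 2) (at t)"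
    and dx: "(cx has_real_derivative (a * w - \<sigma> * b * z) / 2) (at t)"
    and dy: "(cy has_real_derivative (\<sigma> * a * z + b * w) / 2) (at t)"
    and dz: "(cz has_real_derivative (\<sigma> * b * x - \<sigma> * a * y) / 2) (at t)"
  define r where "r = sqrt (w\<^sup>2 + x\<^sup>2)"
  define p where "p = sqrt (y\<^sup>2 + z\<^sup>2)"
  have r: "r\<^sup>2 = w\<^sup>2 + x\<^sup>2" "0 < r" using wx by (auto simp: r_def)
  have p: "p\<^sup>2 = y\<^sup>2 + z\<^sup>2" "0 < p" using nn(4) by (auto simp: p_def sum_power2_gt_zero_iff)
  have o: "w * ((- a * x - b * y) / 2) + x * ((a * w - \<sigma> * b * z) / 2) + y * ((\<sigma> * a * z + b * w) / 2) + z * ((\<sigma> * b * x - \<sigma> * a * y) / 2) = 0"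
    by (simp add: field_simps)
  note D = euler_cost_deriv[OF v dw dx dy dz u o nn(4) r p, of \<kappa>]
  \<comment> \<open>The motion along X lengthens or shortens an outer X-letter of the word, so the
    slope along X is \<open>- \<sigma>\<close>, of modulus 1. Only the slope along Y needs the
    hypotheses.\<close>
  have e: "2 * (y * ((\<sigma> * b * x - \<sigma> * a * y) / 2) - z * ((\<sigma> * a * z + b * w) / 2)) / p\<^sup>2
      + 2 * \<kappa> * (y * ((\<sigma> * a * z + b * w) / 2) + z * ((\<sigma> * b * x - \<sigma> * a * y) / 2)) / (p * r)
      = a * (- \<sigma>) + b * ((\<sigma> * x * y - w * z) / p\<^sup>2 + \<kappa> * (y * w + \<sigma> * z * x) / (p * r))" (is "?L = ?R")
  proof -
    have "2 * (y * ((\<sigma> * b * x - \<sigma> * a * y) / 2) - z * ((\<sigma> * a * z + b * w) / 2)) = - (\<sigma> * a) * p\<^sup>2 + b * (\<sigma> * x * y - w * z)"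
      unfolding p by (simp add: field_simps power2_eq_square)
    moreover have "2 * \<kappa> * (y * ((\<sigma> * a * z + b * w) / 2) + z * ((\<sigma> * b * x - \<sigma> * a * y) / 2)) = b * (\<kappa> * (y * w + \<sigma> * z * x))"
      by (simp add: field_simps)
    ultimately have "?L = (- (\<sigma> * a) * p\<^sup>2 + b * (\<sigma> * x * y - w * z)) / p\<^sup>2 + b * (\<kappa> * (y * w + \<sigma> * z * x)) / (p * r)"
      by (simp only:)
    also have "\<dots> = ?R" using p(2) r(2) by (simp add: field_simps)
    finally show ?thesis .
  qed
  have "a * (- \<sigma>) + b * ((\<sigma> * x * y - w * z) / p\<^sup>2 + \<kappa> * (y * w + \<sigma> * z * x) / (p * r)) \<le> \<bar>a\<bar> + \<kappa> * \<bar>b\<bar>"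
    by (rule linear_form_bound) (use s Y_slope_bounds[OF nn k le r p b s] in auto)
  then show "\<exists>D. ((\<lambda>s. euler_cost \<kappa> (cw s) (cx s) (cy s) (cz s)) has_real_derivative D) (at t) \<and> D \<le> \<bar>a\<bar> + \<kappa> * \<bar>b\<bar>"
    using D unfolding e by blast
qed

text \<open>With s = sin \<beta>, c = cos \<beta>, r = cos \<theta>, p = sin \<theta> the conclusion
  reads \<beta> \<le> \<theta>: the first Y-letter is not longer than the second. The hypothesis
  \<open>0 \<le> hy * c - hw * s\<close> expresses that y was nonnegative before the shift.\<close>

lemma shift_angle_le:
  fixes hw :: real
  assumes "0 < hw" "0 \<le> hx" "0 \<le> hy" "0 < hz" "hx * hy \<le> hw * hz"
    and r: "r\<^sup>2 = hw\<^sup>2 + hx\<^sup>2" "0 < r" and p: "p\<^sup>2 = hy\<^sup>2 + hz\<^sup>2" "0 < p"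
    and "0 \<le> hy * c - hw * s" "0 \<le> c"
  shows "s * r \<le> c * p"
proof -
  have "(hy * r)\<^sup>2 \<le> (hw * p)\<^sup>2"
  proof -
    have "(hw * p)\<^sup>2 - (hy * r)\<^sup>2 = (hw * hz)\<^sup>2 - (hx * hy)\<^sup>2" unfolding power_mult_distrib r p by algebra
    moreover have "(hx * hy)\<^sup>2 \<le> (hw * hz)\<^sup>2" using assms by (intro power_mono) auto
    ultimately show ?thesis by linarith
  qed
  then have 1: "hy * r \<le> hw * p" by (rule power2_le_imp_le) (simp add: assms(1) p(2) less_imp_le)
  have "hw * (s * r) = (hw * s) * r" by simp
  also have "\<dots> \<le> (hy * c) * r" using assms by (intro mult_right_mono) auto
  also have "\<dots> = c * (hy * r)" by simp
  also have "\<dots> \<le> c * (hw * p)" using 1 assms by (intro mult_left_mono) auto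
  finally have "hw * (s * r) \<le> hw * (c * p)" by (simp add: mult_ac)
  then show ?thesis using assms(1) by simp
qed

text \<open>Right multiplication commutes with the shift, so \<sigma> = 1 reduces to the bound for
  \<open>euler_cost\<close>. Left multiplication does not commute: the shift turns its X-part by the
  angle 2 \<beta>, and this case needs \<beta> to be stationary, which is the hypothesis
  \<open>b\<close>.\<close>

lemma grad_bounded_shift:
  fixes w :: real
  assumes h: "hw = w * cos \<beta> - y * sin \<beta>" "hx = x * cos \<beta> + z * sin \<beta>"
      "hy = y * cos \<beta> + w * sin \<beta>" "hz = z * cos \<beta> - x * sin \<beta>"
    and pos: "0 < hw" "0 < hx" "0 < hy" "0 < hz" and le: "hx * hy \<le> hw * hz"
    and u: "w\<^sup>2 + x\<^sup>2 + y\<^sup>2 + z\<^sup>2 = 1" and b: "shift_slope \<kappa> hw hx hy hz = 0"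
    and y: "0 \<le> y" and k: "0 < \<kappa>" and \<beta>: "0 < \<beta>" "\<beta> < pi / 2"
  shows "grad_bounded \<kappa> (\<lambda>w x y z. 2 * \<kappa> * \<beta> + euler_cost \<kappa> (w * cos \<beta> - y * sin \<beta>) (x * cos \<beta> + z * sin \<beta>)
           (y * cos \<beta> + w * sin \<beta>) (z * cos \<beta> - x * sin \<beta>)) w x y z"
  unfolding grad_bounded_def
proof (intro allI impI)
  fix \<sigma> a b :: real and cw cx cy cz :: "real \<Rightarrow> real" and t :: real
  assume s: "\<sigma> \<in> {1, -1}" and v: "cw t = w" "cx t = x" "cy t = y" "cz t = z"
    and dw: "(cw has_real_derivative (- a * x - b * y) / 2) (at t)"
    and dx: "(cx has_real_derivative (a * w - \<sigma> * b * z) / 2) (at t)"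
    and dy: "(cy has_real_derivative (\<sigma> * a * z + b * w) / 2) (at t)"
    and dz: "(cz has_real_derivative (\<sigma> * b * x - \<sigma> * a * y) / 2) (at t)"
  define c where "c = cos \<beta>"
  define S where "S = sin \<beta>"
  have cs: "c\<^sup>2 + S\<^sup>2 = 1" by (simp add: c_def S_def)
  have cpos: "0 < c" "0 < S" using \<beta> by (auto simp: c_def S_def cos_gt_zero_pi sin_gt_zero)
  note h = h[folded c_def S_def]
  have uh: "hw\<^sup>2 + hx\<^sup>2 + hy\<^sup>2 + hz\<^sup>2 = 1"
  proof -
    have "hw\<^sup>2 + hx\<^sup>2 + hy\<^sup>2 + hz\<^sup>2 = (w\<^sup>2 + x\<^sup>2 + y\<^sup>2 + z\<^sup>2) * (c\<^sup>2 + S\<^sup>2)" unfolding h by algebra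
    then show ?thesis by (simp add: u cs)
  qed
  define Hw where "Hw = (\<lambda>s. cw s * c - cy s * S)"
  define Hx where "Hx = (\<lambda>s. cx s * c + cz s * S)"
  define Hy where "Hy = (\<lambda>s. cy s * c + cw s * S)"
  define Hz where "Hz = (\<lambda>s. cz s * c - cx s * S)"
  have vH: "Hw t = hw" "Hx t = hx" "Hy t = hy" "Hz t = hz"
    by (simp_all add: Hw_def Hx_def Hy_def Hz_def v h)
  have dH: "(Hw has_real_derivative ((- a * x - b * y) / 2) * c - ((\<sigma> * a * z + b * w) / 2) * S) (at t)"
    "(Hx has_real_derivative ((a * w - \<sigma> * b * z) / 2) * c + ((\<sigma> * b * x - \<sigma> * a * y) / 2) * S) (at t)"
    "(Hy has_real_derivative ((\<sigma> * a * z + b * w) / 2) * c + ((- a * x - b * y) / 2) * S) (at t)"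
    "(Hz has_real_derivative ((\<sigma> * b * x - \<sigma> * a * y) / 2) * c - ((a * w - \<sigma> * b * z) / 2) * S) (at t)"
    unfolding Hw_def Hx_def Hy_def Hz_def
    by (rule DERIV_diff DERIV_add DERIV_cmult_right dw dx dy dz)+
  have "\<exists>D. ((\<lambda>s. euler_cost \<kappa> (Hw s) (Hx s) (Hy s) (Hz s)) has_real_derivative D) (at t) \<and> D \<le> \<bar>a\<bar> + \<kappa> * \<bar>b\<bar>"
  proof (cases "\<sigma> = 1")
    case True
    have g: "grad_bounded \<kappa> (euler_cost \<kappa>) hw hx hy hz"
      by (rule grad_bounded_euler_cost) (use pos le k uh b in \<open>auto simp: sum_power2_gt_zero_iff\<close>)
    show ?thesis
    proof (rule g[unfolded grad_bounded_def, rule_format, of 1])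
      show "(Hw has_real_derivative (- a * hx - b * hy) / 2) (at t)"
        by (rule DERIV_cong[OF dH(1)]) (simp add: True h field_simps)
      show "(Hx has_real_derivative (a * hw - 1 * b * hz) / 2) (at t)"
        by (rule DERIV_cong[OF dH(2)]) (simp add: True h field_simps)
      show "(Hy has_real_derivative (1 * a * hz + b * hw) / 2) (at t)"
        by (rule DERIV_cong[OF dH(3)]) (simp add: True h field_simps)
      show "(Hz has_real_derivative (1 * b * hx - 1 * a * hy) / 2) (at t)"
        by (rule DERIV_cong[OF dH(4)]) (simp add: True h field_simps)
    qed (use vH in auto)
  next
    case False
    then have [simp]: "\<sigma> = -1" using s by auto
    define r where "r = sqrt (hw\<^sup>2 + hx\<^sup>2)"
    define p where "p = sqrt (hy\<^sup>2 + hz\<^sup>2)"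
    have r: "r\<^sup>2 = hw\<^sup>2 + hx\<^sup>2" "0 < r" using pos by (auto simp: r_def sum_power2_gt_zero_iff)
    have p: "p\<^sup>2 = hy\<^sup>2 + hz\<^sup>2" "0 < p" using pos by (auto simp: p_def sum_power2_gt_zero_iff)
    \<comment> \<open>cos (2 \<beta>) and sin (2 \<beta>): the X-generator of the left motion after
      conjugation by the shift.\<close>
    define C2 where "C2 = c\<^sup>2 - S\<^sup>2"
    define S2 where "S2 = 2 * S * c"
    have inv: "y = hy * c - hw * S"
    proof -
      have "hy * c - hw * S = y * (c\<^sup>2 + S\<^sup>2)" unfolding h by algebra
      then show ?thesis by (simp add: cs)
    qed
    have zC: "hz * C2 + hx * S2 = z * c + x * S"
    proof -
      have "hz * C2 + hx * S2 = (z * c + x * S) * (c\<^sup>2 + S\<^sup>2)" unfolding h C2_def S2_def by algebra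
      then show ?thesis by (simp add: cs)
    qed
    have yC: "hy * C2 - hw * S2 = y * c - w * S"
    proof -
      have "hy * C2 - hw * S2 = (y * c - w * S) * (c\<^sup>2 + S\<^sup>2)" unfolding h C2_def S2_def by algebra
      then show ?thesis by (simp add: cs)
    qed
    define y' where "y' = (- a * (hz * C2 + hx * S2) + b * hw) / 2"
    define z' where "z' = (a * (hy * C2 - hw * S2) - b * hx) / 2"
    have dy': "(Hy has_real_derivative y') (at t)"
      apply (rule DERIV_cong[OF dH(3)])
      unfolding y'_def zC h(1) by (simp add: field_simps)
    have dz': "(Hz has_real_derivative z') (at t)"
      apply (rule DERIV_cong[OF dH(4)])
      unfolding z'_def yC h(2) by (simp add: field_simps)
    define w' where "w' = ((- a * x - b * y) / 2) * c - ((\<sigma> * a * z + b * w) / 2) * S"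
    define x' where "x' = ((a * w - \<sigma> * b * z) / 2) * c + ((\<sigma> * b * x - \<sigma> * a * y) / 2) * S"
    have o: "hw * w' + hx * x' + hy * y' + hz * z' = 0"
      unfolding w'_def x'_def y'_def z'_def zC yC unfolding h by (simp add: field_simps)
    note D = euler_cost_deriv[OF vH dH(1)[folded w'_def] dH(2)[folded x'_def] dy' dz' uh o pos(4) r p, of \<kappa>]
    define K where "K = hy * hw - hz * hx"
    define L where "L = hx * hy + hw * hz"
    have KL: "K\<^sup>2 + L\<^sup>2 = (r * p)\<^sup>2" unfolding K_def L_def power_mult_distrib r p by algebra
    have Lpos: "0 < L" using pos by (simp add: L_def add_pos_pos)
    have shift_slope: "\<kappa> * K / (p * r) - L / p\<^sup>2 + \<kappa> = 0"
      using b by (simp add: shift_slope_def Let_def K_def L_def flip: r_def p_def)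
    have Kpr: "0 < K + p * r"
    proof -
      have "K\<^sup>2 < (r * p)\<^sup>2" using KL Lpos by (smt (verit) zero_less_power)
      then have "\<bar>K\<bar> < r * p" using r(2) p(2) by (metis less_imp_le mult_pos_pos power2_abs power2_less_imp_less)
      then show ?thesis by (simp add: mult.commute)
    qed
    \<comment> \<open>With K = r p cos \<chi> and L = r p sin \<chi>, stationarity reads \<kappa> =
      (r / p) tan (\<chi> / 2), and the claim becomes the half-angle identity cos \<chi> + tan
      (\<chi> / 2) sin \<chi> = 1. Positivity of K + p r keeps \<chi> away from the pole.\<close>
    have LZ: "K / p\<^sup>2 + \<kappa> * L / (p * r) = r / p"
    proof -
      have "(\<kappa> * K / (p * r) - L / p\<^sup>2 + \<kappa>) * (p\<^sup>2 * r) = \<kappa> * (K + p * r) * p - L * r"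
        using p(2) r(2) by (simp add: field_simps power2_eq_square)
      then have k1: "\<kappa> * (K + p * r) * p = L * r" unfolding shift_slope by simp
      have "(K * r + \<kappa> * L * p) * (K + p * r) = K * r * (K + p * r) + L * (\<kappa> * (K + p * r) * p)"
        by (simp add: algebra_simps)
      also have "\<dots> = r * (K\<^sup>2 + L\<^sup>2) + K * p * r\<^sup>2"
        unfolding k1 by (simp add: algebra_simps power2_eq_square)
      also have "\<dots> = r\<^sup>2 * p * (K + p * r)" unfolding KL by (simp add: algebra_simps power2_eq_square)
      finally have "(K * r + \<kappa> * L * p) * (K + p * r) = r\<^sup>2 * p * (K + p * r)" .
      then have "K * r + \<kappa> * L * p = r\<^sup>2 * p" using Kpr by simp
      then show ?thesis using p(2) r(2) by (simp add: field_simps power2_eq_square)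
    qed
    have e: "2 * (hy * z' - hz * y') / p\<^sup>2 + 2 * \<kappa> * (hy * y' + hz * z') / (p * r)
       = a * (C2 - S2 * (r / p)) + b * (- \<kappa>)"
    proof -
      have 1: "2 * (hy * z' - hz * y') = a * (C2 * p\<^sup>2 - S2 * K) - b * L"
        unfolding y'_def z'_def K_def L_def p by (simp add: field_simps power2_eq_square)
      have 2: "2 * \<kappa> * (hy * y' + hz * z') = - a * S2 * (\<kappa> * L) + b * (\<kappa> * K)"
        unfolding y'_def z'_def K_def L_def by (simp add: field_simps)
      have "2 * (hy * z' - hz * y') / p\<^sup>2 + 2 * \<kappa> * (hy * y' + hz * z') / (p * r)
        = a * (C2 - S2 * (K / p\<^sup>2 + \<kappa> * L / (p * r))) + b * (\<kappa> * K / (p * r) - L / p\<^sup>2)"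
        unfolding 1 2 using p(2) r(2) by (simp add: field_simps)
      also have "\<kappa> * K / (p * r) - L / p\<^sup>2 = - \<kappa>" using shift_slope by linarith
      finally show ?thesis unfolding LZ .
    qed
    have sr: "S * r \<le> c * p"
      by (rule shift_angle_le[OF pos(1) _ _ pos(4) le r p]) (use pos y inv cpos in auto)
    \<comment> \<open>The slope along X is cos (2 \<beta>) - sin (2 \<beta>) cot \<theta>, and it
      stays above -1 precisely because \<beta> \<le> \<theta>.\<close>
    have "S2 * (r / p) \<le> 2 * c * c" using sr p(2) cpos unfolding S2_def by (simp add: field_simps)
    moreover have "0 \<le> S2 * (r / p)" using cpos r(2) p(2) by (simp add: S2_def)
    ultimately have "\<bar>C2 - S2 * (r / p)\<bar> \<le> 1" using cs zero_le_power2[of S] zero_le_power2[of c]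
      unfolding C2_def abs_le_iff power2_eq_square by linarith
    then have "a * (C2 - S2 * (r / p)) + b * (- \<kappa>) \<le> \<bar>a\<bar> + \<kappa> * \<bar>b\<bar>"
      by (rule linear_form_bound) (use k in auto)
    then show ?thesis using D unfolding e by blast
  qed
  then obtain D where "((\<lambda>s. euler_cost \<kappa> (Hw s) (Hx s) (Hy s) (Hz s)) has_real_derivative D) (at t)" "D \<le> \<bar>a\<bar> + \<kappa> * \<bar>b\<bar>"
    by blast
  then have "((\<lambda>s. 2 * \<kappa> * \<beta> + euler_cost \<kappa> (Hw s) (Hx s) (Hy s) (Hz s)) has_real_derivative D) (at t) \<and> D \<le> \<bar>a\<bar> + \<kappa> * \<bar>b\<bar>"
    using DERIV_add[OF DERIV_const[of "2 * \<kappa> * \<beta>"]] by force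
  then show "\<exists>D. ((\<lambda>s. 2 * \<kappa> * \<beta> + euler_cost \<kappa> (cw s * cos \<beta> - cy s * sin \<beta>) (cx s * cos \<beta> + cz s * sin \<beta>)
           (cy s * cos \<beta> + cw s * sin \<beta>) (cz s * cos \<beta> - cx s * sin \<beta>)) has_real_derivative D) (at t) \<and> D \<le> \<bar>a\<bar> + \<kappa> * \<bar>b\<bar>"
    unfolding Hw_def Hx_def Hy_def Hz_def c_def S_def by blast
qed

section \<open>Four-letter words\<close>

text \<open>Points with two vanishing coordinates are excluded: there the angles in the closed forms of the costs degenerate.\<close>

definition chamber :: "real \<Rightarrow> real \<Rightarrow> real \<Rightarrow> real \<Rightarrow> bool" where
  "chamber w x y z \<longleftrightarrow> 0 \<le> w \<and> 0 \<le> x \<and> 0 \<le> y \<and> 0 \<le> z \<and> w\<^sup>2 + x\<^sup>2 + y\<^sup>2 + z\<^sup>2 = 1 \<and>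
     0 < w + x \<and> 0 < w + y \<and> 0 < w + z \<and> 0 < x + y \<and> 0 < x + z \<and> 0 < y + z"

lemma chamber_swap: "chamber w x y z \<Longrightarrow> chamber w y x z"
  by (auto simp: chamber_def add_ac)

lemma polar_quadrant:
  assumes "0 \<le> a" "0 \<le> (b::real)"
  obtains t where "0 \<le> t" "t \<le> pi / 2" "a = sqrt (a\<^sup>2 + b\<^sup>2) * cos t" "b = sqrt (a\<^sup>2 + b\<^sup>2) * sin t"
proof (cases "a\<^sup>2 + b\<^sup>2 = 0")
  case True
  then have "a = 0" "b = 0" by (auto simp: sum_power2_eq_zero_iff)
  then show ?thesis using that[of 0] by auto
next
  case False
  define R where "R = sqrt (a\<^sup>2 + b\<^sup>2)"
  have R: "0 < R" "R\<^sup>2 = a\<^sup>2 + b\<^sup>2" using False by (auto simp: R_def sum_power2_gt_zero_iff)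
  have "(a / R)\<^sup>2 + (b / R)\<^sup>2 = (a\<^sup>2 + b\<^sup>2) / R\<^sup>2" by (simp add: power_divide add_divide_distrib)
  then have "(a / R)\<^sup>2 + (b / R)\<^sup>2 = 1" using R(1) unfolding R(2)[symmetric] by simp
  then obtain t where t: "0 \<le> t" "t \<le> pi / 2" "a / R = cos t" "b / R = sin t"
    by (smt (verit) sincos_total_pi_half divide_nonneg_nonneg assms R(1))
  then have "a = R * cos t" "b = R * sin t" using R(1) by (auto simp: field_simps)
  then show ?thesis using that t unfolding R_def by blast
qed

text \<open>Toroidal coordinates of the sphere adapted to X: in a word XYX, \<theta> is the length
  of the Y-letter, while \<phi> and \<psi> are the difference and the sum of the lengths of the
  outer letters.\<close>

lemma polar_coords:
  assumes "0 \<le> w" "0 \<le> x" "0 \<le> y" "0 \<le> z" "w\<^sup>2 + x\<^sup>2 + y\<^sup>2 + (z::real)\<^sup>2 = 1"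
  obtains \<theta> \<phi> \<psi> where "0 \<le> \<theta>" "\<theta> \<le> pi / 2" "0 \<le> \<phi>" "\<phi> \<le> pi / 2" "0 \<le> \<psi>" "\<psi> \<le> pi / 2"
    "w = cos \<theta> * cos \<phi>" "x = cos \<theta> * sin \<phi>" "y = sin \<theta> * cos \<psi>" "z = sin \<theta> * sin \<psi>"
proof -
  obtain \<phi> where f: "0 \<le> \<phi>" "\<phi> \<le> pi / 2" "w = sqrt (w\<^sup>2 + x\<^sup>2) * cos \<phi>" "x = sqrt (w\<^sup>2 + x\<^sup>2) * sin \<phi>"
    using polar_quadrant assms by metis
  obtain \<psi> where g: "0 \<le> \<psi>" "\<psi> \<le> pi / 2" "y = sqrt (y\<^sup>2 + z\<^sup>2) * cos \<psi>" "z = sqrt (y\<^sup>2 + z\<^sup>2) * sin \<psi>"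
    using polar_quadrant assms by metis
  have "(sqrt (w\<^sup>2 + x\<^sup>2))\<^sup>2 + (sqrt (y\<^sup>2 + z\<^sup>2))\<^sup>2 = 1" using assms by simp
  then obtain \<theta> where t: "0 \<le> \<theta>" "\<theta> \<le> pi / 2" "sqrt (w\<^sup>2 + x\<^sup>2) = cos \<theta>" "sqrt (y\<^sup>2 + z\<^sup>2) = sin \<theta>"
    by (smt (verit) sincos_total_pi_half real_sqrt_ge_zero sum_power2_ge_zero)
  show ?thesis using that[OF t(1,2) f(1,2) g(1,2)] f(3,4) g(3,4) unfolding t(3,4) by blast
qed

lemma euler_cost_polar:
  assumes "0 < \<theta>" "\<theta> < pi / 2" "0 < \<psi>" "\<psi> \<le> pi / 2"
  shows "euler_cost \<kappa> (cos \<theta> * cos \<phi>) (cos \<theta> * sin \<phi>) (sin \<theta> * cos \<psi>) (sin \<theta> * sin \<psi>) = 2 * \<psi> + 2 * \<kappa> * \<theta>"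
proof -
  have p: "0 < sin \<theta>" "0 < cos \<theta>" using assms by (auto simp: sin_gt_zero cos_gt_zero_pi)
  have "(sin \<theta> * cos \<psi>) / (sin \<theta> * sin \<psi>) = tan (pi / 2 - \<psi>)"
    using p by (simp add: tan_def sin_diff cos_diff)
  then have 1: "arctan ((sin \<theta> * cos \<psi>) / (sin \<theta> * sin \<psi>)) = pi / 2 - \<psi>"
    using assms by (simp only:) (rule arctan_tan, auto)
  have "((sin \<theta> * cos \<psi>)\<^sup>2 + (sin \<theta> * sin \<psi>)\<^sup>2) / ((cos \<theta> * cos \<phi>)\<^sup>2 + (cos \<theta> * sin \<phi>)\<^sup>2) = (sin \<theta>)\<^sup>2 / (cos \<theta>)\<^sup>2"
    by (simp add: power_mult_distrib flip: distrib_left)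
  also have "sqrt \<dots> = tan \<theta>" using p by (simp add: real_sqrt_divide tan_def)
  finally have 2: "arctan (sqrt (((sin \<theta> * cos \<psi>)\<^sup>2 + (sin \<theta> * sin \<psi>)\<^sup>2) / ((cos \<theta> * cos \<phi>)\<^sup>2 + (cos \<theta> * sin \<phi>)\<^sup>2))) = \<theta>"
    using assms by (simp add: arctan_tan)
  show ?thesis unfolding euler_cost_def 1 2 by simp
qed

text \<open>Left multiplication by \<open>exp (\<beta> Y)\<close>, which leaves a three-letter remainder of a word starting with \<open>exp (- \<beta> Y)\<close>.\<close>

definition sw :: "real \<Rightarrow> real \<Rightarrow> real \<Rightarrow> real \<Rightarrow> real \<Rightarrow> real" where "sw w x y z \<beta> = w * cos \<beta> - y * sin \<beta>"
definition sx :: "real \<Rightarrow> real \<Rightarrow> real \<Rightarrow> real \<Rightarrow> real \<Rightarrow> real" where "sx w x y z \<beta> = x * cos \<beta> + z * sin \<beta>"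
definition sy :: "real \<Rightarrow> real \<Rightarrow> real \<Rightarrow> real \<Rightarrow> real \<Rightarrow> real" where "sy w x y z \<beta> = y * cos \<beta> + w * sin \<beta>"
definition sz :: "real \<Rightarrow> real \<Rightarrow> real \<Rightarrow> real \<Rightarrow> real \<Rightarrow> real" where "sz w x y z \<beta> = z * cos \<beta> - x * sin \<beta>"
lemmas shift_defs = sw_def sx_def sy_def sz_def

definition shift_cost :: "real \<Rightarrow> real \<Rightarrow> real \<Rightarrow> real \<Rightarrow> real \<Rightarrow> real \<Rightarrow> real" where
  "shift_cost \<kappa> w x y z \<beta> = 2 * \<kappa> * \<beta> + euler_cost \<kappa> (sw w x y z \<beta>) (sx w x y z \<beta>) (sy w x y z \<beta>) (sz w x y z \<beta>)"

text \<open>Admissible lengths of the initial Y-letter: the remainder has to stay in the folded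
  chamber and on the side \<open>x * y \<le> w * z\<close>. There \<phi> \<le> \<psi>, so that the
  last X-letter of the remainder has nonnegative length.\<close>

definition shift_range :: "real \<Rightarrow> real \<Rightarrow> real \<Rightarrow> real \<Rightarrow> real set" where
  "shift_range w x y z = {\<beta>. 0 \<le> \<beta> \<and> \<beta> \<le> pi / 2 \<and> 0 \<le> sw w x y z \<beta> \<and> 0 \<le> sx w x y z \<beta> \<and> 0 \<le> sy w x y z \<beta> \<and> 0 \<le> sz w x y z \<beta> \<and>
     sx w x y z \<beta> * sy w x y z \<beta> \<le> sw w x y z \<beta> * sz w x y z \<beta>}"

definition cost_YXYX :: "real \<Rightarrow> real \<Rightarrow> real \<Rightarrow> real \<Rightarrow> real \<Rightarrow> real" where
  "cost_YXYX \<kappa> w x y z = Inf (shift_cost \<kappa> w x y z ` shift_range w x y z)"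

lemma shift_zero [simp]: "sw w x y z 0 = w" "sx w x y z 0 = x" "sy w x y z 0 = y" "sz w x y z 0 = z"
  by (simp_all add: shift_defs)

lemma shift_unit: "(sw w x y z \<beta>)\<^sup>2 + (sx w x y z \<beta>)\<^sup>2 + (sy w x y z \<beta>)\<^sup>2 + (sz w x y z \<beta>)\<^sup>2 = w\<^sup>2 + x\<^sup>2 + y\<^sup>2 + z\<^sup>2"
  using sin_cos_squared_add3[of \<beta>] unfolding shift_defs by algebra

lemma chamber_z_pos: "chamber w x y z \<Longrightarrow> x * y \<le> w * z \<Longrightarrow> 0 < z"
  unfolding chamber_def by (smt (verit) mult_pos_pos mult_eq_0_iff mult_nonneg_nonneg)

lemma chamber_sq_pos:
  assumes "chamber w x y z"
  shows "0 < w\<^sup>2 + x\<^sup>2" "0 < y\<^sup>2 + z\<^sup>2" "0 < w\<^sup>2 + y\<^sup>2" "0 < x\<^sup>2 + z\<^sup>2"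
  using assms by (auto simp: chamber_def sum_power2_gt_zero_iff)

text \<open>The shifted x and y are sums that are positive off the edges, and the inequality between
  the products passes positivity on to the other two. So no angle degenerates at a positive
  shift.\<close>

lemma shift_range_pos:
  assumes ch: "chamber w x y z" and f: "\<beta> \<in> shift_range w x y z" and b: "0 < \<beta>"
  shows "\<beta> < pi / 2" "0 < sw w x y z \<beta>" "0 < sx w x y z \<beta>" "0 < sy w x y z \<beta>" "0 < sz w x y z \<beta>"
proof -
  show b2: "\<beta> < pi / 2"
  proof (rule ccontr)
    assume "\<not> \<beta> < pi / 2"
    then have eq: "\<beta> = pi / 2" using f by (auto simp: shift_range_def)
    \<comment> \<open>At pi / 2 the shifted w and z are -y and -x; if both were nonnegative, then x
      = y = 0, which is an edge.\<close>
    have "pi / 2 \<in> shift_range w x y z" using f unfolding eq .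
    then have "0 \<le> - y" "0 \<le> - x" by (auto simp: shift_range_def shift_defs)
    then show False using ch by (auto simp: chamber_def)
  qed
  have cs: "0 < cos \<beta>" "0 < sin \<beta>" using b b2 by (auto simp: cos_gt_zero_pi sin_gt_zero)
  have pp: "0 < p * cos \<beta> + q * sin \<beta>" if "0 \<le> p" "0 \<le> q" "0 < p + q" for p q
  proof (cases "p = 0")
    case True then show ?thesis using that cs by simp
  next
    case False then show ?thesis using that cs by (simp add: add_pos_nonneg)
  qed
  show x: "0 < sx w x y z \<beta>" unfolding sx_def by (rule pp) (use ch in \<open>auto simp: chamber_def\<close>)
  show y: "0 < sy w x y z \<beta>" unfolding sy_def by (rule pp) (use ch in \<open>auto simp: chamber_def\<close>)
  have "0 < sw w x y z \<beta> * sz w x y z \<beta>" using mult_pos_pos[OF x y] f by (auto simp: shift_range_def)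
  then show "0 < sw w x y z \<beta>" "0 < sz w x y z \<beta>"
    using f by (auto simp: shift_range_def zero_less_mult_iff)
qed

lemma shift_range_0: "chamber w x y z \<Longrightarrow> x * y \<le> w * z \<Longrightarrow> 0 \<in> shift_range w x y z"
  by (auto simp: shift_range_def chamber_def)

lemma shift_range_facts:
  assumes ch: "chamber w x y z" and f: "\<beta> \<in> shift_range w x y z" and le: "x * y \<le> w * z"
  shows "0 < sz w x y z \<beta>" "0 < (sw w x y z \<beta>)\<^sup>2 + (sx w x y z \<beta>)\<^sup>2"
  using shift_range_pos[OF ch f] chamber_z_pos[OF ch le] chamber_sq_pos[OF ch] f
  by (cases "\<beta> = 0"; force simp: shift_range_def sum_power2_gt_zero_iff)+

lemma shift_deriv:
  "(sw w x y z has_real_derivative - sy w x y z \<beta>) (at \<beta>)"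
  "(sx w x y z has_real_derivative sz w x y z \<beta>) (at \<beta>)"
  "(sy w x y z has_real_derivative sw w x y z \<beta>) (at \<beta>)"
  "(sz w x y z has_real_derivative - sx w x y z \<beta>) (at \<beta>)"
  unfolding shift_defs[abs_def] by (auto intro!: derivative_eq_intros simp: algebra_simps)

lemma shift_cost_deriv:
  assumes "w\<^sup>2 + x\<^sup>2 + y\<^sup>2 + z\<^sup>2 = 1" "0 < sz w x y z \<beta>" "0 < (sw w x y z \<beta>)\<^sup>2 + (sx w x y z \<beta>)\<^sup>2"
  shows "(shift_cost \<kappa> w x y z has_real_derivative 2 * shift_slope \<kappa> (sw w x y z \<beta>) (sx w x y z \<beta>) (sy w x y z \<beta>) (sz w x y z \<beta>)) (at \<beta>)"
proof -
  let ?w = "sw w x y z \<beta>" let ?x = "sx w x y z \<beta>" let ?y = "sy w x y z \<beta>" let ?z = "sz w x y z \<beta>"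
  define r where "r = sqrt (?w\<^sup>2 + ?x\<^sup>2)"
  define p where "p = sqrt (?y\<^sup>2 + ?z\<^sup>2)"
  have r: "r\<^sup>2 = ?w\<^sup>2 + ?x\<^sup>2" "0 < r" using assms(3) by (auto simp: r_def)
  have p: "p\<^sup>2 = ?y\<^sup>2 + ?z\<^sup>2" "0 < p" using assms(2) by (auto simp: p_def sum_power2_gt_zero_iff)
  have "((\<lambda>s. euler_cost \<kappa> (sw w x y z s) (sx w x y z s) (sy w x y z s) (sz w x y z s)) has_real_derivative
     2 * (?y * (- ?x) - ?z * ?w) / p\<^sup>2 + 2 * \<kappa> * (?y * ?w + ?z * (- ?x)) / (p * r)) (at \<beta>)"
    by (rule euler_cost_deriv[OF refl refl refl refl shift_deriv _ _ assms(2) r p])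
      (use assms(1) shift_unit[of w x y z \<beta>] in \<open>auto simp: algebra_simps\<close>)
  from DERIV_add[OF DERIV_cmult[OF DERIV_ident, of "2 * \<kappa>"] this]
  have "(shift_cost \<kappa> w x y z has_real_derivative 2 * \<kappa> * 1 +
     (2 * (?y * (- ?x) - ?z * ?w) / p\<^sup>2 + 2 * \<kappa> * (?y * ?w + ?z * (- ?x)) / (p * r))) (at \<beta>)"
    unfolding shift_cost_def[abs_def] by simp
  then show ?thesis
    by (rule DERIV_cong) (use r(2) p(2) in \<open>simp add: shift_slope_def Let_def field_simps flip: r_def p_def\<close>)
qed

text \<open>A sinusoid f satisfies f(\<gamma>) sin \<beta> = f(\<beta>) sin \<gamma> + f(0) sin
  (\<beta> - \<gamma>), so its sign at 0 and at \<beta> is inherited in between. The coordinates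
  have frequency 1, the quadratic form U has frequency 2. Hence the admissible shifts form an
  interval starting at 0.\<close>

lemma shift_range_down:
  assumes f: "\<beta> \<in> shift_range w x y z" and ch: "chamber w x y z" "x * y \<le> w * z" and g: "0 \<le> \<gamma>" "\<gamma> \<le> \<beta>"
  shows "\<gamma> \<in> shift_range w x y z"
proof (cases "\<gamma> = 0 \<or> \<beta> = \<gamma>")
  case True then show ?thesis using shift_range_0[OF ch] f by auto
next
  case False
  then have b: "0 < \<gamma>" "\<gamma> < \<beta>" "0 < \<beta>" using g by auto
  note fp = shift_range_pos[OF ch(1) f b(3)]
  have nn: "0 \<le> w" "0 \<le> x" "0 \<le> y" "0 \<le> z" using ch by (auto simp: chamber_def)
  have s: "0 < sin \<beta>" "0 < sin \<gamma>" "0 < sin (\<beta> - \<gamma>)" "0 < cos \<gamma>" "0 < sin (2 * \<beta>)" "0 \<le> sin (2 * \<gamma>)" "0 \<le> sin (2 * (\<beta> - \<gamma>))"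
    using b fp(1) by (auto simp: sin_gt_zero cos_gt_zero_pi intro!: sin_ge_zero)
  have 1: "sw w x y z \<gamma> * sin \<beta> = sw w x y z \<beta> * sin \<gamma> + w * sin (\<beta> - \<gamma>)"
    unfolding sw_def sin_diff by algebra
  have 2: "sz w x y z \<gamma> * sin \<beta> = sz w x y z \<beta> * sin \<gamma> + z * sin (\<beta> - \<gamma>)"
    unfolding sz_def sin_diff by algebra
  have w: "0 \<le> sw w x y z \<gamma>" using 1 fp s nn by (metis add_nonneg_nonneg less_imp_le mult_nonneg_nonneg zero_le_mult_iff not_less)
  have z: "0 \<le> sz w x y z \<gamma>" using 2 fp s nn by (metis add_nonneg_nonneg less_imp_le mult_nonneg_nonneg zero_le_mult_iff not_less)
  define U where "U = (\<lambda>\<beta>. sx w x y z \<beta> * sy w x y z \<beta> - sw w x y z \<beta> * sz w x y z \<beta>)"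
  have Ueq: "U t = (x * y - w * z) * cos (2 * t) + (w * x + y * z) * sin (2 * t)" for t
    unfolding U_def shift_defs cos_double sin_double by algebra
  have "U \<gamma> * sin (2 * \<beta>) = U \<beta> * sin (2 * \<gamma>) + (x * y - w * z) * sin (2 * (\<beta> - \<gamma>))"
    unfolding Ueq right_diff_distrib sin_diff by algebra
  moreover have "U \<beta> * sin (2 * \<gamma>) \<le> 0" using f s by (intro mult_nonpos_nonneg) (auto simp: shift_range_def U_def)
  moreover have "(x * y - w * z) * sin (2 * (\<beta> - \<gamma>)) \<le> 0" using ch(2) s by (intro mult_nonpos_nonneg) auto
  ultimately have "U \<gamma> * sin (2 * \<beta>) \<le> 0" by linarith
  then have "U \<gamma> \<le> 0" using s(5) by (simp add: mult_le_0_iff)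
  then show ?thesis using w z b fp(1) nn s
    by (auto simp: shift_range_def U_def) (auto simp: shift_defs)
qed

lemma compact_shift_range: "compact (shift_range w x y z)"
proof -
  have c: "continuous_on UNIV (sw w x y z)" "continuous_on UNIV (sx w x y z)" "continuous_on UNIV (sy w x y z)" "continuous_on UNIV (sz w x y z)"
    unfolding shift_defs[abs_def] by (intro continuous_intros)+
  have "closed (shift_range w x y z)"
    unfolding shift_range_def by (intro closed_Collect_conj closed_Collect_le continuous_intros c)
  moreover have "shift_range w x y z \<subseteq> {0..pi/2}" by (auto simp: shift_range_def)
  ultimately show ?thesis by (metis bounded_closed_interval bounded_subset compact_eq_bounded_closed)
qed

lemma cost_YXYX_attained:
  assumes ch: "chamber w x y z" "x * y \<le> w * z"
  obtains \<beta> where "\<beta> \<in> shift_range w x y z" "cost_YXYX \<kappa> w x y z = shift_cost \<kappa> w x y z \<beta>"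
    "\<And>\<gamma>. \<gamma> \<in> shift_range w x y z \<Longrightarrow> shift_cost \<kappa> w x y z \<beta> \<le> shift_cost \<kappa> w x y z \<gamma>"
proof -
  have u: "w\<^sup>2 + x\<^sup>2 + y\<^sup>2 + z\<^sup>2 = 1" using ch by (auto simp: chamber_def)
  have "continuous_on (shift_range w x y z) (shift_cost \<kappa> w x y z)"
    by (rule continuous_at_imp_continuous_on) (use shift_cost_deriv[OF u shift_range_facts[OF ch(1) _ ch(2)]] DERIV_isCont in blast)
  then obtain \<beta> where b: "\<beta> \<in> shift_range w x y z" "\<And>\<gamma>. \<gamma> \<in> shift_range w x y z \<Longrightarrow> shift_cost \<kappa> w x y z \<beta> \<le> shift_cost \<kappa> w x y z \<gamma>"
    using continuous_attains_inf[OF compact_shift_range, of w x y z "shift_cost \<kappa> w x y z"] shift_range_0[OF ch] by blast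
  moreover have "cost_YXYX \<kappa> w x y z = shift_cost \<kappa> w x y z \<beta>"
    unfolding cost_YXYX_def by (rule cInf_eq_minimum) (use b in auto)
  ultimately show ?thesis using that by blast
qed

lemma shift_slope_polar:
  assumes "0 < \<theta>" "\<theta> < pi / 2"
  shows "shift_slope \<kappa> (cos \<theta> * cos \<phi>) (cos \<theta> * sin \<phi>) (sin \<theta> * cos \<psi>) (sin \<theta> * sin \<psi>)
    = \<kappa> * cos (\<phi> + \<psi>) - cos \<theta> / sin \<theta> * sin (\<phi> + \<psi>) + \<kappa>"
proof -
  have p: "0 < sin \<theta>" "0 < cos \<theta>" using assms by (auto simp: sin_gt_zero cos_gt_zero_pi)
  have r: "sqrt ((cos \<theta> * cos \<phi>)\<^sup>2 + (cos \<theta> * sin \<phi>)\<^sup>2) = cos \<theta>"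
    using p by (simp add: power_mult_distrib flip: distrib_left)
  have s: "sqrt ((sin \<theta> * cos \<psi>)\<^sup>2 + (sin \<theta> * sin \<psi>)\<^sup>2) = sin \<theta>"
    using p by (simp add: power_mult_distrib flip: distrib_left)
  show ?thesis unfolding shift_slope_def Let_def r s cos_add sin_add
    using p by (simp add: field_simps power2_eq_square)
qed

text \<open>t is the length of the first X-letter of the remainder. For cos t > 0 the slope has the
  sign of \<kappa> tan \<theta> - tan t, so stationarity is the relation of pattern (I) for the
  times 2 t and 2 \<theta>.\<close>

lemma shift_slope_polar_half:
  assumes "0 < \<theta>" "\<theta> < pi / 2" "\<phi> + \<psi> = 2 * t"
  shows "shift_slope \<kappa> (cos \<theta> * cos \<phi>) (cos \<theta> * sin \<phi>) (sin \<theta> * cos \<psi>) (sin \<theta> * sin \<psi>)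
    = 2 * cos t * (\<kappa> * cos t * sin \<theta> - cos \<theta> * sin t) / sin \<theta>"
proof -
  have p: "0 < sin \<theta>" using assms by (auto simp: sin_gt_zero)
  have c: "cos (2 * t) = 2 * cos t * cos t - 1" by (simp add: cos_double_cos power2_eq_square)
  show ?thesis unfolding shift_slope_polar[OF assms(1,2)] assms(3) sin_double c
    using p by (simp add: field_simps)
qed

lemma chamber_polar:
  assumes ch: "chamber w x y z"
  obtains \<theta> \<phi> \<psi> where "0 < \<theta>" "\<theta> < pi / 2" "0 \<le> \<phi>" "\<phi> \<le> pi / 2" "0 \<le> \<psi>" "\<psi> \<le> pi / 2"
    "w = cos \<theta> * cos \<phi>" "x = cos \<theta> * sin \<phi>" "y = sin \<theta> * cos \<psi>" "z = sin \<theta> * sin \<psi>"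
proof -
  obtain \<theta> \<phi> \<psi> where p: "0 \<le> \<theta>" "\<theta> \<le> pi / 2" "0 \<le> \<phi>" "\<phi> \<le> pi / 2" "0 \<le> \<psi>" "\<psi> \<le> pi / 2"
    and c: "w = cos \<theta> * cos \<phi>" "x = cos \<theta> * sin \<phi>" "y = sin \<theta> * cos \<psi>" "z = sin \<theta> * sin \<psi>"
    using polar_coords[of w x y z] ch unfolding chamber_def by metis
  have "\<theta> \<noteq> 0" using c ch by (auto simp: chamber_def)
  moreover have "cos \<theta> \<noteq> 0" using c ch by (auto simp: chamber_def)
  then have "\<theta> \<noteq> pi / 2" using cos_pi_half by metis
  ultimately show ?thesis using that[OF _ _ p(3-6) c] p(1,2) by force
qed

text \<open>Once the remainder lies on \<open>x * y = w * z\<close>, its last X-letter is gone and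
  the whole word is YXY, an Euler word with X and Y exchanged. The second claim: if the cost does
  not increase on arrival at the surface, the exchanged word satisfies its own sign
  condition.\<close>

lemma on_surface:
  assumes ch: "chamber w x y z" and le: "x * y \<le> w * z" and f: "\<beta> \<in> shift_range w x y z" and k: "0 < \<kappa>"
    and eq: "sx w x y z \<beta> * sy w x y z \<beta> = sw w x y z \<beta> * sz w x y z \<beta>"
  shows "shift_cost \<kappa> w x y z \<beta> = \<kappa> * euler_cost (1 / \<kappa>) w y x z"
    and "shift_slope \<kappa> (sw w x y z \<beta>) (sx w x y z \<beta>) (sy w x y z \<beta>) (sz w x y z \<beta>) \<le> 0 \<Longrightarrow> 0 \<le> shift_slope (1 / \<kappa>) w y x z"
proof -
  obtain \<theta> \<phi> \<psi> where t: "0 < \<theta>" "\<theta> < pi / 2" "0 \<le> \<phi>" "\<phi> \<le> pi / 2" "0 \<le> \<psi>" "\<psi> \<le> pi / 2"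
    and c: "w = cos \<theta> * cos \<phi>" "y = cos \<theta> * sin \<phi>" "x = sin \<theta> * cos \<psi>" "z = sin \<theta> * sin \<psi>"
    using chamber_polar[OF chamber_swap[OF ch]] by metis
  have p: "0 < sin \<theta>" "0 < cos \<theta>" using t by (auto simp: sin_gt_zero cos_gt_zero_pi)
  \<comment> \<open>In coordinates adapted to Y the shift only moves \<phi> up and \<psi> down by
    \<beta>; the surface is reached when the two angles meet.\<close>
  have h: "sw w x y z \<beta> = cos \<theta> * cos (\<phi> + \<beta>)" "sy w x y z \<beta> = cos \<theta> * sin (\<phi> + \<beta>)"
    "sx w x y z \<beta> = sin \<theta> * cos (\<psi> - \<beta>)" "sz w x y z \<beta> = sin \<theta> * sin (\<psi> - \<beta>)"
    by (simp_all add: shift_defs c cos_add sin_add cos_diff sin_diff algebra_simps)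
  have b0: "0 \<le> \<beta>" "\<beta> \<le> pi / 2" using f by (auto simp: shift_range_def)
  note ff = shift_range_facts[OF ch f le]
  have "0 \<le> sw w x y z \<beta>" using f by (auto simp: shift_range_def)
  then have "0 \<le> cos (\<phi> + \<beta>)" using p unfolding h by (auto simp: zero_le_mult_iff)
  then have 1: "\<phi> + \<beta> \<le> pi / 2"
    using cos_monotone_0_pi[of "pi / 2" "\<phi> + \<beta>"] t b0 by (force simp: not_less[symmetric])
  have "0 < sin (\<psi> - \<beta>)" using ff(1) p unfolding h by (simp add: zero_less_mult_iff)
  have 2: "0 < \<psi> - \<beta>"
  proof (rule ccontr)
    assume "\<not> 0 < \<psi> - \<beta>"
    then have "0 \<le> sin (\<beta> - \<psi>)" using t b0 by (intro sin_ge_zero) auto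
    then show False using \<open>0 < sin (\<psi> - \<beta>)\<close> sin_minus[of "\<beta> - \<psi>"] by simp
  qed
  have "sin \<theta> * cos \<theta> * sin ((\<phi> + \<beta>) - (\<psi> - \<beta>)) = 0"
    using eq unfolding h sin_diff[of "\<phi> + \<beta>" "\<psi> - \<beta>"] by (simp add: algebra_simps)
  then have "sin ((\<phi> + \<beta>) - (\<psi> - \<beta>)) = 0" using p by simp
  then have 3: "\<phi> + \<beta> = \<psi> - \<beta>"
    using 1 2 t b0 sin_eq_0_pi[of "(\<phi> + \<beta>) - (\<psi> - \<beta>)"] by force
  define b where "b = \<psi> - \<beta>"
  have b: "0 < b" "b \<le> pi / 2" using 1 2 3 by (auto simp: b_def)
  have b': "b < pi / 2" using ff(2) b(2) unfolding h 3 b_def[symmetric] by (cases "b = pi / 2") auto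
  have hb: "sw w x y z \<beta> = cos b * cos \<theta>" "sx w x y z \<beta> = cos b * sin \<theta>"
    "sy w x y z \<beta> = sin b * cos \<theta>" "sz w x y z \<beta> = sin b * sin \<theta>"
    unfolding h 3 b_def by simp_all
  have psi: "0 < \<psi>" using b b0 by (simp add: b_def)
  have "shift_cost \<kappa> w x y z \<beta> = 2 * \<kappa> * \<beta> + (2 * \<theta> + 2 * \<kappa> * b)"
    unfolding shift_cost_def hb using euler_cost_polar[OF b(1) b' t(1)] t(2) by simp
  also have "\<dots> = \<kappa> * (2 * \<psi> + 2 * (1 / \<kappa>) * \<theta>)" using k by (simp add: b_def field_simps)
  also have "2 * \<psi> + 2 * (1 / \<kappa>) * \<theta> = euler_cost (1 / \<kappa>) w y x z"
    unfolding c using euler_cost_polar[OF t(1,2) psi t(6)] by simp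
  finally show "shift_cost \<kappa> w x y z \<beta> = \<kappa> * euler_cost (1 / \<kappa>) w y x z" .
  have cb: "0 < cos b" "0 < sin b" using b b' by (auto simp: sin_gt_zero cos_gt_zero_pi)
  assume "shift_slope \<kappa> (sw w x y z \<beta>) (sx w x y z \<beta>) (sy w x y z \<beta>) (sz w x y z \<beta>) \<le> 0"
  then have "2 * cos \<theta> * (\<kappa> * cos \<theta> * sin b - cos b * sin \<theta>) / sin b \<le> 0"
    unfolding hb by (subst (asm) shift_slope_polar_half[OF b(1) b', of _ _ \<theta>]) auto
  then have "\<kappa> * cos \<theta> * sin b \<le> cos b * sin \<theta>"
    using cb p by (simp add: divide_le_0_iff mult_le_0_iff)
  then have le2: "0 \<le> (1 / \<kappa>) * cos b * sin \<theta> - cos \<theta> * sin b" using k by (simp add: field_simps)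
  have "shift_slope (1 / \<kappa>) w y x z = 2 * cos b * ((1 / \<kappa>) * cos b * sin \<theta> - cos \<theta> * sin b) / sin \<theta>"
    unfolding c by (rule shift_slope_polar_half[OF t(1,2)]) (use 3 in \<open>simp add: b_def\<close>)
  also have "\<dots> \<ge> 0" using le2 cb p by (intro divide_nonneg_nonneg mult_nonneg_nonneg) auto
  finally show "0 \<le> shift_slope (1 / \<kappa>) w y x z" .
qed

lemma surface_shift_exists:
  assumes ch: "chamber w x y z" and le: "x * y \<le> w * z"
  obtains \<beta> where "\<beta> \<in> shift_range w x y z" "sx w x y z \<beta> * sy w x y z \<beta> = sw w x y z \<beta> * sz w x y z \<beta>"
proof -
  obtain \<theta> \<phi> \<psi> where t: "0 < \<theta>" "\<theta> < pi / 2" "0 \<le> \<phi>" "\<phi> \<le> pi / 2" "0 \<le> \<psi>" "\<psi> \<le> pi / 2"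
    and c: "w = cos \<theta> * cos \<phi>" "y = cos \<theta> * sin \<phi>" "x = sin \<theta> * cos \<psi>" "z = sin \<theta> * sin \<psi>"
    using chamber_polar[OF chamber_swap[OF ch]] by metis
  have p: "0 < sin \<theta>" "0 < cos \<theta>" using t by (auto simp: sin_gt_zero cos_gt_zero_pi)
  define \<beta> where "\<beta> = (\<psi> - \<phi>) / 2"
  define b where "b = (\<psi> + \<phi>) / 2"
  have bb: "\<phi> + \<beta> = b" "\<psi> - \<beta> = b" by (simp_all add: \<beta>_def b_def field_simps)
  have "sin \<theta> * cos \<theta> * sin (\<phi> - \<psi>) \<le> 0"
    using le unfolding c sin_diff by (simp add: algebra_simps)
  then have "sin (\<phi> - \<psi>) \<le> 0" using p by (simp add: mult_le_0_iff)
  then have "\<phi> \<le> \<psi>" using sin_gt_zero[of "\<phi> - \<psi>"] t by force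
  then have b0: "0 \<le> \<beta>" "\<beta> \<le> pi / 2" "0 \<le> b" "b \<le> pi / 2" using t by (auto simp: \<beta>_def b_def)
  have cb: "0 \<le> cos b" "0 \<le> sin b" using b0 by (auto simp: sin_ge_zero cos_ge_zero)
  have h: "sw w x y z \<beta> = cos \<theta> * cos b" "sy w x y z \<beta> = cos \<theta> * sin b"
    "sx w x y z \<beta> = sin \<theta> * cos b" "sz w x y z \<beta> = sin \<theta> * sin b"
  proof -
    have "sw w x y z \<beta> = cos \<theta> * cos (\<phi> + \<beta>)" "sy w x y z \<beta> = cos \<theta> * sin (\<phi> + \<beta>)"
      "sx w x y z \<beta> = sin \<theta> * cos (\<psi> - \<beta>)" "sz w x y z \<beta> = sin \<theta> * sin (\<psi> - \<beta>)"
      by (simp_all add: shift_defs c cos_add sin_add cos_diff sin_diff algebra_simps)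
    then show "sw w x y z \<beta> = cos \<theta> * cos b" "sy w x y z \<beta> = cos \<theta> * sin b"
      "sx w x y z \<beta> = sin \<theta> * cos b" "sz w x y z \<beta> = sin \<theta> * sin b" unfolding bb by auto
  qed
  show ?thesis
    by (rule that[of \<beta>]) (use b0 cb p in \<open>auto simp: shift_range_def h\<close>)
qed

lemma cost_YXYX_le:
  assumes ch: "chamber w x y z" "x * y \<le> w * z" and f: "\<beta> \<in> shift_range w x y z"
  shows "cost_YXYX \<kappa> w x y z \<le> shift_cost \<kappa> w x y z \<beta>"
  using cost_YXYX_attained[OF ch] f by metis

lemma cost_YXYX_le_euler: "chamber w x y z \<Longrightarrow> x * y \<le> w * z \<Longrightarrow> cost_YXYX \<kappa> w x y z \<le> euler_cost \<kappa> w x y z"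
  using cost_YXYX_le[OF _ _ shift_range_0] by (fastforce simp: shift_cost_def)

lemma cost_YXYX_le_swap:
  assumes "chamber w x y z" "x * y \<le> w * z" "0 < \<kappa>"
  shows "cost_YXYX \<kappa> w x y z \<le> \<kappa> * euler_cost (1 / \<kappa>) w y x z"
  using surface_shift_exists[OF assms(1,2)] cost_YXYX_le[OF assms(1,2)] on_surface(1)[OF assms(1,2) _ assms(3)] by metis

text \<open>A minimiser over the admissible interval is its left end, a point on the surface that
  bounds it, or a critical point. These yield words XYX, YXY and genuine four-letter words; the
  one-sided derivative at the minimum supplies the sign condition in each case.\<close>

lemma cost_YXYX_cases:
  assumes ch: "chamber w x y z" and le: "x * y \<le> w * z" and k: "0 < \<kappa>"
  obtains (start) "cost_YXYX \<kappa> w x y z = euler_cost \<kappa> w x y z" "0 \<le> shift_slope \<kappa> w x y z"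
  | (surface) "cost_YXYX \<kappa> w x y z = \<kappa> * euler_cost (1 / \<kappa>) w y x z" "0 \<le> shift_slope (1 / \<kappa>) w y x z"
  | (inner) \<beta> where "0 < \<beta>" "\<beta> \<in> shift_range w x y z" "cost_YXYX \<kappa> w x y z = shift_cost \<kappa> w x y z \<beta>"
      "shift_slope \<kappa> (sw w x y z \<beta>) (sx w x y z \<beta>) (sy w x y z \<beta>) (sz w x y z \<beta>) = 0"
      "sx w x y z \<beta> * sy w x y z \<beta> < sw w x y z \<beta> * sz w x y z \<beta>"
proof -
  obtain \<beta> where b: "\<beta> \<in> shift_range w x y z" "cost_YXYX \<kappa> w x y z = shift_cost \<kappa> w x y z \<beta>"
    and min: "\<And>\<gamma>. \<gamma> \<in> shift_range w x y z \<Longrightarrow> shift_cost \<kappa> w x y z \<beta> \<le> shift_cost \<kappa> w x y z \<gamma>"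
    using cost_YXYX_attained[OF ch le] by metis
  have u: "w\<^sup>2 + x\<^sup>2 + y\<^sup>2 + z\<^sup>2 = 1" using ch by (auto simp: chamber_def)
  define B where "B = shift_slope \<kappa> (sw w x y z \<beta>) (sx w x y z \<beta>) (sy w x y z \<beta>) (sz w x y z \<beta>)"
  have D: "(shift_cost \<kappa> w x y z has_real_derivative 2 * B) (at \<beta>)"
    unfolding B_def by (rule shift_cost_deriv[OF u shift_range_facts[OF ch b(1) le]])
  have b0: "0 \<le> \<beta>" using b(1) by (auto simp: shift_range_def)
  \<comment> \<open>Strictly inside the surface \<beta> can be increased a little without leaving
    the admissible range, so the cost cannot be decreasing at the minimiser.\<close>
  have up: "0 \<le> B" if lt: "sx w x y z \<beta> * sy w x y z \<beta> < sw w x y z \<beta> * sz w x y z \<beta>"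
  proof (rule ccontr)
    assume "\<not> 0 \<le> B"
    then obtain d where d: "0 < d" "\<And>h. 0 < h \<Longrightarrow> h < d \<Longrightarrow> shift_cost \<kappa> w x y z (\<beta> + h) < shift_cost \<kappa> w x y z \<beta>"
      using DERIV_neg_dec_right[OF D] by auto
    have ct: "isCont (sw w x y z) \<beta>" "isCont (sx w x y z) \<beta>" "isCont (sy w x y z) \<beta>" "isCont (sz w x y z) \<beta>"
      by (rule DERIV_isCont, rule shift_deriv)+
    have nn: "0 \<le> sx w x y z \<beta>" "0 \<le> sy w x y z \<beta>" "0 \<le> sw w x y z \<beta>" "0 \<le> sz w x y z \<beta>" using b(1) by (auto simp: shift_range_def)
    have "0 < sw w x y z \<beta> * sz w x y z \<beta>" using lt mult_nonneg_nonneg[OF nn(1,2)] by linarith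
    then have wz: "0 < sw w x y z \<beta>" "0 < sz w x y z \<beta>" using nn by (auto simp: zero_less_mult_iff)
    have bpi: "\<beta> < pi / 2"
      using shift_range_pos(1)[OF ch b(1)] b0 by (cases "\<beta> = 0") auto
    have "\<forall>\<^sub>F t in at \<beta>. 0 < sw w x y z t \<and> 0 < sz w x y z t \<and>
      0 < sw w x y z t * sz w x y z t - sx w x y z t * sy w x y z t \<and> t < pi / 2"
    proof (intro eventually_conj)
      show "\<forall>\<^sub>F t in at \<beta>. 0 < sw w x y z t" using ct(1) wz(1) unfolding isCont_def by (rule order_tendstoD(1))
      show "\<forall>\<^sub>F t in at \<beta>. 0 < sz w x y z t" using ct(4) wz(2) unfolding isCont_def by (rule order_tendstoD(1))
      show "\<forall>\<^sub>F t in at \<beta>. t < pi / 2" using tendsto_ident_at bpi by (rule order_tendstoD(2))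
      have "isCont (\<lambda>t. sw w x y z t * sz w x y z t - sx w x y z t * sy w x y z t) \<beta>"
        by (intro continuous_intros ct)
      then show "\<forall>\<^sub>F t in at \<beta>. 0 < sw w x y z t * sz w x y z t - sx w x y z t * sy w x y z t"
        unfolding isCont_def by (rule order_tendstoD(1)) (use lt in simp)
    qed
    then obtain e where e: "0 < e" "\<And>t. t \<noteq> \<beta> \<Longrightarrow> dist t \<beta> < e \<Longrightarrow> 0 < sw w x y z t \<and> 0 < sz w x y z t \<and>
      0 < sw w x y z t * sz w x y z t - sx w x y z t * sy w x y z t \<and> t < pi / 2"
      unfolding eventually_at by auto
    define t where "t = \<beta> + min d e / 2"
    have t: "t \<noteq> \<beta>" "dist t \<beta> < e" "0 < t - \<beta>" "t - \<beta> < d" using d(1) e(1) by (auto simp: t_def dist_real_def)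
    note et = e(2)[OF t(1,2)]
    have "t \<in> shift_range w x y z"
      unfolding shift_range_def using et t b0 ch
      by (auto simp: chamber_def) (auto simp: shift_defs intro!: add_nonneg_nonneg mult_nonneg_nonneg cos_ge_zero sin_ge_zero)
    from min[OF this] d(2)[OF t(3,4)] show False by simp
  qed
  have down: "B \<le> 0" if "0 < \<beta>"
  proof (rule ccontr)
    assume "\<not> B \<le> 0"
    then obtain d where d: "0 < d" "\<And>h. 0 < h \<Longrightarrow> h < d \<Longrightarrow> shift_cost \<kappa> w x y z (\<beta> - h) < shift_cost \<kappa> w x y z \<beta>"
      using DERIV_pos_inc_left[OF D] by auto
    define t where "t = min d \<beta> / 2"
    have t: "0 < t" "t < d" "t \<le> \<beta>" using d(1) that by (auto simp: t_def)
    have "\<beta> - t \<in> shift_range w x y z" by (rule shift_range_down[OF b(1) ch le]) (use t in auto)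
    from min[OF this] d(2)[OF t(1,2)] show False by simp
  qed
  show ?thesis
  proof (cases "sx w x y z \<beta> * sy w x y z \<beta> = sw w x y z \<beta> * sz w x y z \<beta>")
    case True
    show ?thesis
    proof (cases "B \<le> 0")
      case B: True
      then show ?thesis using surface on_surface[OF ch le b(1) k True] b(2) unfolding B_def by simp
    next
      case B: False
      then have "\<beta> = 0" using down b0 by force
      then show ?thesis using start b(2) B unfolding B_def by (simp add: shift_cost_def)
    qed
  next
    case False
    then have lt: "sx w x y z \<beta> * sy w x y z \<beta> < sw w x y z \<beta> * sz w x y z \<beta>" using b(1) by (auto simp: shift_range_def)
    show ?thesis
    proof (cases "\<beta> = 0")
      case True
      then show ?thesis using start b(2) up[OF lt] unfolding B_def by (simp add: shift_cost_def)
    next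
      case False
      then have "0 < \<beta>" using b0 by simp
      then show ?thesis using inner[OF _ b] up[OF lt] down lt unfolding B_def by force
    qed
  qed
qed

lemma cost_YXYX_touch:
  assumes ch: "chamber w x y z" and le: "x * y \<le> w * z" and k: "0 < \<kappa>"
  obtains G where "G w x y z = cost_YXYX \<kappa> w x y z" "grad_bounded \<kappa> G w x y z"
    "\<forall>\<^sub>F (w', x', y', z') in nhds (w, x, y, z). chamber w' x' y' z' \<longrightarrow> x' * y' \<le> w' * z' \<longrightarrow>
        cost_YXYX \<kappa> w' x' y' z' \<le> G w' x' y' z'"
proof -
  have nn: "0 \<le> w" "0 \<le> x" "0 \<le> y" "0 \<le> z" and u: "w\<^sup>2 + x\<^sup>2 + y\<^sup>2 + z\<^sup>2 = 1" using ch by (auto simp: chamber_def)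
  note zp = chamber_z_pos[OF ch le] note sq = chamber_sq_pos[OF ch]
  show ?thesis
  proof (cases rule: cost_YXYX_cases[OF ch le k, case_names start surface inner])
    case start
    have "\<forall>\<^sub>F (w', x', y', z') in nhds (w, x, y, z). chamber w' x' y' z' \<longrightarrow> x' * y' \<le> w' * z' \<longrightarrow>
        cost_YXYX \<kappa> w' x' y' z' \<le> euler_cost \<kappa> w' x' y' z'"
      by (rule always_eventually) (use cost_YXYX_le_euler in auto)
    from that[of "euler_cost \<kappa>", OF start(1)[symmetric] grad_bounded_euler_cost[OF nn(1-3) zp k le u sq(1) start(2)] this]
    show ?thesis .
  next
    case surface
    have "grad_bounded (1 / \<kappa>) (euler_cost (1 / \<kappa>)) w y x z"
      by (rule grad_bounded_euler_cost) (use nn zp k le u sq surface in \<open>auto simp: add_ac mult_ac\<close>)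
    note g = grad_bounded_swap[OF this k]
    have "\<forall>\<^sub>F (w', x', y', z') in nhds (w, x, y, z). chamber w' x' y' z' \<longrightarrow> x' * y' \<le> w' * z' \<longrightarrow>
        cost_YXYX \<kappa> w' x' y' z' \<le> \<kappa> * euler_cost (1 / \<kappa>) w' y' x' z'"
      by (rule always_eventually) (use cost_YXYX_le_swap[OF _ _ k] in auto)
    from that[of "\<lambda>w x y z. \<kappa> * euler_cost (1 / \<kappa>) w y x z", OF surface(1)[symmetric] g this]
    show ?thesis .
  next
    case (inner \<beta>)
    note fp = shift_range_pos[OF ch inner(2,1)]
    define G where "G = (\<lambda>w x y z. 2 * \<kappa> * \<beta> + euler_cost \<kappa> (w * cos \<beta> - y * sin \<beta>) (x * cos \<beta> + z * sin \<beta>)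
           (y * cos \<beta> + w * sin \<beta>) (z * cos \<beta> - x * sin \<beta>))"
    have Ge: "G w x y z = shift_cost \<kappa> w x y z \<beta>" for w x y z by (simp add: G_def shift_cost_def shift_defs)
    have "grad_bounded \<kappa> G w x y z"
      unfolding G_def
      by (rule grad_bounded_shift[OF _ _ _ _ fp(2-5)[unfolded shift_defs] inner(5)[unfolded shift_defs, THEN less_imp_le] u inner(4)[unfolded shift_defs] nn(3) k inner(1) fp(1)])
        simp_all
    moreover have "\<forall>\<^sub>F (w', x', y', z') in nhds (w, x, y, z). chamber w' x' y' z' \<longrightarrow> x' * y' \<le> w' * z' \<longrightarrow>
        cost_YXYX \<kappa> w' x' y' z' \<le> G w' x' y' z'"
    proof -
      define S where "S = {q::real \<times> real \<times> real \<times> real. case q of (w, x, y, z) \<Rightarrow> 0 < sw w x y z \<beta> \<and> 0 < sx w x y z \<beta> \<and> 0 < sy w x y z \<beta> \<and>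
         0 < sz w x y z \<beta> \<and> sx w x y z \<beta> * sy w x y z \<beta> < sw w x y z \<beta> * sz w x y z \<beta>}"
      have "open S"
        unfolding S_def case_prod_beta shift_defs
        by (intro open_Collect_conj open_Collect_less continuous_intros)
      moreover have "(w, x, y, z) \<in> S" using fp inner(5) by (simp add: S_def)
      ultimately have "\<forall>\<^sub>F q in nhds (w, x, y, z). q \<in> S" by (rule eventually_nhds_in_open)
      then show ?thesis
      proof (rule eventually_mono, clarify)
        fix w' x' y' z' assume q: "(w', x', y', z') \<in> S" "chamber w' x' y' z'" "x' * y' \<le> w' * z'"
        then have "\<beta> \<in> shift_range w' x' y' z'" using inner(1) fp(1) by (auto simp: S_def shift_range_def)
        then show "cost_YXYX \<kappa> w' x' y' z' \<le> G w' x' y' z'" unfolding Ge using cost_YXYX_le q by blast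
      qed
    qed
    moreover have "G w x y z = cost_YXYX \<kappa> w x y z" using inner(3) Ge by simp
    ultimately show ?thesis using that[of G] by blast
  qed
qed

section \<open>Words containing the balanced axis W\<close>

text \<open>The total cost of \<open>exp (\<alpha> X) exp (\<tau> W) exp (\<beta> X)\<close>, with \<open>\<alpha>\<close>, \<open>\<tau>\<close>, \<open>\<beta>\<close> eliminated in favour of the coordinates of the product
  (see \<open>is_XWX\<close>). The words \<open>exp (\<alpha> Y) exp (\<tau> W) exp (\<beta> Y)\<close> arise from it by exchanging \<open>x\<close> with \<open>y\<close> and \<open>\<kappa>\<close> with \<open>1 / \<kappa>\<close>.\<close>

definition cost_XWX :: "real \<Rightarrow> real \<Rightarrow> real \<Rightarrow> real \<Rightarrow> real \<Rightarrow> real" where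
  "cost_XWX \<kappa> w x y z = 2 * (pi / 2 - arctan (w / x)) + 2 * sqrt (1 + \<kappa>\<^sup>2) * arcsin (sqrt (1 + \<kappa>\<^sup>2) / \<kappa> * sqrt (y\<^sup>2 + z\<^sup>2))
     - 2 * arcsin (sqrt (y\<^sup>2 + z\<^sup>2) / (\<kappa> * sqrt (w\<^sup>2 + x\<^sup>2)))"

text \<open>Write r and p for the norms of (w, x) and (y, z). By Cauchy-Schwarz x y - w z < r p, so
  the region forces p < \<kappa> r, which on the unit sphere puts the arguments of both
  \<open>arcsin\<close> in \<open>cost_XWX\<close> below 1. Strictness comes from y w + z x > 0,
  which holds off the edges.\<close>

lemma cost_XWX_region_facts:
  assumes ch: "chamber w x y z" and reg: "y\<^sup>2 + z\<^sup>2 \<le> \<kappa> * (x * y - w * z)" and k: "0 < \<kappa>"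
  shows "0 < x" "0 < y" "sqrt (y\<^sup>2 + z\<^sup>2) < \<kappa> * sqrt (w\<^sup>2 + x\<^sup>2)" "0 < x * y - w * z"
proof -
  note sq = chamber_sq_pos[OF ch]
  have nn: "0 \<le> w" "0 \<le> x" "0 \<le> y" "0 \<le> z" "0 < w + z" using ch by (auto simp: chamber_def)
  have "0 < \<kappa> * (x * y - w * z)" using reg sq by linarith
  then show u: "0 < x * y - w * z" using k by (simp add: zero_less_mult_iff)
  then have "0 < x * y" using mult_nonneg_nonneg[OF nn(1,4)] by linarith
  then show xy: "0 < x" "0 < y" using nn by (auto simp: zero_less_mult_iff)
  define r where "r = sqrt (w\<^sup>2 + x\<^sup>2)"
  define p where "p = sqrt (y\<^sup>2 + z\<^sup>2)"
  have r: "r\<^sup>2 = w\<^sup>2 + x\<^sup>2" "0 < r" using sq by (auto simp: r_def)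
  have p: "p\<^sup>2 = y\<^sup>2 + z\<^sup>2" "0 < p" using sq by (auto simp: p_def)
  have "0 < y * w + z * x" using nn xy by (metis add_pos_nonneg add_nonneg_pos mult_nonneg_nonneg mult_pos_pos le_less add_0 less_imp_le)
  then have "0 < (y * w + z * x)\<^sup>2" by simp
  moreover have "(r * p)\<^sup>2 - (x * y - w * z)\<^sup>2 = (y * w + z * x)\<^sup>2" unfolding power_mult_distrib r p by algebra
  ultimately have "(x * y - w * z)\<^sup>2 < (r * p)\<^sup>2" by linarith
  then have "x * y - w * z < r * p" by (rule power2_less_imp_less) (simp add: r(2) p(2) less_imp_le)
  then have "\<kappa> * (x * y - w * z) < \<kappa> * (r * p)" using k by simp
  then have "p\<^sup>2 < (\<kappa> * r) * p" using reg unfolding p(1)[symmetric] by (simp add: mult_ac)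
  then have "p * p < (\<kappa> * r) * p" by (simp add: power2_eq_square)
  then have "p < \<kappa> * r" using p(2) by simp
  then show "sqrt (y\<^sup>2 + z\<^sup>2) < \<kappa> * sqrt (w\<^sup>2 + x\<^sup>2)" unfolding r_def p_def .
qed

text \<open>The X-letters at both ends make the slope along X exactly 1 for either \<sigma>. The
  slope E along Y is the scalar product of (p, D) and (K, L) divided by p r^2, and Cauchy-Schwarz
  bounds it by \<kappa>.\<close>

lemma grad_bounded_cost_XWX:
  assumes ch: "chamber w x y z" and reg: "y\<^sup>2 + z\<^sup>2 \<le> \<kappa> * (x * y - w * z)" and k: "0 < \<kappa>"
  shows "grad_bounded \<kappa> (cost_XWX \<kappa>) w x y z"
  unfolding grad_bounded_def
proof (intro allI impI)
  fix \<sigma> a b :: real and cw cx cy cz :: "real \<Rightarrow> real" and t :: real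
  assume s: "\<sigma> \<in> {1, -1}" and v: "cw t = w" "cx t = x" "cy t = y" "cz t = z"
    and dw: "(cw has_real_derivative (- a * x - b * y) / 2) (at t)"
    and dx: "(cx has_real_derivative (a * w - \<sigma> * b * z) / 2) (at t)"
    and dy: "(cy has_real_derivative (\<sigma> * a * z + b * w) / 2) (at t)"
    and dz: "(cz has_real_derivative (\<sigma> * b * x - \<sigma> * a * y) / 2) (at t)"
  define r where "r = sqrt (w\<^sup>2 + x\<^sup>2)"
  define p where "p = sqrt (y\<^sup>2 + z\<^sup>2)"
  define n where "n = sqrt (1 + \<kappa>\<^sup>2)"
  note sq = chamber_sq_pos[OF ch] and ff = cost_XWX_region_facts[OF ch reg k]
  have r: "r\<^sup>2 = w\<^sup>2 + x\<^sup>2" "0 < r" using sq by (auto simp: r_def)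
  have p: "p\<^sup>2 = y\<^sup>2 + z\<^sup>2" "0 < p" using sq by (auto simp: p_def)
  have rp: "r\<^sup>2 + p\<^sup>2 = 1" using ch unfolding r p chamber_def by simp
  have n: "n\<^sup>2 = 1 + \<kappa>\<^sup>2" "0 < n" by (auto simp: n_def sum_power2_gt_zero_iff add_pos_nonneg)
  have pk: "p < \<kappa> * r" using ff(3) by (simp add: p_def r_def)
  \<comment> \<open>D encodes the cosines of both \<open>arcsin\<close> angles:
    \<open>D / \<kappa>\<close> for the W-letter and \<open>D / (\<kappa> * r)\<close> for the
    correction angle. It also gives (p, D) the length \<kappa> r.\<close>
  define D where "D = sqrt ((\<kappa> * r)\<^sup>2 - p\<^sup>2)"
  have "p\<^sup>2 < (\<kappa> * r)\<^sup>2" using pk p(2) by (intro power_strict_mono) auto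
  then have D: "D\<^sup>2 = (\<kappa> * r)\<^sup>2 - p\<^sup>2" "0 < D" by (auto simp: D_def)
  define m where "m = b * (y * w + \<sigma> * z * x) / 2"
  have m1: "y * ((\<sigma> * a * z + b * w) / 2) + z * ((\<sigma> * b * x - \<sigma> * a * y) / 2) = m"
    by (simp add: m_def field_simps)
  have m2: "w * ((- a * x - b * y) / 2) + x * ((a * w - \<sigma> * b * z) / 2) = - m"
    by (simp add: m_def field_simps)
  have dp: "((\<lambda>s. sqrt ((cy s)\<^sup>2 + (cz s)\<^sup>2)) has_real_derivative m / p) (at t)"
  proof -
    have "((\<lambda>s. (cy s)\<^sup>2 + (cz s)\<^sup>2) has_real_derivative 2 * m) (at t)"
      unfolding m1[symmetric] by (rule derivative_eq_intros dy dz refl)+ (use v in \<open>simp add: algebra_simps\<close>)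
    from DERIV_chain2[OF DERIV_real_sqrt this] sq(2) v
    have "((\<lambda>s. sqrt ((cy s)\<^sup>2 + (cz s)\<^sup>2)) has_real_derivative inverse p / 2 * (2 * m)) (at t)"
      by (simp add: p_def)
    then show ?thesis by (rule DERIV_cong) (simp add: field_simps)
  qed
  have dr: "((\<lambda>s. sqrt ((cw s)\<^sup>2 + (cx s)\<^sup>2)) has_real_derivative - m / r) (at t)"
  proof -
    have "((\<lambda>s. (cw s)\<^sup>2 + (cx s)\<^sup>2) has_real_derivative 2 * (- m)) (at t)"
      unfolding m2[symmetric] by (rule derivative_eq_intros dw dx refl)+ (use v in \<open>simp add: algebra_simps\<close>)
    from DERIV_chain2[OF DERIV_real_sqrt this] sq(1) v
    have "((\<lambda>s. sqrt ((cw s)\<^sup>2 + (cx s)\<^sup>2)) has_real_derivative inverse r / 2 * (2 * (- m))) (at t)"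
      by (simp add: r_def)
    then show ?thesis by (rule DERIV_cong) (simp add: field_simps)
  qed
  have e: "sqrt ((cy t)\<^sup>2 + (cz t)\<^sup>2) = p" "sqrt ((cw t)\<^sup>2 + (cx t)\<^sup>2) = r" by (simp_all add: v p_def r_def)
  have 1: "((\<lambda>s. arctan (cw s / cx s)) has_real_derivative
     (((- a * x - b * y) / 2) * x - w * ((a * w - \<sigma> * b * z) / 2)) / r\<^sup>2) (at t)"
  proof -
    have "((\<lambda>s. cw s / cx s) has_real_derivative (((- a * x - b * y) / 2) * x - w * ((a * w - \<sigma> * b * z) / 2)) / (x * x)) (at t)"
      using DERIV_divide[OF dw dx] v ff(1) by simp
    from DERIV_chain2[OF DERIV_arctan this]
    have "((\<lambda>s. arctan (cw s / cx s)) has_real_derivative inverse (1 + (w / x)\<^sup>2) * ((((- a * x - b * y) / 2) * x - w * ((a * w - \<sigma> * b * z) / 2)) / (x * x))) (at t)"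
      unfolding v .
    moreover have "1 + (w / x)\<^sup>2 = r\<^sup>2 / x\<^sup>2" unfolding r using ff(1) by (simp add: field_simps)
    ultimately show ?thesis using ff(1) by (simp add: power2_eq_square)
  qed
  have 2: "((\<lambda>s. arcsin (n / \<kappa> * sqrt ((cy s)\<^sup>2 + (cz s)\<^sup>2))) has_real_derivative n * m / (p * D)) (at t)"
  proof -
    have q: "1 - (n / \<kappa> * p)\<^sup>2 = (D / \<kappa>)\<^sup>2"
    proof -
      have "1 - (n / \<kappa> * p)\<^sup>2 = (\<kappa>\<^sup>2 - n\<^sup>2 * p\<^sup>2) / \<kappa>\<^sup>2" using k by (simp add: field_simps)
      also have "\<kappa>\<^sup>2 - n\<^sup>2 * p\<^sup>2 = D\<^sup>2" unfolding n D power_mult_distrib using rp by algebra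
      finally show ?thesis by (simp add: power_divide)
    qed
    have "(n / \<kappa> * p)\<^sup>2 < 1" using q D(2) k by (smt (verit) divide_pos_pos zero_less_power)
    then have bd: "- 1 < n / \<kappa> * p" "n / \<kappa> * p < 1" unfolding abs_square_less_1 abs_less_iff by linarith+
    have sq: "sqrt (1 - (n / \<kappa> * p)\<^sup>2) = D / \<kappa>" unfolding q using D(2) k by simp
    have "((\<lambda>s. arcsin (n / \<kappa> * sqrt ((cy s)\<^sup>2 + (cz s)\<^sup>2))) has_real_derivative inverse (D / \<kappa>) * (n / \<kappa> * (m / p))) (at t)"
      using DERIV_chain2[OF DERIV_arcsin DERIV_cmult[OF dp, of "n / \<kappa>"]] bd sq unfolding e by simp
    then show ?thesis by (rule DERIV_cong) (use D(2) k p(2) in \<open>simp add: field_simps\<close>)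
  qed
  have 3: "((\<lambda>s. arcsin (sqrt ((cy s)\<^sup>2 + (cz s)\<^sup>2) / (\<kappa> * sqrt ((cw s)\<^sup>2 + (cx s)\<^sup>2)))) has_real_derivative m / (p * D * r\<^sup>2)) (at t)"
  proof -
    have q: "1 - (p / (\<kappa> * r))\<^sup>2 = (D / (\<kappa> * r))\<^sup>2"
      unfolding power_divide D(1) using k r(2) by (simp add: diff_divide_distrib)
    have bd: "- 1 < p / (\<kappa> * r)" "p / (\<kappa> * r) < 1" using pk p(2) k r(2) by (auto simp: less_divide_eq)
    have sq: "sqrt (1 - (p / (\<kappa> * r))\<^sup>2) = D / (\<kappa> * r)" unfolding q using D(2) k r(2) by simp
    have "((\<lambda>s. sqrt ((cy s)\<^sup>2 + (cz s)\<^sup>2) / (\<kappa> * sqrt ((cw s)\<^sup>2 + (cx s)\<^sup>2))) has_real_derivative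
       (m / p * (\<kappa> * r) - p * (\<kappa> * (- m / r))) / ((\<kappa> * r) * (\<kappa> * r))) (at t)"
      using DERIV_divide[OF dp DERIV_cmult[OF dr, of \<kappa>]] k r(2) unfolding e by simp
    moreover have "(m / p * (\<kappa> * r) - p * (\<kappa> * (- m / r))) / ((\<kappa> * r) * (\<kappa> * r)) = m * (r\<^sup>2 + p\<^sup>2) / (\<kappa> * p * r ^ 3)"
      using k r(2) p(2) by (simp add: field_simps power2_eq_square power3_eq_cube)
    ultimately have "((\<lambda>s. sqrt ((cy s)\<^sup>2 + (cz s)\<^sup>2) / (\<kappa> * sqrt ((cw s)\<^sup>2 + (cx s)\<^sup>2))) has_real_derivative m / (\<kappa> * p * r ^ 3)) (at t)"
      by (simp add: rp)
    from DERIV_chain2[OF DERIV_arcsin this] bd sq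
    have "((\<lambda>s. arcsin (sqrt ((cy s)\<^sup>2 + (cz s)\<^sup>2) / (\<kappa> * sqrt ((cw s)\<^sup>2 + (cx s)\<^sup>2)))) has_real_derivative inverse (D / (\<kappa> * r)) * (m / (\<kappa> * p * r ^ 3))) (at t)"
      unfolding e by simp
    then show ?thesis by (rule DERIV_cong) (use D(2) k p(2) r(2) in \<open>simp add: field_simps power2_eq_square power3_eq_cube\<close>)
  qed
  define E where "E = (x * y - \<sigma> * w * z) / r\<^sup>2 + D * (y * w + \<sigma> * z * x) / (p * r\<^sup>2)"
  have "((\<lambda>s. cost_XWX \<kappa> (cw s) (cx s) (cy s) (cz s)) has_real_derivative
     2 * (0 - (((- a * x - b * y) / 2) * x - w * ((a * w - \<sigma> * b * z) / 2)) / r\<^sup>2) + 2 * n * (n * m / (p * D)) - 2 * (m / (p * D * r\<^sup>2))) (at t)"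
    unfolding cost_XWX_def n_def[symmetric]
    by (intro DERIV_add DERIV_diff DERIV_cmult DERIV_const 1 2 3)
  moreover have "2 * (0 - (((- a * x - b * y) / 2) * x - w * ((a * w - \<sigma> * b * z) / 2)) / r\<^sup>2) + 2 * n * (n * m / (p * D)) - 2 * (m / (p * D * r\<^sup>2))
     = a * 1 + b * E"
  proof -
    have i: "2 * (0 - (((- a * x - b * y) / 2) * x - w * ((a * w - \<sigma> * b * z) / 2)) / r\<^sup>2) = a + b * ((x * y - \<sigma> * w * z) / r\<^sup>2)"
    proof -
      have "- 2 * (((- a * x - b * y) / 2) * x - w * ((a * w - \<sigma> * b * z) / 2)) = a * r\<^sup>2 + b * (x * y - \<sigma> * w * z)"
        unfolding r by (simp add: field_simps power2_eq_square)
      then have "(- 2 * (((- a * x - b * y) / 2) * x - w * ((a * w - \<sigma> * b * z) / 2))) / r\<^sup>2 = a + b * ((x * y - \<sigma> * w * z) / r\<^sup>2)"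
        using r(2) by (simp add: add_divide_distrib)
      moreover have "2 * (0 - Q / d) = (- 2 * Q) / d" for Q d :: real by simp
      ultimately show ?thesis by (simp only:)
    qed
    have "2 * n * (n * m / (p * D)) - 2 * (m / (p * D * r\<^sup>2)) = 2 * m * (n\<^sup>2 * r\<^sup>2 - 1) / (p * D * r\<^sup>2)"
      using p(2) D(2) r(2) by (simp add: field_simps power2_eq_square)
    also have "n\<^sup>2 * r\<^sup>2 - 1 = D\<^sup>2" unfolding n D power_mult_distrib using rp by algebra
    also have "2 * m * D\<^sup>2 / (p * D * r\<^sup>2) = b * (D * (y * w + \<sigma> * z * x) / (p * r\<^sup>2))"
      using p(2) D(2) r(2) by (simp add: m_def power2_eq_square)
    finally show ?thesis using i unfolding E_def by (simp add: distrib_left)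
  qed
  moreover have "a * 1 + b * E \<le> \<bar>a\<bar> + \<kappa> * \<bar>b\<bar>"
  proof (rule linear_form_bound)
    define K where "K = x * y - \<sigma> * w * z"
    define L where "L = y * w + \<sigma> * z * x"
    have KL: "K\<^sup>2 + L\<^sup>2 = r\<^sup>2 * p\<^sup>2" proof -
      have "\<sigma>\<^sup>2 = 1" using s by auto
      then show ?thesis unfolding K_def L_def r p by algebra
    qed
    have E: "E = (p * K + D * L) / (p * r\<^sup>2)" unfolding E_def K_def[symmetric] L_def[symmetric]
      using p(2) r(2) by (simp add: field_simps)
    have "(p * K + D * L)\<^sup>2 \<le> (p\<^sup>2 + D\<^sup>2) * (K\<^sup>2 + L\<^sup>2)"
    proof -
      have "(p\<^sup>2 + D\<^sup>2) * (K\<^sup>2 + L\<^sup>2) - (p * K + D * L)\<^sup>2 = (p * L - D * K)\<^sup>2" by algebra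
      then show ?thesis by (metis diff_ge_0_iff_ge zero_le_power2)
    qed
    also have "\<dots> = (\<kappa> * p * r\<^sup>2)\<^sup>2" unfolding KL D(1) by (simp add: power_mult_distrib power2_eq_square)
    finally have "\<bar>p * K + D * L\<bar> \<le> \<kappa> * p * r\<^sup>2"
      using k p(2) r(2) by (metis abs_le_square_iff abs_of_pos mult_pos_pos zero_less_power)
    then show "\<bar>E\<bar> \<le> \<kappa>" unfolding E using p(2) r(2) by (simp add: abs_divide abs_mult pos_divide_le_eq mult_ac)
  qed auto
  ultimately show "\<exists>D. ((\<lambda>s. cost_XWX \<kappa> (cw s) (cx s) (cy s) (cz s)) has_real_derivative D) (at t) \<and> D \<le> \<bar>a\<bar> + \<kappa> * \<bar>b\<bar>"
    by auto
qed

section \<open>Words with an X-letter, a W-letter and a Y-letter\<close>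

definition Psi :: "real \<Rightarrow> real \<Rightarrow> real" where
  "Psi \<kappa> u = (let v = sqrt (u / (\<kappa> - (1 + \<kappa>\<^sup>2) * u)); n = sqrt (1 + \<kappa>\<^sup>2) in
     2 * n * arctan (n * v) - (1 + \<kappa>) * arctan ((1 + \<kappa>) * v) - (1 - \<kappa>) * arctan ((1 - \<kappa>) * v))"

text \<open>The origin is 2 \<alpha> + 2 \<kappa> \<beta> = (1 + \<kappa>) (\<alpha> + \<beta>) + (1
  - \<kappa>) (\<alpha> - \<beta>). The \<open>arctan\<close> terms are the polar angles of the
  plane vectors (w - z, x + y) and (w + z, x - y); \<open>Psi\<close> adds the cost of the W-letter
  and removes the angles it contributes. Since x y - w z = \<kappa> (sin \<tau>)^2 / (1 +
  \<kappa>^2), the v inside \<open>Psi\<close> is tan \<tau> divided by the length of W.\<close>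

definition cost_XWY :: "real \<Rightarrow> real \<Rightarrow> real \<Rightarrow> real \<Rightarrow> real \<Rightarrow> real" where
  "cost_XWY \<kappa> w x y z = (1 + \<kappa>) * (pi / 2 - arctan ((w - z) / (x + y))) + (1 - \<kappa>) * arctan ((x - y) / (w + z)) + Psi \<kappa> (x * y - w * z)"

text \<open>\<open>Psi\<close> in the variable v, in which it is smooth; the square root that
  produces v from u is not differentiable at u = 0.\<close>

definition Psi0 :: "real \<Rightarrow> real \<Rightarrow> real" where
  "Psi0 \<kappa> v = 2 * sqrt (1 + \<kappa>\<^sup>2) * arctan (sqrt (1 + \<kappa>\<^sup>2) * v) - (1 + \<kappa>) * arctan ((1 + \<kappa>) * v) - (1 - \<kappa>) * arctan ((1 - \<kappa>) * v)"

lemma arctan_scale_deriv: "((\<lambda>v. g * arctan (g * v)) has_real_derivative g\<^sup>2 / (1 + g\<^sup>2 * v\<^sup>2)) (at v)"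
proof -
  have "((\<lambda>v. g * arctan (g * v)) has_real_derivative g * (inverse (1 + (g * v)\<^sup>2) * (g * 1))) (at v)"
    by (intro DERIV_cmult DERIV_chain2[OF DERIV_arctan] DERIV_ident)
  then show ?thesis by (rule DERIV_cong) (simp add: field_simps power2_eq_square)
qed

lemma Psi0_deriv: "(Psi0 \<kappa> has_real_derivative 2 * (1 + \<kappa>\<^sup>2) / (1 + (1 + \<kappa>\<^sup>2) * v\<^sup>2) - (1 + \<kappa>)\<^sup>2 / (1 + (1 + \<kappa>)\<^sup>2 * v\<^sup>2) - (1 - \<kappa>)\<^sup>2 / (1 + (1 - \<kappa>)\<^sup>2 * v\<^sup>2)) (at v)"
proof -
  have n: "(sqrt (1 + \<kappa>\<^sup>2))\<^sup>2 = 1 + \<kappa>\<^sup>2" by simp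
  have "((\<lambda>v. 2 * (sqrt (1 + \<kappa>\<^sup>2) * arctan (sqrt (1 + \<kappa>\<^sup>2) * v)) - (1 + \<kappa>) * arctan ((1 + \<kappa>) * v) - (1 - \<kappa>) * arctan ((1 - \<kappa>) * v))
    has_real_derivative 2 * ((1 + \<kappa>\<^sup>2) / (1 + (1 + \<kappa>\<^sup>2) * v\<^sup>2)) - (1 + \<kappa>)\<^sup>2 / (1 + (1 + \<kappa>)\<^sup>2 * v\<^sup>2) - (1 - \<kappa>)\<^sup>2 / (1 + (1 - \<kappa>)\<^sup>2 * v\<^sup>2)) (at v)"
    using arctan_scale_deriv[of "sqrt (1 + \<kappa>\<^sup>2)" v, unfolded n] by (intro DERIV_diff DERIV_cmult arctan_scale_deriv)
  then show ?thesis unfolding Psi0_def[abs_def] by (simp add: mult.assoc)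
qed

text \<open>The linear terms cancel because 2 (1 + \<kappa>^2) = (1 + \<kappa>)^2 + (1 -
  \<kappa>)^2. Cubic order in v is order 3/2 in u, and this makes \<open>Psi\<close> differentiable
  at u = 0 in spite of the square root.\<close>

lemma Psi0_cubic: "\<bar>Psi0 \<kappa> v\<bar> \<le> (2 * (1 + \<kappa>\<^sup>2)\<^sup>2 + (1 + \<kappa>) ^ 4 + (1 - \<kappa>) ^ 4) * \<bar>v\<bar> ^ 3"
proof -
  define M where "M = 2 * (1 + \<kappa>\<^sup>2)\<^sup>2 + (1 + \<kappa>) ^ 4 + (1 - \<kappa>) ^ 4"
  define d where "d = (\<lambda>v::real. 2 * (1 + \<kappa>\<^sup>2) / (1 + (1 + \<kappa>\<^sup>2) * v\<^sup>2) - (1 + \<kappa>)\<^sup>2 / (1 + (1 + \<kappa>)\<^sup>2 * v\<^sup>2) - (1 - \<kappa>)\<^sup>2 / (1 + (1 - \<kappa>)\<^sup>2 * v\<^sup>2))"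
  have sp: "g / (1 + g * s) = g - g\<^sup>2 * s / (1 + g * s) \<and> 0 \<le> g\<^sup>2 * s / (1 + g * s) \<and> g\<^sup>2 * s / (1 + g * s) \<le> g\<^sup>2 * s"
    if "0 \<le> g" "0 \<le> s" for g s :: real
  proof -
    have p: "1 \<le> 1 + g * s" using that by simp
    have "g\<^sup>2 * s / (1 + g * s) \<le> g\<^sup>2 * s / 1" using that p by (intro divide_left_mono) (auto simp: add_pos_nonneg)
    moreover have "g / (1 + g * s) = g - g\<^sup>2 * s / (1 + g * s)" using p by (simp add: field_simps power2_eq_square)
    ultimately show ?thesis using that by simp
  qed
  have db: "\<bar>d t\<bar> \<le> M * t\<^sup>2" for t
  proof -
    note a = sp[of "1 + \<kappa>\<^sup>2" "t\<^sup>2"] sp[of "(1 + \<kappa>)\<^sup>2" "t\<^sup>2"] sp[of "(1 - \<kappa>)\<^sup>2" "t\<^sup>2"]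
    have "2 * (1 + \<kappa>\<^sup>2) - (1 + \<kappa>)\<^sup>2 - (1 - \<kappa>)\<^sup>2 = 0" by algebra
    moreover have "M * t\<^sup>2 = 2 * ((1 + \<kappa>\<^sup>2)\<^sup>2 * t\<^sup>2) + ((1 + \<kappa>)\<^sup>2)\<^sup>2 * t\<^sup>2 + ((1 - \<kappa>)\<^sup>2)\<^sup>2 * t\<^sup>2"
      unfolding M_def by algebra
    moreover have "d t = 2 * ((1 + \<kappa>\<^sup>2) / (1 + (1 + \<kappa>\<^sup>2) * t\<^sup>2)) - (1 + \<kappa>)\<^sup>2 / (1 + (1 + \<kappa>)\<^sup>2 * t\<^sup>2) - (1 - \<kappa>)\<^sup>2 / (1 + (1 - \<kappa>)\<^sup>2 * t\<^sup>2)"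
      by (simp add: d_def)
    moreover have "0 \<le> 1 + \<kappa>\<^sup>2" "0 \<le> (1 + \<kappa>)\<^sup>2" "0 \<le> (1 - \<kappa>)\<^sup>2" "0 \<le> t\<^sup>2" by auto
    moreover have "\<bar>D\<bar> \<le> N" if "2 * g1 - g2 - g3 = 0" "N = 2 * K1 + K2 + params_W" "D = 2 * X1 - X2 - X3"
      "X1 = g1 - H1 \<and> 0 \<le> H1 \<and> H1 \<le> K1" "X2 = g2 - H2 \<and> 0 \<le> H2 \<and> H2 \<le> K2" "X3 = g3 - H3 \<and> 0 \<le> H3 \<and> H3 \<le> params_W"
      for D N g1 g2 g3 K1 K2 params_W X1 X2 X3 H1 H2 H3 :: real
      using that by linarith
    ultimately show ?thesis using a by blast
  qed
  have M0: "0 \<le> M" by (simp add: M_def)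
  have "\<bar>Psi0 \<kappa> v - Psi0 \<kappa> 0\<bar> \<le> (M * \<bar>v\<bar>\<^sup>2) * \<bar>v - 0\<bar>"
  proof (rule field_differentiable_bound[of "cball 0 \<bar>v\<bar>" "Psi0 \<kappa>" d, unfolded real_norm_def])
    show "convex (cball 0 \<bar>v\<bar> :: real set)" by simp
    show "(Psi0 \<kappa> has_field_derivative d t) (at t within cball 0 \<bar>v\<bar>)" for t
      unfolding d_def using Psi0_deriv has_field_derivative_at_within by blast
    show "\<bar>d t\<bar> \<le> M * \<bar>v\<bar>\<^sup>2" if "t \<in> cball 0 \<bar>v\<bar>" for t
    proof -
      have "t\<^sup>2 \<le> \<bar>v\<bar>\<^sup>2" using that by (simp add: abs_le_square_iff)
      then show ?thesis using db[of t] mult_left_mono[OF _ M0] by (meson order_trans)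
    qed
  qed auto
  moreover have "Psi0 \<kappa> 0 = 0" by (simp add: Psi0_def)
  moreover have "M * \<bar>v\<bar>\<^sup>2 * \<bar>v - 0\<bar> = M * \<bar>v\<bar> ^ 3" by (simp add: power2_eq_square power3_eq_cube)
  ultimately show ?thesis unfolding M_def[symmetric] by (simp only: diff_0_right)
qed

lemma Psi_Psi0: "Psi \<kappa> u = Psi0 \<kappa> (sqrt (u / (\<kappa> - (1 + \<kappa>\<^sup>2) * u)))"
  by (simp add: Psi_def Psi0_def Let_def)

lemma half_bound: "0 < \<kappa> \<Longrightarrow> (1 + \<kappa>\<^sup>2) * u < \<kappa> \<Longrightarrow> 2 * u < (1::real)"
proof -
  assume k: "0 < \<kappa>" and u: "(1 + \<kappa>\<^sup>2) * u < \<kappa>"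
  have "2 * \<kappa> \<le> 1 + \<kappa>\<^sup>2" using zero_le_power2[of "\<kappa> - 1"] by (simp add: power2_eq_square algebra_simps)
  then have "(1 + \<kappa>\<^sup>2) * (2 * u) < (1 + \<kappa>\<^sup>2) * 1" using u by simp
  then show ?thesis by (simp add: add_pos_nonneg)
qed

text \<open>The value u = 0 has to be included: it is the interface \<open>x * y = w * z\<close>,
  which paths cross. For u > 0 the three fractions of the derivative of \<open>Psi0\<close> combine
  over the denominators 1 + 2 u and 1 - 2 u.\<close>

lemma Psi_deriv:
  assumes k: "0 < \<kappa>" and u: "0 \<le> u" "(1 + \<kappa>\<^sup>2) * u < \<kappa>"
  shows "(Psi \<kappa> has_real_derivative 4 * sqrt (u * (\<kappa> - (1 + \<kappa>\<^sup>2) * u)) / (1 - 4 * u\<^sup>2)) (at u)"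
proof (cases "u = 0")
  case False
  then have u0: "0 < u" using u by simp
  define E where "E = \<kappa> - (1 + \<kappa>\<^sup>2) * u"
  define v where "v = sqrt (u / E)"
  have E: "0 < E" using u by (simp add: E_def)
  have v: "0 < v" "v\<^sup>2 = u / E" using u0 E by (auto simp: v_def)
  have 2: "2 * u < 1" by (rule half_bound[OF k u(2)])
  then have pos: "0 < 1 + 2 * u" "0 < 1 - 2 * u" using u0 by auto
  have q: "1 - 4 * u\<^sup>2 = (1 + 2 * u) * (1 - 2 * u)" by algebra
  have d1: "((\<lambda>u. u / (\<kappa> - (1 + \<kappa>\<^sup>2) * u)) has_real_derivative \<kappa> / E\<^sup>2) (at u)"
  proof -
    have "((\<lambda>u. u / (\<kappa> - (1 + \<kappa>\<^sup>2) * u)) has_real_derivative (1 * E - u * (0 - (1 + \<kappa>\<^sup>2) * 1)) / (E * E)) (at u)"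
      unfolding E_def by (intro DERIV_divide DERIV_diff DERIV_const DERIV_cmult DERIV_ident) (use E E_def in auto)
    then show ?thesis by (rule DERIV_cong) (simp add: E_def power2_eq_square algebra_simps)
  qed
  have d2: "((\<lambda>u. sqrt (u / (\<kappa> - (1 + \<kappa>\<^sup>2) * u))) has_real_derivative inverse v / 2 * (\<kappa> / E\<^sup>2)) (at u)"
    using DERIV_chain2[OF DERIV_real_sqrt d1] u0 E by (simp add: v_def E_def)
  have n1: "1 + (1 + \<kappa>\<^sup>2) * v\<^sup>2 = \<kappa> / E" unfolding v(2) using E by (simp add: field_simps E_def)
  have n2: "1 + (1 + \<kappa>)\<^sup>2 * v\<^sup>2 = \<kappa> * (1 + 2 * u) / E" unfolding v(2) using E by (simp add: field_simps E_def power2_eq_square)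
  have n3: "1 + (1 - \<kappa>)\<^sup>2 * v\<^sup>2 = \<kappa> * (1 - 2 * u) / E" unfolding v(2) using E by (simp add: field_simps E_def power2_eq_square)
  have D0: "(Psi0 \<kappa> has_real_derivative 8 * u * E\<^sup>2 / (\<kappa> * (1 - 4 * u\<^sup>2))) (at v)"
  proof (rule DERIV_cong[OF Psi0_deriv])
    have "2 * (1 + \<kappa>\<^sup>2) * ((1 + 2 * u) * (1 - 2 * u)) - (1 + \<kappa>)\<^sup>2 * (1 - 2 * u) - (1 - \<kappa>)\<^sup>2 * (1 + 2 * u) = 8 * u * E"
      unfolding E_def by algebra
    then have "8 * u * E / ((1 + 2 * u) * (1 - 2 * u)) = 2 * (1 + \<kappa>\<^sup>2) - (1 + \<kappa>)\<^sup>2 / (1 + 2 * u) - (1 - \<kappa>)\<^sup>2 / (1 - 2 * u)"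
      using pos by (simp add: field_simps)
    note s = this
    have "2 * (1 + \<kappa>\<^sup>2) / (1 + (1 + \<kappa>\<^sup>2) * v\<^sup>2) - (1 + \<kappa>)\<^sup>2 / (1 + (1 + \<kappa>)\<^sup>2 * v\<^sup>2) - (1 - \<kappa>)\<^sup>2 / (1 + (1 - \<kappa>)\<^sup>2 * v\<^sup>2)
      = E / \<kappa> * (2 * (1 + \<kappa>\<^sup>2) - (1 + \<kappa>)\<^sup>2 / (1 + 2 * u) - (1 - \<kappa>)\<^sup>2 / (1 - 2 * u))"
    proof -
      have g: "A / (\<kappa> / E) = E / \<kappa> * A" "A / (\<kappa> * B / E) = E / \<kappa> * (A / B)" for A B by simp_all
      show ?thesis unfolding n1 n2 n3 unfolding g by (simp only: right_diff_distrib)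
    qed
    also have "\<dots> = 8 * u * E\<^sup>2 / (\<kappa> * (1 - 4 * u\<^sup>2))" unfolding s[symmetric] q by (simp add: power2_eq_square)
    finally show "2 * (1 + \<kappa>\<^sup>2) / (1 + (1 + \<kappa>\<^sup>2) * v\<^sup>2) - (1 + \<kappa>)\<^sup>2 / (1 + (1 + \<kappa>)\<^sup>2 * v\<^sup>2) - (1 - \<kappa>)\<^sup>2 / (1 + (1 - \<kappa>)\<^sup>2 * v\<^sup>2) =
      8 * u * E\<^sup>2 / (\<kappa> * (1 - 4 * u\<^sup>2))" .
  qed
  have "(Psi \<kappa> has_real_derivative 8 * u * E\<^sup>2 / (\<kappa> * (1 - 4 * u\<^sup>2)) * (inverse v / 2 * (\<kappa> / E\<^sup>2))) (at u)"
    unfolding Psi_Psi0[abs_def] by (rule DERIV_chain2[OF _ d2]) (use D0 in \<open>simp only: v_def E_def\<close>)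
  moreover have "sqrt (u * E) = u / v" using u0 E by (simp add: v_def real_sqrt_mult real_sqrt_divide field_simps)
  moreover have "8 * u * E\<^sup>2 / (\<kappa> * Q) * (inverse v / 2 * (\<kappa> / E\<^sup>2)) = 4 * (u / v) / Q" for Q
    using E k v(1) by (simp add: divide_simps)
  ultimately show ?thesis unfolding E_def[symmetric] by (simp only:)
next
  case True
  define M where "M = 2 * (1 + \<kappa>\<^sup>2)\<^sup>2 + (1 + \<kappa>) ^ 4 + (1 - \<kappa>) ^ 4"
  define g where "g = (\<lambda>u. sqrt (u / (\<kappa> - (1 + \<kappa>\<^sup>2) * u)))"
  have "((\<lambda>h. M * \<bar>g h\<bar> * \<bar>1 / (\<kappa> - (1 + \<kappa>\<^sup>2) * h)\<bar>) \<longlongrightarrow> M * \<bar>sqrt (0 / (\<kappa> - (1 + \<kappa>\<^sup>2) * 0))\<bar> * \<bar>1 / (\<kappa> - (1 + \<kappa>\<^sup>2) * 0)\<bar>) (at 0)"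
    unfolding g_def by (intro tendsto_intros) (use k in auto)
  then have lim: "((\<lambda>h. M * \<bar>g h\<bar> * \<bar>1 / (\<kappa> - (1 + \<kappa>\<^sup>2) * h)\<bar>) \<longlongrightarrow> 0) (at 0)" by simp
  have "((\<lambda>h. (Psi \<kappa> (0 + h) - Psi \<kappa> 0) / h) \<longlongrightarrow> 0) (at 0)"
  proof (rule Lim_null_comparison[OF always_eventually lim], intro allI)
    fix h :: real
    have P: "\<bar>Psi \<kappa> h\<bar> \<le> M * \<bar>g h\<bar> ^ 3" using Psi0_cubic[of \<kappa> "g h"] by (simp add: Psi_Psi0 g_def M_def)
    \<comment> \<open>\<open>sqrt\<close> is an odd function here, so the estimate also covers h <
      0, as the two-sided derivative requires.\<close>
    have g2: "\<bar>g h\<bar>\<^sup>2 = \<bar>h\<bar> * \<bar>1 / (\<kappa> - (1 + \<kappa>\<^sup>2) * h)\<bar>" unfolding g_def by (simp add: real_sqrt_abs2 abs_divide power2_eq_square flip: abs_mult real_sqrt_mult)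
    show "norm ((Psi \<kappa> (0 + h) - Psi \<kappa> 0) / h) \<le> M * \<bar>g h\<bar> * \<bar>1 / (\<kappa> - (1 + \<kappa>\<^sup>2) * h)\<bar>"
    proof (cases "h = 0")
      case False
      have "Psi \<kappa> 0 = 0" by (simp add: Psi_Psi0 Psi0_def)
      then have "norm ((Psi \<kappa> (0 + h) - Psi \<kappa> 0) / h) = \<bar>Psi \<kappa> h\<bar> / \<bar>h\<bar>" by (simp add: abs_divide)
      also have "\<dots> \<le> M * \<bar>g h\<bar> ^ 3 / \<bar>h\<bar>" using P by (intro divide_right_mono) auto
      also have "\<bar>g h\<bar> ^ 3 = \<bar>g h\<bar> * (\<bar>h\<bar> * \<bar>1 / (\<kappa> - (1 + \<kappa>\<^sup>2) * h)\<bar>)" using g2 by (simp add: power3_eq_cube power2_eq_square)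
      finally show ?thesis using False by simp
    next
      case True then show ?thesis by (simp add: M_def)
    qed
  qed
  then show ?thesis unfolding True DERIV_def by simp
qed

text \<open>Right multiplication changes the Y-letter at the end, left multiplication the X-letter
  at the beginning. So one slope is exact: \<kappa> along Y for \<sigma> = 1, and 1 along X for
  \<sigma> = -1. The other slope is a scalar product of two plane vectors of known length.\<close>

lemma grad_bounded_cost_XWY:
  assumes ch: "chamber w x y z" and k: "0 < \<kappa>" and u0: "0 \<le> x * y - w * z" "(1 + \<kappa>\<^sup>2) * (x * y - w * z) < \<kappa>"
  shows "grad_bounded \<kappa> (cost_XWY \<kappa>) w x y z"
  unfolding grad_bounded_def
proof (intro allI impI)
  fix \<sigma> a b :: real and cw cx cy cz :: "real \<Rightarrow> real" and t :: real
  assume s: "\<sigma> \<in> {1, -1}" and v: "cw t = w" "cx t = x" "cy t = y" "cz t = z"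
    and dw: "(cw has_real_derivative (- a * x - b * y) / 2) (at t)"
    and dx: "(cx has_real_derivative (a * w - \<sigma> * b * z) / 2) (at t)"
    and dy: "(cy has_real_derivative (\<sigma> * a * z + b * w) / 2) (at t)"
    and dz: "(cz has_real_derivative (\<sigma> * b * x - \<sigma> * a * y) / 2) (at t)"
  have unit: "w\<^sup>2 + x\<^sup>2 + y\<^sup>2 + z\<^sup>2 = 1" and pos: "0 < x + y" "0 < w + z" using ch by (auto simp: chamber_def)
  define w' where "w' = (- a * x - b * y) / 2"
  define x' where "x' = (a * w - \<sigma> * b * z) / 2"
  define y' where "y' = (\<sigma> * a * z + b * w) / 2"
  define z' where "z' = (\<sigma> * b * x - \<sigma> * a * y) / 2"
  note d = dw[folded w'_def] dx[folded x'_def] dy[folded y'_def] dz[folded z'_def]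
  define u where "u = x * y - w * z"
  note u1 = u0[folded u_def]
  \<comment> \<open>\<open>2 * R / (1 - 4 * u\<^sup>2)\<close> is the derivative of
    \<open>Psi\<close>. Adding the square of R turns both
    \<open>(1 - 2 * \<kappa> * u)\<^sup>2\<close> and \<open>(\<kappa> - 2 * u)\<^sup>2\<close> into
    multiples of \<open>1 - 4 * u\<^sup>2\<close>, which is what Cauchy-Schwarz needs.\<close>
  define R where "R = 2 * sqrt (u * (\<kappa> - (1 + \<kappa>\<^sup>2) * u))"
  have R2: "R\<^sup>2 = 4 * (u * (\<kappa> - (1 + \<kappa>\<^sup>2) * u))" using u1 by (simp add: R_def power_mult_distrib)
  have h: "2 * u < 1" by (rule half_bound[OF k u1(2)])
  have N: "0 < 1 + 2 * u" "0 < 1 - 2 * u" using h u1 by auto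
  have Np: "(w - z)\<^sup>2 + (x + y)\<^sup>2 = 1 + 2 * u" unfolding u_def using unit by algebra
  have Nm: "(w + z)\<^sup>2 + (x - y)\<^sup>2 = 1 - 2 * u" unfolding u_def using unit by algebra
  have q: "1 - 4 * u\<^sup>2 = (1 + 2 * u) * (1 - 2 * u)" by algebra
  have q0: "0 < 1 - 4 * u\<^sup>2" unfolding q using N by simp
  have 1: "((\<lambda>s. arctan ((cw s - cz s) / (cx s + cy s))) has_real_derivative
     ((w' - z') * (x + y) - (w - z) * (x' + y')) / (1 + 2 * u)) (at t)"
  proof -
    have "((\<lambda>s. (cw s - cz s) / (cx s + cy s)) has_real_derivative ((w' - z') * (x + y) - (w - z) * (x' + y')) / ((x + y) * (x + y))) (at t)"
      using DERIV_divide[OF DERIV_diff[OF d(1,4)] DERIV_add[OF d(2,3)]] pos unfolding v by simp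
    from DERIV_chain2[OF DERIV_arctan this]
    have "((\<lambda>s. arctan ((cw s - cz s) / (cx s + cy s))) has_real_derivative inverse (1 + ((w - z) / (x + y))\<^sup>2) * (((w' - z') * (x + y) - (w - z) * (x' + y')) / ((x + y) * (x + y)))) (at t)"
      unfolding v .
    moreover have "1 + ((w - z) / (x + y))\<^sup>2 = (1 + 2 * u) / (x + y)\<^sup>2" unfolding Np[symmetric] using pos by (simp add: power_divide add_divide_distrib)
    ultimately show ?thesis using pos by (simp add: power2_eq_square)
  qed
  have 2: "((\<lambda>s. arctan ((cx s - cy s) / (cw s + cz s))) has_real_derivative
     ((x' - y') * (w + z) - (x - y) * (w' + z')) / (1 - 2 * u)) (at t)"
  proof -
    have "((\<lambda>s. (cx s - cy s) / (cw s + cz s)) has_real_derivative ((x' - y') * (w + z) - (x - y) * (w' + z')) / ((w + z) * (w + z))) (at t)"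
      using DERIV_divide[OF DERIV_diff[OF d(2,3)] DERIV_add[OF d(1,4)]] pos unfolding v by simp
    from DERIV_chain2[OF DERIV_arctan this]
    have "((\<lambda>s. arctan ((cx s - cy s) / (cw s + cz s))) has_real_derivative inverse (1 + ((x - y) / (w + z))\<^sup>2) * (((x' - y') * (w + z) - (x - y) * (w' + z')) / ((w + z) * (w + z)))) (at t)"
      unfolding v .
    moreover have "1 + ((x - y) / (w + z))\<^sup>2 = (1 - 2 * u) / (w + z)\<^sup>2" unfolding Nm[symmetric] using pos by (simp add: power_divide add_divide_distrib)
    ultimately show ?thesis using pos by (simp add: power2_eq_square)
  qed
  have 3: "((\<lambda>s. Psi \<kappa> (cx s * cy s - cw s * cz s)) has_real_derivative (2 * R / (1 - 4 * u\<^sup>2)) * (x' * y + y' * x - (w' * z + z' * w))) (at t)"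
  proof -
    have 0: "((\<lambda>s. cx s * cy s - cw s * cz s) has_real_derivative x' * y + y' * x - (w' * z + z' * w)) (at t)"
      using DERIV_diff[OF DERIV_mult[OF d(2,3)] DERIV_mult[OF d(1,4)]] unfolding v .
    have "(Psi \<kappa> has_real_derivative 2 * R / (1 - 4 * u\<^sup>2)) (at (cx t * cy t - cw t * cz t))"
      using Psi_deriv[OF k u1] unfolding v u_def[symmetric] R_def by simp
    from DERIV_chain2[OF this 0] show ?thesis .
  qed
  define T where "T = (1 + \<kappa>) * (0 - ((w' - z') * (x + y) - (w - z) * (x' + y')) / (1 + 2 * u))
     + (1 - \<kappa>) * (((x' - y') * (w + z) - (x - y) * (w' + z')) / (1 - 2 * u)) + (2 * R / (1 - 4 * u\<^sup>2)) * (x' * y + y' * x - (w' * z + z' * w))"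
  have D: "((\<lambda>s. cost_XWY \<kappa> (cw s) (cx s) (cy s) (cz s)) has_real_derivative T) (at t)"
    unfolding cost_XWY_def T_def by (intro DERIV_add DERIV_diff DERIV_cmult DERIV_const 1 2 3)
  have cs: "\<bar>A * C + B * E\<bar> \<le> M" if "A\<^sup>2 + B\<^sup>2 = N1" "C\<^sup>2 + E\<^sup>2 = N2" "N1 * N2 = M\<^sup>2" "0 \<le> M" for A B C E M N1 N2 :: real
  proof -
    have "M\<^sup>2 = (A\<^sup>2 + B\<^sup>2) * (C\<^sup>2 + E\<^sup>2)" using that by simp
    then have "M\<^sup>2 - (A * C + B * E)\<^sup>2 = (A * E - B * C)\<^sup>2" by algebra
    then have "(A * C + B * E)\<^sup>2 \<le> M\<^sup>2" by (smt (verit) zero_le_power2)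
    then show ?thesis using that(4) by (metis abs_le_square_iff abs_of_nonneg)
  qed
  have neg: "0 - Q / N = (0 - Q) / N" for Q N :: real by simp
  have "T \<le> \<bar>a\<bar> + \<kappa> * \<bar>b\<bar>"
  proof (cases "\<sigma> = 1")
    case True
    define C where "C = w\<^sup>2 + x\<^sup>2 - y\<^sup>2 - z\<^sup>2"
    define S where "S = w * y + x * z"
    have e1: "0 - ((w' - z') * (x + y) - (w - z) * (x' + y')) = a * C / 2 + b * (1 + 2 * u) / 2"
      unfolding Np[symmetric] w'_def x'_def y'_def z'_def C_def True by (simp add: field_simps power2_eq_square)
    have e2: "(x' - y') * (w + z) - (x - y) * (w' + z') = a * C / 2 - b * (1 - 2 * u) / 2"
      unfolding Nm[symmetric] w'_def x'_def y'_def z'_def C_def True by (simp add: field_simps power2_eq_square)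
    have e3: "x' * y + y' * x - (w' * z + z' * w) = a * S"
      unfolding w'_def x'_def y'_def z'_def S_def True by (simp add: field_simps)
    have "T = (1 + \<kappa>) * ((a * C / 2 + b * (1 + 2 * u) / 2) / (1 + 2 * u)) + (1 - \<kappa>) * ((a * C / 2 - b * (1 - 2 * u) / 2) / (1 - 2 * u)) + (2 * R / (1 - 4 * u\<^sup>2)) * (a * S)"
      unfolding T_def neg e1 e2 e3 ..
    also have "\<dots> = a * (((1 - 2 * \<kappa> * u) * C + R * (2 * S)) / (1 - 4 * u\<^sup>2)) + b * \<kappa>"
      unfolding q using N by (simp add: divide_simps) (simp add: algebra_simps)
    finally have T: "T = a * (((1 - 2 * \<kappa> * u) * C + R * (2 * S)) / (1 - 4 * u\<^sup>2)) + b * \<kappa>" .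
    have "\<bar>(1 - 2 * \<kappa> * u) * C + R * (2 * S)\<bar> \<le> 1 - 4 * u\<^sup>2"
    proof (rule cs)
      show "(1 - 2 * \<kappa> * u)\<^sup>2 + R\<^sup>2 = 1 - 4 * u\<^sup>2" unfolding R2 by algebra
      show "C\<^sup>2 + (2 * S)\<^sup>2 = 1 - 4 * u\<^sup>2" unfolding q Np[symmetric] Nm[symmetric] C_def S_def by algebra
    qed (use q0 in \<open>auto simp: power2_eq_square\<close>)
    then have "\<bar>((1 - 2 * \<kappa> * u) * C + R * (2 * S)) / (1 - 4 * u\<^sup>2)\<bar> \<le> 1" using q0 by (simp add: abs_divide)
    then show ?thesis unfolding T by (rule linear_form_bound) (use k in auto)
  next
    case False
    then have \<sigma>: "\<sigma> = -1" using s by auto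
    define C where "C = w\<^sup>2 - x\<^sup>2 + y\<^sup>2 - z\<^sup>2"
    define S where "S = w * x + y * z"
    have e1: "0 - ((w' - z') * (x + y) - (w - z) * (x' + y')) = a * (1 + 2 * u) / 2 + b * C / 2"
      unfolding Np[symmetric] w'_def x'_def y'_def z'_def C_def \<sigma> by (simp add: field_simps power2_eq_square)
    have e2: "(x' - y') * (w + z) - (x - y) * (w' + z') = a * (1 - 2 * u) / 2 - b * C / 2"
      unfolding Nm[symmetric] w'_def x'_def y'_def z'_def C_def \<sigma> by (simp add: field_simps power2_eq_square)
    have e3: "x' * y + y' * x - (w' * z + z' * w) = b * S"
      unfolding w'_def x'_def y'_def z'_def S_def \<sigma> by (simp add: field_simps)
    have "T = (1 + \<kappa>) * ((a * (1 + 2 * u) / 2 + b * C / 2) / (1 + 2 * u)) + (1 - \<kappa>) * ((a * (1 - 2 * u) / 2 - b * C / 2) / (1 - 2 * u)) + (2 * R / (1 - 4 * u\<^sup>2)) * (b * S)"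
      unfolding T_def neg e1 e2 e3 ..
    also have "\<dots> = a * 1 + b * (((\<kappa> - 2 * u) * C + R * (2 * S)) / (1 - 4 * u\<^sup>2))"
      unfolding q using N by (simp add: divide_simps) (simp add: algebra_simps)
    finally have T: "T = a * 1 + b * (((\<kappa> - 2 * u) * C + R * (2 * S)) / (1 - 4 * u\<^sup>2))" .
    have "\<bar>(\<kappa> - 2 * u) * C + R * (2 * S)\<bar> \<le> \<kappa> * (1 - 4 * u\<^sup>2)"
    proof (rule cs)
      show "(\<kappa> - 2 * u)\<^sup>2 + R\<^sup>2 = \<kappa>\<^sup>2 * (1 - 4 * u\<^sup>2)" unfolding R2 by algebra
      show "C\<^sup>2 + (2 * S)\<^sup>2 = 1 - 4 * u\<^sup>2" unfolding q Np[symmetric] Nm[symmetric] C_def S_def by algebra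
    qed (use q0 k in \<open>auto simp: power2_eq_square\<close>)
    then have "\<bar>((\<kappa> - 2 * u) * C + R * (2 * S)) / (1 - 4 * u\<^sup>2)\<bar> \<le> \<kappa>" using q0 by (simp add: abs_divide pos_divide_le_eq)
    then show ?thesis unfolding T by (intro linear_form_bound) auto
  qed
  then show "\<exists>D. ((\<lambda>s. cost_XWY \<kappa> (cw s) (cx s) (cy s) (cz s)) has_real_derivative D) (at t) \<and> D \<le> \<bar>a\<bar> + \<kappa> * \<bar>b\<bar>"
    using D by blast
qed

section \<open>Recovering the letters of a word from the coordinates of its product\<close>

lemma norm_sqrt: "0 < sqrt (1 + (\<kappa>::real)\<^sup>2)" "(sqrt (1 + \<kappa>\<^sup>2))\<^sup>2 = 1 + \<kappa>\<^sup>2"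
  by (auto simp: add_pos_nonneg)

text \<open>Coordinates of exp (\<alpha> X) exp (\<tau> W) exp (\<beta> X) with W = (X + \<kappa> Y)
  / n normalised. The outer letters act on (w, x) through their sum and on (y, z) through their
  difference.\<close>

definition is_XWX :: "real \<Rightarrow> real \<Rightarrow> real \<Rightarrow> real \<Rightarrow> real \<Rightarrow> real \<Rightarrow> real \<Rightarrow> real \<Rightarrow> bool" where
  "is_XWX \<kappa> \<alpha> \<tau> \<beta> w x y z \<longleftrightarrow> (let n = sqrt (1 + \<kappa>\<^sup>2) in
     w = cos \<tau> * cos (\<alpha> + \<beta>) - sin \<tau> / n * sin (\<alpha> + \<beta>) \<and>
     x = cos \<tau> * sin (\<alpha> + \<beta>) + sin \<tau> / n * cos (\<alpha> + \<beta>) \<and>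
     y = \<kappa> * sin \<tau> / n * cos (\<alpha> - \<beta>) \<and> z = \<kappa> * sin \<tau> / n * sin (\<alpha> - \<beta>))"

text \<open>The norm p of (y, z) equals \<kappa> sin \<tau> / n and fixes \<tau>. The W-letter adds
  an angle \<omega>, so that \<phi> = \<alpha> + \<beta> + \<omega> and \<psi> = \<alpha> - \<beta>.
  The region condition is \<omega> \<le> \<phi> - \<psi>, that is \<beta> \<ge> 0, with equality on
  its boundary.\<close>

lemma cost_XWX_word:
  assumes ch: "chamber w x y z" and reg: "y\<^sup>2 + z\<^sup>2 \<le> \<kappa> * (x * y - w * z)" and k: "0 < \<kappa>"
  obtains \<alpha> \<tau> \<beta> where "is_XWX \<kappa> \<alpha> \<tau> \<beta> w x y z" "0 \<le> \<alpha>" "\<alpha> \<le> pi / 2" "0 \<le> \<tau>" "\<tau> < pi / 2" "0 \<le> \<beta>" "\<beta> \<le> pi / 2"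
    "cost_XWX \<kappa> w x y z = 2 * \<alpha> + 2 * \<beta> + 2 * sqrt (1 + \<kappa>\<^sup>2) * \<tau>"
    "y\<^sup>2 + z\<^sup>2 = \<kappa> * (x * y - w * z) \<Longrightarrow> \<beta> = 0"
proof -
  obtain \<theta> \<phi> \<psi> where t: "0 < \<theta>" "\<theta> < pi / 2" "0 \<le> \<phi>" "\<phi> \<le> pi / 2" "0 \<le> \<psi>" "\<psi> \<le> pi / 2"
    and c: "w = cos \<theta> * cos \<phi>" "x = cos \<theta> * sin \<phi>" "y = sin \<theta> * cos \<psi>" "z = sin \<theta> * sin \<psi>"
    using chamber_polar[OF ch] by metis
  define n where "n = sqrt (1 + \<kappa>\<^sup>2)"
  have n: "0 < n" "n\<^sup>2 = 1 + \<kappa>\<^sup>2" using norm_sqrt by (auto simp: n_def)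
  define r where "r = cos \<theta>"
  define p where "p = sin \<theta>"
  note c = c[folded r_def p_def]
  have rp: "0 < r" "0 < p" using t by (auto simp: r_def p_def sin_gt_zero cos_gt_zero_pi)
  have rp1: "r\<^sup>2 + p\<^sup>2 = 1" by (simp add: r_def p_def)
  have sr: "sqrt (w\<^sup>2 + x\<^sup>2) = r" using rp unfolding c by (simp add: power_mult_distrib flip: distrib_left)
  have sp: "sqrt (y\<^sup>2 + z\<^sup>2) = p" using rp unfolding c by (simp add: power_mult_distrib flip: distrib_left)
  have p2: "y\<^sup>2 + z\<^sup>2 = p\<^sup>2" unfolding c by (simp add: power_mult_distrib flip: distrib_left)
  have u: "x * y - w * z = r * p * sin (\<phi> - \<psi>)" unfolding c sin_diff by algebra
  note ff = cost_XWX_region_facts[OF ch reg k, unfolded sr sp]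
  have "p\<^sup>2 < (\<kappa> * r)\<^sup>2" using ff(3) rp by (intro power_strict_mono) auto
  moreover have "\<kappa>\<^sup>2 - (n * p)\<^sup>2 = (\<kappa> * r)\<^sup>2 - p\<^sup>2" unfolding power_mult_distrib n using rp1 by algebra
  ultimately have lt: "(n * p)\<^sup>2 < \<kappa>\<^sup>2" by linarith
  have np: "n * p < \<kappa>" using lt k by (metis less_imp_le power2_less_imp_less)
  define \<tau> where "\<tau> = arcsin (n / \<kappa> * p)"
  define \<omega> where "\<omega> = arcsin (p / (\<kappa> * r))"
  have tb: "0 < n / \<kappa> * p" "n / \<kappa> * p < 1" using np k n rp by (auto simp: field_simps)
  have ob: "0 < p / (\<kappa> * r)" "p / (\<kappa> * r) < 1" using ff(3) k rp by (auto simp: field_simps)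
  have st: "sin \<tau> = n / \<kappa> * p" unfolding \<tau>_def using tb by (intro sin_arcsin) auto
  have so: "sin \<omega> = p / (\<kappa> * r)" unfolding \<omega>_def using ob by (intro sin_arcsin) auto
  have tr: "0 \<le> \<tau>" "\<tau> < pi / 2"
    unfolding \<tau>_def using arcsin_lt_bounded[of "n / \<kappa> * p"] arcsin_less_arcsin[of 0 "n / \<kappa> * p"] tb by auto
  have orr: "0 \<le> \<omega>" "\<omega> < pi / 2"
    unfolding \<omega>_def using arcsin_lt_bounded[of "p / (\<kappa> * r)"] arcsin_less_arcsin[of 0 "p / (\<kappa> * r)"] ob by auto
  have ct: "cos \<tau> = r * cos \<omega>"
  proof -
    have "(cos \<tau>)\<^sup>2 = (r * cos \<omega>)\<^sup>2"
    proof -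
      have "(cos \<tau>)\<^sup>2 = 1 - (n / \<kappa> * p)\<^sup>2" by (simp add: cos_squared_eq st)
      moreover have "(r * cos \<omega>)\<^sup>2 = r\<^sup>2 - p\<^sup>2 / \<kappa>\<^sup>2"
        unfolding power_mult_distrib cos_squared_eq so using rp k by (simp add: field_simps)
      moreover have "(n / \<kappa> * p)\<^sup>2 = (1 + \<kappa>\<^sup>2) * p\<^sup>2 / \<kappa>\<^sup>2" by (simp add: power_mult_distrib power_divide n)
      moreover have "1 - (1 + \<kappa>\<^sup>2) * p\<^sup>2 / \<kappa>\<^sup>2 = r\<^sup>2 - p\<^sup>2 / \<kappa>\<^sup>2"
      proof -
        have "(1 + \<kappa>\<^sup>2) * p\<^sup>2 / \<kappa>\<^sup>2 = p\<^sup>2 / \<kappa>\<^sup>2 + p\<^sup>2" using k by (simp add: field_simps)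
        then show ?thesis using rp1 by linarith
      qed
      ultimately show ?thesis by simp
    qed
    moreover have "0 \<le> cos \<tau>" "0 \<le> r * cos \<omega>" using tr orr rp by (auto intro!: cos_ge_zero mult_nonneg_nonneg)
    ultimately show ?thesis by (metis power2_eq_iff_nonneg)
  qed
  have sn: "sin \<tau> / n = r * sin \<omega>" unfolding st so using n k rp by (simp add: field_simps)
  have kn: "\<kappa> * sin \<tau> / n = p" unfolding st using n k by (simp add: field_simps)
  have sin_le: "sin \<omega> \<le> sin (\<phi> - \<psi>)"
    using reg unfolding p2 u so using k rp by (simp add: field_simps power2_eq_square)
  have phpi: "0 \<le> \<phi> - \<psi>"
  proof (rule ccontr)
    assume "\<not> 0 \<le> \<phi> - \<psi>"
    then have "0 < sin (\<psi> - \<phi>)" using t by (intro sin_gt_zero) auto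
    then show False using sin_le so ob(1) sin_minus[of "\<psi> - \<phi>"] by simp
  qed
  have le: "\<omega> \<le> \<phi> - \<psi>" using sin_le phpi orr t by (subst (asm) sin_mono_le_eq) auto
  define \<alpha> where "\<alpha> = (\<phi> - \<omega> + \<psi>) / 2"
  define \<beta> where "\<beta> = (\<phi> - \<omega> - \<psi>) / 2"
  have ab: "\<alpha> + \<beta> = \<phi> - \<omega>" "\<alpha> - \<beta> = \<psi>" by (simp_all add: \<alpha>_def \<beta>_def field_simps)
  have W: "is_XWX \<kappa> \<alpha> \<tau> \<beta> w x y z"
    unfolding is_XWX_def Let_def n_def[symmetric] kn sn ct ab c
  proof (intro conjI)
    have "cos \<phi> = cos (\<phi> - \<omega>) * cos \<omega> - sin (\<phi> - \<omega>) * sin \<omega>" "sin \<phi> = sin (\<phi> - \<omega>) * cos \<omega> + cos (\<phi> - \<omega>) * sin \<omega>"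
      using cos_add[of "\<phi> - \<omega>" \<omega>] sin_add[of "\<phi> - \<omega>" \<omega>] by auto
    then show "r * cos \<phi> = r * cos \<omega> * cos (\<phi> - \<omega>) - r * sin \<omega> * sin (\<phi> - \<omega>)"
      "r * sin \<phi> = r * cos \<omega> * sin (\<phi> - \<omega>) + r * sin \<omega> * cos (\<phi> - \<omega>)"
      by (simp_all only:) (simp_all add: algebra_simps)
  qed auto
  have "0 < sin \<phi>" using ff(1) rp unfolding c by (simp add: zero_less_mult_iff)
  then have ph: "0 < \<phi>" using t(3) by (cases "\<phi> = 0") auto
  have "w / x = tan (pi / 2 - \<phi>)" unfolding c using rp by (simp add: tan_def sin_diff cos_diff)
  then have at: "arctan (w / x) = pi / 2 - \<phi>" using ph t by (simp only:) (rule arctan_tan, auto)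
  have F: "cost_XWX \<kappa> w x y z = 2 * \<alpha> + 2 * \<beta> + 2 * n * \<tau>"
    unfolding cost_XWX_def at sr sp n_def[symmetric] \<tau>_def[symmetric] \<omega>_def[symmetric] using ab by simp
  have z: "\<beta> = 0" if "y\<^sup>2 + z\<^sup>2 = \<kappa> * (x * y - w * z)"
  proof -
    have "sin (\<phi> - \<psi>) = sin \<omega>"
      using that unfolding p2 u so using k rp by (simp add: field_simps power2_eq_square)
    then have "\<phi> - \<psi> = \<omega>" using phpi orr t sin_inj_pi[of "\<phi> - \<psi>" \<omega>] by auto
    then show ?thesis by (simp add: \<beta>_def)
  qed
  show ?thesis
    by (rule that[OF W _ _ tr _ _ F[unfolded n_def] z]) (use le t orr in \<open>auto simp: \<alpha>_def \<beta>_def\<close>)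
qed

text \<open>The product \<open>exp (\<alpha> X) exp (\<tau> W) exp (\<beta> Y)\<close>: in the coordinates \<open>(w - z, x + y)\<close> and \<open>(w + z, x - y)\<close> it splits into two plane
  rotations, by \<open>\<alpha> + \<beta>\<close> and \<open>\<alpha> - \<beta>\<close>.\<close>

definition is_XWY :: "real \<Rightarrow> real \<Rightarrow> real \<Rightarrow> real \<Rightarrow> real \<Rightarrow> real \<Rightarrow> real \<Rightarrow> real \<Rightarrow> bool" where
  "is_XWY \<kappa> \<alpha> \<tau> \<beta> w x y z \<longleftrightarrow> (let n = sqrt (1 + \<kappa>\<^sup>2) in
     w - z = cos \<tau> * cos (\<alpha> + \<beta>) - (1 + \<kappa>) * sin \<tau> / n * sin (\<alpha> + \<beta>) \<and>
     x + y = cos \<tau> * sin (\<alpha> + \<beta>) + (1 + \<kappa>) * sin \<tau> / n * cos (\<alpha> + \<beta>) \<and>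
     w + z = cos \<tau> * cos (\<alpha> - \<beta>) - (1 - \<kappa>) * sin \<tau> / n * sin (\<alpha> - \<beta>) \<and>
     x - y = cos \<tau> * sin (\<alpha> - \<beta>) + (1 - \<kappa>) * sin \<tau> / n * cos (\<alpha> - \<beta>))"

lemma tan_polar:
  assumes "0 < c" and "d = arctan (g / c)"
  obtains N where "0 < N" "c = N * cos d" "g = N * sin d"
proof -
  have cd: "0 < cos d" unfolding assms(2) by (simp add: cos_arctan add_pos_nonneg)
  have "tan d = g / c" unfolding assms(2) by (rule tan_arctan)
  then have "sin d = g / c * cos d" using cd by (simp add: tan_def field_simps)
  then have "g = c / cos d * sin d" using assms(1) cd by (simp add: field_simps)
  moreover have "0 < c / cos d" "c = c / cos d * cos d" using assms(1) cd by simp_all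
  ultimately show ?thesis using that by blast
qed

text \<open>The substance is that \<open>arctan\<close> returns the right branch: x + y > 0 and w +
  z > 0 confine the two polar angles to (0, pi) and (-pi / 2, pi / 2).\<close>

lemma cost_XWY_of_XWY:
  assumes W: "is_XWY \<kappa> \<alpha> \<tau> \<beta> w x y z" and pos: "0 < x + y" "0 < w + z" and k: "0 < \<kappa>"
    and a: "0 \<le> \<alpha>" "\<alpha> \<le> pi / 2" and t: "0 \<le> \<tau>" "\<tau> < pi / 2" and b: "0 \<le> \<beta>" "\<beta> \<le> pi / 2"
  shows "cost_XWY \<kappa> w x y z = 2 * \<alpha> + 2 * \<kappa> * \<beta> + 2 * sqrt (1 + \<kappa>\<^sup>2) * \<tau>"
proof -
  define n where "n = sqrt (1 + \<kappa>\<^sup>2)"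
  have n: "0 < n" "n\<^sup>2 = 1 + \<kappa>\<^sup>2" using norm_sqrt by (auto simp: n_def)
  note W = W[unfolded is_XWY_def Let_def n_def[symmetric]]
  have ct: "0 < cos \<tau>" "0 \<le> sin \<tau>" using t by (auto simp: cos_gt_zero_pi sin_ge_zero)
  define dp where "dp = arctan (((1 + \<kappa>) * sin \<tau> / n) / cos \<tau>)"
  define dm where "dm = arctan (((1 - \<kappa>) * sin \<tau> / n) / cos \<tau>)"
  obtain N where N: "0 < N" "cos \<tau> = N * cos dp" "(1 + \<kappa>) * sin \<tau> / n = N * sin dp" using tan_polar[OF ct(1) dp_def] .
  obtain M where M: "0 < M" "cos \<tau> = M * cos dm" "(1 - \<kappa>) * sin \<tau> / n = M * sin dm" using tan_polar[OF ct(1) dm_def] .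
  have wz: "w - z = N * cos (\<alpha> + \<beta> + dp)" "x + y = N * sin (\<alpha> + \<beta> + dp)"
  proof -
    have "N * (A * cos dp - B * sin dp) = cos \<tau> * A - (1 + \<kappa>) * sin \<tau> / n * B"
      "N * (B * cos dp + A * sin dp) = cos \<tau> * B + (1 + \<kappa>) * sin \<tau> / n * A" for A B
      unfolding N(2,3) by (simp_all add: algebra_simps)
    then show "w - z = N * cos (\<alpha> + \<beta> + dp)" "x + y = N * sin (\<alpha> + \<beta> + dp)"
      unfolding cos_add[of "\<alpha> + \<beta>" dp] sin_add[of "\<alpha> + \<beta>" dp] using W by (simp_all only:)
  qed
  have wm: "w + z = M * cos (\<alpha> - \<beta> + dm)" "x - y = M * sin (\<alpha> - \<beta> + dm)"
  proof -
    have "M * (A * cos dm - B * sin dm) = cos \<tau> * A - (1 - \<kappa>) * sin \<tau> / n * B"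
      "M * (B * cos dm + A * sin dm) = cos \<tau> * B + (1 - \<kappa>) * sin \<tau> / n * A" for A B
      unfolding M(2,3) by (simp_all add: algebra_simps)
    then show "w + z = M * cos (\<alpha> - \<beta> + dm)" "x - y = M * sin (\<alpha> - \<beta> + dm)"
      unfolding cos_add[of "\<alpha> - \<beta>" dm] sin_add[of "\<alpha> - \<beta>" dm] using W by (simp_all only:)
  qed
  have dpb: "0 \<le> dp" "dp < pi / 2" unfolding dp_def using ct n k arctan_ubound by auto
  have dmb: "- (pi / 2) < dm" "dm < pi / 2" unfolding dm_def using arctan_ubound arctan_lbound by auto
  have s1: "0 < sin (\<alpha> + \<beta> + dp)" using pos(1) N(1) unfolding wz by (simp add: zero_less_mult_iff)
  have "\<alpha> + \<beta> + dp \<noteq> 0" using s1 by auto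
  moreover have "\<alpha> + \<beta> + dp < pi"
  proof (rule ccontr)
    assume "\<not> \<alpha> + \<beta> + dp < pi"
    then have "0 \<le> sin (\<alpha> + \<beta> + dp - pi)" using a b dpb by (intro sin_ge_zero) auto
    then show False using s1 by simp
  qed
  ultimately have r1: "0 < \<alpha> + \<beta> + dp" "\<alpha> + \<beta> + dp < pi" using a b dpb by auto
  have c1: "0 < cos (\<alpha> - \<beta> + dm)" using pos(2) M(1) unfolding wm by (simp add: zero_less_mult_iff)
  have r2: "\<bar>\<alpha> - \<beta> + dm\<bar> < pi / 2"
  proof (rule ccontr)
    assume "\<not> \<bar>\<alpha> - \<beta> + dm\<bar> < pi / 2"
    then have "cos \<bar>\<alpha> - \<beta> + dm\<bar> \<le> cos (pi / 2)" using a b dmb by (intro cos_monotone_0_pi_le) auto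
    then show False using c1 by simp
  qed
  have r3: "- (pi / 2) < \<alpha> - \<beta> + dm" "\<alpha> - \<beta> + dm < pi / 2" using r2 unfolding abs_less_iff by linarith+
  have "(w - z) / (x + y) = tan (pi / 2 - (\<alpha> + \<beta> + dp))" unfolding wz using N(1) by (simp add: tan_def sin_diff cos_diff)
  then have A: "arctan ((w - z) / (x + y)) = pi / 2 - (\<alpha> + \<beta> + dp)" using r1 by (simp only:) (rule arctan_tan, auto)
  have "(x - y) / (w + z) = tan (\<alpha> - \<beta> + dm)" unfolding wm using M(1) by (simp add: tan_def)
  then have B: "arctan ((x - y) / (w + z)) = \<alpha> - \<beta> + dm" using arctan_tan[OF r3] by (simp only:)
  \<comment> \<open>The outer letters act as plane rotations and preserve both lengths N and M, so x
    y - w z, a quarter of the difference of their squares, depends on the W-letter alone.\<close>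
  have u: "x * y - w * z = \<kappa> * (sin \<tau>)\<^sup>2 / n\<^sup>2"
  proof -
    have "4 * (x * y - w * z) = ((w - z)\<^sup>2 + (x + y)\<^sup>2) - ((w + z)\<^sup>2 + (x - y)\<^sup>2)" by algebra
    also have "(w - z)\<^sup>2 + (x + y)\<^sup>2 = N\<^sup>2" unfolding wz by (simp add: power_mult_distrib flip: distrib_left)
    also have "(w + z)\<^sup>2 + (x - y)\<^sup>2 = M\<^sup>2" unfolding wm by (simp add: power_mult_distrib flip: distrib_left)
    also have "N\<^sup>2 = (N * cos dp)\<^sup>2 + (N * sin dp)\<^sup>2" by (simp add: power_mult_distrib flip: distrib_left)
    also have "M\<^sup>2 = (M * cos dm)\<^sup>2 + (M * sin dm)\<^sup>2" by (simp add: power_mult_distrib flip: distrib_left)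
    finally have "4 * (x * y - w * z) = ((1 + \<kappa>) * sin \<tau> / n)\<^sup>2 - ((1 - \<kappa>) * sin \<tau> / n)\<^sup>2"
      unfolding N(2)[symmetric] M(2)[symmetric] N(3)[symmetric] M(3)[symmetric] by simp
    also have "\<dots> = 4 * (\<kappa> * (sin \<tau>)\<^sup>2 / n\<^sup>2)" unfolding power_divide diff_divide_distrib[symmetric] by (simp add: power_mult_distrib) algebra
    finally show ?thesis by simp
  qed
  have v: "sqrt ((x * y - w * z) / (\<kappa> - (1 + \<kappa>\<^sup>2) * (x * y - w * z))) = sin \<tau> / (n * cos \<tau>)"
  proof -
    have "\<kappa> - (1 + \<kappa>\<^sup>2) * (x * y - w * z) = \<kappa> * (cos \<tau>)\<^sup>2" unfolding u n(2)[symmetric] using n(1) by (simp add: cos_squared_eq algebra_simps)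
    then have "(x * y - w * z) / (\<kappa> - (1 + \<kappa>\<^sup>2) * (x * y - w * z)) = (sin \<tau> / (n * cos \<tau>))\<^sup>2"
      unfolding u using k n ct by (simp add: power_divide power_mult_distrib)
    then show ?thesis using n ct by (simp add: real_sqrt_abs)
  qed
  have "arctan (n * (sin \<tau> / (n * cos \<tau>))) = \<tau>"
    using n arctan_tan[of \<tau>] t by (simp add: tan_def)
  moreover have "arctan ((1 + \<kappa>) * (sin \<tau> / (n * cos \<tau>))) = dp" "arctan ((1 - \<kappa>) * (sin \<tau> / (n * cos \<tau>))) = dm"
    by (simp_all add: dp_def dm_def mult.commute)
  ultimately have P: "Psi \<kappa> (x * y - w * z) = 2 * n * \<tau> - (1 + \<kappa>) * dp - (1 - \<kappa>) * dm"
    unfolding Psi_def Let_def n_def[symmetric] v by simp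
  show ?thesis unfolding cost_XWY_def A B P n_def[symmetric] by (simp add: algebra_simps)
qed

text \<open>This keeps \<tau> below pi / 2. With S = x^2 + z^2 one has u^2 + (x w + y z)^2 = S (1 -
  S). If u reached \<kappa> / (1 + \<kappa>^2), then S \<ge> 1 / (1 + \<kappa>^2) \<ge> 1 / 2, where
  S (1 - S) is at most the square of that bound; so x w + y z = 0, which is impossible off the edges
  since x and y are positive.\<close>

lemma cost_XWY_region_strict:
  assumes ch: "chamber w x y z" and k: "0 < \<kappa>" "\<kappa> \<le> 1" and B: "x * y - w * z \<le> \<kappa> * (x\<^sup>2 + z\<^sup>2)"
  shows "(1 + \<kappa>\<^sup>2) * (x * y - w * z) < \<kappa>"
proof (rule ccontr)
  define u where "u = x * y - w * z"
  define S where "S = x\<^sup>2 + z\<^sup>2"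
  assume "\<not> (1 + \<kappa>\<^sup>2) * (x * y - w * z) < \<kappa>"
  then have ge: "\<kappa> \<le> (1 + \<kappa>\<^sup>2) * u" by (simp add: u_def)
  have p: "0 < 1 + \<kappa>\<^sup>2" by (simp add: add_pos_nonneg)
  have nn: "0 \<le> w" "0 \<le> x" "0 \<le> y" "0 \<le> z" "0 < w + z" using ch by (auto simp: chamber_def)
  have unit: "w\<^sup>2 + x\<^sup>2 + y\<^sup>2 + z\<^sup>2 = 1" using ch by (auto simp: chamber_def)
  have "0 < (1 + \<kappa>\<^sup>2) * u" using ge k by linarith
  then have "0 < u" using p by (simp add: zero_less_mult_iff)
  then have "0 < x * y" using mult_nonneg_nonneg[OF nn(1,4)] unfolding u_def by linarith
  then have xy: "0 < x" "0 < y" using nn by (auto simp: zero_less_mult_iff)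
  have "\<kappa> * 1 \<le> \<kappa> * ((1 + \<kappa>\<^sup>2) * S)"
  proof -
    have "(1 + \<kappa>\<^sup>2) * u \<le> (1 + \<kappa>\<^sup>2) * (\<kappa> * S)" using B[folded u_def S_def] p by (intro mult_left_mono) auto
    also have "\<dots> = \<kappa> * ((1 + \<kappa>\<^sup>2) * S)" by simp
    finally show ?thesis using ge by linarith
  qed
  then have S1: "1 \<le> (1 + \<kappa>\<^sup>2) * S" using k by simp
  have k2: "\<kappa>\<^sup>2 \<le> 1" using k by (simp add: power_le_one)
  have "u\<^sup>2 + (x * w + y * z)\<^sup>2 = S * (1 - S)"
  proof -
    have "1 - S = w\<^sup>2 + y\<^sup>2" unfolding S_def using unit by linarith
    then show ?thesis unfolding u_def S_def by algebra
  qed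
  moreover have "(1 + \<kappa>\<^sup>2)\<^sup>2 * (S * (1 - S)) \<le> \<kappa>\<^sup>2"
  proof -
    define Q where "Q = (1 + \<kappa>\<^sup>2) * S - 1"
    have Q: "0 \<le> Q" using S1 by (simp add: Q_def)
    have "\<kappa>\<^sup>2 - (1 + \<kappa>\<^sup>2)\<^sup>2 * (S * (1 - S)) = Q\<^sup>2 + Q * (1 - \<kappa>\<^sup>2)" unfolding Q_def by algebra
    also have "\<dots> \<ge> 0" using Q k2 by (intro add_nonneg_nonneg mult_nonneg_nonneg) auto
    finally show ?thesis by simp
  qed
  moreover have "\<kappa>\<^sup>2 \<le> ((1 + \<kappa>\<^sup>2) * u)\<^sup>2" using ge k by (intro power_mono) auto
  ultimately have "(1 + \<kappa>\<^sup>2)\<^sup>2 * (u\<^sup>2 + (x * w + y * z)\<^sup>2) \<le> (1 + \<kappa>\<^sup>2)\<^sup>2 * u\<^sup>2"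
    unfolding power_mult_distrib by simp
  then have "(x * w + y * z)\<^sup>2 \<le> 0" using p by (simp add: mult_le_cancel_left_pos)
  then have "x * w + y * z = 0" by simp
  then have "x * w = 0" "y * z = 0" using nn by (simp_all add: add_nonneg_eq_0_iff)
  then show False using xy nn by auto
qed

text \<open>\<tau> is determined by x y - w z. Subtracting the angles dp and dm contributed by the
  W-letter from the polar angles a and b leaves \<alpha> + \<beta> and \<alpha> - \<beta>.
  Hypothesis \<open>B\<close> amounts to \<alpha> \<ge> 0 and hypothesis \<open>A\<close> to \<beta>
  \<ge> 0, both seen by comparing cosines.\<close>

lemma cost_XWY_word:
  assumes ch: "chamber w x y z" and k: "0 < \<kappa>"
    and u: "0 \<le> x * y - w * z" "(1 + \<kappa>\<^sup>2) * (x * y - w * z) < \<kappa>"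
    and A: "\<kappa> * (x * y - w * z) \<le> y\<^sup>2 + z\<^sup>2" and B: "x * y - w * z \<le> \<kappa> * (x\<^sup>2 + z\<^sup>2)"
  obtains \<alpha> \<tau> \<beta> where "is_XWY \<kappa> \<alpha> \<tau> \<beta> w x y z" "0 \<le> \<alpha>" "\<alpha> \<le> pi / 2" "0 \<le> \<tau>" "\<tau> < pi / 2" "0 \<le> \<beta>" "\<beta> \<le> pi / 2"
proof -
  define n where "n = sqrt (1 + \<kappa>\<^sup>2)"
  have n: "0 < n" "n\<^sup>2 = 1 + \<kappa>\<^sup>2" using norm_sqrt by (auto simp: n_def)
  have nn: "0 \<le> w" "0 \<le> x" "0 \<le> y" "0 \<le> z" "0 < w + z" "0 < x + y" using ch by (auto simp: chamber_def)
  have unit: "w\<^sup>2 + x\<^sup>2 + y\<^sup>2 + z\<^sup>2 = 1" using ch by (auto simp: chamber_def)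
  define s where "s = x * y - w * z"
  note u = u[folded s_def]
  define E where "E = \<kappa> - (1 + \<kappa>\<^sup>2) * s"
  have E: "0 < E" using u by (simp add: E_def)
  have 2: "2 * s < 1" by (rule half_bound[OF k u(2)])
  define v where "v = sqrt (s / E)"
  have v: "0 \<le> v" "v\<^sup>2 = s / E" using u E by (auto simp: v_def)
  define \<tau> where "\<tau> = arctan (n * v)"
  have tb: "0 \<le> \<tau>" "\<tau> < pi / 2" using v(1) n(1) arctan_ubound[of "n * v"] by (auto simp: \<tau>_def)
  have ct: "0 < cos \<tau>" using tb by (intro cos_gt_zero_pi) auto
  have st: "sin \<tau> = n * v * cos \<tau>"
    using tan_arctan[of "n * v"] ct unfolding \<tau>_def[symmetric] tan_def by (simp add: field_simps)
  have ct2: "(cos \<tau>)\<^sup>2 = E / \<kappa>"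
  proof -
    have "(cos \<tau>)\<^sup>2 * (1 + (n * v)\<^sup>2) = 1"
      using sin_cos_squared_add[of \<tau>] unfolding st by (simp add: power_mult_distrib algebra_simps)
    moreover have "1 + (n * v)\<^sup>2 = \<kappa> / E" unfolding power_mult_distrib n v using E by (simp add: E_def field_simps)
    ultimately have "(cos \<tau>)\<^sup>2 * (\<kappa> / E) = 1" by (simp only:)
    then show ?thesis using E k by (simp add: field_simps)
  qed
  have vE: "v\<^sup>2 * E = s" using v E by simp
  define gp where "gp = (1 + \<kappa>) * sin \<tau> / n"
  define gm where "gm = (1 - \<kappa>) * sin \<tau> / n"
  have gp: "gp = (1 + \<kappa>) * v * cos \<tau>" unfolding gp_def st using n by simp
  have gm: "gm = (1 - \<kappa>) * v * cos \<tau>" unfolding gm_def st using n by simp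
  define dp where "dp = arctan (gp / cos \<tau>)"
  define dm where "dm = arctan (gm / cos \<tau>)"
  obtain N where N: "0 < N" "cos \<tau> = N * cos dp" "gp = N * sin dp" using tan_polar[OF ct dp_def] .
  obtain M where M: "0 < M" "cos \<tau> = M * cos dm" "gm = M * sin dm" using tan_polar[OF ct dm_def] .
  have sq: "(cos \<tau>)\<^sup>2 + gp\<^sup>2 = 1 + 2 * s" "(cos \<tau>)\<^sup>2 + gm\<^sup>2 = 1 - 2 * s"
  proof -
    have a: "(cos \<tau>)\<^sup>2 + (g * v * cos \<tau>)\<^sup>2 = (E + g\<^sup>2 * s) / \<kappa>" for g
    proof -
      have "(cos \<tau>)\<^sup>2 + (g * v * cos \<tau>)\<^sup>2 = (cos \<tau>)\<^sup>2 * (1 + g\<^sup>2 * v\<^sup>2)" by algebra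
      also have "\<dots> = (E + g\<^sup>2 * (v\<^sup>2 * E)) / \<kappa>" unfolding ct2 by (simp add: algebra_simps add_divide_distrib diff_divide_distrib)
      finally show ?thesis unfolding vE .
    qed
    have "E + (1 + \<kappa>)\<^sup>2 * s = \<kappa> * (1 + 2 * s)" "E + (1 - \<kappa>)\<^sup>2 * s = \<kappa> * (1 - 2 * s)" unfolding E_def by algebra+
    then show "(cos \<tau>)\<^sup>2 + gp\<^sup>2 = 1 + 2 * s" "(cos \<tau>)\<^sup>2 + gm\<^sup>2 = 1 - 2 * s" unfolding gp gm a using k by simp_all
  qed
  have N2: "N\<^sup>2 = 1 + 2 * s"
  proof -
    have "N\<^sup>2 = (N * cos dp)\<^sup>2 + (N * sin dp)\<^sup>2" by (simp add: power_mult_distrib flip: distrib_left)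
    then show ?thesis unfolding N(2,3)[symmetric] sq .
  qed
  have M2: "M\<^sup>2 = 1 - 2 * s"
  proof -
    have "M\<^sup>2 = (M * cos dm)\<^sup>2 + (M * sin dm)\<^sup>2" by (simp add: power_mult_distrib flip: distrib_left)
    then show ?thesis unfolding M(2,3)[symmetric] sq .
  qed
  have Np: "(w - z)\<^sup>2 + (x + y)\<^sup>2 = N\<^sup>2" unfolding N2 s_def using unit by algebra
  have Nm: "(w + z)\<^sup>2 + (x - y)\<^sup>2 = M\<^sup>2" unfolding M2 s_def using unit by algebra
  obtain a where a: "w - z = N * cos a" "x + y = N * sin a" "0 \<le> a" "a \<le> pi"
  proof -
    have "((w - z) / N)\<^sup>2 + ((x + y) / N)\<^sup>2 = 1"
      unfolding power_divide add_divide_distrib[symmetric] Np using N(1) by simp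
    moreover have "0 \<le> (x + y) / N" using nn N by simp
    ultimately obtain t where "0 \<le> t" "t \<le> pi" "(w - z) / N = cos t" "(x + y) / N = sin t"
      using sincos_total_pi[of "(x + y) / N" "(w - z) / N"] by (auto simp: add.commute)
    then show ?thesis using that[of t] N(1) by (simp add: field_simps)
  qed
  obtain b where b: "w + z = M * cos b" "x - y = M * sin b" "- (pi / 2) \<le> b" "b \<le> pi / 2"
  proof -
    have "((x - y) / M)\<^sup>2 + ((w + z) / M)\<^sup>2 = 1"
      unfolding power_divide add_divide_distrib[symmetric] using Nm M(1) by (simp add: add.commute)
    moreover have "0 \<le> (w + z) / M" using nn M by simp
    ultimately obtain t where "0 \<le> t" "t \<le> pi" "(x - y) / M = cos t" "(w + z) / M = sin t"
      using sincos_total_pi[of "(w + z) / M" "(x - y) / M"] by (auto simp: add.commute)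
    then have t: "0 \<le> t" "t \<le> pi" "x - y = M * cos t" "w + z = M * sin t" using M(1) by (auto simp: field_simps)
    have e: "cos (pi / 2 - t) = sin t" "sin (pi / 2 - t) = cos t" by (simp_all add: cos_diff sin_diff)
    show ?thesis
    proof (rule that[of "pi / 2 - t"])
      show "w + z = M * cos (pi / 2 - t)" "x - y = M * sin (pi / 2 - t)" unfolding e using t by auto
    qed (use t in auto)
  qed
  have "0 \<le> gp / cos \<tau>" unfolding gp using ct v(1) k by simp
  then have dpb: "0 \<le> dp" "dp < pi / 2" unfolding dp_def using arctan_ubound by auto
  have dmb: "- (pi / 2) < dm" "dm < pi / 2" unfolding dm_def using arctan_ubound arctan_lbound by auto
  have sum_nonneg: "0 \<le> sin (dp + dm)" "0 \<le> sin (dp - dm)"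
  proof -
    have "N * M * sin (dp + dm) = (N * sin dp) * (M * cos dm) + (N * cos dp) * (M * sin dm)" unfolding sin_add by algebra
    also have "\<dots> = gp * cos \<tau> + cos \<tau> * gm" using N M by simp
    also have "\<dots> = 2 * v * (cos \<tau>)\<^sup>2" unfolding gp gm by algebra
    finally show "0 \<le> sin (dp + dm)" using N(1) M(1) v(1) by (metis mult_pos_pos mult_nonneg_nonneg zero_le_power2 zero_le_mult_iff not_less zero_le_numeral)
    have "N * M * sin (dp - dm) = (N * sin dp) * (M * cos dm) - (N * cos dp) * (M * sin dm)" unfolding sin_diff by algebra
    also have "\<dots> = gp * cos \<tau> - cos \<tau> * gm" using N M by simp
    also have "\<dots> = 2 * \<kappa> * v * (cos \<tau>)\<^sup>2" unfolding gp gm by algebra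
    finally show "0 \<le> sin (dp - dm)" using N(1) M(1) v(1) k by (metis mult_pos_pos mult_nonneg_nonneg zero_le_power2 zero_le_mult_iff not_less zero_le_numeral less_imp_le)
  qed
  have ab_nonneg: "0 \<le> sin (a + b)" "0 \<le> sin (a - b)"
  proof -
    have "N * M * sin (a + b) = (N * sin a) * (M * cos b) + (N * cos a) * (M * sin b)" unfolding sin_add by algebra
    also have "\<dots> = 2 * (w * x + y * z)" unfolding a(1,2)[symmetric] b(1,2)[symmetric] by algebra
    finally show "0 \<le> sin (a + b)" using N(1) M(1) nn by (metis mult_pos_pos mult_nonneg_nonneg add_nonneg_nonneg zero_le_mult_iff not_less zero_le_numeral)
    have "N * M * sin (a - b) = (N * sin a) * (M * cos b) - (N * cos a) * (M * sin b)" unfolding sin_diff by algebra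
    also have "\<dots> = 2 * (w * y + x * z)" unfolding a(1,2)[symmetric] b(1,2)[symmetric] by algebra
    finally show "0 \<le> sin (a - b)" using N(1) M(1) nn by (metis mult_pos_pos mult_nonneg_nonneg add_nonneg_nonneg zero_le_mult_iff not_less zero_le_numeral)
  qed
  have upper: "t \<le> pi" if "0 \<le> sin t" "t \<le> 3 * pi / 2" "- (pi / 2) \<le> t" for t
  proof (rule ccontr)
    assume "\<not> t \<le> pi"
    then have "0 < sin (t - pi)" using that by (intro sin_gt_zero) auto
    then show False using that by simp
  qed
  have lower: "0 \<le> t" if "0 \<le> sin t" "t \<le> 3 * pi / 2" "- (pi / 2) \<le> t" for t
  proof (rule ccontr)
    assume "\<not> 0 \<le> t"
    then have "0 < sin (- t)" using that by (intro sin_gt_zero) auto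
    then show False using that by simp
  qed
  \<comment> \<open>All these sums have a nonnegative sine and lie in [-pi / 2, 3 pi / 2], hence in
    [0, pi], where the cosine is decreasing.\<close>
  have ranges: "0 \<le> a + b" "a + b \<le> pi" "0 \<le> a - b" "a - b \<le> pi"
    "0 \<le> dp + dm" "dp + dm \<le> pi" "0 \<le> dp - dm" "dp - dm \<le> pi"
    using upper[OF ab_nonneg(1)] upper[OF ab_nonneg(2)] lower[OF ab_nonneg(1)] lower[OF ab_nonneg(2)]
      upper[OF sum_nonneg(1)] upper[OF sum_nonneg(2)] lower[OF sum_nonneg(1)] lower[OF sum_nonneg(2)]
      a(3,4) b(3,4) dpb dmb by auto
  have NM: "0 < N * M" using N M by simp
  have c1: "dp + dm \<le> a + b"
  proof -
    have "N * M * cos (a + b) = (N * cos a) * (M * cos b) - (N * sin a) * (M * sin b)" unfolding cos_add by algebra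
    also have "\<dots> = 1 - 2 * (x\<^sup>2 + z\<^sup>2)" unfolding a(1,2)[symmetric] b(1,2)[symmetric] using unit by algebra
    finally have 1: "N * M * cos (a + b) = 1 - 2 * (x\<^sup>2 + z\<^sup>2)" .
    have "N * M * cos (dp + dm) = (N * cos dp) * (M * cos dm) - (N * sin dp) * (M * sin dm)" unfolding cos_add by algebra
    also have "\<dots> = (cos \<tau>)\<^sup>2 - gp * gm" using N M by (simp add: power2_eq_square)
    also have "\<dots> = (cos \<tau>)\<^sup>2 * (1 - (1 - \<kappa>\<^sup>2) * v\<^sup>2)" unfolding gp gm by algebra
    also have "\<dots> = (E - (1 - \<kappa>\<^sup>2) * (v\<^sup>2 * E)) / \<kappa>" unfolding ct2 by (simp add: algebra_simps add_divide_distrib diff_divide_distrib)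
    also have "\<dots> = 1 - 2 * (s / \<kappa>)" unfolding vE unfolding E_def using k by (simp add: field_simps)
    finally have 2: "N * M * cos (dp + dm) = 1 - 2 * (s / \<kappa>)" .
    have "s / \<kappa> \<le> x\<^sup>2 + z\<^sup>2" using B k by (simp add: s_def pos_divide_le_eq mult.commute)
    then have "N * M * cos (a + b) \<le> N * M * cos (dp + dm)" unfolding 1 2 by simp
    then have "cos (a + b) \<le> cos (dp + dm)" using NM by (simp add: mult_le_cancel_left_pos)
    then show ?thesis using ranges by (simp add: cos_mono_le_eq)
  qed
  have c2: "dp - dm \<le> a - b"
  proof -
    have "N * M * cos (a - b) = (N * cos a) * (M * cos b) + (N * sin a) * (M * sin b)" unfolding cos_diff by algebra
    also have "\<dots> = 1 - 2 * (y\<^sup>2 + z\<^sup>2)" unfolding a(1,2)[symmetric] b(1,2)[symmetric] using unit by algebra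
    finally have 1: "N * M * cos (a - b) = 1 - 2 * (y\<^sup>2 + z\<^sup>2)" .
    have "N * M * cos (dp - dm) = (N * cos dp) * (M * cos dm) + (N * sin dp) * (M * sin dm)" unfolding cos_diff by algebra
    also have "\<dots> = (cos \<tau>)\<^sup>2 + gp * gm" using N M by (simp add: power2_eq_square)
    also have "\<dots> = (cos \<tau>)\<^sup>2 * (1 + (1 - \<kappa>\<^sup>2) * v\<^sup>2)" unfolding gp gm by algebra
    also have "\<dots> = (E + (1 - \<kappa>\<^sup>2) * (v\<^sup>2 * E)) / \<kappa>" unfolding ct2 by (simp add: algebra_simps add_divide_distrib diff_divide_distrib)
    also have "\<dots> = 1 - 2 * (\<kappa> * s)" unfolding vE unfolding E_def using k by (simp add: field_simps power2_eq_square)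
    finally have 2: "N * M * cos (dp - dm) = 1 - 2 * (\<kappa> * s)" .
    have "N * M * cos (a - b) \<le> N * M * cos (dp - dm)" using A unfolding 1 2 s_def by simp
    then have "cos (a - b) \<le> cos (dp - dm)" using NM by (simp add: mult_le_cancel_left_pos)
    then show ?thesis using ranges by (simp add: cos_mono_le_eq)
  qed
  define \<alpha> where "\<alpha> = ((a - dp) + (b - dm)) / 2"
  define \<beta> where "\<beta> = ((a - dp) - (b - dm)) / 2"
  have ab: "a = \<alpha> + \<beta> + dp" "b = \<alpha> - \<beta> + dm" by (simp_all add: \<alpha>_def \<beta>_def field_simps)
  have W: "is_XWY \<kappa> \<alpha> \<tau> \<beta> w x y z"
    unfolding is_XWY_def Let_def n_def[symmetric] gp_def[symmetric] gm_def[symmetric]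
  proof (intro conjI)
    show "w - z = cos \<tau> * cos (\<alpha> + \<beta>) - gp * sin (\<alpha> + \<beta>)" unfolding a(1) ab(1) N(2,3) cos_add[of "\<alpha> + \<beta>" dp] by algebra
    show "x + y = cos \<tau> * sin (\<alpha> + \<beta>) + gp * cos (\<alpha> + \<beta>)" unfolding a(2) ab(1) N(2,3) sin_add[of "\<alpha> + \<beta>" dp] by algebra
    show "w + z = cos \<tau> * cos (\<alpha> - \<beta>) - gm * sin (\<alpha> - \<beta>)" unfolding b(1) ab(2) M(2,3) cos_add[of "\<alpha> - \<beta>" dm] by algebra
    show "x - y = cos \<tau> * sin (\<alpha> - \<beta>) + gm * cos (\<alpha> - \<beta>)" unfolding b(2) ab(2) M(2,3) sin_add[of "\<alpha> - \<beta>" dm] by algebra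
  qed
  show ?thesis
    by (rule that[OF W _ _ tb]) (use c1 c2 ranges in \<open>auto simp: \<alpha>_def \<beta>_def\<close>)
qed

section \<open>Symmetry of the cost formulas and their agreement on interfaces\<close>

lemma cost_XWY_swap: "0 < \<kappa> \<Longrightarrow> \<kappa> * cost_XWY (1 / \<kappa>) w y x z = cost_XWY \<kappa> w x y z"
proof -
  assume k: "0 < \<kappa>"
  define n where "n = sqrt (1 + \<kappa>\<^sup>2)"
  define u where "u = x * y - w * z"
  define v where "v = sqrt (u / (\<kappa> - (1 + \<kappa>\<^sup>2) * u))"
  have n': "sqrt (1 + (1 / \<kappa>)\<^sup>2) = n / \<kappa>"
  proof -
    have "1 + (1 / \<kappa>)\<^sup>2 = (1 + \<kappa>\<^sup>2) / \<kappa>\<^sup>2" using k by (simp add: field_simps)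
    then show ?thesis using k by (simp add: real_sqrt_divide n_def)
  qed
  have v': "sqrt (u / (1 / \<kappa> - (1 + (1 / \<kappa>)\<^sup>2) * u)) = \<kappa> * v"
  proof -
    have "1 / \<kappa> - (1 + (1 / \<kappa>)\<^sup>2) * u = (\<kappa> - (1 + \<kappa>\<^sup>2) * u) / \<kappa>\<^sup>2" using k by (simp add: field_simps power2_eq_square)
    then have "u / (1 / \<kappa> - (1 + (1 / \<kappa>)\<^sup>2) * u) = \<kappa>\<^sup>2 * (u / (\<kappa> - (1 + \<kappa>\<^sup>2) * u))" by simp
    then show ?thesis using k by (simp only: real_sqrt_mult v_def) simp
  qed
  have uu: "y * x - w * z = u" by (simp add: u_def)
  have e1: "n / \<kappa> * (\<kappa> * v) = n * v" "(1 + 1 / \<kappa>) * (\<kappa> * v) = (1 + \<kappa>) * v" "(1 - 1 / \<kappa>) * (\<kappa> * v) = - ((1 - \<kappa>) * v)"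
    using k by (simp_all add: field_simps)
  have e2: "(y - x) / (w + z) = - ((x - y) / (w + z))" "(w - z) / (y + x) = (w - z) / (x + y)"
    by (metis minus_diff_eq minus_divide_left) (simp add: add.commute)
  have "cost_XWY (1 / \<kappa>) w y x z = (1 + 1 / \<kappa>) * (pi / 2 - arctan ((w - z) / (x + y))) - (1 - 1 / \<kappa>) * arctan ((x - y) / (w + z))
    + (2 * (n / \<kappa>) * arctan (n * v) - (1 + 1 / \<kappa>) * arctan ((1 + \<kappa>) * v) + (1 - 1 / \<kappa>) * arctan ((1 - \<kappa>) * v))"
    unfolding cost_XWY_def Psi_def Let_def uu n' v' e1 e2 arctan_minus by simp
  also have "\<kappa> * \<dots> = (1 + \<kappa>) * (pi / 2 - arctan ((w - z) / (x + y))) + (1 - \<kappa>) * arctan ((x - y) / (w + z))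
    + (2 * n * arctan (n * v) - (1 + \<kappa>) * arctan ((1 + \<kappa>) * v) - (1 - \<kappa>) * arctan ((1 - \<kappa>) * v))"
    using k by (simp add: field_simps)
  also have "\<dots> = cost_XWY \<kappa> w x y z" unfolding cost_XWY_def Psi_def Let_def n_def v_def u_def by simp
  finally show ?thesis .
qed

text \<open>On this boundary the last letter has length 0, so one and the same word is of both kinds
  and both formulas compute its cost.\<close>

lemma cost_XWX_eq_cost_XWY:
  assumes ch: "chamber w x y z" and eq: "y\<^sup>2 + z\<^sup>2 = \<kappa> * (x * y - w * z)" and k: "0 < \<kappa>"
  shows "cost_XWX \<kappa> w x y z = cost_XWY \<kappa> w x y z"
proof -
  obtain \<alpha> \<tau> \<beta> where W: "is_XWX \<kappa> \<alpha> \<tau> \<beta> w x y z" "0 \<le> \<alpha>" "\<alpha> \<le> pi / 2" "0 \<le> \<tau>" "\<tau> < pi / 2" "0 \<le> \<beta>" "\<beta> \<le> pi / 2"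
    and F: "cost_XWX \<kappa> w x y z = 2 * \<alpha> + 2 * \<beta> + 2 * sqrt (1 + \<kappa>\<^sup>2) * \<tau>" and b: "\<beta> = 0"
    using cost_XWX_word[OF ch _ k] eq by (metis order_refl)
  have "is_XWY \<kappa> \<alpha> \<tau> 0 w x y z"
    using W(1) unfolding b is_XWX_def is_XWY_def Let_def
    by (simp add: algebra_simps add_divide_distrib diff_divide_distrib)
  then have "cost_XWY \<kappa> w x y z = 2 * \<alpha> + 2 * \<kappa> * 0 + 2 * sqrt (1 + \<kappa>\<^sup>2) * \<tau>"
    by (rule cost_XWY_of_XWY) (use ch k W in \<open>auto simp: chamber_def\<close>)
  then show ?thesis using F b by simp
qed

text \<open>On \<open>x * y = w * z\<close> the W-letter vanishes, \<phi> = \<psi>, and the word is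
  XY. Any positive shift would make U positive and leave the admissible range, so the minimum over
  \<beta> is taken at 0.\<close>

lemma euler_eq_cost_XWY:
  assumes ch: "chamber w x y z" and eq: "x * y = w * z" and k: "0 < \<kappa>"
  shows "euler_cost \<kappa> w x y z = cost_XWY \<kappa> w x y z" "cost_YXYX \<kappa> w x y z = cost_XWY \<kappa> w x y z"
proof -
  obtain \<theta> \<phi> \<psi> where t: "0 < \<theta>" "\<theta> < pi / 2" "0 \<le> \<phi>" "\<phi> \<le> pi / 2" "0 \<le> \<psi>" "\<psi> \<le> pi / 2"
    and c: "w = cos \<theta> * cos \<phi>" "x = cos \<theta> * sin \<phi>" "y = sin \<theta> * cos \<psi>" "z = sin \<theta> * sin \<psi>"
    using chamber_polar[OF ch] by metis
  have p: "0 < sin \<theta>" "0 < cos \<theta>" using t by (auto simp: sin_gt_zero cos_gt_zero_pi)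
  have "sin \<theta> * cos \<theta> * sin (\<phi> - \<psi>) = 0" using eq unfolding c sin_diff by (simp add: algebra_simps)
  then have "sin (\<phi> - \<psi>) = 0" using p by simp
  then have fp: "\<phi> = \<psi>" using sin_eq_0_pi[of "\<phi> - \<psi>"] t by force
  have z: "0 < z" using chamber_z_pos[OF ch] eq by simp
  have ps: "0 < \<psi>" using z t(5) unfolding c by (cases "\<psi> = 0") auto
  have e: "euler_cost \<kappa> w x y z = 2 * \<psi> + 2 * \<kappa> * \<theta>" unfolding c by (rule euler_cost_polar[OF t(1,2) ps t(6)])
  have "is_XWY \<kappa> \<psi> 0 \<theta> w x y z" unfolding is_XWY_def Let_def c fp
    by (simp add: cos_add sin_add cos_diff sin_diff algebra_simps)
  then have "cost_XWY \<kappa> w x y z = 2 * \<psi> + 2 * \<kappa> * \<theta> + 2 * sqrt (1 + \<kappa>\<^sup>2) * 0"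
    by (rule cost_XWY_of_XWY) (use ch k t in \<open>auto simp: chamber_def\<close>)
  then show *: "euler_cost \<kappa> w x y z = cost_XWY \<kappa> w x y z" using e by simp
  have "\<kappa> * euler_cost (1 / \<kappa>) w y x z = euler_cost \<kappa> w x y z"
    using on_surface(1)[OF ch _ shift_range_0[OF ch] k] eq by (simp add: shift_cost_def)
  moreover obtain \<beta> where \<beta>: "\<beta> \<in> shift_range w x y z" "cost_YXYX \<kappa> w x y z = shift_cost \<kappa> w x y z \<beta>"
    using cost_YXYX_attained[OF ch] eq by (metis order_refl)
  moreover have "\<beta> = 0"
  proof (rule ccontr)
    assume "\<beta> \<noteq> 0"
    then have b: "0 < \<beta>" using \<beta> by (auto simp: shift_range_def)
    note fp = shift_range_pos[OF ch \<beta>(1) b]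
    define U where "U = sx w x y z \<beta> * sy w x y z \<beta> - sw w x y z \<beta> * sz w x y z \<beta>"
    have "U = (x * y - w * z) * cos (2 * \<beta>) + (w * x + y * z) * sin (2 * \<beta>)"
      unfolding U_def shift_defs cos_double sin_double by algebra
    also have "\<dots> = (w * x + y * z) * sin (2 * \<beta>)" using eq by simp
    also have "\<dots> > 0"
    proof (intro mult_pos_pos)
      show "0 < sin (2 * \<beta>)" using b fp(1) by (intro sin_gt_zero) auto
      have nn: "0 \<le> w" "0 \<le> x" "0 \<le> y" using ch by (auto simp: chamber_def)
      show "0 < w * x + y * z"
      proof (cases "y = 0")
        case True
        then have "0 < w" "0 < x" using ch by (auto simp: chamber_def)
        then show ?thesis using True by simp
      next
        case False
        then show ?thesis using nn z by (simp add: add_nonneg_pos)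
      qed
    qed
    finally show False using \<beta>(1) by (auto simp: shift_range_def U_def)
  qed
  ultimately show "cost_YXYX \<kappa> w x y z = cost_XWY \<kappa> w x y z" using * by (simp add: shift_cost_def)
qed

section \<open>The value function\<close>

definition value_fun :: "real \<Rightarrow> real \<Rightarrow> real \<Rightarrow> real \<Rightarrow> real \<Rightarrow> real" where
  "value_fun \<kappa> w x y z = (if x * y \<le> w * z then cost_YXYX \<kappa> w x y z
     else if y\<^sup>2 + z\<^sup>2 \<le> \<kappa> * (x * y - w * z) then cost_XWX \<kappa> w x y z
     else if \<kappa> * (x\<^sup>2 + z\<^sup>2) \<le> x * y - w * z then \<kappa> * cost_XWX (1 / \<kappa>) w y x z
     else cost_XWY \<kappa> w x y z)"

lemma swap_region: "0 < \<kappa> \<Longrightarrow> \<kappa> * (x\<^sup>2 + z\<^sup>2) \<le> x * y - w * z \<longleftrightarrow> x\<^sup>2 + z\<^sup>2 \<le> (1 / \<kappa>) * (y * x - w * z)"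
  "0 < \<kappa> \<Longrightarrow> \<kappa> * (x\<^sup>2 + z\<^sup>2) = x * y - w * z \<longleftrightarrow> x\<^sup>2 + z\<^sup>2 = (1 / \<kappa>) * (y * x - w * z)" for \<kappa> :: real
  by (auto simp: field_simps)

lemma cost_YWY_eq_cost_XWY:
  assumes ch: "chamber w x y z" and eq: "\<kappa> * (x\<^sup>2 + z\<^sup>2) = x * y - w * z" and k: "0 < \<kappa>"
  shows "\<kappa> * cost_XWX (1 / \<kappa>) w y x z = cost_XWY \<kappa> w x y z"
  using cost_XWX_eq_cost_XWY[OF chamber_swap[OF ch], of "1 / \<kappa>"] eq k cost_XWY_swap[OF k] by (simp add: swap_region(2))

text \<open>Each formula holds on a closed region, interfaces included. Closedness serves twice: a
  region that misses a point is absent near it, and limits of points of a region are computed by the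
  same formula.\<close>

lemma value_fun_regions:
  assumes ch: "chamber w x y z" and k: "0 < \<kappa>" "\<kappa> \<le> 1"
  shows "x * y \<le> w * z \<Longrightarrow> value_fun \<kappa> w x y z = cost_YXYX \<kappa> w x y z"
    and "0 \<le> x * y - w * z \<Longrightarrow> y\<^sup>2 + z\<^sup>2 \<le> \<kappa> * (x * y - w * z) \<Longrightarrow> value_fun \<kappa> w x y z = cost_XWX \<kappa> w x y z"
    and "0 \<le> x * y - w * z \<Longrightarrow> \<kappa> * (x\<^sup>2 + z\<^sup>2) \<le> x * y - w * z \<Longrightarrow> value_fun \<kappa> w x y z = \<kappa> * cost_XWX (1 / \<kappa>) w y x z"
    and "0 \<le> x * y - w * z \<Longrightarrow> \<kappa> * (x * y - w * z) \<le> y\<^sup>2 + z\<^sup>2 \<Longrightarrow> x * y - w * z \<le> \<kappa> * (x\<^sup>2 + z\<^sup>2) \<Longrightarrow> value_fun \<kappa> w x y z = cost_XWY \<kappa> w x y z"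
proof -
  note sq = chamber_sq_pos[OF ch]
  have nn: "0 \<le> w" "0 \<le> x" "0 \<le> y" "0 \<le> z" using ch by (auto simp: chamber_def)
  show "value_fun \<kappa> w x y z = cost_YXYX \<kappa> w x y z" if "x * y \<le> w * z" using that by (simp add: value_fun_def)
  \<comment> \<open>The regions of XWX and YWY meet only where y = \<kappa> x and z = 0, that is at
    pure W-letters. Both conditions are equalities there, and \<open>cost_XWY\<close> mediates
    between the two formulas.\<close>
  have both: "y\<^sup>2 + z\<^sup>2 = \<kappa> * (x * y - w * z) \<and> \<kappa> * (x\<^sup>2 + z\<^sup>2) = x * y - w * z"
    if a: "y\<^sup>2 + z\<^sup>2 \<le> \<kappa> * (x * y - w * z)" and b: "\<kappa> * (x\<^sup>2 + z\<^sup>2) \<le> x * y - w * z"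
  proof -
    have ff: "0 < x" "0 < y" using cost_XWX_region_facts[OF ch a k(1)] by auto
    have wz: "0 \<le> w * z" using nn by simp
    have "\<kappa> * (x * y - w * z) \<le> \<kappa> * (x * y)" using wz k by (intro mult_left_mono) auto
    then have "y\<^sup>2 \<le> \<kappa> * (x * y)" using a zero_le_power2[of z] by linarith
    then have "y * y \<le> (\<kappa> * x) * y" by (simp add: power2_eq_square)
    then have 1: "y \<le> \<kappa> * x" using ff by simp
    have "\<kappa> * x\<^sup>2 \<le> x * y" using b wz k zero_le_power2[of z] by (smt (verit) mult_nonneg_nonneg distrib_left)
    then have 2: "\<kappa> * x \<le> y" using ff by (simp add: power2_eq_square mult_ac)
    have y: "y = \<kappa> * x" using 1 2 by simp
    have "\<kappa> * z\<^sup>2 + w * z \<le> 0" using b unfolding y by (simp add: power2_eq_square algebra_simps)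
    then have "\<kappa> * z\<^sup>2 \<le> 0" using wz by linarith
    then have "z = 0" using k by (simp add: mult_le_0_iff)
    then show ?thesis unfolding y by (simp add: power2_eq_square)
  qed
  show 2: "value_fun \<kappa> w x y z = cost_XWX \<kappa> w x y z" if "0 \<le> x * y - w * z" "y\<^sup>2 + z\<^sup>2 \<le> \<kappa> * (x * y - w * z)"
    using cost_XWX_region_facts(4)[OF ch that(2) k(1)] that by (simp add: value_fun_def)
  show 3: "value_fun \<kappa> w x y z = \<kappa> * cost_XWX (1 / \<kappa>) w y x z" if h: "0 \<le> x * y - w * z" "\<kappa> * (x\<^sup>2 + z\<^sup>2) \<le> x * y - w * z"
  proof (cases "y\<^sup>2 + z\<^sup>2 \<le> \<kappa> * (x * y - w * z)")
    case True
    then show ?thesis using 2[OF h(1) True] both[OF True h(2)] cost_XWX_eq_cost_XWY[OF ch _ k(1)] cost_YWY_eq_cost_XWY[OF ch _ k(1)] by simp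
  next
    case False
    have "0 < \<kappa> * (x\<^sup>2 + z\<^sup>2)" using sq k by simp
    then show ?thesis using False h by (simp add: value_fun_def)
  qed
  show "value_fun \<kappa> w x y z = cost_XWY \<kappa> w x y z" if h: "0 \<le> x * y - w * z" "\<kappa> * (x * y - w * z) \<le> y\<^sup>2 + z\<^sup>2" "x * y - w * z \<le> \<kappa> * (x\<^sup>2 + z\<^sup>2)"
  proof -
    consider "x * y = w * z" | "y\<^sup>2 + z\<^sup>2 \<le> \<kappa> * (x * y - w * z)" | "\<kappa> * (x\<^sup>2 + z\<^sup>2) \<le> x * y - w * z"
      | "\<not> x * y \<le> w * z" "\<not> y\<^sup>2 + z\<^sup>2 \<le> \<kappa> * (x * y - w * z)" "\<not> \<kappa> * (x\<^sup>2 + z\<^sup>2) \<le> x * y - w * z"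
      using h by linarith
    then show ?thesis
    proof cases
      case 1 then show ?thesis using euler_eq_cost_XWY[OF ch 1 k(1)] by (simp add: value_fun_def)
    next
      case c: 2 then show ?thesis using 2[OF h(1) c] cost_XWX_eq_cost_XWY[OF ch _ k(1)] h by simp
    next
      case c: 3 then show ?thesis using 3[OF h(1) c] cost_YWY_eq_cost_XWY[OF ch _ k(1)] h by simp
    next
      case 4 then show ?thesis by (simp add: value_fun_def)
    qed
  qed
qed

text \<open>Each region containing the point contributes one touching function, the others none. At
  an interface several functions are needed, because the one that dominates may vary with the nearby
  point.\<close>

lemma value_fun_touch:
  assumes ch: "chamber w x y z" and k: "0 < \<kappa>" "\<kappa> \<le> 1"
  obtains \<G> where "finite \<G>" "\<And>G. G \<in> \<G> \<Longrightarrow> G w x y z = value_fun \<kappa> w x y z" "\<And>G. G \<in> \<G> \<Longrightarrow> grad_bounded \<kappa> G w x y z"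
    "\<forall>\<^sub>F (w', x', y', z') in nhds (w, x, y, z). chamber w' x' y' z' \<longrightarrow> (\<exists>G\<in>\<G>. value_fun \<kappa> w' x' y' z' \<le> G w' x' y' z')"
proof -
  let ?N = "nhds (w, x, y, z)"
  define R1 where "R1 = {(w::real, x, y, z). x * y \<le> w * z}"
  define R2 where "R2 = {(w, x, y, z). 0 \<le> x * y - w * z \<and> y\<^sup>2 + z\<^sup>2 \<le> \<kappa> * (x * y - w * z)}"
  define R3 where "R3 = {(w, x, y, z). 0 \<le> x * y - w * z \<and> \<kappa> * (x\<^sup>2 + z\<^sup>2) \<le> x * y - w * z}"
  define R4 where "R4 = {(w, x, y, z). 0 \<le> x * y - w * z \<and> \<kappa> * (x * y - w * z) \<le> y\<^sup>2 + z\<^sup>2 \<and> x * y - w * z \<le> \<kappa> * (x\<^sup>2 + z\<^sup>2)}"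
  note Rdefs = R1_def R2_def R3_def R4_def
  have cl: "closed R1" "closed R2" "closed R3" "closed R4"
    unfolding Rdefs case_prod_beta by (intro closed_Collect_conj closed_Collect_le continuous_intros)+
  have piece: "\<exists>\<G>. finite \<G> \<and> (\<forall>G\<in>\<G>. G w x y z = value_fun \<kappa> w x y z \<and> grad_bounded \<kappa> G w x y z) \<and>
      (\<forall>\<^sub>F (w', x', y', z') in ?N. chamber w' x' y' z' \<longrightarrow> (w', x', y', z') \<in> R \<longrightarrow> (\<exists>G\<in>\<G>. value_fun \<kappa> w' x' y' z' \<le> G w' x' y' z'))"
    if "closed R" and R: "(w, x, y, z) \<in> R \<Longrightarrow> \<exists>G. G w x y z = value_fun \<kappa> w x y z \<and> grad_bounded \<kappa> G w x y z \<and>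
       (\<forall>\<^sub>F (w', x', y', z') in ?N. chamber w' x' y' z' \<longrightarrow> (w', x', y', z') \<in> R \<longrightarrow> value_fun \<kappa> w' x' y' z' \<le> G w' x' y' z')" for R
  proof (cases "(w, x, y, z) \<in> R")
    case True
    then obtain G where G: "G w x y z = value_fun \<kappa> w x y z" "grad_bounded \<kappa> G w x y z"
       "\<forall>\<^sub>F (w', x', y', z') in ?N. chamber w' x' y' z' \<longrightarrow> (w', x', y', z') \<in> R \<longrightarrow> value_fun \<kappa> w' x' y' z' \<le> G w' x' y' z'"
      using R by blast
    show ?thesis by (rule exI[of _ "{G}"]) (use G in auto)
  next
    case False
    then have "\<forall>\<^sub>F q in ?N. q \<in> - R" using that(1) by (intro eventually_nhds_in_open) auto
    then have "\<forall>\<^sub>F (w', x', y', z') in ?N. chamber w' x' y' z' \<longrightarrow> (w', x', y', z') \<in> R \<longrightarrow> (\<exists>G\<in>{}. value_fun \<kappa> w' x' y' z' \<le> G w' x' y' z')"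
      by (rule eventually_mono) auto
    then show ?thesis by blast
  qed
  have alw: "\<forall>\<^sub>F (w', x', y', z') in ?N. chamber w' x' y' z' \<longrightarrow> (w', x', y', z') \<in> R \<longrightarrow> value_fun \<kappa> w' x' y' z' \<le> G w' x' y' z'"
    if "\<And>w' x' y' z'. chamber w' x' y' z' \<Longrightarrow> (w', x', y', z') \<in> R \<Longrightarrow> value_fun \<kappa> w' x' y' z' = G w' x' y' z'" for R G
    by (rule always_eventually) (use that in auto)
  obtain G1 where G1: "finite G1" "\<forall>G\<in>G1. G w x y z = value_fun \<kappa> w x y z \<and> grad_bounded \<kappa> G w x y z"
      "\<forall>\<^sub>F (w', x', y', z') in ?N. chamber w' x' y' z' \<longrightarrow> (w', x', y', z') \<in> R1 \<longrightarrow> (\<exists>G\<in>G1. value_fun \<kappa> w' x' y' z' \<le> G w' x' y' z')"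
  proof (atomize_elim, rule piece[OF cl(1)])
    assume "(w, x, y, z) \<in> R1"
    then have le: "x * y \<le> w * z" by (simp add: R1_def)
    obtain G where "G w x y z = cost_YXYX \<kappa> w x y z" "grad_bounded \<kappa> G w x y z" and
      ev: "\<forall>\<^sub>F (w', x', y', z') in ?N. chamber w' x' y' z' \<longrightarrow> x' * y' \<le> w' * z' \<longrightarrow> cost_YXYX \<kappa> w' x' y' z' \<le> G w' x' y' z'"
      using cost_YXYX_touch[OF ch le k(1)] .
    moreover have "\<forall>\<^sub>F (w', x', y', z') in ?N. chamber w' x' y' z' \<longrightarrow> (w', x', y', z') \<in> R1 \<longrightarrow> value_fun \<kappa> w' x' y' z' \<le> G w' x' y' z'"
      using ev by (rule eventually_mono) (auto simp: R1_def value_fun_def)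
    ultimately show "\<exists>G. G w x y z = value_fun \<kappa> w x y z \<and> grad_bounded \<kappa> G w x y z \<and>
       (\<forall>\<^sub>F (w', x', y', z') in ?N. chamber w' x' y' z' \<longrightarrow> (w', x', y', z') \<in> R1 \<longrightarrow> value_fun \<kappa> w' x' y' z' \<le> G w' x' y' z')"
      using value_fun_regions(1)[OF ch k le] by (intro exI[of _ G]) auto
  qed
  obtain G2 where G2: "finite G2" "\<forall>G\<in>G2. G w x y z = value_fun \<kappa> w x y z \<and> grad_bounded \<kappa> G w x y z"
      "\<forall>\<^sub>F (w', x', y', z') in ?N. chamber w' x' y' z' \<longrightarrow> (w', x', y', z') \<in> R2 \<longrightarrow> (\<exists>G\<in>G2. value_fun \<kappa> w' x' y' z' \<le> G w' x' y' z')"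
  proof (atomize_elim, rule piece[OF cl(2)])
    assume "(w, x, y, z) \<in> R2"
    then have R: "0 \<le> x * y - w * z" "y\<^sup>2 + z\<^sup>2 \<le> \<kappa> * (x * y - w * z)" by (auto simp: R2_def)
    show "\<exists>G. G w x y z = value_fun \<kappa> w x y z \<and> grad_bounded \<kappa> G w x y z \<and>
       (\<forall>\<^sub>F (w', x', y', z') in ?N. chamber w' x' y' z' \<longrightarrow> (w', x', y', z') \<in> R2 \<longrightarrow> value_fun \<kappa> w' x' y' z' \<le> G w' x' y' z')"
      by (rule exI[of _ "cost_XWX \<kappa>"], intro conjI alw)
        (use value_fun_regions(2)[OF _ k] grad_bounded_cost_XWX[OF ch R(2) k(1)] ch R in \<open>auto simp: R2_def\<close>)
  qed
  obtain G3 where G3: "finite G3" "\<forall>G\<in>G3. G w x y z = value_fun \<kappa> w x y z \<and> grad_bounded \<kappa> G w x y z"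
      "\<forall>\<^sub>F (w', x', y', z') in ?N. chamber w' x' y' z' \<longrightarrow> (w', x', y', z') \<in> R3 \<longrightarrow> (\<exists>G\<in>G3. value_fun \<kappa> w' x' y' z' \<le> G w' x' y' z')"
  proof (atomize_elim, rule piece[OF cl(3)])
    assume "(w, x, y, z) \<in> R3"
    then have R: "0 \<le> x * y - w * z" "\<kappa> * (x\<^sup>2 + z\<^sup>2) \<le> x * y - w * z" by (auto simp: R3_def)
    have "grad_bounded (1 / \<kappa>) (cost_XWX (1 / \<kappa>)) w y x z"
      by (rule grad_bounded_cost_XWX[OF chamber_swap[OF ch]]) (use R k in \<open>auto simp: swap_region\<close>)
    note g = grad_bounded_swap[OF this k(1)]
    show "\<exists>G. G w x y z = value_fun \<kappa> w x y z \<and> grad_bounded \<kappa> G w x y z \<and>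
       (\<forall>\<^sub>F (w', x', y', z') in ?N. chamber w' x' y' z' \<longrightarrow> (w', x', y', z') \<in> R3 \<longrightarrow> value_fun \<kappa> w' x' y' z' \<le> G w' x' y' z')"
      by (rule exI[of _ "\<lambda>w x y z. \<kappa> * cost_XWX (1 / \<kappa>) w y x z"], intro conjI alw)
        (use value_fun_regions(3)[OF _ k] g ch R in \<open>auto simp: R3_def\<close>)
  qed
  obtain G4 where G4: "finite G4" "\<forall>G\<in>G4. G w x y z = value_fun \<kappa> w x y z \<and> grad_bounded \<kappa> G w x y z"
      "\<forall>\<^sub>F (w', x', y', z') in ?N. chamber w' x' y' z' \<longrightarrow> (w', x', y', z') \<in> R4 \<longrightarrow> (\<exists>G\<in>G4. value_fun \<kappa> w' x' y' z' \<le> G w' x' y' z')"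
  proof (atomize_elim, rule piece[OF cl(4)])
    assume "(w, x, y, z) \<in> R4"
    then have R: "0 \<le> x * y - w * z" "\<kappa> * (x * y - w * z) \<le> y\<^sup>2 + z\<^sup>2" "x * y - w * z \<le> \<kappa> * (x\<^sup>2 + z\<^sup>2)" by (auto simp: R4_def)
    show "\<exists>G. G w x y z = value_fun \<kappa> w x y z \<and> grad_bounded \<kappa> G w x y z \<and>
       (\<forall>\<^sub>F (w', x', y', z') in ?N. chamber w' x' y' z' \<longrightarrow> (w', x', y', z') \<in> R4 \<longrightarrow> value_fun \<kappa> w' x' y' z' \<le> G w' x' y' z')"
      by (rule exI[of _ "cost_XWY \<kappa>"], intro conjI alw)
        (use value_fun_regions(4)[OF _ k] grad_bounded_cost_XWY[OF ch k(1) R(1) cost_XWY_region_strict[OF ch k R(3)]] ch R in \<open>auto simp: R4_def\<close>)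
  qed
  show ?thesis
  proof (rule that[of "G1 \<union> G2 \<union> G3 \<union> G4"])
    show "\<forall>\<^sub>F (w', x', y', z') in ?N. chamber w' x' y' z' \<longrightarrow> (\<exists>G\<in>G1 \<union> G2 \<union> G3 \<union> G4. value_fun \<kappa> w' x' y' z' \<le> G w' x' y' z')"
      using G1(3) G2(3) G3(3) G4(3)
    proof eventually_elim
      case (elim q)
      obtain w' x' y' z' where q: "q = (w', x', y', z')" by (cases q) auto
      have "q \<in> R1 \<or> q \<in> R2 \<or> q \<in> R3 \<or> q \<in> R4" unfolding q Rdefs by auto
      then show ?case using elim unfolding q by auto
    qed
  qed (use G1 G2 G3 G4 in auto)
qed

section \<open>Lower semicontinuity of the value\<close>

lemma euler_cost_tendsto:
  assumes "(W \<longlongrightarrow> w) F" "(X \<longlongrightarrow> x) F" "(Y \<longlongrightarrow> y) F" "(Z \<longlongrightarrow> z) F"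
    and "0 < z" "0 < w\<^sup>2 + x\<^sup>2"
  shows "((\<lambda>k. euler_cost \<kappa> (W k) (X k) (Y k) (Z k)) \<longlongrightarrow> euler_cost \<kappa> w x y z) F"
  unfolding euler_cost_def by (intro tendsto_intros assms(1-4)) (use assms(5,6) in auto)

lemma cost_XWX_tendsto:
  assumes t: "(W \<longlongrightarrow> w) F" "(X \<longlongrightarrow> x) F" "(Y \<longlongrightarrow> y) F" "(Z \<longlongrightarrow> z) F"
    and ch: "chamber w x y z" and reg: "y\<^sup>2 + z\<^sup>2 \<le> \<kappa> * (x * y - w * z)" and k: "0 < \<kappa>"
  shows "((\<lambda>k. cost_XWX \<kappa> (W k) (X k) (Y k) (Z k)) \<longlongrightarrow> cost_XWX \<kappa> w x y z) F"
proof -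
  define r where "r = sqrt (w\<^sup>2 + x\<^sup>2)"
  define p where "p = sqrt (y\<^sup>2 + z\<^sup>2)"
  define n where "n = sqrt (1 + \<kappa>\<^sup>2)"
  note sq = chamber_sq_pos[OF ch] and ff = cost_XWX_region_facts[OF ch reg k]
  have r: "r\<^sup>2 = w\<^sup>2 + x\<^sup>2" "0 < r" using sq by (auto simp: r_def)
  have p: "p\<^sup>2 = y\<^sup>2 + z\<^sup>2" "0 < p" using sq by (auto simp: p_def)
  have rp: "r\<^sup>2 + p\<^sup>2 = 1" using ch unfolding r p chamber_def by simp
  have n: "n\<^sup>2 = 1 + \<kappa>\<^sup>2" "0 < n" using norm_sqrt by (auto simp: n_def)
  have pk: "p < \<kappa> * r" using ff(3) by (simp add: p_def r_def)
  have "p\<^sup>2 < (\<kappa> * r)\<^sup>2" using pk p(2) by (intro power_strict_mono) auto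
  moreover have "\<kappa>\<^sup>2 - (n * p)\<^sup>2 = (\<kappa> * r)\<^sup>2 - p\<^sup>2" unfolding power_mult_distrib n using rp by algebra
  ultimately have "(n * p)\<^sup>2 < \<kappa>\<^sup>2" by linarith
  then have np: "n * p < \<kappa>" using k by (metis less_imp_le power2_less_imp_less)
  have b1: "- 1 < n / \<kappa> * p" "n / \<kappa> * p < 1"
  proof -
    have "0 < n / \<kappa> * p" using n(2) p(2) k by simp
    then show "- 1 < n / \<kappa> * p" by linarith
    show "n / \<kappa> * p < 1" using np k by simp
  qed
  have b2: "- 1 < p / (\<kappa> * r)" "p / (\<kappa> * r) < 1"
  proof -
    have "0 < p / (\<kappa> * r)" using r(2) p(2) k by simp
    then show "- 1 < p / (\<kappa> * r)" by linarith
    show "p / (\<kappa> * r) < 1" using pk k r(2) by simp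
  qed
  have tp: "((\<lambda>k. sqrt ((Y k)\<^sup>2 + (Z k)\<^sup>2)) \<longlongrightarrow> p) F" unfolding p_def by (intro tendsto_intros t)
  have tr: "((\<lambda>k. sqrt ((W k)\<^sup>2 + (X k)\<^sup>2)) \<longlongrightarrow> r) F" unfolding r_def by (intro tendsto_intros t)
  have 1: "((\<lambda>k. arcsin (n / \<kappa> * sqrt ((Y k)\<^sup>2 + (Z k)\<^sup>2))) \<longlongrightarrow> arcsin (n / \<kappa> * p)) F"
    by (rule isCont_tendsto_compose[OF isCont_arcsin[OF b1]]) (intro tendsto_intros tp)
  have 2: "((\<lambda>k. arcsin (sqrt ((Y k)\<^sup>2 + (Z k)\<^sup>2) / (\<kappa> * sqrt ((W k)\<^sup>2 + (X k)\<^sup>2)))) \<longlongrightarrow> arcsin (p / (\<kappa> * r))) F"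
    by (rule isCont_tendsto_compose[OF isCont_arcsin[OF b2]]) (use k r(2) in \<open>intro tendsto_intros tp tr; simp\<close>)
  show ?thesis unfolding cost_XWX_def n_def[symmetric] p_def[symmetric] r_def[symmetric]
    by (intro tendsto_intros t 1 2) (use ff in auto)
qed

lemma cost_XWY_tendsto:
  assumes t: "(W \<longlongrightarrow> w) F" "(X \<longlongrightarrow> x) F" "(Y \<longlongrightarrow> y) F" "(Z \<longlongrightarrow> z) F"
    and ch: "chamber w x y z" and u: "(1 + \<kappa>\<^sup>2) * (x * y - w * z) < \<kappa>"
  shows "((\<lambda>k. cost_XWY \<kappa> (W k) (X k) (Y k) (Z k)) \<longlongrightarrow> cost_XWY \<kappa> w x y z) F"
  unfolding cost_XWY_def Psi_def Let_def
  by (intro tendsto_intros t) (use ch u in \<open>auto simp: chamber_def\<close>)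

text \<open>The conditions on a shift are closed, so a limit of minimisers is an admissible shift at
  the limit point and bounds the minimum there from above. Semicontinuity is phrased through bounds
  C converging to c, as closedness of the epigraph.\<close>

lemma cost_YXYX_lsc:
  assumes t: "W \<longlonglongrightarrow> w" "X \<longlonglongrightarrow> x" "Y \<longlonglongrightarrow> y" "Z \<longlonglongrightarrow> z"
    and chk: "\<And>k. chamber (W k) (X k) (Y k) (Z k)" "\<And>k. X k * Y k \<le> W k * Z k"
    and ch: "chamber w x y z" "x * y \<le> w * z"
    and C: "\<And>k. cost_YXYX \<kappa> (W k) (X k) (Y k) (Z k) \<le> C k" "C \<longlonglongrightarrow> c"
  shows "cost_YXYX \<kappa> w x y z \<le> c"
proof -
  have "\<exists>\<beta>. \<beta> \<in> shift_range (W k) (X k) (Y k) (Z k) \<and> cost_YXYX \<kappa> (W k) (X k) (Y k) (Z k) = shift_cost \<kappa> (W k) (X k) (Y k) (Z k) \<beta>" for k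
    using cost_YXYX_attained[OF chk] by metis
  then obtain \<beta> where b: "\<And>k. \<beta> k \<in> shift_range (W k) (X k) (Y k) (Z k)"
    "\<And>k. cost_YXYX \<kappa> (W k) (X k) (Y k) (Z k) = shift_cost \<kappa> (W k) (X k) (Y k) (Z k) (\<beta> k)" by metis
  have "\<forall>k. \<beta> k \<in> {0..pi / 2}" using b(1) by (auto simp: shift_range_def)
  then obtain d r where d: "d \<in> {0..pi / 2}" and r: "strict_mono r" "(\<beta> \<circ> r) \<longlonglongrightarrow> d"
    using compact_Icc[of 0 "pi / 2"] unfolding compact_def by metis
  have t': "(\<lambda>k. W (r k)) \<longlonglongrightarrow> w" "(\<lambda>k. X (r k)) \<longlonglongrightarrow> x" "(\<lambda>k. Y (r k)) \<longlonglongrightarrow> y" "(\<lambda>k. Z (r k)) \<longlonglongrightarrow> z" "(\<lambda>k. C (r k)) \<longlonglongrightarrow> c"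
    using LIMSEQ_subseq_LIMSEQ[OF _ r(1)] t C(2) by (auto simp: o_def)
  have rd: "(\<lambda>k. \<beta> (r k)) \<longlonglongrightarrow> d" using r(2) by (simp add: o_def)
  have s: "(\<lambda>k. sw (W (r k)) (X (r k)) (Y (r k)) (Z (r k)) (\<beta> (r k))) \<longlonglongrightarrow> sw w x y z d"
    "(\<lambda>k. sx (W (r k)) (X (r k)) (Y (r k)) (Z (r k)) (\<beta> (r k))) \<longlonglongrightarrow> sx w x y z d"
    "(\<lambda>k. sy (W (r k)) (X (r k)) (Y (r k)) (Z (r k)) (\<beta> (r k))) \<longlonglongrightarrow> sy w x y z d"
    "(\<lambda>k. sz (W (r k)) (X (r k)) (Y (r k)) (Z (r k)) (\<beta> (r k))) \<longlonglongrightarrow> sz w x y z d"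
    unfolding shift_defs by (intro tendsto_intros t' rd)+
  have f: "d \<in> shift_range w x y z"
  proof -
    have "0 \<le> sw w x y z d" "0 \<le> sx w x y z d" "0 \<le> sy w x y z d" "0 \<le> sz w x y z d"
      by (rule LIMSEQ_le_const[OF s(1)] LIMSEQ_le_const[OF s(2)] LIMSEQ_le_const[OF s(3)] LIMSEQ_le_const[OF s(4)], use b(1) in \<open>auto simp: shift_range_def\<close>)+
    moreover have "sx w x y z d * sy w x y z d \<le> sw w x y z d * sz w x y z d"
      by (rule LIMSEQ_le[OF tendsto_mult[OF s(2,3)] tendsto_mult[OF s(1,4)]]) (use b(1) in \<open>auto simp: shift_range_def\<close>)
    ultimately show ?thesis using d by (auto simp: shift_range_def)
  qed
  have "(\<lambda>k. shift_cost \<kappa> (W (r k)) (X (r k)) (Y (r k)) (Z (r k)) (\<beta> (r k))) \<longlonglongrightarrow> shift_cost \<kappa> w x y z d"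
    unfolding shift_cost_def
    by (intro tendsto_add tendsto_mult tendsto_const rd euler_cost_tendsto s shift_range_facts[OF ch(1) f ch(2)])
  moreover have "\<forall>k. shift_cost \<kappa> (W (r k)) (X (r k)) (Y (r k)) (Z (r k)) (\<beta> (r k)) \<le> C (r k)" using b(2) C(1) by metis
  ultimately have "shift_cost \<kappa> w x y z d \<le> c" using LIMSEQ_le[OF _ t'(5)] by blast
  then show ?thesis using cost_YXYX_le[OF ch f, of \<kappa>] by linarith
qed

text \<open>One of the closed regions contains infinitely many of the points; along that subsequence
  a single formula applies, and it still applies at the limit.\<close>

lemma value_fun_lsc:
  assumes k: "0 < \<kappa>" "\<kappa> \<le> 1"
    and t: "W \<longlonglongrightarrow> w" "X \<longlonglongrightarrow> x" "Y \<longlonglongrightarrow> y" "Z \<longlonglongrightarrow> z"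
    and chk: "\<And>k. chamber (W k) (X k) (Y k) (Z k)" and ch: "chamber w x y z"
    and C: "\<And>k. value_fun \<kappa> (W k) (X k) (Y k) (Z k) \<le> C k" "C \<longlonglongrightarrow> c"
  shows "value_fun \<kappa> w x y z \<le> c"
proof -
  define P1 where "P1 = (\<lambda>k. X k * Y k \<le> W k * Z k)"
  define P2 where "P2 = (\<lambda>k. 0 \<le> X k * Y k - W k * Z k \<and> (Y k)\<^sup>2 + (Z k)\<^sup>2 \<le> \<kappa> * (X k * Y k - W k * Z k))"
  define P3 where "P3 = (\<lambda>k. 0 \<le> X k * Y k - W k * Z k \<and> \<kappa> * ((X k)\<^sup>2 + (Z k)\<^sup>2) \<le> X k * Y k - W k * Z k)"
  define P4 where "P4 = (\<lambda>k. 0 \<le> X k * Y k - W k * Z k \<and> \<kappa> * (X k * Y k - W k * Z k) \<le> (Y k)\<^sup>2 + (Z k)\<^sup>2 \<and> X k * Y k - W k * Z k \<le> \<kappa> * ((X k)\<^sup>2 + (Z k)\<^sup>2))"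
  have all: "P1 k \<or> P2 k \<or> P3 k \<or> P4 k" for k unfolding P1_def P2_def P3_def P4_def by auto
  have "\<exists>r::nat \<Rightarrow> nat. strict_mono r \<and> ((\<forall>k. P1 (r k)) \<or> (\<forall>k. P2 (r k)) \<or> (\<forall>k. P3 (r k)) \<or> (\<forall>k. P4 (r k)))"
  proof (rule ccontr)
    assume "\<not> ?thesis"
    then have "eventually (\<lambda>k. \<not> P1 k) sequentially" "eventually (\<lambda>k. \<not> P2 k) sequentially"
      "eventually (\<lambda>k. \<not> P3 k) sequentially" "eventually (\<lambda>k. \<not> P4 k) sequentially"
      using not_eventually_sequentiallyD by (metis (lifting))+
    then have "eventually (\<lambda>k. False) sequentially" by eventually_elim (use all in auto)
    then show False by simp
  qed
  then obtain r :: "nat \<Rightarrow> nat" where r: "strict_mono r" and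
    cases: "(\<forall>k. P1 (r k)) \<or> (\<forall>k. P2 (r k)) \<or> (\<forall>k. P3 (r k)) \<or> (\<forall>k. P4 (r k))" by blast
  have t': "(\<lambda>k. W (r k)) \<longlonglongrightarrow> w" "(\<lambda>k. X (r k)) \<longlonglongrightarrow> x" "(\<lambda>k. Y (r k)) \<longlonglongrightarrow> y" "(\<lambda>k. Z (r k)) \<longlonglongrightarrow> z" "(\<lambda>k. C (r k)) \<longlonglongrightarrow> c"
    using LIMSEQ_subseq_LIMSEQ[OF _ r] t C(2) by (auto simp: o_def)
  have tu: "(\<lambda>k. X (r k) * Y (r k) - W (r k) * Z (r k)) \<longlonglongrightarrow> x * y - w * z"
    and tku: "(\<lambda>k. \<kappa> * (X (r k) * Y (r k) - W (r k) * Z (r k))) \<longlonglongrightarrow> \<kappa> * (x * y - w * z)"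
    and tyz: "(\<lambda>k. (Y (r k))\<^sup>2 + (Z (r k))\<^sup>2) \<longlonglongrightarrow> y\<^sup>2 + z\<^sup>2"
    and txz: "(\<lambda>k. \<kappa> * ((X (r k))\<^sup>2 + (Z (r k))\<^sup>2)) \<longlonglongrightarrow> \<kappa> * (x\<^sup>2 + z\<^sup>2)"
    by (intro tendsto_intros t')+
  note R = value_fun_regions[OF ch k] and Rk = value_fun_regions[OF chk k]
  show ?thesis
  proof (cases "\<forall>k. P1 (r k)")
    case True
    have le: "x * y \<le> w * z" by (rule LIMSEQ_le[OF tendsto_mult[OF t'(2,3)] tendsto_mult[OF t'(1,4)]]) (use True in \<open>auto simp: P1_def\<close>)
    have "cost_YXYX \<kappa> (W (r k)) (X (r k)) (Y (r k)) (Z (r k)) \<le> C (r k)" for k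
      using True C(1)[of "r k"] Rk(1)[of "r k"] by (simp add: P1_def)
    then have "cost_YXYX \<kappa> w x y z \<le> c"
      by (intro cost_YXYX_lsc[OF t'(1-4) chk _ ch le _ t'(5)]) (use True in \<open>auto simp: P1_def\<close>)
    then show ?thesis using R(1)[OF le] by simp
  next
    case n1: False
    show ?thesis
    proof (cases "\<forall>k. P2 (r k)")
      case True
      have u: "0 \<le> x * y - w * z" by (rule LIMSEQ_le_const[OF tu]) (use True in \<open>auto simp: P2_def\<close>)
      have g: "y\<^sup>2 + z\<^sup>2 \<le> \<kappa> * (x * y - w * z)" by (rule LIMSEQ_le[OF tyz tku]) (use True in \<open>auto simp: P2_def\<close>)
      have "cost_XWX \<kappa> (W (r k)) (X (r k)) (Y (r k)) (Z (r k)) \<le> C (r k)" for k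
        using True C(1)[of "r k"] Rk(2)[of "r k"] by (simp add: P2_def)
      then have "cost_XWX \<kappa> w x y z \<le> c"
        using LIMSEQ_le[OF cost_XWX_tendsto[OF t'(1-4) ch g k(1)] t'(5)] by blast
      then show ?thesis using R(2)[OF u g] by simp
    next
      case n2: False
      show ?thesis
      proof (cases "\<forall>k. P3 (r k)")
        case True
        have u: "0 \<le> x * y - w * z" by (rule LIMSEQ_le_const[OF tu]) (use True in \<open>auto simp: P3_def\<close>)
        have g: "\<kappa> * (x\<^sup>2 + z\<^sup>2) \<le> x * y - w * z" by (rule LIMSEQ_le[OF txz tu]) (use True in \<open>auto simp: P3_def\<close>)
        have g': "x\<^sup>2 + z\<^sup>2 \<le> (1 / \<kappa>) * (y * x - w * z)" using g k by (simp add: swap_region)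
        have k': "0 < 1 / \<kappa>" using k by simp
        have "\<kappa> * cost_XWX (1 / \<kappa>) (W (r k)) (Y (r k)) (X (r k)) (Z (r k)) \<le> C (r k)" for k
          using True C(1)[of "r k"] Rk(3)[of "r k"] by (simp add: P3_def)
        then have "\<kappa> * cost_XWX (1 / \<kappa>) w y x z \<le> c"
          using LIMSEQ_le[OF tendsto_mult[OF tendsto_const cost_XWX_tendsto[OF t'(1,3,2,4) chamber_swap[OF ch] g' k']] t'(5)] by blast
        then show ?thesis using R(3)[OF u g] by simp
      next
        case False
        then have True: "\<forall>k. P4 (r k)" using n1 n2 cases by blast
        have u: "0 \<le> x * y - w * z" by (rule LIMSEQ_le_const[OF tu]) (use True in \<open>auto simp: P4_def\<close>)
        have g: "\<kappa> * (x * y - w * z) \<le> y\<^sup>2 + z\<^sup>2" by (rule LIMSEQ_le[OF tku tyz]) (use True in \<open>auto simp: P4_def\<close>)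
        have h: "x * y - w * z \<le> \<kappa> * (x\<^sup>2 + z\<^sup>2)" by (rule LIMSEQ_le[OF tu txz]) (use True in \<open>auto simp: P4_def\<close>)
        have "cost_XWY \<kappa> (W (r k)) (X (r k)) (Y (r k)) (Z (r k)) \<le> C (r k)" for k
          using True C(1)[of "r k"] Rk(4)[of "r k"] by (simp add: P4_def)
        then have "cost_XWY \<kappa> w x y z \<le> c"
          using LIMSEQ_le[OF cost_XWY_tendsto[OF t'(1-4) ch cost_XWY_region_strict[OF ch k h]] t'(5)] by blast
        then show ?thesis using R(4)[OF u g h] by simp
      qed
    qed
  qed
qed

section \<open>Growth along curves\<close>

text \<open>With slack e, the times obeying the bound form a closed set by semicontinuity, so there
  is a last one. The estimate to the right would prolong it unless it is T. Thus semicontinuity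
  controls jumps at limits from the left, and \<open>dini\<close> controls what happens to the
  right.\<close>

lemma dini_bound:
  fixes f :: "real \<Rightarrow> real"
  assumes T: "0 \<le> T"
    and lsc: "\<And>t S C c. S \<longlonglongrightarrow> t \<Longrightarrow> (\<And>k. S k \<in> {0..T}) \<Longrightarrow> t \<in> {0..T} \<Longrightarrow> (\<And>k::nat. f (S k) \<le> C k) \<Longrightarrow> C \<longlonglongrightarrow> c \<Longrightarrow> f t \<le> c"
    and dini: "\<And>t e. 0 \<le> t \<Longrightarrow> t < T \<Longrightarrow> 0 < e \<Longrightarrow> \<forall>\<^sub>F s in at_right t. f s \<le> f t + (L + e) * (s - t)"
  shows "f T \<le> f 0 + L * T"
proof -
  have main: "f T \<le> f 0 + (L + e) * T" if e: "0 < e" for e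
  proof -
    define S where "S = {t \<in> {0..T}. f t \<le> f 0 + (L + e) * t}"
    have "closed S"
      unfolding closed_sequential_limits
    proof (intro allI impI, elim conjE)
      fix X l assume X: "\<forall>n. X n \<in> S" "X \<longlonglongrightarrow> l"
      have l: "l \<in> {0..T}" using X closed_sequentially[OF closed_atLeastAtMost, of X 0 T l] by (auto simp: S_def)
      have "f l \<le> f 0 + (L + e) * l"
        by (rule lsc[OF X(2) _ l, of "\<lambda>n. f 0 + (L + e) * X n"]) (use X in \<open>auto simp: S_def intro!: tendsto_intros\<close>)
      then show "l \<in> S" using l by (simp add: S_def)
    qed
    moreover have "bounded S" by (rule bounded_subset[of "{0..T}"]) (auto simp: S_def)
    ultimately have "compact S" by (simp add: compact_eq_bounded_closed)
    moreover have "0 \<in> S" using T by (simp add: S_def)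
    ultimately obtain m where m: "m \<in> S" "\<And>t. t \<in> S \<Longrightarrow> t \<le> m"
      using compact_attains_sup[of S] by blast
    have "m = T"
    proof (rule ccontr)
      assume "m \<noteq> T"
      then have lt: "0 \<le> m" "m < T" using m(1) by (auto simp: S_def)
      have "\<forall>\<^sub>F s in at_right m. s < T" using lt(2) by (rule eventually_at_right_real[THEN eventually_mono]) auto
      moreover have "\<forall>\<^sub>F s in at_right m. m < s" by (rule eventually_at_right_less)
      ultimately have "\<forall>\<^sub>F s in at_right m. s < T \<and> m < s \<and> f s \<le> f m + (L + e) * (s - m)"
        using dini[OF lt e] by eventually_elim auto
      then obtain s where s: "s < T" "m < s" "f s \<le> f m + (L + e) * (s - m)"
        using eventually_happens'[OF trivial_limit_at_right_real] by blast
      then have "s \<in> S" using m(1) by (auto simp: S_def algebra_simps)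
      then show False using m(2) s(2) by force
    qed
    then show ?thesis using m(1) by (simp add: S_def)
  qed
  show ?thesis
  proof (rule field_le_epsilon)
    fix d :: real assume d: "0 < d"
    \<comment> \<open>The divisor T + 1 keeps the accumulated slack below d and avoids division by T
      when T = 0.\<close>
    have "f T \<le> f 0 + (L + d / (T + 1)) * T" by (rule main) (use d T in simp)
    also have "\<dots> = f 0 + L * T + d * (T / (T + 1))" by (simp add: algebra_simps)
    also have "d * (T / (T + 1)) \<le> d * 1" using d T by (intro mult_left_mono) auto
    finally show "f T \<le> f 0 + L * T + d" by simp
  qed
qed

lemma deriv_upper_right:
  assumes "(g has_real_derivative D) (at t)" "D \<le> L" "0 < e"
  shows "\<forall>\<^sub>F s in at_right t. g s \<le> g t + (L + e) * (s - t)"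
proof -
  have "((\<lambda>s. (g s - g t) / (s - t)) \<longlongrightarrow> D) (at t)" using assms(1) by (simp add: has_field_derivative_iff)
  then have "((\<lambda>s. (g s - g t) / (s - t)) \<longlongrightarrow> D) (at_right t)" by (rule tendsto_within_subset) auto
  then have "\<forall>\<^sub>F s in at_right t. (g s - g t) / (s - t) < L + e"
    by (rule order_tendstoD) (use assms in auto)
  moreover have "\<forall>\<^sub>F s in at_right t. t < s" by (rule eventually_at_right_less)
  ultimately show ?thesis by eventually_elim (simp add: pos_divide_less_eq)
qed

text \<open>Near a zero of f the sign may vary with s, hence \<sigma> is chosen after s; otherwise
  it is the sign of f t. In this way the absolute value is replaced by the differentiable function
  \<sigma> f.\<close>

lemma eventually_abs_sign:
  fixes f :: "real \<Rightarrow> real"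
  assumes "isCont f t"
  shows "\<forall>\<^sub>F s in at_right t. \<exists>\<sigma>\<in>{1, -1}. \<sigma> * f t = \<bar>f t\<bar> \<and> \<bar>f s\<bar> = \<sigma> * f s"
proof -
  have lim: "(f \<longlongrightarrow> f t) (at_right t)" using assms unfolding isCont_def by (rule tendsto_within_subset) auto
  consider "f t = 0" | "0 < f t" | "f t < 0" by linarith
  then show ?thesis
  proof cases
    case 1
    then show ?thesis by (intro always_eventually allI) (auto simp: abs_if)
  next
    case 2
    then have "\<forall>\<^sub>F s in at_right t. 0 < f s" using order_tendstoD(1)[OF lim] by blast
    then show ?thesis by eventually_elim (use 2 in auto)
  next
    case 3
    then have "\<forall>\<^sub>F s in at_right t. f s < 0" using order_tendstoD(2)[OF lim] by blast
    then show ?thesis by eventually_elim (use 3 in auto)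
  qed
qed

text \<open>Multiplying the coordinates by signs turns the velocity of right multiplication into
  that of right or left multiplication, according to the product \<sigma> of the signs. The signs
  near a zero are not known in advance, so all compatible sign patterns and all touching functions
  are estimated simultaneously, which is possible because they are finitely many.\<close>

lemma value_fun_curve:
  fixes cw cx cy cz :: "real \<Rightarrow> real"
  assumes k: "0 < \<kappa>" "\<kappa> \<le> 1" and T: "0 \<le> T"
    and dw: "\<And>t. (cw has_real_derivative (- a * cx t - b * cy t) / 2) (at t)"
    and dx: "\<And>t. (cx has_real_derivative (a * cw t - b * cz t) / 2) (at t)"
    and dy: "\<And>t. (cy has_real_derivative (a * cz t + b * cw t) / 2) (at t)"
    and dz: "\<And>t. (cz has_real_derivative (b * cx t - a * cy t) / 2) (at t)"
    and ch: "\<And>t. t \<in> {0..T} \<Longrightarrow> chamber (abs (cw t)) (abs (cx t)) (abs (cy t)) (abs (cz t))"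
  shows "value_fun \<kappa> (abs (cw T)) (abs (cx T)) (abs (cy T)) (abs (cz T)) \<le> value_fun \<kappa> (abs (cw 0)) (abs (cx 0)) (abs (cy 0)) (abs (cz 0)) + (\<bar>a\<bar> + \<kappa> * \<bar>b\<bar>) * T"
proof (rule dini_bound[where f = "\<lambda>t. value_fun \<kappa> (abs (cw t)) (abs (cx t)) (abs (cy t)) (abs (cz t))", OF T])
  have ct: "isCont cw t" "isCont cx t" "isCont cy t" "isCont cz t" for t
    using DERIV_isCont[OF dw] DERIV_isCont[OF dx] DERIV_isCont[OF dy] DERIV_isCont[OF dz] by auto
  {
    fix t and S C :: "nat \<Rightarrow> real" and c
    assume S: "S \<longlonglongrightarrow> t" "\<And>k. S k \<in> {0..T}" "t \<in> {0..T}" and C: "\<And>k. value_fun \<kappa> (abs (cw (S k))) (abs (cx (S k))) (abs (cy (S k))) (abs (cz (S k))) \<le> C k" "C \<longlonglongrightarrow> c"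
    show "value_fun \<kappa> (abs (cw t)) (abs (cx t)) (abs (cy t)) (abs (cz t)) \<le> c"
      by (rule value_fun_lsc[OF k _ _ _ _ ch[OF S(2)] ch[OF S(3)] C])
        (intro tendsto_intros isCont_tendsto_compose[OF ct(1) S(1)] isCont_tendsto_compose[OF ct(2) S(1)]
          isCont_tendsto_compose[OF ct(3) S(1)] isCont_tendsto_compose[OF ct(4) S(1)])+
  }
  fix t e :: real assume t: "0 \<le> t" "t < T" and e: "0 < e"
  define L where "L = \<bar>a\<bar> + \<kappa> * \<bar>b\<bar>"
  have cht: "chamber (abs (cw t)) (abs (cx t)) (abs (cy t)) (abs (cz t))" using ch t by simp
  obtain \<G> where G: "finite \<G>" "\<And>G. G \<in> \<G> \<Longrightarrow> G (abs (cw t)) (abs (cx t)) (abs (cy t)) (abs (cz t)) = value_fun \<kappa> (abs (cw t)) (abs (cx t)) (abs (cy t)) (abs (cz t))"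
    "\<And>G. G \<in> \<G> \<Longrightarrow> grad_bounded \<kappa> G (abs (cw t)) (abs (cx t)) (abs (cy t)) (abs (cz t))"
    and ev: "\<forall>\<^sub>F (w', x', y', z') in nhds ((abs (cw t)), (abs (cx t)), (abs (cy t)), (abs (cz t))). chamber w' x' y' z' \<longrightarrow> (\<exists>G\<in>\<G>. value_fun \<kappa> w' x' y' z' \<le> G w' x' y' z')"
  proof -
    have "\<exists>\<G>. finite \<G> \<and> (\<forall>G\<in>\<G>. G (abs (cw t)) (abs (cx t)) (abs (cy t)) (abs (cz t)) = value_fun \<kappa> (abs (cw t)) (abs (cx t)) (abs (cy t)) (abs (cz t)) \<and>
         grad_bounded \<kappa> G (abs (cw t)) (abs (cx t)) (abs (cy t)) (abs (cz t))) \<and>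
       (\<forall>\<^sub>F (w', x', y', z') in nhds (abs (cw t), abs (cx t), abs (cy t), abs (cz t)). chamber w' x' y' z' \<longrightarrow> (\<exists>G\<in>\<G>. value_fun \<kappa> w' x' y' z' \<le> G w' x' y' z'))"
    proof (rule value_fun_touch[OF cht k], goal_cases)
      case (1 \<G>)
      show ?case by (rule exI[of _ \<G>], intro conjI ballI 1)
    qed
    then show ?thesis using that by blast
  qed
  define A where "A = {1, -1 :: real}"
  \<comment> \<open>Sign patterns compatible with the absolute values at time t; a vanishing
    coordinate leaves its sign free.\<close>
  define Sg where "Sg = {(ew, ex, ey, ez). ew \<in> A \<and> ex \<in> A \<and> ey \<in> A \<and> ez \<in> A \<and> ew * cw t = (abs (cw t)) \<and> ex * cx t = (abs (cx t)) \<and> ey * cy t = (abs (cy t)) \<and> ez * cz t = (abs (cz t))}"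
  have "finite (A \<times> A \<times> A \<times> A)" by (simp add: A_def)
  then have fS: "finite Sg" by (rule rev_finite_subset) (auto simp: Sg_def)
  have each: "\<forall>\<^sub>F s in at_right t. G (ew * cw s) (ex * cx s) (ey * cy s) (ez * cz s) \<le> value_fun \<kappa> (abs (cw t)) (abs (cx t)) (abs (cy t)) (abs (cz t)) + (L + e) * (s - t)"
    if "(ew, ex, ey, ez) \<in> Sg" "G \<in> \<G>" for ew ex ey ez G
  proof -
    have v: "ew * cw t = (abs (cw t))" "ex * cx t = (abs (cx t))" "ey * cy t = (abs (cy t))" "ez * cz t = (abs (cz t))"
      and sg: "ew \<in> A" "ex \<in> A" "ey \<in> A" "ez \<in> A" using that(1) by (auto simp: Sg_def)
    have sq: "ew * ew = 1" "ex * ex = 1" "ey * ey = 1" "ez * ez = 1" using sg by (auto simp: A_def)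
    define \<sigma> where "\<sigma> = ew * ex * ey * ez"
    have s1: "\<sigma> \<in> {1, -1}" using sg by (auto simp: \<sigma>_def A_def)
    \<comment> \<open>The signs are moved from the coordinates to the coefficients, whose absolute
      values, and hence the cost rate, do not change.\<close>
    define a' where "a' = a * ew * ex"
    define b' where "b' = b * ew * ey"
    have ab: "\<bar>a'\<bar> = \<bar>a\<bar>" "\<bar>b'\<bar> = \<bar>b\<bar>" using sg by (auto simp: a'_def b'_def A_def)
    have "\<exists>D. ((\<lambda>s. G (ew * cw s) (ex * cx s) (ey * cy s) (ez * cz s)) has_real_derivative D) (at t) \<and> D \<le> \<bar>a'\<bar> + \<kappa> * \<bar>b'\<bar>"
    proof (rule G(3)[OF that(2), unfolded grad_bounded_def, rule_format, OF s1, of "\<lambda>s. ew * cw s" t "\<lambda>s. ex * cx s" "\<lambda>s. ey * cy s" "\<lambda>s. ez * cz s" a' b'])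
      show "((\<lambda>s. ew * cw s) has_real_derivative (- a' * (abs (cx t)) - b' * (abs (cy t))) / 2) (at t)"
        by (rule DERIV_cong[OF DERIV_cmult[OF dw]]) (use sq in \<open>unfold v[symmetric] a'_def b'_def, algebra\<close>)
      show "((\<lambda>s. ex * cx s) has_real_derivative (a' * (abs (cw t)) - \<sigma> * b' * (abs (cz t))) / 2) (at t)"
        by (rule DERIV_cong[OF DERIV_cmult[OF dx]]) (use sq in \<open>unfold v[symmetric] a'_def b'_def \<sigma>_def, algebra\<close>)
      show "((\<lambda>s. ey * cy s) has_real_derivative (\<sigma> * a' * (abs (cz t)) + b' * (abs (cw t))) / 2) (at t)"
        by (rule DERIV_cong[OF DERIV_cmult[OF dy]]) (use sq in \<open>unfold v[symmetric] a'_def b'_def \<sigma>_def, algebra\<close>)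
      show "((\<lambda>s. ez * cz s) has_real_derivative (\<sigma> * b' * (abs (cx t)) - \<sigma> * a' * (abs (cy t))) / 2) (at t)"
        by (rule DERIV_cong[OF DERIV_cmult[OF dz]]) (use sq in \<open>unfold v[symmetric] a'_def b'_def \<sigma>_def, algebra\<close>)
    qed (rule v)+
    then obtain D where "((\<lambda>s. G (ew * cw s) (ex * cx s) (ey * cy s) (ez * cz s)) has_real_derivative D) (at t)" "D \<le> L"
      unfolding ab L_def by blast
    from deriv_upper_right[OF this e] show ?thesis unfolding v using G(2)[OF that(2)] by simp
  qed
  have "\<forall>\<^sub>F s in at_right t. \<forall>p\<in>Sg \<times> \<G>. (case p of ((ew, ex, ey, ez), G) \<Rightarrow> G (ew * cw s) (ex * cx s) (ey * cy s) (ez * cz s) \<le> value_fun \<kappa> (abs (cw t)) (abs (cx t)) (abs (cy t)) (abs (cz t)) + (L + e) * (s - t))"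
    using fS G(1) each by (intro eventually_ball_finite) auto
  moreover have "\<forall>\<^sub>F s in at_right t. chamber (abs (cw s)) (abs (cx s)) (abs (cy s)) (abs (cz s))"
  proof -
    have "\<forall>\<^sub>F s in at_right t. s \<in> {t<..<T}" using t(2) by (rule eventually_at_right_real)
    then show ?thesis by eventually_elim (use ch t in auto)
  qed
  moreover have "\<forall>\<^sub>F s in at_right t. chamber (abs (cw s)) (abs (cx s)) (abs (cy s)) (abs (cz s)) \<longrightarrow> (\<exists>G\<in>\<G>. value_fun \<kappa> (abs (cw s)) (abs (cx s)) (abs (cy s)) (abs (cz s)) \<le> G (abs (cw s)) (abs (cx s)) (abs (cy s)) (abs (cz s)))"
  proof -
    have l: "(cw \<longlongrightarrow> cw t) (at_right t)" "(cx \<longlongrightarrow> cx t) (at_right t)" "(cy \<longlongrightarrow> cy t) (at_right t)" "(cz \<longlongrightarrow> cz t) (at_right t)"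
      using ct[of t] unfolding isCont_def by (auto intro: tendsto_within_subset)
    have "filterlim (\<lambda>s. ((abs (cw s)), (abs (cx s)), (abs (cy s)), (abs (cz s)))) (nhds ((abs (cw t)), (abs (cx t)), (abs (cy t)), (abs (cz t)))) (at_right t)"
      by (intro tendsto_intros l)
    from eventually_compose_filterlim[OF ev this] show ?thesis by simp
  qed
  ultimately show "\<forall>\<^sub>F s in at_right t. value_fun \<kappa> (abs (cw s)) (abs (cx s)) (abs (cy s)) (abs (cz s)) \<le> value_fun \<kappa> (abs (cw t)) (abs (cx t)) (abs (cy t)) (abs (cz t)) + (\<bar>a\<bar> + \<kappa> * \<bar>b\<bar> + e) * (s - t)"
    using eventually_abs_sign[OF ct(1)[of t]] eventually_abs_sign[OF ct(2)[of t]] eventually_abs_sign[OF ct(3)[of t]] eventually_abs_sign[OF ct(4)[of t]]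
  proof eventually_elim
    case (elim s)
    obtain G where g: "G \<in> \<G>" "value_fun \<kappa> (abs (cw s)) (abs (cx s)) (abs (cy s)) (abs (cz s)) \<le> G (abs (cw s)) (abs (cx s)) (abs (cy s)) (abs (cz s))" using elim by blast
    obtain ew ex ey ez where s: "ew \<in> {1, -1}" "ew * cw t = (abs (cw t))" "(abs (cw s)) = ew * cw s"
      "ex \<in> {1, -1}" "ex * cx t = (abs (cx t))" "(abs (cx s)) = ex * cx s"
      "ey \<in> {1, -1}" "ey * cy t = (abs (cy t))" "(abs (cy s)) = ey * cy s"
      "ez \<in> {1, -1}" "ez * cz t = (abs (cz t))" "(abs (cz s)) = ez * cz s" using elim(4-7) by metis
    have "((ew, ex, ey, ez), G) \<in> Sg \<times> \<G>" using s g by (auto simp: Sg_def A_def)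
    from elim(1)[rule_format, OF this] have "G (ew * cw s) (ex * cx s) (ey * cy s) (ez * cz s) \<le> value_fun \<kappa> (abs (cw t)) (abs (cx t)) (abs (cy t)) (abs (cz t)) + (L + e) * (s - t)" by simp
    then show ?case using g(2) unfolding s(3,6,9,12) L_def by simp
  qed
qed

section \<open>Candidate words\<close>

type_synonym quat = "real \<times> real \<times> real \<times> real"

fun qmul :: "quat \<Rightarrow> quat \<Rightarrow> quat" where
  "qmul (w, x, y, z) (w', x', y', z') = (w * w' - x * x' - y * y' - z * z', w * x' + x * w' + y * z' - z * y',
     w * y' - x * z' + y * w' + z * x', w * z' + x * y' - y * x' + z * w')"

definition qX :: "real \<Rightarrow> quat" where "qX t = (cos t, sin t, 0, 0)"
definition qY :: "real \<Rightarrow> quat" where "qY t = (cos t, 0, sin t, 0)"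
definition qW :: "real \<Rightarrow> real \<Rightarrow> quat" where
  "qW \<kappa> t = (cos t, sin t / sqrt (1 + \<kappa>\<^sup>2), \<kappa> * sin t / sqrt (1 + \<kappa>\<^sup>2), 0)"

lemma qmul_assoc: "qmul (qmul p q) r = qmul p (qmul q r)"
  by (cases p; cases q; cases r) (simp add: algebra_simps)

lemma qmul_1 [simp]: "qmul (1, 0, 0, 0) q = q" "qmul q (1, 0, 0, 0) = q"
  by (cases q, simp)+

text \<open>A and B are half the full times of the X- and Y-letters of pattern (I); \<beta>, a, b,
  \<alpha> are those of the subword, whose inner letters must be complete while the outer ones may
  be shortened. The relation is cleared of tangents, which makes the set closed at pi / 2.\<close>

definition params_YXYX :: "real \<Rightarrow> (real \<times> real \<times> real \<times> real \<times> real \<times> real) set" where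
  "params_YXYX \<kappa> = {(\<beta>, a, b, \<alpha>, A, B). 0 \<le> \<beta> \<and> 0 \<le> a \<and> 0 \<le> b \<and> 0 \<le> \<alpha> \<and> a \<le> A \<and> \<alpha> \<le> A \<and> b \<le> B \<and> \<beta> \<le> B \<and>
     A \<le> pi / 2 \<and> B \<le> pi / 2 \<and> sin A * cos B = \<kappa> * (cos A * sin B) \<and>
     (\<beta> = 0 \<and> b = B \<or> \<alpha> = 0 \<and> a = A \<or> a = A \<and> b = B)}"

definition candI :: "real \<Rightarrow> (quat \<times> real) set" where
  "candI \<kappa> = (\<lambda>(\<beta>, a, b, \<alpha>, A, B). (qmul (qmul (qmul (qY (- \<beta>)) (qX a)) (qY b)) (qX (- \<alpha>)), 2 * \<kappa> * \<beta> + 2 * a + 2 * \<kappa> * b + 2 * \<alpha>)) ` params_YXYX \<kappa>"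

definition params_W :: "(real \<times> real \<times> real) set" where "params_W = {0..pi / 2} \<times> {0..pi / 2} \<times> {0..pi / 2}"

definition candXWX :: "real \<Rightarrow> (quat \<times> real) set" where
  "candXWX \<kappa> = (\<lambda>(\<alpha>, \<tau>, \<beta>). (qmul (qmul (qX \<alpha>) (qW \<kappa> \<tau>)) (qX \<beta>), 2 * \<alpha> + 2 * \<beta> + 2 * sqrt (1 + \<kappa>\<^sup>2) * \<tau>)) ` params_W"
definition candYWY :: "real \<Rightarrow> (quat \<times> real) set" where
  "candYWY \<kappa> = (\<lambda>(\<alpha>, \<tau>, \<beta>). (qmul (qmul (qY \<alpha>) (qW \<kappa> \<tau>)) (qY \<beta>), 2 * \<kappa> * \<alpha> + 2 * \<kappa> * \<beta> + 2 * sqrt (1 + \<kappa>\<^sup>2) * \<tau>)) ` params_W"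
definition candXWY :: "real \<Rightarrow> (quat \<times> real) set" where
  "candXWY \<kappa> = (\<lambda>(\<alpha>, \<tau>, \<beta>). (qmul (qmul (qX \<alpha>) (qW \<kappa> \<tau>)) (qY \<beta>), 2 * \<alpha> + 2 * \<kappa> * \<beta> + 2 * sqrt (1 + \<kappa>\<^sup>2) * \<tau>)) ` params_W"

definition candidates :: "real \<Rightarrow> (quat \<times> real) set" where
  "candidates \<kappa> = candI \<kappa> \<union> candXWX \<kappa> \<union> candYWY \<kappa> \<union> candXWY \<kappa>"

lemma compact_params_YXYX: "compact (params_YXYX \<kappa>)"
proof -
  have "closed (params_YXYX \<kappa>)"
    unfolding params_YXYX_def case_prod_beta
    by (intro closed_Collect_conj closed_Collect_disj closed_Collect_le closed_Collect_eq continuous_intros)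
  moreover have "params_YXYX \<kappa> \<subseteq> cbox (0, 0, 0, 0, 0, 0) (pi / 2, pi / 2, pi / 2, pi / 2, pi / 2, pi / 2)"
    unfolding cbox_Pair_eq by (auto simp: params_YXYX_def)
  ultimately show ?thesis using bounded_subset[OF bounded_cbox] compact_eq_bounded_closed by blast
qed

lemma compact_candidates: "compact (candidates \<kappa>)"
proof -
  have params_W: "compact params_W" unfolding params_W_def by (intro compact_Times compact_Icc)
  have e: "qmul p q = (fst p * fst q - fst (snd p) * fst (snd q) - fst (snd (snd p)) * fst (snd (snd q)) - snd (snd (snd p)) * snd (snd (snd q)),
      fst p * fst (snd q) + fst (snd p) * fst q + fst (snd (snd p)) * snd (snd (snd q)) - snd (snd (snd p)) * fst (snd (snd q)),
      fst p * fst (snd (snd q)) - fst (snd p) * snd (snd (snd q)) + fst (snd (snd p)) * fst q + snd (snd (snd p)) * fst (snd q),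
      fst p * snd (snd (snd q)) + fst (snd p) * fst (snd (snd q)) - fst (snd (snd p)) * fst (snd q) + snd (snd (snd p)) * fst q)" for p q
    by (cases p; cases q) simp
  have m: "continuous_on S (\<lambda>s. qmul (f s) (g s))" if "continuous_on S f" "continuous_on S g" for S :: "'a::t2_space set" and f g
    unfolding e by (intro continuous_intros that)
  have qX: "continuous_on S (\<lambda>s. qX (f s))" if "continuous_on S f" for S :: "'a::t2_space set" and f
    unfolding qX_def by (intro continuous_intros that)
  have qY: "continuous_on S (\<lambda>s. qY (f s))" if "continuous_on S f" for S :: "'a::t2_space set" and f
    unfolding qY_def by (intro continuous_intros that)
  have qW: "continuous_on S (\<lambda>s. qW \<kappa> (f s))" if "continuous_on S f" for S :: "'a::t2_space set" and f
  proof -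
    have "sqrt (1 + \<kappa>\<^sup>2) \<noteq> 0" using norm_sqrt(1)[of \<kappa>] by linarith
    then show ?thesis unfolding qW_def by (intro continuous_intros that) auto
  qed
  show ?thesis
    unfolding candidates_def candI_def candXWX_def candYWY_def candXWY_def case_prod_beta
    by (intro compact_Un compact_continuous_image compact_params_YXYX params_W continuous_on_Pair m qX qY qW continuous_intros)
qed

lemma candidates_XWX:
  assumes "is_XWX \<kappa> \<alpha> \<tau> \<beta> w x y z" "0 \<le> \<alpha>" "\<alpha> \<le> pi / 2" "0 \<le> \<tau>" "\<tau> < pi / 2" "0 \<le> \<beta>" "\<beta> \<le> pi / 2"
  shows "((w, x, y, z), 2 * \<alpha> + 2 * \<beta> + 2 * sqrt (1 + \<kappa>\<^sup>2) * \<tau>) \<in> candXWX \<kappa>"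
proof -
  have "qmul (qmul (qX \<alpha>) (qW \<kappa> \<tau>)) (qX \<beta>) = (w, x, y, z)"
    using assms(1) unfolding is_XWX_def Let_def qX_def qW_def cos_add sin_add cos_diff sin_diff
    by (simp add: algebra_simps add_divide_distrib diff_divide_distrib)
  then show ?thesis unfolding candXWX_def
    by (intro image_eqI[of _ _ "(\<alpha>, \<tau>, \<beta>)"]) (use assms in \<open>auto simp: params_W_def\<close>)
qed

text \<open>Exchanging X and Y with z kept reverses the order of the factors, so \<alpha> and
  \<beta> change places.\<close>

lemma candidates_YWY:
  assumes "is_XWX (1 / \<kappa>) \<alpha> \<tau> \<beta> w y x z" "0 \<le> \<alpha>" "\<alpha> \<le> pi / 2" "0 \<le> \<tau>" "\<tau> < pi / 2" "0 \<le> \<beta>" "\<beta> \<le> pi / 2" "0 < \<kappa>"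
  shows "((w, x, y, z), \<kappa> * (2 * \<alpha> + 2 * \<beta> + 2 * sqrt (1 + (1 / \<kappa>)\<^sup>2) * \<tau>)) \<in> candYWY \<kappa>"
proof -
  have n': "sqrt (1 + (1 / \<kappa>)\<^sup>2) = sqrt (1 + \<kappa>\<^sup>2) / \<kappa>"
  proof -
    have "1 + (1 / \<kappa>)\<^sup>2 = (1 + \<kappa>\<^sup>2) / \<kappa>\<^sup>2" using assms(8) by (simp add: field_simps)
    then show ?thesis using assms(8) by (simp add: real_sqrt_divide)
  qed
  have i: "1 / \<kappa> * sin \<tau> / (sqrt (1 + \<kappa>\<^sup>2) / \<kappa>) = sin \<tau> / sqrt (1 + \<kappa>\<^sup>2)" "sin \<tau> / (sqrt (1 + \<kappa>\<^sup>2) / \<kappa>) = \<kappa> * sin \<tau> / sqrt (1 + \<kappa>\<^sup>2)"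
    using assms(8) by (simp_all add: field_simps)
  have "qmul (qmul (qY \<beta>) (qW \<kappa> \<tau>)) (qY \<alpha>) = (w, x, y, z)"
    using assms(1) unfolding is_XWX_def Let_def n' i qY_def qW_def cos_add sin_add cos_diff sin_diff
    by (simp add: algebra_simps add_divide_distrib diff_divide_distrib)
  then show ?thesis unfolding candYWY_def n'
    by (intro image_eqI[of _ _ "(\<beta>, \<tau>, \<alpha>)"]) (use assms in \<open>auto simp: params_W_def algebra_simps\<close>)
qed

lemma candidates_XWY:
  assumes "is_XWY \<kappa> \<alpha> \<tau> \<beta> w x y z" "0 \<le> \<alpha>" "\<alpha> \<le> pi / 2" "0 \<le> \<tau>" "\<tau> < pi / 2" "0 \<le> \<beta>" "\<beta> \<le> pi / 2"
  shows "((w, x, y, z), 2 * \<alpha> + 2 * \<kappa> * \<beta> + 2 * sqrt (1 + \<kappa>\<^sup>2) * \<tau>) \<in> candXWY \<kappa>"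
proof -
  define g where "g = sin \<tau> / sqrt (1 + \<kappa>\<^sup>2)"
  have W: "w - z = cos \<tau> * cos (\<alpha> + \<beta>) - (1 + \<kappa>) * g * sin (\<alpha> + \<beta>)"
     "x + y = cos \<tau> * sin (\<alpha> + \<beta>) + (1 + \<kappa>) * g * cos (\<alpha> + \<beta>)"
     "w + z = cos \<tau> * cos (\<alpha> - \<beta>) - (1 - \<kappa>) * g * sin (\<alpha> - \<beta>)"
     "x - y = cos \<tau> * sin (\<alpha> - \<beta>) + (1 - \<kappa>) * g * cos (\<alpha> - \<beta>)"
    using assms(1) unfolding is_XWY_def Let_def g_def by auto
  have "w = (cos \<alpha> * cos \<tau> - sin \<alpha> * g) * cos \<beta> - cos \<alpha> * (\<kappa> * g) * sin \<beta>"
    "x = (cos \<alpha> * g + sin \<alpha> * cos \<tau>) * cos \<beta> - sin \<alpha> * (\<kappa> * g) * sin \<beta>"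
    "y = (cos \<alpha> * cos \<tau> - sin \<alpha> * g) * sin \<beta> + cos \<alpha> * (\<kappa> * g) * cos \<beta>"
    "z = sin \<alpha> * (\<kappa> * g) * cos \<beta> + (cos \<alpha> * g + sin \<alpha> * cos \<tau>) * sin \<beta>"
    using W unfolding cos_add sin_add cos_diff sin_diff by algebra+
  note c = this
  have q: "qW \<kappa> \<tau> = (cos \<tau>, g, \<kappa> * g, 0)" by (simp add: qW_def g_def)
  have "qmul (qmul (qX \<alpha>) (qW \<kappa> \<tau>)) (qY \<beta>) = (w, x, y, z)"
    unfolding q qX_def qY_def c by (simp add: mult.commute)
  then show ?thesis unfolding candXWY_def
    by (intro image_eqI[of _ _ "(\<alpha>, \<tau>, \<beta>)"]) (use assms in \<open>auto simp: params_W_def\<close>)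
qed

text \<open>At a critical shift the relation of pattern (I) holds outright and both middle letters
  are complete. In the other two cases there is only an inequality; it says that the outer letters
  are not longer than the relation demands, so the word can be completed to the pattern.\<close>

lemma candidates_cost_YXYX:
  assumes ch: "chamber w x y z" and le: "x * y \<le> w * z" and k: "0 < \<kappa>"
  shows "((w, x, y, z), cost_YXYX \<kappa> w x y z) \<in> candI \<kappa>"
proof -
  \<comment> \<open>If tan a \<le> \<mu> tan b, the full length A is obtained by solving tan A =
    \<mu> tan b. The conclusion avoids tangents to match \<open>params_YXYX\<close>.\<close>
  have rel: "\<exists>A. a \<le> A \<and> A \<le> pi / 2 \<and> sin A * cos b = \<mu> * (cos A * sin b)" if "0 \<le> a" "a < pi / 2" "0 < b" "b < pi / 2" "0 < \<mu>" "sin a * cos b \<le> \<mu> * (cos a * sin b)" for a b \<mu> :: real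
  proof -
    define A where "A = arctan (\<mu> * tan b)"
    have cb: "0 < cos b" "0 < sin b" "0 < cos a" using that by (auto simp: cos_gt_zero_pi sin_gt_zero)
    have cA: "0 < cos A" unfolding A_def by (simp add: cos_arctan add_pos_nonneg)
    have "tan A = \<mu> * tan b" unfolding A_def by (rule tan_arctan)
    then have e: "sin A * cos b = \<mu> * (cos A * sin b)" using cA cb by (simp add: tan_def field_simps)
    have "tan a \<le> \<mu> * tan b" using that(6) cb by (simp add: tan_def field_simps)
    then have "arctan (tan a) \<le> A" unfolding A_def by (simp add: arctan_le_iff)
    moreover have "arctan (tan a) = a" using that by (intro arctan_tan) auto
    ultimately show ?thesis using e arctan_ubound[of "\<mu> * tan b"] by (intro exI[of _ A]) (auto simp: A_def)
  qed
  show ?thesis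
  proof (cases rule: cost_YXYX_cases[OF ch le k, case_names start surface inner])
    case start
    obtain \<theta> \<phi> \<psi> where t: "0 < \<theta>" "\<theta> < pi / 2" "0 \<le> \<phi>" "\<phi> \<le> pi / 2" "0 \<le> \<psi>" "\<psi> \<le> pi / 2"
      and c: "w = cos \<theta> * cos \<phi>" "x = cos \<theta> * sin \<phi>" "y = sin \<theta> * cos \<psi>" "z = sin \<theta> * sin \<psi>"
      using chamber_polar[OF ch] by metis
    have p: "0 < sin \<theta>" "0 < cos \<theta>" using t by (auto simp: sin_gt_zero cos_gt_zero_pi)
    define a where "a = (\<psi> + \<phi>) / 2"
    define \<alpha> where "\<alpha> = (\<psi> - \<phi>) / 2"
    have ab: "a - \<alpha> = \<phi>" "a + \<alpha> = \<psi>" by (simp_all add: a_def \<alpha>_def field_simps)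
    have z: "0 < z" using chamber_z_pos[OF ch le] .
    have ps: "0 < \<psi>" using z t(5) unfolding c by (cases "\<psi> = 0") auto
    have "sin \<theta> * cos \<theta> * sin (\<phi> - \<psi>) \<le> 0" using le unfolding c sin_diff by (simp add: algebra_simps)
    then have "sin (\<phi> - \<psi>) \<le> 0" using p by (simp add: mult_le_0_iff)
    then have fp: "\<phi> \<le> \<psi>" using sin_gt_zero[of "\<phi> - \<psi>"] t by force
    have "0 < w + y" using ch by (simp add: chamber_def)
    then have "cos \<phi> \<noteq> 0 \<or> cos \<psi> \<noteq> 0" unfolding c by auto
    then have "\<phi> \<noteq> pi / 2 \<or> \<psi> \<noteq> pi / 2" using cos_pi_half by metis
    then have a2: "0 \<le> a" "a < pi / 2" using t by (auto simp: a_def)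
    have "0 \<le> 2 * cos a * (\<kappa> * cos a * sin \<theta> - cos \<theta> * sin a) / sin \<theta>"
      using start(2) unfolding c by (subst (asm) shift_slope_polar_half[OF t(1,2), of _ _ a]) (auto simp: a_def)
    moreover have "0 < cos a" using a2 by (intro cos_gt_zero_pi) auto
    ultimately have "0 \<le> \<kappa> * cos a * sin \<theta> - cos \<theta> * sin a" using p by (simp add: zero_le_divide_iff zero_le_mult_iff)
    then have "sin a * cos \<theta> \<le> \<kappa> * (cos a * sin \<theta>)" by (simp add: algebra_simps)
    then obtain A where A: "a \<le> A" "A \<le> pi / 2" "sin A * cos \<theta> = \<kappa> * (cos A * sin \<theta>)"
      using rel[OF a2 t(1,2) k] by blast
    have "qmul (qmul (qmul (qY (- 0)) (qX a)) (qY \<theta>)) (qX (- \<alpha>)) = (cos \<theta> * cos (a - \<alpha>), cos \<theta> * sin (a - \<alpha>), sin \<theta> * cos (a + \<alpha>), sin \<theta> * sin (a + \<alpha>))"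
      unfolding qX_def qY_def cos_add sin_add cos_diff sin_diff by (simp add: algebra_simps)
    then have q: "qmul (qmul (qmul (qY (- 0)) (qX a)) (qY \<theta>)) (qX (- \<alpha>)) = (w, x, y, z)" unfolding ab c .
    have e: "cost_YXYX \<kappa> w x y z = 2 * \<psi> + 2 * \<kappa> * \<theta>"
      unfolding start(1) unfolding c by (rule euler_cost_polar[OF t(1,2) ps t(6)])
    show ?thesis unfolding candI_def
    proof (rule image_eqI[of _ _ "(0, a, \<theta>, \<alpha>, A, \<theta>)"])
      show "(0, a, \<theta>, \<alpha>, A, \<theta>) \<in> params_YXYX \<kappa>" using a2 A t fp by (auto simp: params_YXYX_def \<alpha>_def a_def)
    qed (use q e ab in auto)
  next
    case surface
    obtain \<theta> \<phi> \<psi> where t: "0 < \<theta>" "\<theta> < pi / 2" "0 \<le> \<phi>" "\<phi> \<le> pi / 2" "0 \<le> \<psi>" "\<psi> \<le> pi / 2"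
      and c: "w = cos \<theta> * cos \<phi>" "y = cos \<theta> * sin \<phi>" "x = sin \<theta> * cos \<psi>" "z = sin \<theta> * sin \<psi>"
      using chamber_polar[OF chamber_swap[OF ch]] by metis
    have p: "0 < sin \<theta>" "0 < cos \<theta>" using t by (auto simp: sin_gt_zero cos_gt_zero_pi)
    define b where "b = (\<psi> + \<phi>) / 2"
    define \<beta> where "\<beta> = (\<psi> - \<phi>) / 2"
    have ab: "b - \<beta> = \<phi>" "b + \<beta> = \<psi>" by (simp_all add: b_def \<beta>_def field_simps)
    have z: "0 < z" using chamber_z_pos[OF ch le] .
    have ps: "0 < \<psi>" using z t(5) unfolding c by (cases "\<psi> = 0") auto
    have "sin \<theta> * cos \<theta> * sin (\<phi> - \<psi>) \<le> 0" using le unfolding c sin_diff by (simp add: algebra_simps)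
    then have "sin (\<phi> - \<psi>) \<le> 0" using p by (simp add: mult_le_0_iff)
    then have fp: "\<phi> \<le> \<psi>" using sin_gt_zero[of "\<phi> - \<psi>"] t by force
    have "0 < w + x" using ch by (simp add: chamber_def)
    then have "cos \<phi> \<noteq> 0 \<or> cos \<psi> \<noteq> 0" unfolding c by auto
    then have "\<phi> \<noteq> pi / 2 \<or> \<psi> \<noteq> pi / 2" using cos_pi_half by metis
    then have b2: "0 \<le> b" "b < pi / 2" using t by (auto simp: b_def)
    have "0 \<le> 2 * cos b * ((1 / \<kappa>) * cos b * sin \<theta> - cos \<theta> * sin b) / sin \<theta>"
      using surface(2) unfolding c by (subst (asm) shift_slope_polar_half[OF t(1,2), of _ _ b]) (auto simp: b_def)
    moreover have "0 < cos b" using b2 by (intro cos_gt_zero_pi) auto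
    ultimately have "0 \<le> (1 / \<kappa>) * cos b * sin \<theta> - cos \<theta> * sin b" using p by (simp add: zero_le_divide_iff zero_le_mult_iff)
    then have "sin b * cos \<theta> \<le> (1 / \<kappa>) * (cos b * sin \<theta>)" by (simp add: algebra_simps)
    then obtain B where B: "b \<le> B" "B \<le> pi / 2" "sin B * cos \<theta> = (1 / \<kappa>) * (cos B * sin \<theta>)"
      using rel[OF b2 t(1,2), of "1 / \<kappa>"] k by auto
    have B': "sin \<theta> * cos B = \<kappa> * (cos \<theta> * sin B)" using B(3) k by (simp add: field_simps)
    have "qmul (qmul (qmul (qY (- \<beta>)) (qX \<theta>)) (qY b)) (qX (- 0)) = (cos \<theta> * cos (b - \<beta>), sin \<theta> * cos (b + \<beta>), cos \<theta> * sin (b - \<beta>), sin \<theta> * sin (b + \<beta>))"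
      unfolding qX_def qY_def cos_add sin_add cos_diff sin_diff by (simp add: algebra_simps)
    then have q: "qmul (qmul (qmul (qY (- \<beta>)) (qX \<theta>)) (qY b)) (qX (- 0)) = (w, x, y, z)" unfolding ab c .
    have "euler_cost (1 / \<kappa>) w y x z = 2 * \<psi> + 2 * (1 / \<kappa>) * \<theta>"
      unfolding c by (rule euler_cost_polar[OF t(1,2) ps t(6)])
    then have e: "cost_YXYX \<kappa> w x y z = 2 * \<kappa> * \<psi> + 2 * \<theta>" unfolding surface(1) using k by (simp add: algebra_simps)
    show ?thesis unfolding candI_def
    proof (rule image_eqI[of _ _ "(\<beta>, \<theta>, b, 0, \<theta>, B)"])
      show "(\<beta>, \<theta>, b, 0, \<theta>, B) \<in> params_YXYX \<kappa>" using b2 B B' t fp by (auto simp: params_YXYX_def \<beta>_def b_def)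
      show "((w, x, y, z), cost_YXYX \<kappa> w x y z) = (case (\<beta>, \<theta>, b, 0, \<theta>, B) of (\<beta>, a, b, \<alpha>, A, B) \<Rightarrow> (qmul (qmul (qmul (qY (- \<beta>)) (qX a)) (qY b)) (qX (- \<alpha>)), 2 * \<kappa> * \<beta> + 2 * a + 2 * \<kappa> * b + 2 * \<alpha>))"
        using q by (simp add: e flip: ab(2)) (simp add: algebra_simps)
    qed
  next
    case (inner \<beta>)
    note fp = shift_range_pos[OF ch inner(2,1)]
    let ?w = "sw w x y z \<beta>" let ?x = "sx w x y z \<beta>" let ?y = "sy w x y z \<beta>" let ?z = "sz w x y z \<beta>"
    have u: "w\<^sup>2 + x\<^sup>2 + y\<^sup>2 + z\<^sup>2 = 1" "0 \<le> y" using ch by (auto simp: chamber_def)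
    have "chamber ?w ?x ?y ?z" using fp shift_unit[of w x y z \<beta>] u by (auto simp: chamber_def)
    then obtain \<theta> \<phi> \<psi> where t: "0 < \<theta>" "\<theta> < pi / 2" "0 \<le> \<phi>" "\<phi> \<le> pi / 2" "0 \<le> \<psi>" "\<psi> \<le> pi / 2"
      and c: "?w = cos \<theta> * cos \<phi>" "?x = cos \<theta> * sin \<phi>" "?y = sin \<theta> * cos \<psi>" "?z = sin \<theta> * sin \<psi>"
      using chamber_polar by metis
    have p: "0 < sin \<theta>" "0 < cos \<theta>" using t by (auto simp: sin_gt_zero cos_gt_zero_pi)
    define a where "a = (\<psi> + \<phi>) / 2"
    define \<alpha> where "\<alpha> = (\<psi> - \<phi>) / 2"
    have ab: "a - \<alpha> = \<phi>" "a + \<alpha> = \<psi>" by (simp_all add: a_def \<alpha>_def field_simps)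
    have ps: "0 < \<psi>" using fp(5) t(5) unfolding c by (cases "\<psi> = 0") auto
    have "cos \<phi> \<noteq> 0" using fp(2) unfolding c by auto
    then have "\<phi> \<noteq> pi / 2" using cos_pi_half by metis
    then have a2: "0 \<le> a" "a < pi / 2" using t by (auto simp: a_def)
    have "sin \<theta> * cos \<theta> * sin (\<phi> - \<psi>) \<le> 0" using inner(5) unfolding c sin_diff by (simp add: algebra_simps)
    then have "sin (\<phi> - \<psi>) \<le> 0" using p by (simp add: mult_le_0_iff)
    then have pp: "\<phi> \<le> \<psi>" using sin_gt_zero[of "\<phi> - \<psi>"] t by force
    have "2 * cos a * (\<kappa> * cos a * sin \<theta> - cos \<theta> * sin a) / sin \<theta> = 0"
      using inner(4) unfolding c by (subst (asm) shift_slope_polar_half[OF t(1,2), of _ _ a]) (auto simp: a_def)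
    moreover have "0 < cos a" using a2 by (intro cos_gt_zero_pi) auto
    ultimately have r: "sin a * cos \<theta> = \<kappa> * (cos a * sin \<theta>)" using p by (simp add: algebra_simps)
    have cs: "(cos \<beta>)\<^sup>2 + (sin \<beta>)\<^sup>2 = 1" by simp
    \<comment> \<open>The first Y-letter must not exceed the full length \<theta> of the second; the
      inequality is the one that also governs the derivative bound.\<close>
    have "sin \<beta> * cos \<theta> \<le> cos \<beta> * sin \<theta>"
    proof (rule shift_angle_le[where hx = "?x" and hy = "?y", OF fp(2) _ _ fp(5)])
      have "?y * cos \<beta> - ?w * sin \<beta> = y * ((cos \<beta>)\<^sup>2 + (sin \<beta>)\<^sup>2)" unfolding shift_defs by algebra
      then show "0 \<le> ?y * cos \<beta> - ?w * sin \<beta>" using u(2) by (simp add: cs)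
      show "(cos \<theta>)\<^sup>2 = ?w\<^sup>2 + ?x\<^sup>2" "(sin \<theta>)\<^sup>2 = ?y\<^sup>2 + ?z\<^sup>2" unfolding c by (simp_all add: power_mult_distrib flip: distrib_left)
      show "0 \<le> cos \<beta>" using inner(1) fp(1) by (intro cos_ge_zero) auto
    qed (use fp p inner(5) in auto)
    then have "sin (\<beta> - \<theta>) \<le> 0" by (simp add: sin_diff mult.commute)
    then have bt: "\<beta> \<le> \<theta>" using sin_gt_zero[of "\<beta> - \<theta>"] t fp(1) by force
    have "qmul (qmul (qX a) (qY \<theta>)) (qX (- \<alpha>)) = (cos \<theta> * cos (a - \<alpha>), cos \<theta> * sin (a - \<alpha>), sin \<theta> * cos (a + \<alpha>), sin \<theta> * sin (a + \<alpha>))"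
      unfolding qX_def qY_def cos_add sin_add cos_diff sin_diff by (simp add: algebra_simps)
    then have "qmul (qmul (qX a) (qY \<theta>)) (qX (- \<alpha>)) = (?w, ?x, ?y, ?z)" unfolding ab c .
    then have "qmul (qmul (qmul (qY (- \<beta>)) (qX a)) (qY \<theta>)) (qX (- \<alpha>)) = qmul (qY (- \<beta>)) (?w, ?x, ?y, ?z)"
      by (simp add: qmul_assoc)
    also have "\<dots> = (w * ((cos \<beta>)\<^sup>2 + (sin \<beta>)\<^sup>2), x * ((cos \<beta>)\<^sup>2 + (sin \<beta>)\<^sup>2), y * ((cos \<beta>)\<^sup>2 + (sin \<beta>)\<^sup>2), z * ((cos \<beta>)\<^sup>2 + (sin \<beta>)\<^sup>2))"
      unfolding qY_def shift_defs qmul.simps prod.inject cos_minus sin_minus by (intro conjI; algebra)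
    also have "\<dots> = (w, x, y, z)" by (simp only: cs mult_1_right)
    finally have q: "qmul (qmul (qmul (qY (- \<beta>)) (qX a)) (qY \<theta>)) (qX (- \<alpha>)) = (w, x, y, z)" .
    have e: "cost_YXYX \<kappa> w x y z = 2 * \<kappa> * \<beta> + (2 * \<psi> + 2 * \<kappa> * \<theta>)"
      unfolding inner(3) shift_cost_def unfolding c using euler_cost_polar[OF t(1,2) ps t(6)] by simp
    show ?thesis unfolding candI_def
    proof (rule image_eqI[of _ _ "(\<beta>, a, \<theta>, \<alpha>, a, \<theta>)"])
      show "(\<beta>, a, \<theta>, \<alpha>, a, \<theta>) \<in> params_YXYX \<kappa>" using a2 r t pp bt inner(1) by (auto simp: params_YXYX_def \<alpha>_def a_def)
    qed (use q e ab in auto)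
  qed
qed

lemma candidates_V:
  assumes ch: "chamber w x y z" and k: "0 < \<kappa>" "\<kappa> \<le> 1"
  shows "((w, x, y, z), value_fun \<kappa> w x y z) \<in> candidates \<kappa>"
proof -
  consider "x * y \<le> w * z" | "0 \<le> x * y - w * z" "y\<^sup>2 + z\<^sup>2 \<le> \<kappa> * (x * y - w * z)"
    | "0 \<le> x * y - w * z" "\<kappa> * (x\<^sup>2 + z\<^sup>2) \<le> x * y - w * z"
    | "0 \<le> x * y - w * z" "\<kappa> * (x * y - w * z) \<le> y\<^sup>2 + z\<^sup>2" "x * y - w * z \<le> \<kappa> * (x\<^sup>2 + z\<^sup>2)" by linarith
  then show ?thesis
  proof cases
    case 1
    then show ?thesis using candidates_cost_YXYX[OF ch 1 k(1)] value_fun_regions(1)[OF ch k 1] by (simp add: candidates_def)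
  next
    case 2
    obtain \<alpha> \<tau> \<beta> where "is_XWX \<kappa> \<alpha> \<tau> \<beta> w x y z" "0 \<le> \<alpha>" "\<alpha> \<le> pi / 2" "0 \<le> \<tau>" "\<tau> < pi / 2" "0 \<le> \<beta>" "\<beta> \<le> pi / 2"
      "cost_XWX \<kappa> w x y z = 2 * \<alpha> + 2 * \<beta> + 2 * sqrt (1 + \<kappa>\<^sup>2) * \<tau>" using cost_XWX_word[OF ch 2(2) k(1)] by metis
    then show ?thesis using candidates_XWX value_fun_regions(2)[OF ch k 2] by (simp add: candidates_def)
  next
    case 3
    have "x\<^sup>2 + z\<^sup>2 \<le> (1 / \<kappa>) * (y * x - w * z)" "0 < 1 / \<kappa>" using 3 k by (auto simp: swap_region)
    from cost_XWX_word[OF chamber_swap[OF ch] this]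
    obtain \<alpha> \<tau> \<beta> where "is_XWX (1 / \<kappa>) \<alpha> \<tau> \<beta> w y x z" "0 \<le> \<alpha>" "\<alpha> \<le> pi / 2" "0 \<le> \<tau>" "\<tau> < pi / 2" "0 \<le> \<beta>" "\<beta> \<le> pi / 2"
      "cost_XWX (1 / \<kappa>) w y x z = 2 * \<alpha> + 2 * \<beta> + 2 * sqrt (1 + (1 / \<kappa>)\<^sup>2) * \<tau>" by metis
    then show ?thesis using candidates_YWY[OF _ _ _ _ _ _ _ k(1)] value_fun_regions(3)[OF ch k 3] by (simp add: candidates_def)
  next
    case 4
    obtain \<alpha> \<tau> \<beta> where W: "is_XWY \<kappa> \<alpha> \<tau> \<beta> w x y z" "0 \<le> \<alpha>" "\<alpha> \<le> pi / 2" "0 \<le> \<tau>" "\<tau> < pi / 2" "0 \<le> \<beta>" "\<beta> \<le> pi / 2"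
      using cost_XWY_word[OF ch k(1) 4(1) cost_XWY_region_strict[OF ch k 4(3)] 4(2,3)] by metis
    have "cost_XWY \<kappa> w x y z = 2 * \<alpha> + 2 * \<kappa> * \<beta> + 2 * sqrt (1 + \<kappa>\<^sup>2) * \<tau>"
      by (rule cost_XWY_of_XWY[OF W(1) _ _ k(1) W(2-7)]) (use ch in \<open>auto simp: chamber_def\<close>)
    then show ?thesis using candidates_XWY[OF W] value_fun_regions(4)[OF ch k 4] by (simp add: candidates_def)
  qed
qed

section \<open>The lower bound\<close>

text \<open>The nondegeneracy part of \<open>chamber\<close> in a form invariant under signs and
  scaling, so that it makes sense in all of R^4.\<close>

fun offedge :: "quat \<Rightarrow> bool" where
  "offedge (w, x, y, z) \<longleftrightarrow> (w \<noteq> 0 \<or> x \<noteq> 0) \<and> (w \<noteq> 0 \<or> y \<noteq> 0) \<and> (w \<noteq> 0 \<or> z \<noteq> 0) \<and> (x \<noteq> 0 \<or> y \<noteq> 0) \<and> (x \<noteq> 0 \<or> z \<noteq> 0) \<and> (y \<noteq> 0 \<or> z \<noteq> 0)"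

fun qnorm2 :: "quat \<Rightarrow> real" where "qnorm2 (w, x, y, z) = w\<^sup>2 + x\<^sup>2 + y\<^sup>2 + z\<^sup>2"

fun qabs :: "quat \<Rightarrow> quat" where "qabs (w, x, y, z) = (\<bar>w\<bar>, \<bar>x\<bar>, \<bar>y\<bar>, \<bar>z\<bar>)"

fun qvalue :: "real \<Rightarrow> quat \<Rightarrow> real" where "qvalue \<kappa> (w, x, y, z) = value_fun \<kappa> (abs w) (abs x) (abs y) (abs z)"

lemma qnorm2_qmul: "qnorm2 (qmul p q) = qnorm2 p * qnorm2 q"
  by (cases p; cases q) (simp add: power2_eq_square algebra_simps)

lemma chamber_qabs: "offedge (w, x, y, z) \<Longrightarrow> qnorm2 (w, x, y, z) = 1 \<Longrightarrow> chamber (abs w) (abs x) (abs y) (abs z)"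
proof -
  assume "offedge (w, x, y, z)" "qnorm2 (w, x, y, z) = 1"
  moreover have "0 < abs u + abs v \<longleftrightarrow> u \<noteq> 0 \<or> v \<noteq> 0" for u v :: real by auto
  ultimately show ?thesis by (simp add: chamber_def)
qed

text \<open>The lift exp (t (a X + b Y) / 2) of a letter to the quaternions.\<close>

definition qletter :: "real \<Rightarrow> real \<Rightarrow> real \<Rightarrow> quat" where
  "qletter a b t = (let n = sqrt (a\<^sup>2 + b\<^sup>2) in (cos (t * n / 2), sin (t * n / 2) / n * a, sin (t * n / 2) / n * b, 0))"

lemma qnorm2_qletter: "a \<noteq> 0 \<or> b \<noteq> 0 \<Longrightarrow> qnorm2 (qletter a b t) = 1"
proof -
  assume ab: "a \<noteq> 0 \<or> b \<noteq> 0"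
  define n where "n = sqrt (a\<^sup>2 + b\<^sup>2)"
  have n: "0 < n" "n\<^sup>2 = a\<^sup>2 + b\<^sup>2" using ab by (auto simp: n_def sum_power2_gt_zero_iff)
  have "(sin (t * n / 2) / n * a)\<^sup>2 + (sin (t * n / 2) / n * b)\<^sup>2 = (sin (t * n / 2))\<^sup>2 * (a\<^sup>2 + b\<^sup>2) / n\<^sup>2"
    by (simp add: power_mult_distrib power_divide algebra_simps add_divide_distrib)
  also have "\<dots> = (sin (t * n / 2))\<^sup>2" unfolding n(2)[symmetric] using n(1) by simp
  finally have "(sin (t * n / 2) / n * a)\<^sup>2 + (sin (t * n / 2) / n * b)\<^sup>2 = (sin (t * n / 2))\<^sup>2" .
  moreover have "C + P + Q + 0\<^sup>2 = 1" if "P + Q = R" "R + C = 1" for C P Q R :: real using that by simp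
  ultimately show ?thesis unfolding qletter_def Let_def n_def[symmetric] qnorm2.simps using sin_cos_squared_add[of "t * n / 2"] by blast
qed

lemma letter_V:
  assumes k: "0 < \<kappa>" "\<kappa> \<le> 1" and ab: "a \<noteq> 0 \<or> b \<noteq> 0" and T: "0 \<le> T"
    and off: "\<And>s. offedge (qmul q (qletter a b s))" and u: "qnorm2 q = 1"
  shows "qvalue \<kappa> (qmul q (qletter a b T)) \<le> qvalue \<kappa> q + T * (\<bar>a\<bar> + \<kappa> * \<bar>b\<bar>)"
proof -
  obtain w x y z where q: "q = (w, x, y, z)" by (cases q) auto
  define n where "n = sqrt (a\<^sup>2 + b\<^sup>2)"
  have n: "0 < n" "n\<^sup>2 = a\<^sup>2 + b\<^sup>2" using ab by (auto simp: n_def sum_power2_gt_zero_iff)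
  define c where "c = (\<lambda>t. cos (t * n / 2))"
  define s where "s = (\<lambda>t. sin (t * n / 2) / n)"
  have dc: "(c has_real_derivative - (n\<^sup>2 * s t / 2)) (at t)" for t
    unfolding c_def s_def by (auto intro!: derivative_eq_intros simp: power2_eq_square)
  have ds: "(s has_real_derivative c t / 2) (at t)" for t
    unfolding c_def s_def using n(1) by (auto intro!: derivative_eq_intros)
  define cw where "cw = (\<lambda>t. w * c t - (a * x + b * y) * s t)"
  define cx where "cx = (\<lambda>t. x * c t + (a * w - b * z) * s t)"
  define cy where "cy = (\<lambda>t. y * c t + (a * z + b * w) * s t)"
  define cz where "cz = (\<lambda>t. z * c t + (b * x - a * y) * s t)"
  have path: "qmul q (qletter a b t) = (cw t, cx t, cy t, cz t)" for t
    unfolding q qletter_def Let_def n_def[symmetric] cw_def cx_def cy_def cz_def c_def s_def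
    by (simp add: algebra_simps add_divide_distrib diff_divide_distrib)
  have d: "(cw has_real_derivative w * (- (n\<^sup>2 * s t / 2)) - (a * x + b * y) * (c t / 2)) (at t)"
    "(cx has_real_derivative x * (- (n\<^sup>2 * s t / 2)) + (a * w - b * z) * (c t / 2)) (at t)"
    "(cy has_real_derivative y * (- (n\<^sup>2 * s t / 2)) + (a * z + b * w) * (c t / 2)) (at t)"
    "(cz has_real_derivative z * (- (n\<^sup>2 * s t / 2)) + (b * x - a * y) * (c t / 2)) (at t)" for t
    unfolding cw_def cx_def cy_def cz_def by (intro DERIV_add DERIV_diff DERIV_cmult dc ds)+
  have "value_fun \<kappa> (abs (cw T)) (abs (cx T)) (abs (cy T)) (abs (cz T)) \<le> value_fun \<kappa> (abs (cw 0)) (abs (cx 0)) (abs (cy 0)) (abs (cz 0)) + (\<bar>a\<bar> + \<kappa> * \<bar>b\<bar>) * T"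
  proof (rule value_fun_curve[OF k T])
    fix t
    show "(cw has_real_derivative (- a * cx t - b * cy t) / 2) (at t)"
      by (rule DERIV_cong[OF d(1)]) (unfold n(2) cx_def cy_def, simp add: field_simps power2_eq_square)
    show "(cx has_real_derivative (a * cw t - b * cz t) / 2) (at t)"
      by (rule DERIV_cong[OF d(2)]) (unfold n(2) cw_def cz_def, simp add: field_simps power2_eq_square)
    show "(cy has_real_derivative (a * cz t + b * cw t) / 2) (at t)"
      by (rule DERIV_cong[OF d(3)]) (unfold n(2) cw_def cz_def, simp add: field_simps power2_eq_square)
    show "(cz has_real_derivative (b * cx t - a * cy t) / 2) (at t)"
      by (rule DERIV_cong[OF d(4)]) (unfold n(2) cx_def cy_def, simp add: field_simps power2_eq_square)
    have "qnorm2 (qmul q (qletter a b t)) = 1" using u qnorm2_qletter[OF ab] by (simp add: qnorm2_qmul)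
    then show "chamber (abs (cw t)) (abs (cx t)) (abs (cy t)) (abs (cz t))"
      using chamber_qabs off[of t] unfolding path by blast
  qed
  moreover have "cw 0 = w" "cx 0 = x" "cy 0 = y" "cz 0 = z" by (simp_all add: cw_def cx_def cy_def cz_def c_def s_def)
  ultimately show ?thesis unfolding path unfolding q by (simp add: mult.commute)
qed

definition qprod :: "(real \<times> real \<times> real) list \<Rightarrow> quat" where
  "qprod ls = foldr (\<lambda>(t, a, b) acc. qmul (qletter a b t) acc) ls (1, 0, 0, 0)"

definition lcost :: "real \<Rightarrow> (real \<times> real \<times> real) list \<Rightarrow> real" where
  "lcost \<kappa> ls = sum_list (map (\<lambda>(t, a, b). t * (\<bar>a\<bar> + \<kappa> * \<bar>b\<bar>)) ls)"

definition letters_ok :: "(real \<times> real \<times> real) list \<Rightarrow> bool" where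
  "letters_ok ls \<longleftrightarrow> (\<forall>(t, a, b) \<in> set ls. 0 \<le> t \<and> (a \<noteq> 0 \<or> b \<noteq> 0))"

text \<open>The full orbit of each letter has to avoid the edges, so that the starts excluded by a
  letter are covered by smooth images of R^3.\<close>

fun path_ok :: "quat \<Rightarrow> (real \<times> real \<times> real) list \<Rightarrow> bool" where
  "path_ok q [] = offedge q"
| "path_ok q ((t, a, b) # ls) = ((\<forall>s. offedge (qmul q (qletter a b s))) \<and> path_ok (qmul q (qletter a b t)) ls)"

lemma path_V:
  assumes k: "0 < \<kappa>" "\<kappa> \<le> 1"
  shows "letters_ok ls \<Longrightarrow> path_ok q ls \<Longrightarrow> qnorm2 q = 1 \<Longrightarrow>
    qvalue \<kappa> (qmul q (qprod ls)) \<le> qvalue \<kappa> q + lcost \<kappa> ls \<and> offedge (qmul q (qprod ls)) \<and> qnorm2 (qmul q (qprod ls)) = 1"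
proof (induction ls arbitrary: q)
  case Nil
  then show ?case by (simp add: qprod_def lcost_def)
next
  case (Cons l ls)
  obtain t a b where l: "l = (t, a, b)" by (cases l) auto
  have ok: "0 \<le> t" "a \<noteq> 0 \<or> b \<noteq> 0" "letters_ok ls" using Cons.prems(1) by (auto simp: letters_ok_def l)
  let ?q = "qmul q (qletter a b t)"
  have p: "\<And>s. offedge (qmul q (qletter a b s))" "path_ok ?q ls" using Cons.prems(2) by (auto simp: l)
  have u: "qnorm2 ?q = 1" using Cons.prems(3) qnorm2_qletter[OF ok(2)] by (simp add: qnorm2_qmul)
  have e: "qmul q (qprod (l # ls)) = qmul ?q (qprod ls)" by (simp add: qprod_def l qmul_assoc)
  have c: "lcost \<kappa> (l # ls) = t * (\<bar>a\<bar> + \<kappa> * \<bar>b\<bar>) + lcost \<kappa> ls" by (simp add: lcost_def l)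
  show ?case unfolding e c using Cons.IH[OF ok(3) p(2) u] letter_V[OF k ok(2,1) p(1) Cons.prems(3)] by linarith
qed

section \<open>Bad starting points are negligible\<close>

lemma qmul_scaleR: "qmul (c *\<^sub>R q) p = c *\<^sub>R qmul q p"
  by (cases q; cases p) (simp add: algebra_simps)

lemma qmul_add: "qmul (q + r) p = qmul q p + qmul r p"
  by (cases q; cases r; cases p) (simp add: algebra_simps)

lemma offedge_scaleR: "c \<noteq> 0 \<Longrightarrow> offedge (c *\<^sub>R q) \<longleftrightarrow> offedge q"
  by (cases q) simp

text \<open>By homogeneity bad starts can be measured in R^4 instead of the sphere, and a good start
  can be normalised afterwards.\<close>

lemma path_ok_scaleR: "c \<noteq> 0 \<Longrightarrow> path_ok (c *\<^sub>R q) ls \<longleftrightarrow> path_ok q ls"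
proof (induction ls arbitrary: q)
  case Nil from offedge_scaleR[OF Nil] show ?case by (simp only: path_ok.simps)
next
  case (Cons l ls)
  obtain t a b where l: "l = (t, a, b)" by (cases l) auto
  show ?case unfolding l path_ok.simps qmul_scaleR Cons.IH[OF Cons.prems] offedge_scaleR[OF Cons.prems] ..
qed

lemma linear_qmul: "linear (\<lambda>q. qmul q p)"
  by (rule linearI) (auto simp: qmul_add qmul_scaleR)

lemma qletter_inverse: assumes "a \<noteq> 0 \<or> b \<noteq> 0" shows "qmul (qmul q (qletter a b t)) (qletter a b (- t)) = q"
proof -
  define n where "n = sqrt (a\<^sup>2 + b\<^sup>2)"
  have u: "qnorm2 (qletter a b t) = 1" by (rule qnorm2_qletter[OF assms])
  have "qmul (qletter a b t) (qletter a b (- t)) = (qnorm2 (qletter a b t), 0, 0, 0)"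
    unfolding qletter_def Let_def n_def[symmetric] by (simp add: power2_eq_square)
  then show ?thesis by (simp add: qmul_assoc u)
qed

text \<open>Two coefficients in the plane and one time make three parameters: the set lies in the
  image of R^3 under a differentiable map into R^4.\<close>

lemma negligible_edge_orbit:
  fixes e1 e2 :: quat
  assumes "a \<noteq> 0 \<or> b \<noteq> 0"
  shows "negligible {q. \<exists>s p1 p2. qmul q (qletter a b s) = p1 *\<^sub>R e1 + p2 *\<^sub>R e2}"
proof -
  define n where "n = sqrt (a\<^sup>2 + b\<^sup>2)"
  define f where "f = (\<lambda>(p1, p2, s). (p1 * cos (s * n / 2)) *\<^sub>R e1 - (p1 * (sin (s * n / 2) / n)) *\<^sub>R qmul e1 (0, a, b, 0)
     + ((p2 * cos (s * n / 2)) *\<^sub>R e2 - (p2 * (sin (s * n / 2) / n)) *\<^sub>R qmul e2 (0, a, b, 0)) :: quat)"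
  have nz: "n \<noteq> 0" using assms by (auto simp: n_def)
  have q: "qmul e (qletter a b (- s)) = cos (s * n / 2) *\<^sub>R e - (sin (s * n / 2) / n) *\<^sub>R qmul e (0, a, b, 0)" for e s
    by (cases e) (simp add: qletter_def Let_def n_def[symmetric] algebra_simps add_divide_distrib diff_divide_distrib)
  have "f differentiable_on UNIV"
    unfolding f_def case_prod_beta differentiable_on_def differentiable_def
    by (intro ballI exI) (rule derivative_intros nz | simp)+
  then have "negligible (f ` UNIV)" by (rule negligible_differentiable_image_lowdim[rotated]) simp
  moreover have "{q. \<exists>s p1 p2. qmul q (qletter a b s) = p1 *\<^sub>R e1 + p2 *\<^sub>R e2} \<subseteq> f ` UNIV"
  proof clarify
    fix w x y z s p1 p2 assume "qmul (w, x, y, z) (qletter a b s) = p1 *\<^sub>R e1 + p2 *\<^sub>R e2"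
    then have "(w, x, y, z) = qmul (p1 *\<^sub>R e1 + p2 *\<^sub>R e2) (qletter a b (- s))" using qletter_inverse[OF assms, of "(w, x, y, z)" s] by simp
    also have "\<dots> = f (p1, p2, s)" unfolding f_def by (simp add: qmul_add qmul_scaleR q algebra_simps)
    finally show "(w, x, y, z) \<in> f ` UNIV" by simp
  qed
  ultimately show ?thesis by (rule negligible_subset)
qed

lemma negligible_letter_bad:
  assumes "a \<noteq> 0 \<or> b \<noteq> 0"
  shows "negligible {q. \<exists>s. \<not> offedge (qmul q (qletter a b s))}"
proof -
  let ?N = "\<lambda>e1 e2. {q. \<exists>s p1 p2. qmul q (qletter a b s) = p1 *\<^sub>R e1 + p2 *\<^sub>R e2}"
  have "negligible (?N (0,0,1,0) (0,0,0,1) \<union> ?N (0,1,0,0) (0,0,0,1) \<union> ?N (0,1,0,0) (0,0,1,0) \<union>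
      ?N (1,0,0,0) (0,0,0,1) \<union> ?N (1,0,0,0) (0,0,1,0) \<union> ?N (1,0,0,0) (0,1,0,0))"
    by (intro negligible_Un negligible_edge_orbit assms)
  moreover have "{q. \<exists>s. \<not> offedge (qmul q (qletter a b s))} \<subseteq> ?N (0,0,1,0) (0,0,0,1) \<union> ?N (0,1,0,0) (0,0,0,1) \<union> ?N (0,1,0,0) (0,0,1,0) \<union>
      ?N (1,0,0,0) (0,0,0,1) \<union> ?N (1,0,0,0) (0,0,1,0) \<union> ?N (1,0,0,0) (0,1,0,0)"
  proof
    fix q assume "q \<in> {q. \<exists>s. \<not> offedge (qmul q (qletter a b s))}"
    then obtain s where s: "\<not> offedge (qmul q (qletter a b s))" by blast
    obtain w x y z where p: "qmul q (qletter a b s) = (w, x, y, z)" by (cases "qmul q (qletter a b s)") auto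
    have "(w, x, y, z) = y *\<^sub>R (0,0,1,0) + z *\<^sub>R (0,0,0,1) \<or> (w, x, y, z) = x *\<^sub>R (0,1,0,0) + z *\<^sub>R (0,0,0,1) \<or>
       (w, x, y, z) = x *\<^sub>R (0,1,0,0) + y *\<^sub>R (0,0,1,0) \<or> (w, x, y, z) = w *\<^sub>R (1,0,0,0) + z *\<^sub>R (0,0,0,1) \<or>
       (w, x, y, z) = w *\<^sub>R (1,0,0,0) + y *\<^sub>R (0,0,1,0) \<or> (w, x, y, z) = w *\<^sub>R (1,0,0,0) + x *\<^sub>R (0,1,0,0)"
      using s unfolding p by auto
    then show "q \<in> ?N (0,0,1,0) (0,0,0,1) \<union> ?N (0,1,0,0) (0,0,0,1) \<union> ?N (0,1,0,0) (0,0,1,0) \<union>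
      ?N (1,0,0,0) (0,0,0,1) \<union> ?N (1,0,0,0) (0,0,1,0) \<union> ?N (1,0,0,0) (0,1,0,0)"
      unfolding p[symmetric] by blast
  qed
  ultimately show ?thesis by (rule negligible_subset)
qed

text \<open>A start is bad if the orbit of its first letter meets an edge, or if the point after
  that letter is bad for the remaining word. The starts of the second kind are a linear image of a
  negligible set.\<close>

lemma negligible_path_bad: "letters_ok ls \<Longrightarrow> negligible {q. \<not> path_ok q ls}"
proof (induction ls)
  case Nil
  have "{q. \<not> path_ok q []} \<subseteq> {q. \<exists>s. \<not> offedge (qmul q (qletter 1 0 s))}"
  proof clarify
    fix w x y z assume "\<not> path_ok (w, x, y, z) []"
    then show "\<exists>s. \<not> offedge (qmul (w, x, y, z) (qletter 1 0 s))" by (intro exI[of _ 0]) (auto simp: qletter_def)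
  qed
  then show ?case using negligible_letter_bad[of 1 0] negligible_subset by auto
next
  case (Cons l ls)
  obtain t a b where l: "l = (t, a, b)" by (cases l) auto
  have ab: "a \<noteq> 0 \<or> b \<noteq> 0" and ok: "letters_ok ls" using Cons.prems by (auto simp: letters_ok_def l)
  have "negligible ((\<lambda>q. qmul q (qletter a b (- t))) ` {q. \<not> path_ok q ls})"
    by (rule negligible_differentiable_image_negligible[OF order_refl Cons.IH[OF ok] linear_imp_differentiable_on[OF linear_qmul]])
  then have "negligible ({q. \<exists>s. \<not> offedge (qmul q (qletter a b s))} \<union> (\<lambda>q. qmul q (qletter a b (- t))) ` {q. \<not> path_ok q ls})"
    by (intro negligible_Un negligible_letter_bad ab)
  moreover have "{q. \<not> path_ok q (l # ls)} \<subseteq> {q. \<exists>s. \<not> offedge (qmul q (qletter a b s))} \<union> (\<lambda>q. qmul q (qletter a b (- t))) ` {q. \<not> path_ok q ls}"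
  proof
    fix q assume "q \<in> {q. \<not> path_ok q (l # ls)}"
    then have "(\<exists>s. \<not> offedge (qmul q (qletter a b s))) \<or> \<not> path_ok (qmul q (qletter a b t)) ls" by (auto simp: l)
    moreover have "q = qmul (qmul q (qletter a b t)) (qletter a b (- t))" using qletter_inverse[OF ab] by simp
    ultimately show "q \<in> {q. \<exists>s. \<not> offedge (qmul q (qletter a b s))} \<union> (\<lambda>q. qmul q (qletter a b (- t))) ` {q. \<not> path_ok q ls}"
      by blast
  qed
  ultimately show ?case by (rule negligible_subset)
qed

text \<open>The cone \<open>x y < w z\<close>, \<open>z < \<delta> y\<close> is chosen because \<open>euler_cost\<close> bounds the value there and is small; being open and nonempty,
  it contains a starting point whose path avoids the edges.\<close>

lemma start_points:
  assumes ok: "letters_ok ls" and d: "0 < \<delta>" "\<delta> < 1 / 2" and k: "0 < \<kappa>" "\<kappa> \<le> 1"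
  obtains q where "path_ok q ls" "qnorm2 q = 1" "qvalue \<kappa> q \<le> 8 * \<delta>" "norm (q - (1, 0, 0, 0)) \<le> 20 * \<delta>"
proof -
  define U where "U = {q::quat. case q of (w, x, y, z) \<Rightarrow> 1 - \<delta> < w \<and> w < 1 + \<delta> \<and> 0 < x \<and> x < \<delta> \<and> 0 < y \<and> y < \<delta> \<and> x * y < w * z \<and> z < \<delta> * y}"
  have "open U" unfolding U_def case_prod_beta by (intro open_Collect_conj open_Collect_less continuous_intros)
  \<comment> \<open>At this point x y = \<delta>^2 / 8 is below w z = \<delta>^2 / 4, and z is below
    \<delta> y = \<delta>^2 / 2.\<close>
  moreover have "(1, \<delta> / 4, \<delta> / 2, \<delta>\<^sup>2 / 4) \<in> U" using d by (auto simp: U_def power2_eq_square)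
  ultimately have "\<not> negligible U" using open_not_negligible by blast
  then have "\<not> U \<subseteq> {q. \<not> path_ok q ls}" using negligible_path_bad[OF ok] negligible_subset by blast
  then obtain w x y z where q: "(w, x, y, z) \<in> U" "path_ok (w, x, y, z) ls" by auto
  have b: "1 - \<delta> < w" "w < 1 + \<delta>" "0 < x" "x < \<delta>" "0 < y" "y < \<delta>" "x * y < w * z" "z < \<delta> * y" using q by (auto simp: U_def)
  have w: "1 / 2 < w" using b d by linarith
  have "0 < w * z" using b mult_pos_pos[of x y] by linarith
  then have z: "0 < z" using w by (simp add: zero_less_mult_iff)
  have zd: "z < \<delta>" proof -
    have "\<delta> * y \<le> 1 * y" using b(5) d by (intro mult_right_mono) auto
    then show ?thesis using b(6,8) by linarith
  qed
  define N where "N = sqrt (w\<^sup>2 + x\<^sup>2 + y\<^sup>2 + z\<^sup>2)"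
  have N2: "N\<^sup>2 = w\<^sup>2 + x\<^sup>2 + y\<^sup>2 + z\<^sup>2" by (simp add: N_def)
  have N: "0 < N" using w by (simp add: N_def sum_power2_gt_zero_iff add_pos_nonneg)
  have Nl: "w \<le> N" unfolding N_def by (rule real_le_rsqrt) simp
  have Nu: "N \<le> w + x + y + z"
    unfolding N_def by (rule real_le_lsqrt) (use b z w in \<open>auto simp: power2_eq_square algebra_simps\<close>)
  define p where "p = (1 / N) *\<^sub>R (w, x, y, z)"
  have p: "p = (w / N, x / N, y / N, z / N)" by (simp add: p_def)
  have 1: "path_ok p ls" unfolding p_def by (rule path_ok_scaleR[THEN iffD2, OF _ q(2)]) (use N in simp)
  have un: "(w / N)\<^sup>2 + (x / N)\<^sup>2 + (y / N)\<^sup>2 + (z / N)\<^sup>2 = 1"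
    unfolding power_divide add_divide_distrib[symmetric] N2 using N N2 by (metis divide_self less_irrefl zero_less_power)
  then have 2: "qnorm2 p = 1" unfolding p by simp
  have ch: "chamber (w / N) (x / N) (y / N) (z / N)" unfolding chamber_def using un b z w N by (auto intro!: divide_nonneg_pos add_pos_pos)
  have le: "x / N * (y / N) \<le> w / N * (z / N)" using b(7) N by (simp add: divide_right_mono)
  have "qvalue \<kappa> p = value_fun \<kappa> (w / N) (x / N) (y / N) (z / N)" unfolding p using b z w N by simp
  also have "\<dots> = cost_YXYX \<kappa> (w / N) (x / N) (y / N) (z / N)" by (rule value_fun_regions(1)[OF ch k le])
  also have "\<dots> \<le> euler_cost \<kappa> (w / N) (x / N) (y / N) (z / N)" by (rule cost_YXYX_le_euler[OF ch le])
  also have "\<dots> = 2 * (pi / 2 - arctan (y / z)) + 2 * \<kappa> * arctan (sqrt ((y\<^sup>2 + z\<^sup>2) / (w\<^sup>2 + x\<^sup>2)))"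
    unfolding euler_cost_def power_divide add_divide_distrib[symmetric] using N by simp
  \<comment> \<open>pi / 2 - arctan (y / z) is arctan (z / y), at most \<delta> by the choice of the
    cone. The other angle is small because y and z are small compared with w.\<close>
  also have "\<dots> \<le> 2 * \<delta> + 2 * 1 * (3 * \<delta>)"
  proof (intro add_mono mult_left_mono mult_mono)
    have "pi / 2 - arctan (y / z) = arctan (1 / (y / z))" using arctan_inverse[of "y / z"] b z by simp
    also have "\<dots> \<le> z / y" using arctan_le_self[of "z / y"] b z by simp
    also have "\<dots> \<le> \<delta>" using b by (simp add: pos_divide_le_eq)
    finally show "pi / 2 - arctan (y / z) \<le> \<delta>" .
    have "(y\<^sup>2 + z\<^sup>2) / (w\<^sup>2 + x\<^sup>2) \<le> (\<delta>\<^sup>2 + \<delta>\<^sup>2) / (1 / 2)\<^sup>2"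
    proof (rule frac_le)
      show "y\<^sup>2 + z\<^sup>2 \<le> \<delta>\<^sup>2 + \<delta>\<^sup>2" using b z zd by (intro add_mono power_mono) auto
      have "(1 / 2)\<^sup>2 \<le> w\<^sup>2" using w by (intro power_mono) auto
      then show "(1 / 2)\<^sup>2 \<le> w\<^sup>2 + x\<^sup>2" by (smt (verit) zero_le_power2)
    qed auto
    also have "\<dots> \<le> (3 * \<delta>)\<^sup>2" by (simp add: power2_eq_square)
    finally have "sqrt ((y\<^sup>2 + z\<^sup>2) / (w\<^sup>2 + x\<^sup>2)) \<le> 3 * \<delta>" using d by (intro real_le_lsqrt) auto
    then show "arctan (sqrt ((y\<^sup>2 + z\<^sup>2) / (w\<^sup>2 + x\<^sup>2))) \<le> 3 * \<delta>"
      using arctan_le_self[of "sqrt ((y\<^sup>2 + z\<^sup>2) / (w\<^sup>2 + x\<^sup>2))"] by simp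
  qed (use k d in auto)
  finally have 3: "qvalue \<kappa> p \<le> 8 * \<delta>" by simp
  have "norm (p - (1, 0, 0, 0)) = norm (w / N - 1, x / N, y / N, z / N)" by (simp add: p)
  also have "\<dots> \<le> norm (w / N - 1) + (norm (x / N) + (norm (y / N) + norm (z / N)))"
    by (meson add_left_mono norm_Pair_le order_trans)
  also have "\<dots> \<le> 6 * \<delta> + (2 * \<delta> + (2 * \<delta> + 2 * \<delta>))"
  proof (intro add_mono)
    have N2: "1 / 2 < N" using w Nl by linarith
    have "\<bar>w - N\<bar> \<le> 3 * \<delta>" using Nl Nu b zd by linarith
    also have "\<dots> = 6 * \<delta> * (1 / 2)" by simp
    also have "\<dots> \<le> 6 * \<delta> * N" using N2 d by (intro mult_left_mono) auto
    finally have "\<bar>w - N\<bar> / N \<le> 6 * \<delta>" using N by (simp add: pos_divide_le_eq)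
    moreover have "w / N - 1 = (w - N) / N" using N by (simp add: diff_divide_distrib)
    ultimately show "norm (w / N - 1) \<le> 6 * \<delta>" using N by (simp add: abs_divide)
    have s: "norm (t / N) \<le> 2 * \<delta>" if "0 < t" "t < \<delta>" for t
    proof -
      have "2 * \<delta> * (1 / 2) \<le> 2 * \<delta> * N" using N2 d by (intro mult_left_mono) auto
      then have "t \<le> 2 * \<delta> * N" using that by linarith
      then show ?thesis using N that by (simp add: pos_divide_le_eq)
    qed
    show "norm (x / N) \<le> 2 * \<delta>" "norm (y / N) \<le> 2 * \<delta>" "norm (z / N) \<le> 2 * \<delta>" using s b z zd by auto
  qed
  finally have 4: "norm (p - (1, 0, 0, 0)) \<le> 20 * \<delta>" using d by simp
  show ?thesis by (rule that[OF 1 2 3 4])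
qed

text \<open>No continuity of the value at the endpoint is required: the perturbed endpoints with
  their values are candidates, and compactness of the candidates produces one over the limiting
  endpoint.\<close>

lemma lower_bound:
  assumes ok: "letters_ok ls" and k: "0 < \<kappa>" "\<kappa> \<le> 1"
  obtains c where "c \<le> lcost \<kappa> ls" "(qabs (qprod ls), c) \<in> candidates \<kappa>"
proof -
  \<comment> \<open>The 3 keeps \<delta> below 1 / 2 already at index 0, as
    \<open>start_points\<close> demands.\<close>
  define \<delta> where "\<delta> = (\<lambda>k::nat. 1 / (real k + 3))"
  have d: "0 < \<delta> k" "\<delta> k < 1 / 2" for k by (auto simp: \<delta>_def field_simps)
  have dl: "\<delta> \<longlonglongrightarrow> 0" unfolding \<delta>_def using LIMSEQ_ignore_initial_segment[OF lim_1_over_n, of 3] by (simp add: add.commute)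
  have "\<exists>q. path_ok q ls \<and> qnorm2 q = 1 \<and> qvalue \<kappa> q \<le> 8 * \<delta> k \<and> norm (q - (1, 0, 0, 0)) \<le> 20 * \<delta> k" for k
    using start_points[OF ok d k] by metis
  then obtain Q where Q: "\<And>k. path_ok (Q k) ls" "\<And>k. qnorm2 (Q k) = 1" "\<And>k. qvalue \<kappa> (Q k) \<le> 8 * \<delta> k" "\<And>k. norm (Q k - (1, 0, 0, 0)) \<le> 20 * \<delta> k"
    by metis
  define P where "P = (\<lambda>k. qmul (Q k) (qprod ls))"
  have "(\<lambda>k. Q k - (1, 0, 0, 0)) \<longlonglongrightarrow> 0"
    by (rule Lim_null_comparison[where g = "\<lambda>k. 20 * \<delta> k"]) (use Q(4) tendsto_mult_left[OF dl, of 20] in auto)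
  then have "Q \<longlonglongrightarrow> (1, 0, 0, 0)" by (simp add: LIM_zero_iff)
  from linear_continuous_at[OF linear_conv_bounded_linear[THEN iffD1, OF linear_qmul], THEN isCont_tendsto_compose, OF this]
  have "P \<longlonglongrightarrow> qmul (1, 0, 0, 0) (qprod ls)" unfolding P_def .
  then have Pl: "P \<longlonglongrightarrow> qprod ls" by simp
  have qa: "qabs p = (\<bar>fst p\<bar>, \<bar>fst (snd p)\<bar>, \<bar>fst (snd (snd p))\<bar>, \<bar>snd (snd (snd p))\<bar>)" for p by (cases p) simp
  have Al: "(\<lambda>k. qabs (P k)) \<longlonglongrightarrow> qabs (qprod ls)" unfolding qa by (intro tendsto_intros Pl)
  have VP: "qvalue \<kappa> (P k) \<le> qvalue \<kappa> (Q k) + lcost \<kappa> ls \<and> offedge (P k) \<and> qnorm2 (P k) = 1" for k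
    unfolding P_def by (rule path_V[OF k ok Q(1,2)])
  have "(qabs (P k), qvalue \<kappa> (P k)) \<in> candidates \<kappa>" for k
  proof -
    obtain w x y z where p: "P k = (w, x, y, z)" by (cases "P k") auto
    show ?thesis using VP[of k] chamber_qabs candidates_V[OF _ k] unfolding p by simp
  qed
  then obtain l r where l: "l \<in> candidates \<kappa>" and r: "strict_mono r" "((\<lambda>k. (qabs (P k), qvalue \<kappa> (P k))) \<circ> r) \<longlonglongrightarrow> l"
    using compact_candidates[of \<kappa>, unfolded compact_def, THEN spec[of _ "\<lambda>k. (qabs (P k), qvalue \<kappa> (P k))"]] by blast
  have "(\<lambda>k. qabs (P (r k))) \<longlonglongrightarrow> fst l" using tendsto_fst[OF r(2)] by (simp add: o_def)
  moreover have "(\<lambda>k. qabs (P (r k))) \<longlonglongrightarrow> qabs (qprod ls)" using LIMSEQ_subseq_LIMSEQ[OF Al r(1)] by (simp add: o_def)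
  ultimately have 1: "fst l = qabs (qprod ls)" by (rule LIMSEQ_unique)
  have "(\<lambda>k. qvalue \<kappa> (P (r k))) \<longlonglongrightarrow> snd l" using tendsto_snd[OF r(2)] by (simp add: o_def)
  moreover have "(\<lambda>k. 8 * \<delta> (r k) + lcost \<kappa> ls) \<longlonglongrightarrow> 8 * 0 + lcost \<kappa> ls"
    using LIMSEQ_subseq_LIMSEQ[OF dl r(1)] by (intro tendsto_intros) (simp add: o_def)
  moreover have "qvalue \<kappa> (P (r k)) \<le> 8 * \<delta> (r k) + lcost \<kappa> ls" for k using VP[of "r k"] Q(3)[of "r k"] by linarith
  ultimately have 2: "snd l \<le> lcost \<kappa> ls" using LIMSEQ_le[of "\<lambda>k. qvalue \<kappa> (P (r k))" "snd l"] by fastforce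
  show ?thesis using that[OF 2] l 1 by (metis prod.collapse)
qed

section \<open>Rotations as quaternions\<close>

text \<open>Conjugation of vectors by the quaternion q = w + v, that is u -> q u times the conjugate
  of q; a rotation when q has norm 1.\<close>

definition Mv :: "real \<Rightarrow> real^3 \<Rightarrow> real^3^3" where
  "Mv w v = matrix (\<lambda>u. (w\<^sup>2 - v \<bullet> v) *\<^sub>R u + (2 * (v \<bullet> u)) *\<^sub>R v + (2 * w) *\<^sub>R cross3 v u)"

lemma Mv_apply: "Mv w v *v u = (w\<^sup>2 - v \<bullet> v) *\<^sub>R u + (2 * (v \<bullet> u)) *\<^sub>R v + (2 * w) *\<^sub>R cross3 v u"
proof -
  have "linear (\<lambda>u. (w\<^sup>2 - v \<bullet> v) *\<^sub>R u + (2 * (v \<bullet> u)) *\<^sub>R v + (2 * w) *\<^sub>R cross3 v u)"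
    by (rule linearI) (simp_all add: inner_add_right cross_add_right cross_mult_right algebra_simps)
  from fun_cong[OF matrix_vector_mul(2)[OF this], of u] show ?thesis unfolding Mv_def by simp
qed

lemma Mv_mult: "Mv w v ** Mv w' v' = Mv (w * w' - v \<bullet> v') (w *\<^sub>R v' + w' *\<^sub>R v + cross3 v v')"
proof -
  have "(Mv w v ** Mv w' v') *v u = Mv (w * w' - v \<bullet> v') (w *\<^sub>R v' + w' *\<^sub>R v + cross3 v v') *v u" for u
    unfolding matrix_vector_mul_assoc[symmetric] Mv_apply vec_eq_iff forall_3
    by (simp add: inner_vec_def sum_3 cross3_def vector_3 power2_eq_square algebra_simps)
  then show ?thesis by (simp add: matrix_eq)
qed

text \<open>Rodrigues' formula rewritten in half angles.\<close>

lemma rot_Mv: "rot t C = Mv (cos (t * norm C / 2)) ((sin (t * norm C / 2) / norm C) *\<^sub>R C)" if "C \<noteq> 0"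
proof -
  define u where "u = (1 / norm C) *\<^sub>R C"
  define h where "h = t * norm C / 2"
  have u: "u \<bullet> u = 1" using that by (simp add: u_def dot_square_norm power2_eq_square)
  have h2: "t * norm C = 2 * h" by (simp add: h_def)
  have "linear (\<lambda>w. cross3 u w)" by (rule linearI) (simp_all add: cross_add_right cross_mult_right)
  then have 1: "matrix (\<lambda>w. cross3 u w) *v x = cross3 u x" for x using matrix_vector_mul(2) by (metis (no_types, lifting))
  have "linear (\<lambda>w. (u \<bullet> w) *\<^sub>R u)" by (rule linearI) (simp_all add: inner_add_right algebra_simps)
  then have 2: "matrix (\<lambda>w. (u \<bullet> w) *\<^sub>R u) *v x = (u \<bullet> x) *\<^sub>R u" for x using matrix_vector_mul(2) by (metis (no_types, lifting))
  have sc: "(c *\<^sub>R A) *v x = c *\<^sub>R (A *v x)" for c :: real and A :: "real^3^3" and x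
    by (simp add: scaleR_matrix_vector_assoc)
  have "rot t C *v x = Mv (cos h) (sin h *\<^sub>R u) *v x" for x
  proof -
    have c: "1 - cos (2 * h) = 2 * (sin h)\<^sup>2" by (simp add: cos_double_sin)
    have "rot t C *v x = cos (2 * h) *\<^sub>R x + sin (2 * h) *\<^sub>R cross3 u x + (2 * (sin h)\<^sup>2) *\<^sub>R ((u \<bullet> x) *\<^sub>R u)"
      unfolding rot_def rot_unit_def u_def[symmetric] h2 matrix_vector_mult_add_rdistrib sc 1 2 c by simp
    then show ?thesis unfolding Mv_apply sin_double cos_double
      by (simp add: u cross_mult_left power2_eq_square mult_ac)
  qed
  then have "rot t C = Mv (cos h) (sin h *\<^sub>R u)" by (simp add: matrix_eq)
  then show ?thesis by (simp add: u_def h_def)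
qed

section \<open>Quaternions and rotations in the orthonormal frame\<close>

locale frame =
  fixes X Y :: "real^3"
  assumes nX: "norm X = 1" and nY: "norm Y = 1" and XY: "X \<bullet> Y = 0"
begin

definition "Z = cross3 X Y"

lemma inners: "X \<bullet> X = 1" "Y \<bullet> Y = 1" "Z \<bullet> Z = 1" "X \<bullet> Y = 0" "Y \<bullet> X = 0" "X \<bullet> Z = 0" "Z \<bullet> X = 0" "Y \<bullet> Z = 0" "Z \<bullet> Y = 0"
proof -
  show 1: "X \<bullet> X = 1" "Y \<bullet> Y = 1" using nX nY by (simp_all add: dot_square_norm)
  show "X \<bullet> Y = 0" "Y \<bullet> X = 0" using XY by (simp_all add: inner_commute)
  show "X \<bullet> Z = 0" "Z \<bullet> X = 0" "Y \<bullet> Z = 0" "Z \<bullet> Y = 0" by (simp_all add: Z_def dot_cross_self inner_commute)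
  have "(norm Z)\<^sup>2 = 1" using norm_cross_dot[of X Y] nX nY XY by (simp add: Z_def)
  then show "Z \<bullet> Z = 1" by (simp add: dot_square_norm)
qed

lemma crosses: "cross3 X Y = Z" "cross3 Y Z = X" "cross3 Z X = Y" "cross3 Y X = - Z" "cross3 Z Y = - X" "cross3 X Z = - Y"
proof -
  show "cross3 X Y = Z" by (simp add: Z_def)
  then show "cross3 Y X = - Z" by (metis cross_skew)
  show 1: "cross3 Y Z = X" unfolding Z_def Lagrange using inners by simp
  then show "cross3 Z Y = - X" by (metis cross_skew)
  show 2: "cross3 X Z = - Y" unfolding Z_def Lagrange using inners by simp
  then show "cross3 Z X = Y" by (metis cross_skew minus_minus)
qed

fun Mq :: "quat \<Rightarrow> real^3^3" where
  "Mq (w, x, y, z) = Mv w (x *\<^sub>R X + y *\<^sub>R Y + z *\<^sub>R Z)"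

lemma Mq_mult: "Mq (qmul p q) = Mq p ** Mq q"
proof -
  obtain w x y z where p: "p = (w, x, y, z)" by (cases p) auto
  obtain w' x' y' z' where q: "q = (w', x', y', z')" by (cases q) auto
  have i: "(x *\<^sub>R X + y *\<^sub>R Y + z *\<^sub>R Z) \<bullet> (x' *\<^sub>R X + y' *\<^sub>R Y + z' *\<^sub>R Z) = x * x' + y * y' + z * z'"
    by (simp add: inner_add_left inner_add_right inners)
  have c: "cross3 (x *\<^sub>R X + y *\<^sub>R Y + z *\<^sub>R Z) (x' *\<^sub>R X + y' *\<^sub>R Y + z' *\<^sub>R Z) =
     (y * z' - z * y') *\<^sub>R X + (z * x' - x * z') *\<^sub>R Y + (x * y' - y * x') *\<^sub>R Z"
    by (simp add: cross_add_left cross_add_right cross_mult_left cross_mult_right crosses algebra_simps)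
  show ?thesis unfolding p q qmul.simps Mq.simps Mv_mult i c
    by (rule arg_cong2[where f = Mv]) (simp_all add: algebra_simps)
qed

lemma Mq_1: "Mq (1, 0, 0, 0) = mat 1"
  by (simp add: Mv_def matrix_id_mat_1[unfolded id_def])

lemma Mq_minus: "Mq (- q) = Mq q"
proof -
  obtain w x y z where q: "q = (w, x, y, z)" by (cases q) auto
  have "(- x) *\<^sub>R X + (- y) *\<^sub>R Y + (- z) *\<^sub>R Z = - (x *\<^sub>R X + y *\<^sub>R Y + z *\<^sub>R Z)" by (simp add: algebra_simps)
  moreover have "Mv (- w) (- v) = Mv w v" for v by (simp add: Mv_def)
  ultimately show ?thesis unfolding q by (simp only: Mq.simps uminus_prod_def fst_conv snd_conv)
qed

lemma norm_comb: "norm (a *\<^sub>R X + b *\<^sub>R Y) = sqrt (a\<^sup>2 + b\<^sup>2)"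
  by (simp add: norm_eq_sqrt_inner inner_add_left inner_add_right inners power2_eq_square)

lemma comb_nonzero: "a \<noteq> 0 \<or> b \<noteq> 0 \<Longrightarrow> a *\<^sub>R X + b *\<^sub>R Y \<noteq> 0"
  using norm_comb[of a b] by (auto simp: sum_power2_eq_zero_iff)

lemma rot_qletter: "a \<noteq> 0 \<or> b \<noteq> 0 \<Longrightarrow> rot t (a *\<^sub>R X + b *\<^sub>R Y) = Mq (qletter a b t)"
  unfolding rot_Mv[OF comb_nonzero] norm_comb qletter_def Let_def Mq.simps by (simp add: scaleR_add_right)

text \<open>Orthonormality makes the coefficients of a vector unique, so the definite description in
  \<open>cost\<close> really denotes.\<close>

lemma cost_comb: "cost X Y \<kappa> (a *\<^sub>R X + b *\<^sub>R Y) = \<bar>a\<bar> + \<kappa> * \<bar>b\<bar>"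
  unfolding cost_def
proof (rule the_equality)
  fix r assume "\<exists>a' b'. a *\<^sub>R X + b *\<^sub>R Y = a' *\<^sub>R X + b' *\<^sub>R Y \<and> r = \<bar>a'\<bar> + \<kappa> * \<bar>b'\<bar>"
  then obtain a' b' where e: "a *\<^sub>R X + b *\<^sub>R Y = a' *\<^sub>R X + b' *\<^sub>R Y" and r: "r = \<bar>a'\<bar> + \<kappa> * \<bar>b'\<bar>" by blast
  have "a = a'" using arg_cong[OF e, of "\<lambda>v. v \<bullet> X"] by (simp add: inner_add_left inners)
  moreover have "b = b'" using arg_cong[OF e, of "\<lambda>v. v \<bullet> Y"] by (simp add: inner_add_left inners)
  ultimately show "r = \<bar>a\<bar> + \<kappa> * \<bar>b\<bar>" using r by simp
qed auto

lemma span_comb: "C \<in> span {X, Y} \<longleftrightarrow> (\<exists>a b. C = a *\<^sub>R X + b *\<^sub>R Y)"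
proof
  assume "C \<in> span {X, Y}"
  then obtain a where "C - a *\<^sub>R X \<in> span {Y}" using span_breakdown_eq[of C X "{Y}"] by auto
  then obtain b where "C - a *\<^sub>R X = b *\<^sub>R Y" by (auto simp: span_singleton)
  then have "C = a *\<^sub>R X + b *\<^sub>R Y" by (simp add: algebra_simps)
  then show "\<exists>a b. C = a *\<^sub>R X + b *\<^sub>R Y" by blast
next
  have "X \<in> span {X, Y}" "Y \<in> span {X, Y}" by (simp_all add: span_base)
  then show "\<exists>a b. C = a *\<^sub>R X + b *\<^sub>R Y \<Longrightarrow> C \<in> span {X, Y}" by (auto intro!: span_add span_scale)
qed

lemma decomposition_letters:
  assumes "is_decomposition X Y g w"
  obtains ls where "letters_ok ls" "Mq (qprod ls) = g" "lcost \<kappa> ls = word_cost X Y \<kappa> w"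
proof -
  have "\<exists>ls. letters_ok ls \<and> Mq (qprod ls) = word_prod w \<and> lcost \<kappa> ls = word_cost X Y \<kappa> w"
    if "\<forall>(\<tau>, C) \<in> set w. 0 \<le> \<tau> \<and> C \<noteq> 0 \<and> C \<in> span {X, Y}"
    using that
  proof (induction w)
    case Nil
    show ?case by (rule exI[of _ "[]"]) (simp add: letters_ok_def qprod_def word_prod_def lcost_def word_cost_def Mq_1 del: Mq.simps)
  next
    case (Cons l w)
    obtain t C where l: "l = (t, C)" by (cases l) auto
    have t: "0 \<le> t" "C \<noteq> 0" "C \<in> span {X, Y}" using Cons.prems by (auto simp: l)
    obtain a b where C: "C = a *\<^sub>R X + b *\<^sub>R Y" using t(3) span_comb by blast
    have ab: "a \<noteq> 0 \<or> b \<noteq> 0" using t(2) C by auto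
    obtain ls where ls: "letters_ok ls" "Mq (qprod ls) = word_prod w" "lcost \<kappa> ls = word_cost X Y \<kappa> w"
      using Cons by auto
    show ?case
    proof (intro exI[of _ "(t, a, b) # ls"] conjI)
      show "letters_ok ((t, a, b) # ls)" using ls(1) t ab by (auto simp: letters_ok_def)
      show "Mq (qprod ((t, a, b) # ls)) = word_prod (l # w)"
        using ls(2) rot_qletter[OF ab, of t] by (simp add: qprod_def word_prod_def l C Mq_mult)
      show "lcost \<kappa> ((t, a, b) # ls) = word_cost X Y \<kappa> (l # w)"
        using ls(3) by (simp add: lcost_def word_cost_def l C cost_comb)
    qed
  qed
  then show ?thesis using assms that unfolding is_decomposition_def by blast
qed

text \<open>Together with the norm, the three diagonal entries determine the squares of all four
  coordinates. Hence a rotation determines the folded coordinates of its unit quaternions.\<close>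

lemma Mq_diag:
  "X \<bullet> (Mq (w, x, y, z) *v X) = w\<^sup>2 + x\<^sup>2 - y\<^sup>2 - z\<^sup>2"
  "Y \<bullet> (Mq (w, x, y, z) *v Y) = w\<^sup>2 - x\<^sup>2 + y\<^sup>2 - z\<^sup>2"
  "Z \<bullet> (Mq (w, x, y, z) *v Z) = w\<^sup>2 - x\<^sup>2 - y\<^sup>2 + z\<^sup>2"
  by (simp_all add: Mv_apply inner_add_left inner_add_right inners cross_add_left cross_mult_left crosses power2_eq_square algebra_simps)

lemma Mq_inj_abs: "Mq p = Mq q \<Longrightarrow> qnorm2 p = 1 \<Longrightarrow> qnorm2 q = 1 \<Longrightarrow> qabs p = qabs q"
proof -
  assume e: "Mq p = Mq q" and n: "qnorm2 p = 1" "qnorm2 q = 1"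
  obtain w x y z where p: "p = (w, x, y, z)" by (cases p) auto
  obtain w' x' y' z' where q: "q = (w', x', y', z')" by (cases q) auto
  have "w\<^sup>2 + x\<^sup>2 - y\<^sup>2 - z\<^sup>2 = w'\<^sup>2 + x'\<^sup>2 - y'\<^sup>2 - z'\<^sup>2" "w\<^sup>2 - x\<^sup>2 + y\<^sup>2 - z\<^sup>2 = w'\<^sup>2 - x'\<^sup>2 + y'\<^sup>2 - z'\<^sup>2"
    "w\<^sup>2 - x\<^sup>2 - y\<^sup>2 + z\<^sup>2 = w'\<^sup>2 - x'\<^sup>2 - y'\<^sup>2 + z'\<^sup>2"
    using Mq_diag e unfolding p q by metis+
  moreover have "w\<^sup>2 + x\<^sup>2 + y\<^sup>2 + z\<^sup>2 = 1" "w'\<^sup>2 + x'\<^sup>2 + y'\<^sup>2 + z'\<^sup>2 = 1" using n unfolding p q by simp_all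
  ultimately have "w\<^sup>2 = w'\<^sup>2" "x\<^sup>2 = x'\<^sup>2" "y\<^sup>2 = y'\<^sup>2" "z\<^sup>2 = z'\<^sup>2" by linarith+
  then show ?thesis unfolding p q by (auto simp: power2_eq_iff)
qed

lemma Mq_qX: "Mq (qX t) *v X = X" "Mq (qX t) *v Y = cos (2 * t) *\<^sub>R Y + sin (2 * t) *\<^sub>R Z"
  "Mq (qX t) *v Z = cos (2 * t) *\<^sub>R Z - sin (2 * t) *\<^sub>R Y"
proof -
  have a: "Mq (qX t) *v u = ((cos t)\<^sup>2 - (sin t)\<^sup>2) *\<^sub>R u + (2 * (sin t)\<^sup>2 * (X \<bullet> u)) *\<^sub>R X + (2 * cos t * sin t) *\<^sub>R cross3 X u" for u
    unfolding qX_def Mq.simps Mv_apply by (simp add: inners cross_mult_left power2_eq_square mult_ac)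
  have "(cos t)\<^sup>2 - (sin t)\<^sup>2 + 2 * (sin t)\<^sup>2 = 1" using sin_cos_squared_add[of t] by linarith
  then show "Mq (qX t) *v X = X" unfolding a by (simp add: inners flip: scaleR_add_left)
  show "Mq (qX t) *v Y = cos (2 * t) *\<^sub>R Y + sin (2 * t) *\<^sub>R Z" unfolding a cos_double sin_double by (simp add: inners crosses mult_ac)
  show "Mq (qX t) *v Z = cos (2 * t) *\<^sub>R Z - sin (2 * t) *\<^sub>R Y" unfolding a cos_double sin_double by (simp add: inners crosses mult_ac)
qed

lemma Mq_qY: "Mq (qY t) *v X = cos (2 * t) *\<^sub>R X - sin (2 * t) *\<^sub>R Z"
  unfolding qY_def Mq.simps Mv_apply cos_double sin_double by (simp add: inners cross_mult_left crosses power2_eq_square mult_ac)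

lemma frame_expansion: "u = (u \<bullet> X) *\<^sub>R X + (u \<bullet> Y) *\<^sub>R Y + (u \<bullet> Z) *\<^sub>R Z"
proof -
  define d where "d = u - ((u \<bullet> X) *\<^sub>R X + (u \<bullet> Y) *\<^sub>R Y + (u \<bullet> Z) *\<^sub>R Z)"
  have o: "d \<bullet> X = 0" "d \<bullet> Y = 0" "d \<bullet> Z = 0" by (simp_all add: d_def inner_diff_left inner_add_left inners)
  have "cross3 d Z = 0" unfolding Z_def Lagrange using o by simp
  then have "cross3 Z (cross3 d Z) = 0" by simp
  then have "d = 0" unfolding Lagrange using o inners by (simp add: inner_commute)
  then show ?thesis by (simp add: d_def)
qed

lemma matrix_frame_eqI:
  assumes "A *v X = B *v X" "A *v Y = B *v Y" "A *v Z = B *v Z"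
  shows "A = (B :: real^3^3)"
proof -
  have "A *v u = B *v u" for u
    by (subst (1 2) frame_expansion) (simp add: matrix_vector_right_distrib matrix_vector_mult_scaleR assms)
  then show ?thesis by (simp add: matrix_eq)
qed

fun qconj :: "quat \<Rightarrow> quat" where "qconj (w, x, y, z) = (w, - x, - y, - z)"

lemma Mq_conj: "qnorm2 q = 1 \<Longrightarrow> Mq (qconj q) ** Mq q = mat 1" "qnorm2 q = 1 \<Longrightarrow> Mq q ** Mq (qconj q) = mat 1"
proof -
  assume q: "qnorm2 q = 1"
  have "qmul (qconj q) q = (qnorm2 q, 0, 0, 0)" "qmul q (qconj q) = (qnorm2 q, 0, 0, 0)" by (cases q, simp add: power2_eq_square)+
  then show "Mq (qconj q) ** Mq q = mat 1" "Mq q ** Mq (qconj q) = mat 1" using q Mq_1 Mq_mult by (metis, metis)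
qed

lemma transpose_Mq: "transpose (Mq q) = Mq (qconj q)"
proof -
  obtain w x y z where q: "q = (w, x, y, z)" by (cases q) auto
  define v where "v = x *\<^sub>R X + y *\<^sub>R Y + z *\<^sub>R Z"
  have v': "(- x) *\<^sub>R X + (- y) *\<^sub>R Y + (- z) *\<^sub>R Z = - v" by (simp add: v_def algebra_simps)
  have "(Mv w v *v a) \<bullet> b = a \<bullet> (Mv w (- v) *v b)" for a b
  proof -
    have "cross3 v a \<bullet> b = - (a \<bullet> cross3 v b)" by (metis cross_triple inner_commute cross_skew inner_minus_right)
    then show ?thesis unfolding Mv_apply by (simp add: inner_add_left inner_add_right inner_commute algebra_simps)
  qed
  then have "(transpose (Mv w v) *v b) \<bullet> a = (Mv w (- v) *v b) \<bullet> a" for a b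
    by (metis dot_lmul_matrix inner_commute transpose_matrix_vector vector_transpose_matrix)
  then have "transpose (Mv w v) *v b = Mv w (- v) *v b" for b by (metis vector_eq_rdot)
  then show ?thesis unfolding q Mq.simps qconj.simps v' v_def[symmetric] by (simp add: matrix_eq)
qed

text \<open>A unit quaternion with w \<ge> 0 is a square, so its matrix is the square of an
  orthogonal matrix and has determinant 1. The root is (1 + w, x, y, z) normalised; for w < 0 the
  quaternion is negated first.\<close>

lemma det_Mq: "qnorm2 q = 1 \<Longrightarrow> det (Mq q) = 1"
proof -
  have pos: "det (Mq (w, x, y, z)) = 1" if n: "qnorm2 (w, x, y, z) = 1" and w: "0 \<le> w" for w x y z
  proof -
    define N where "N = sqrt (2 * (1 + w))"
    have N: "N\<^sup>2 = 2 * (1 + w)" "0 < N" using w by (auto simp: N_def)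
    define r where "r = ((1 + w) / N, x / N, y / N, z / N)"
    have xyz: "x\<^sup>2 + y\<^sup>2 + z\<^sup>2 = 1 - w\<^sup>2" using n by simp
    have a: "(1 + w)\<^sup>2 - (1 - w\<^sup>2) = w * (2 * (1 + w))" by (simp add: power2_eq_square algebra_simps)
    have "(1 + w) / N * ((1 + w) / N) - x / N * (x / N) - y / N * (y / N) - z / N * (z / N) = ((1 + w)\<^sup>2 - x\<^sup>2 - y\<^sup>2 - z\<^sup>2) / N\<^sup>2"
      unfolding diff_divide_distrib by (simp add: power2_eq_square)
    also have "(1 + w)\<^sup>2 - x\<^sup>2 - y\<^sup>2 - z\<^sup>2 = w * (2 * (1 + w))" using xyz a by linarith
    also have "w * (2 * (1 + w)) / N\<^sup>2 = w" unfolding N(1) using w by simp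
    finally have 1: "(1 + w) / N * ((1 + w) / N) - x / N * (x / N) - y / N * (y / N) - z / N * (z / N) = w" .
    have 2: "(1 + w) / N * (s / N) + s / N * ((1 + w) / N) = s" for s
    proof -
      have "(1 + w) / N * (s / N) + s / N * ((1 + w) / N) = s * (2 * (1 + w)) / N\<^sup>2" by (simp add: power2_eq_square add_divide_distrib algebra_simps)
      then show ?thesis unfolding N(1) using w by simp
    qed
    have "qmul r r = (w, x, y, z)" unfolding r_def qmul.simps using 1 2 by (simp add: mult.commute)
    then have e: "Mq (w, x, y, z) = Mq r ** Mq r" by (metis Mq_mult)
    have "qnorm2 r * qnorm2 r = 1" using n qnorm2_qmul[of r r] \<open>qmul r r = (w, x, y, z)\<close> by simp
    moreover have "0 \<le> qnorm2 r" by (simp add: r_def)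
    ultimately have nr: "qnorm2 r = 1" by (simp add: square_eq_1_iff)
    have "orthogonal_matrix (Mq r)" unfolding orthogonal_matrix_def transpose_Mq using Mq_conj[OF nr] by simp
    then have "det (Mq r) = 1 \<or> det (Mq r) = - 1" by (rule det_orthogonal_matrix)
    then show ?thesis unfolding e det_mul by auto
  qed
  assume q: "qnorm2 q = 1"
  obtain w x y z where e: "q = (w, x, y, z)" by (cases q) auto
  show ?thesis
  proof (cases "0 \<le> w")
    case True then show ?thesis using pos q unfolding e by blast
  next
    case False
    then have "det (Mq (- w, - x, - y, - z)) = 1" using q unfolding e by (intro pos) auto
    moreover have "Mq (- w, - x, - y, - z) = Mq q" unfolding e using Mq_minus[of "(w, x, y, z)"] by (simp only: uminus_prod_def fst_conv snd_conv)
    ultimately show ?thesis by simp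
  qed
qed

text \<open>Euler angles: an X- and a Y-letter are chosen to carry X to its image under g; what
  remains fixes X and is a rotation about it. Besides a lift of g this provides a first
  decomposition.\<close>

lemma SO3_quat:
  assumes g: "g \<in> SO3"
  obtains s t r where "g = Mq (qmul (qmul (qX s) (qY t)) (qX r))"
proof -
  have og: "orthogonal_matrix g" "det g = 1" using g by (auto simp: SO3_def)
  define v where "v = g *v X"
  have pres: "(g *v a) \<bullet> (g *v b) = a \<bullet> b" for a b
    using og(1) orthogonal_transformation_matrix[of "(*v) g"] by (simp add: orthogonal_transformation_def)
  define a where "a = v \<bullet> X" define b where "b = v \<bullet> Y" define c where "c = v \<bullet> Z"
  have ve: "v = a *\<^sub>R X + b *\<^sub>R Y + c *\<^sub>R Z" unfolding a_def b_def c_def by (rule frame_expansion)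
  have "v \<bullet> v = 1" unfolding v_def pres by (rule inners)
  then have n: "a\<^sup>2 + (b\<^sup>2 + c\<^sup>2) = 1" unfolding ve by (simp add: inner_add_left inner_add_right inners power2_eq_square)
  define \<rho> where "\<rho> = sqrt (b\<^sup>2 + c\<^sup>2)"
  have r2: "\<rho>\<^sup>2 = b\<^sup>2 + c\<^sup>2" by (simp add: \<rho>_def)
  obtain T where T: "a = cos T" "\<rho> = sin T" using sincos_total_2pi[of a \<rho>] n r2 by metis
  obtain S where S: "b = \<rho> * sin S" "c = - (\<rho> * cos S)"
  proof (cases "\<rho> = 0")
    case True
    then have "b = 0" "c = 0" using r2 by (auto simp: sum_power2_eq_zero_iff)
    then show ?thesis using that[of 0] True by simp
  next
    case False
    have "(- c)\<^sup>2 + b\<^sup>2 = \<rho>\<^sup>2" using r2 by simp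
    then have "(- c / \<rho>)\<^sup>2 + (b / \<rho>)\<^sup>2 = 1" unfolding power_divide add_divide_distrib[symmetric] using False by simp
    then obtain S where "- c / \<rho> = cos S" "b / \<rho> = sin S" using sincos_total_2pi by metis
    then show ?thesis using that[of S] False by (simp add: field_simps)
  qed
  define p where "p = qmul (qX (S / 2)) (qY (T / 2))"
  have np: "qnorm2 p = 1" unfolding p_def qnorm2_qmul by (simp add: qX_def qY_def)
  have pX: "Mq p *v X = v"
    unfolding p_def Mq_mult matrix_vector_mul_assoc[symmetric] Mq_qY matrix_vector_mult_diff_distrib matrix_vector_mult_scaleR Mq_qX ve T(1) S T(2)
    by (simp add: algebra_simps)
  define k where "k = Mq (qconj p) ** g"
  have ok: "orthogonal_matrix (Mq (qconj p))"
  proof -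
    have nc: "qnorm2 (qconj p) = 1" using np by (cases p) simp
    show ?thesis unfolding orthogonal_matrix_def transpose_Mq using Mq_conj[OF nc] by simp
  qed
  have rk: "rotation_matrix k" unfolding rotation_matrix_def k_def
  proof
    show "orthogonal_matrix (Mq (qconj p) ** g)" by (rule orthogonal_matrix_mul[OF ok og(1)])
    have "qnorm2 (qconj p) = 1" using np by (cases p) simp
    then show "det (Mq (qconj p) ** g) = 1" using det_Mq og(2) by (simp add: det_mul)
  qed
  have kX: "k *v X = X"
  proof -
    have "k *v X = Mq (qconj p) *v (Mq p *v X)" unfolding k_def pX v_def by (simp add: matrix_vector_mul_assoc)
    also have "\<dots> = X" unfolding matrix_vector_mul_assoc Mq_conj[OF np] by simp
    finally show ?thesis .
  qed
  have kpres: "(k *v a) \<bullet> (k *v b) = a \<bullet> b" for a b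
    using rk orthogonal_transformation_matrix[of "(*v) k"] by (simp add: orthogonal_transformation_def rotation_matrix_def)
  define y where "y = (k *v Y) \<bullet> Y" define z where "z = (k *v Y) \<bullet> Z"
  have "(k *v Y) \<bullet> X = 0" using kpres[of Y X] kX inners by simp
  then have kY: "k *v Y = y *\<^sub>R Y + z *\<^sub>R Z" using frame_expansion[of "k *v Y"] by (simp add: y_def z_def)
  have "y\<^sup>2 + z\<^sup>2 = 1" using kpres[of Y Y] unfolding kY by (simp add: inner_add_left inner_add_right inners power2_eq_square)
  then obtain R where R: "y = cos R" "z = sin R" using sincos_total_2pi by metis
  have kZ: "k *v Z = y *\<^sub>R Z - z *\<^sub>R Y"
  proof -
    have "k *v Z = cross3 (k *v X) (k *v Y)" unfolding cross_rotation_matrix[OF rk] Z_def ..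
    then show ?thesis unfolding kX kY by (simp add: cross_add_right cross_mult_right crosses)
  qed
  have "k = Mq (qX (R / 2))" by (rule matrix_frame_eqI) (simp_all add: Mq_qX kX kY kZ R)
  then have "Mq p ** k = Mq (qmul p (qX (R / 2)))" by (simp only: Mq_mult)
  moreover have "Mq p ** k = g" unfolding k_def by (simp add: matrix_mul_assoc Mq_conj[OF np])
  ultimately show ?thesis using that unfolding p_def by metis
qed

end

section \<open>Realization by subwords of the patterns\<close>

text \<open>Letters of candidate words as symbols, on which sign flips and reversal can act before
  vectors are inserted. The argument of \<open>kX\<close> and \<open>kY\<close> is a sign.\<close>

datatype kind = kX real | kY real | kW

fun kq :: "real \<Rightarrow> kind \<times> real \<Rightarrow> quat" where
  "kq \<kappa> (kX s, t) = qX (s * t)"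
| "kq \<kappa> (kY s, t) = qY (s * t)"
| "kq \<kappa> (kW, t) = qW \<kappa> t"

text \<open>The factor 2 undoes the half angle of quaternions. The generator of the W-letter has
  length sqrt (1 + \<kappa>^2) and cost 1 + \<kappa>^2, which explains the divisor here and the
  factor in \<open>kcost\<close>.\<close>

fun ktime :: "real \<Rightarrow> kind \<times> real \<Rightarrow> real" where
  "ktime \<kappa> (kX s, t) = 2 * t"
| "ktime \<kappa> (kY s, t) = 2 * t"
| "ktime \<kappa> (kW, t) = 2 * t / sqrt (1 + \<kappa>\<^sup>2)"

fun kcost :: "real \<Rightarrow> kind \<times> real \<Rightarrow> real" where
  "kcost \<kappa> (kX s, t) = 2 * t"
| "kcost \<kappa> (kY s, t) = 2 * \<kappa> * t"
| "kcost \<kappa> (kW, t) = 2 * sqrt (1 + \<kappa>\<^sup>2) * t"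

fun kok :: "kind \<times> real \<Rightarrow> bool" where
  "kok (kX s, t) \<longleftrightarrow> s \<in> {1, -1} \<and> 0 \<le> t"
| "kok (kY s, t) \<longleftrightarrow> s \<in> {1, -1} \<and> 0 \<le> t"
| "kok (kW, t) \<longleftrightarrow> 0 \<le> t"

text \<open>Conjugation by the half-turns about the frame axes, which flips the signs of the letters; \<open>qrev\<close> reverses a word.\<close>

fun qsign :: "real \<Rightarrow> real \<Rightarrow> quat \<Rightarrow> quat" where
  "qsign e1 e2 (w, x, y, z) = (w, e1 * x, e2 * y, e1 * e2 * z)"

fun qrev :: "quat \<Rightarrow> quat" where "qrev (w, x, y, z) = (w, x, y, - z)"

lemma qsign_qmul: "e1 \<in> {1, -1} \<Longrightarrow> e2 \<in> {1, -1} \<Longrightarrow> qsign e1 e2 (qmul p q) = qmul (qsign e1 e2 p) (qsign e1 e2 q)"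
  by (cases p; cases q) auto

lemma qrev_qmul: "qrev (qmul p q) = qmul (qrev q) (qrev p)"
  by (cases p; cases q) (simp add: algebra_simps)

definition kprod :: "real \<Rightarrow> (kind \<times> real) list \<Rightarrow> quat" where
  "kprod \<kappa> xs = foldr (\<lambda>k acc. qmul (kq \<kappa> k) acc) xs (1, 0, 0, 0)"

lemma kprod_append: "kprod \<kappa> (xs @ ys) = qmul (kprod \<kappa> xs) (kprod \<kappa> ys)"
  by (induction xs) (simp_all add: kprod_def qmul_assoc)

lemma qrev_kq: "qrev (kq \<kappa> k) = kq \<kappa> k"
  by (cases "(\<kappa>, k)" rule: kq.cases) (auto simp: qX_def qY_def qW_def)

text \<open>\<open>qrev\<close> is an anti-automorphism that fixes every letter, since letters have
  no component along the third axis.\<close>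

lemma kprod_rev: "kprod \<kappa> (rev xs) = qrev (kprod \<kappa> xs)"
proof (induction xs)
  case Nil show ?case by (simp add: kprod_def)
next
  case (Cons k xs)
  have 1: "kprod \<kappa> [k] = kq \<kappa> k" by (simp add: kprod_def)
  have 2: "kprod \<kappa> (k # xs) = qmul (kq \<kappa> k) (kprod \<kappa> xs)" by (simp add: kprod_def)
  show ?case unfolding 2 by (simp add: kprod_append Cons.IH 1 qrev_qmul qrev_kq)
qed

text \<open>The sixteen sign patterns of four coordinates are generated by the flips of X and Y, by
  reversal, which changes the sign of z alone, and by the overall sign, which the rotation does not
  see.\<close>

lemma qabs_unfold:
  assumes "qabs q0 = q"
  obtains e1 e2 :: real and rv where "e1 \<in> {1, -1}" "e2 \<in> {1, -1}" "q0 = qsign e1 e2 (if rv then qrev q else q) \<or> q0 = - qsign e1 e2 (if rv then qrev q else q)"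
proof -
  obtain w x y z where q0: "q0 = (w, x, y, z)" by (cases q0) auto
  define s where "s = (\<lambda>t::real. if 0 \<le> t then 1 else - 1 :: real)"
  have s: "s t * \<bar>t\<bar> = t" "s t \<in> {1, -1}" "s t * s t = 1" for t by (auto simp: s_def)
  have q: "q = (\<bar>w\<bar>, \<bar>x\<bar>, \<bar>y\<bar>, \<bar>z\<bar>)" using assms q0 by simp
  define e1 where "e1 = s w * s x"
  define e2 where "e2 = s w * s y"
  define rv where "rv = (s w * s x * s y * s z = - 1)"
  have e: "e1 \<in> {1, -1}" "e2 \<in> {1, -1}" using s(2)[of w] s(2)[of x] s(2)[of y] by (auto simp: e1_def e2_def)
  have "s w *\<^sub>R qsign e1 e2 (if rv then qrev q else q) = (s w * \<bar>w\<bar>, s w * s w * (s x * \<bar>x\<bar>), s w * s w * (s y * \<bar>y\<bar>), s w * (s w * s w) * s x * s y * (if rv then - \<bar>z\<bar> else \<bar>z\<bar>))"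
    unfolding q by (simp add: e1_def e2_def mult_ac)
  also have "s w * (s w * s w) * s x * s y * (if rv then - \<bar>z\<bar> else \<bar>z\<bar>) = z"
    using s(2)[of w] s(2)[of x] s(2)[of y] s(2)[of z] s(1)[of z] by (auto simp: rv_def)
  finally have "s w *\<^sub>R qsign e1 e2 (if rv then qrev q else q) = q0" by (simp add: s q0)
  then have "q0 = qsign e1 e2 (if rv then qrev q else q) \<or> q0 = - qsign e1 e2 (if rv then qrev q else q)"
    using s(2)[of w] by auto
  then show ?thesis using that e by blast
qed

lemma sym_images_foldrI: "foldr apply_gen gs P \<in> sym_images P"
  by (auto simp: sym_images_def)

context frame
begin

fun kvec :: "real \<Rightarrow> real \<Rightarrow> real \<Rightarrow> kind \<times> real \<Rightarrow> real^3" where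
  "kvec \<kappa> e1 e2 (kX s, t) = (s * e1) *\<^sub>R X"
| "kvec \<kappa> e1 e2 (kY s, t) = (s * e2) *\<^sub>R Y"
| "kvec \<kappa> e1 e2 (kW, t) = e1 *\<^sub>R X + (e2 * \<kappa>) *\<^sub>R Y"

definition kword :: "real \<Rightarrow> real \<Rightarrow> real \<Rightarrow> (kind \<times> real) list \<Rightarrow> (real \<times> (real^3)) list" where
  "kword \<kappa> e1 e2 xs = map (\<lambda>k. (ktime \<kappa> k, kvec \<kappa> e1 e2 k)) xs"

lemma kvec_comb:
  assumes e: "e1 \<in> {1, -1}" "e2 \<in> {1, -1}" and k: "0 < \<kappa>" and ok: "kok x"
  obtains a b where "kvec \<kappa> e1 e2 x = a *\<^sub>R X + b *\<^sub>R Y" "a \<noteq> 0 \<or> b \<noteq> 0"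
    "qletter a b (ktime \<kappa> x) = qsign e1 e2 (kq \<kappa> x)" "ktime \<kappa> x * (\<bar>a\<bar> + \<kappa> * \<bar>b\<bar>) = kcost \<kappa> x" "0 \<le> ktime \<kappa> x"
proof (cases "(\<kappa>, x)" rule: kq.cases)
  case (1 \<kappa>' s t)
  have s: "s \<in> {1, -1}" "0 \<le> t" using ok 1 by auto
  have "sqrt ((s * e1)\<^sup>2) = 1" using s e by auto
  then have "qletter (s * e1) 0 (2 * t) = qsign e1 e2 (qX (s * t))"
    unfolding qletter_def qX_def Let_def using s e by auto
  then show ?thesis using that[of "s * e1" 0] s e 1 by auto
next
  case (2 \<kappa>' s t)
  have s: "s \<in> {1, -1}" "0 \<le> t" using ok 2 by auto
  have "sqrt ((s * e2)\<^sup>2) = 1" using s e by auto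
  then have "qletter 0 (s * e2) (2 * t) = qsign e1 e2 (qY (s * t))"
    unfolding qletter_def qY_def Let_def using s e by auto
  then show ?thesis using that[of 0 "s * e2"] s e 2 k by auto
next
  case (3 \<kappa>' t)
  have t: "0 \<le> t" using ok 3 by auto
  define n where "n = sqrt (1 + \<kappa>\<^sup>2)"
  have n: "0 < n" "n\<^sup>2 = 1 + \<kappa>\<^sup>2" using norm_sqrt by (auto simp: n_def)
  have "e1\<^sup>2 + (e2 * \<kappa>)\<^sup>2 = 1 + \<kappa>\<^sup>2" using e by auto
  then have q: "qletter e1 (e2 * \<kappa>) (2 * t / n) = qsign e1 e2 (qW \<kappa> t)"
    unfolding qletter_def qW_def Let_def n_def[symmetric] using n(1) by (simp add: n_def[symmetric] mult_ac)
  have c: "2 * t / n * (\<bar>e1\<bar> + \<kappa> * \<bar>e2 * \<kappa>\<bar>) = 2 * n * t"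
  proof -
    have "\<bar>e1\<bar> + \<kappa> * \<bar>e2 * \<kappa>\<bar> = n\<^sup>2" unfolding n using e k by (auto simp: power2_eq_square)
    then show ?thesis using n(1) by (simp add: power2_eq_square)
  qed
  have 33: "x = (kW, t)" using 3 by simp
  have e0: "e1 \<noteq> 0" using e(1) by force
  have 4: "kvec \<kappa> e1 e2 x = e1 *\<^sub>R X + (e2 * \<kappa>) *\<^sub>R Y" by (simp only: 33 kvec.simps)
  have 5: "qletter e1 (e2 * \<kappa>) (ktime \<kappa> x) = qsign e1 e2 (kq \<kappa> x)"
    using q by (simp only: 33 ktime.simps kq.simps n_def)
  have 6: "ktime \<kappa> x * (\<bar>e1\<bar> + \<kappa> * \<bar>e2 * \<kappa>\<bar>) = kcost \<kappa> x"
    using c by (simp only: 33 ktime.simps kcost.simps n_def)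
  have 7: "0 \<le> ktime \<kappa> x" using t n(1) by (simp add: 33 n_def)
  show ?thesis by (rule that[OF 4 disjI1[OF e0] 5 6 7])
qed

lemma kword_props:
  assumes e: "e1 \<in> {1, -1}" "e2 \<in> {1, -1}" and k: "0 < \<kappa>" and ok: "list_all kok xs"
  shows "word_prod (kword \<kappa> e1 e2 xs) = Mq (qsign e1 e2 (kprod \<kappa> xs)) \<and>
    word_cost X Y \<kappa> (kword \<kappa> e1 e2 xs) = sum_list (map (kcost \<kappa>) xs) \<and>
    (\<forall>(\<tau>, C) \<in> set (kword \<kappa> e1 e2 xs). 0 \<le> \<tau> \<and> C \<noteq> 0 \<and> C \<in> span {X, Y})"
  using ok
proof (induction xs)
  case Nil
  have "qsign e1 e2 (1, 0, 0, 0) = (1, 0, 0, 0)" by simp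
  then have "word_prod (kword \<kappa> e1 e2 []) = Mq (qsign e1 e2 (kprod \<kappa> []))" unfolding kprod_def kword_def word_prod_def
    by (simp only: list.map foldr.simps id_apply Mq_1)
  moreover have "word_cost X Y \<kappa> (kword \<kappa> e1 e2 []) = sum_list (map (kcost \<kappa>) [])"
    "\<forall>(\<tau>, C) \<in> set (kword \<kappa> e1 e2 []). 0 \<le> \<tau> \<and> C \<noteq> 0 \<and> C \<in> span {X, Y}"
    by (simp_all add: kword_def word_cost_def)
  ultimately show ?case by blast
next
  case (Cons x xs)
  then have ok: "kok x" "list_all kok xs" by auto
  note IH = Cons.IH[OF ok(2)]
  obtain a b where ab: "kvec \<kappa> e1 e2 x = a *\<^sub>R X + b *\<^sub>R Y" "a \<noteq> 0 \<or> b \<noteq> 0"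
    "qletter a b (ktime \<kappa> x) = qsign e1 e2 (kq \<kappa> x)" "ktime \<kappa> x * (\<bar>a\<bar> + \<kappa> * \<bar>b\<bar>) = kcost \<kappa> x" "0 \<le> ktime \<kappa> x"
    using kvec_comb[OF e k ok(1)] .
  have "word_prod (kword \<kappa> e1 e2 (x # xs)) = rot (ktime \<kappa> x) (kvec \<kappa> e1 e2 x) ** word_prod (kword \<kappa> e1 e2 xs)"
    by (simp add: word_prod_def kword_def)
  also have "\<dots> = Mq (qmul (qsign e1 e2 (kq \<kappa> x)) (qsign e1 e2 (kprod \<kappa> xs)))"
    unfolding ab(1) rot_qletter[OF ab(2)] ab(3) IH[THEN conjunct1] Mq_mult ..
  also have "\<dots> = Mq (qsign e1 e2 (kprod \<kappa> (x # xs)))" unfolding qsign_qmul[OF e, symmetric] by (simp add: kprod_def)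
  finally have 1: "word_prod (kword \<kappa> e1 e2 (x # xs)) = Mq (qsign e1 e2 (kprod \<kappa> (x # xs)))" .
  have 2: "word_cost X Y \<kappa> (kword \<kappa> e1 e2 (x # xs)) = sum_list (map (kcost \<kappa>) (x # xs))"
    using IH ab(4) by (simp add: word_cost_def kword_def ab(1) cost_comb del: Mq.simps)
  have 3: "\<forall>(\<tau>, C) \<in> set (kword \<kappa> e1 e2 (x # xs)). 0 \<le> \<tau> \<and> C \<noteq> 0 \<and> C \<in> span {X, Y}"
    using IH[THEN conjunct2, THEN conjunct2] ab comb_nonzero[OF ab(2)] span_comb[of "kvec \<kappa> e1 e2 x"] by (auto simp: kword_def)
  show ?case using 1 2 3 by blast
qed

section \<open>Symmetric images of the patterns\<close>

lemma W_vecs: "Wplus X Y \<kappa> = X - \<kappa> *\<^sub>R Y" "Wminus X Y \<kappa> = X + \<kappa> *\<^sub>R Y"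
  by (simp_all add: Wplus_def Wminus_def inners)

lemmas pat_simps = pattern_word_def label_vec_def W_vecs nu_lab_def ext_lab_def patI_def patII_def patIII_def

lemma pattern_word_I:
  assumes "P \<in> sym_images patI" "(tX, tY, 0) \<in> paramsI \<kappa>"
  shows "pattern_word X Y \<kappa> (tX, tY, 0) P \<in> thm21_words X Y \<kappa>"
  using assms unfolding thm21_words_def by blast

lemma pattern_word_II_III:
  assumes "P \<in> sym_images patII \<or> P \<in> sym_images patIII" "0 \<le> t"
  shows "pattern_word X Y \<kappa> (0, 0, t) P \<in> thm21_words X Y \<kappa>"
  using assms unfolding thm21_words_def paramsII_def by blast

text \<open>The second word is the first one read backwards, so reversal stays within the images of
  pattern (I): the first word arises from images involving \<open>Gvsig\<close>, the second from
  images without it.\<close>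

lemma pattern_I:
  assumes e: "e1 \<in> {1, -1}" "e2 \<in> {1, -1}" and p: "(tX, tY, 0) \<in> paramsI \<kappa>"
  shows "[(tY, - (e2 *\<^sub>R Y)), (tX, e1 *\<^sub>R X), (tY, e2 *\<^sub>R Y), (tX, - (e1 *\<^sub>R X))] \<in> thm21_words X Y \<kappa>"
    "[(tX, - (e1 *\<^sub>R X)), (tY, e2 *\<^sub>R Y), (tX, e1 *\<^sub>R X), (tY, - (e2 *\<^sub>R Y))] \<in> thm21_words X Y \<kappa>"
proof -
  note w = pattern_word_I[OF sym_images_foldrI p]
  show "[(tY, - (e2 *\<^sub>R Y)), (tX, e1 *\<^sub>R X), (tY, e2 *\<^sub>R Y), (tX, - (e1 *\<^sub>R X))] \<in> thm21_words X Y \<kappa>"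
    using e w[of "[Grho, Gvsig]"] w[of "[Gvsig]"] w[of "[Gnu, Gvsig]"] w[of "[Gnu, Grho, Gvsig]"]
    by (auto simp: pat_simps)
  show "[(tX, - (e1 *\<^sub>R X)), (tY, e2 *\<^sub>R Y), (tX, e1 *\<^sub>R X), (tY, - (e2 *\<^sub>R Y))] \<in> thm21_words X Y \<kappa>"
    using e w[of "[Grho]"] w[of "[]"] w[of "[Gnu]"] w[of "[Gnu, Grho]"]
    by (auto simp: pat_simps)
qed

text \<open>For orthogonal X and Y the labels W_+ and W_- stand for X - \<kappa> Y and X + \<kappa>
  Y, so e1 and e2 run through both labels and their negatives. The third and fourth word are
  reversals of each other.\<close>

lemma pattern_W:
  assumes e: "e1 \<in> {1, -1}" "e2 \<in> {1, -1}" and t: "0 \<le> t"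
  shows "[(pi, e1 *\<^sub>R X), (t, e1 *\<^sub>R X + (e2 * \<kappa>) *\<^sub>R Y), (pi, e1 *\<^sub>R X)] \<in> thm21_words X Y \<kappa>"
    "[(pi, e2 *\<^sub>R Y), (t, e1 *\<^sub>R X + (e2 * \<kappa>) *\<^sub>R Y), (pi, e2 *\<^sub>R Y)] \<in> thm21_words X Y \<kappa>"
    "[(pi, e1 *\<^sub>R X), (t, e1 *\<^sub>R X + (e2 * \<kappa>) *\<^sub>R Y), (pi, e2 *\<^sub>R Y)] \<in> thm21_words X Y \<kappa>"
    "[(pi, e2 *\<^sub>R Y), (t, e1 *\<^sub>R X + (e2 * \<kappa>) *\<^sub>R Y), (pi, e1 *\<^sub>R X)] \<in> thm21_words X Y \<kappa>"
proof -
  note w2 = pattern_word_II_III[OF disjI1[OF sym_images_foldrI] t, of \<kappa>] and w3 = pattern_word_II_III[OF disjI2[OF sym_images_foldrI] t, of \<kappa>]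
  show "[(pi, e1 *\<^sub>R X), (t, e1 *\<^sub>R X + (e2 * \<kappa>) *\<^sub>R Y), (pi, e1 *\<^sub>R X)] \<in> thm21_words X Y \<kappa>"
    using e w2[of "[]"] w2[of "[Grho]"] w2[of "[Gnu]"] w2[of "[Gnu, Grho]"] by (auto simp: pat_simps algebra_simps)
  show "[(pi, e2 *\<^sub>R Y), (t, e1 *\<^sub>R X + (e2 * \<kappa>) *\<^sub>R Y), (pi, e2 *\<^sub>R Y)] \<in> thm21_words X Y \<kappa>"
    using e w2[of "[Gvsig]"] w2[of "[Grho, Gvsig]"] w2[of "[Gnu, Gvsig]"] w2[of "[Gnu, Grho, Gvsig]"] by (auto simp: pat_simps algebra_simps)
  show "[(pi, e1 *\<^sub>R X), (t, e1 *\<^sub>R X + (e2 * \<kappa>) *\<^sub>R Y), (pi, e2 *\<^sub>R Y)] \<in> thm21_words X Y \<kappa>"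
    using e w3[of "[]"] w3[of "[Grho]"] w3[of "[Gnu]"] w3[of "[Gnu, Grho]"] by (auto simp: pat_simps algebra_simps)
  show "[(pi, e2 *\<^sub>R Y), (t, e1 *\<^sub>R X + (e2 * \<kappa>) *\<^sub>R Y), (pi, e1 *\<^sub>R X)] \<in> thm21_words X Y \<kappa>"
    using e w3[of "[Gvsig]"] w3[of "[Grho, Gvsig]"] w3[of "[Gnu, Gvsig]"] w3[of "[Gnu, Grho, Gvsig]"] by (auto simp: pat_simps algebra_simps)
qed

lemma subword_3: "0 \<le> a \<Longrightarrow> a \<le> A \<Longrightarrow> 0 \<le> c \<Longrightarrow> c \<le> C \<Longrightarrow> is_subword [(a, u), (b, v), (c, w)] [(A, u), (b, v), (C, w)]"
  unfolding is_subword_def by (rule exI[of _ 0], rule exI[of _ 2], rule exI[of _ a], rule exI[of _ c]) (simp add: numeral_2_eq_2)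

lemma subword_4_first: "0 \<le> a \<Longrightarrow> a \<le> A \<Longrightarrow> 0 \<le> c \<Longrightarrow> c \<le> C \<Longrightarrow> is_subword [(a, u), (b, v), (c, w)] [(A, u), (b, v), (C, w), d]"
  unfolding is_subword_def by (rule exI[of _ 0], rule exI[of _ 2], rule exI[of _ a], rule exI[of _ c]) (simp add: numeral_2_eq_2)

lemma subword_4_last: "0 \<le> a \<Longrightarrow> a \<le> A \<Longrightarrow> 0 \<le> c \<Longrightarrow> c \<le> C \<Longrightarrow> is_subword [(a, u), (b, v), (c, w)] [d, (A, u), (b, v), (C, w)]"
  unfolding is_subword_def by (rule exI[of _ 1], rule exI[of _ 3], rule exI[of _ a], rule exI[of _ c]) (simp add: numeral_3_eq_3)

lemma subword_4: "0 \<le> a \<Longrightarrow> a \<le> A \<Longrightarrow> 0 \<le> c \<Longrightarrow> c \<le> C \<Longrightarrow> is_subword [(a, u), b, b', (c, w)] [(A, u), b, b', (C, w)]"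
  unfolding is_subword_def by (rule exI[of _ 0], rule exI[of _ 3], rule exI[of _ a], rule exI[of _ c]) (simp add: numeral_3_eq_3)

text \<open>At \<open>A = B = pi / 2\<close> the relation holds because of the junk value \<open>tan (pi / 2) = 0\<close> on both sides.\<close>

lemma params_closed:
  assumes "sin A * cos B = \<kappa> * (cos A * sin B)" "0 < A" "A \<le> pi / 2" "0 \<le> B" "B \<le> pi / 2" "0 < \<kappa>"
  shows "(2 * A, 2 * B, 0) \<in> paramsI \<kappa>"
proof -
  have sA: "0 < sin A" using assms by (intro sin_gt_zero) auto
  have B: "B \<noteq> 0" using assms(1) sA by auto
  have "tan A = \<kappa> * tan B"
  proof (cases "A = pi / 2")
    case True
    have "cos A = 0" unfolding True by simp
    then have "cos B = 0" using assms(1) sA by simp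
    then show ?thesis using \<open>cos A = 0\<close> by (simp add: tan_def)
  next
    case False
    then have cA: "0 < cos A" using assms by (intro cos_gt_zero_pi) auto
    have "0 < sin B" using assms B by (intro sin_gt_zero) auto
    then have "cos B \<noteq> 0" using assms(1,6) sA cA by auto
    then show ?thesis using assms(1) cA by (simp add: tan_def field_simps)
  qed
  then show ?thesis using assms B by (auto simp: paramsI_def)
qed

text \<open>Both the word and its reversal are located in the patterns, because unfolding the
  coordinates may call for either.\<close>

lemma candidates_kword:
  assumes c: "(q, c) \<in> candidates \<kappa>" and k: "0 < \<kappa>" and e: "e1 \<in> {1, -1}" "e2 \<in> {1, -1}"
  obtains xs where "list_all kok xs" "kprod \<kappa> xs = q" "sum_list (map (kcost \<kappa>) xs) = c"
    "\<exists>P \<in> thm21_words X Y \<kappa>. is_subword (kword \<kappa> e1 e2 xs) P"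
    "\<exists>P \<in> thm21_words X Y \<kappa>. is_subword (kword \<kappa> e1 e2 (rev xs)) P"
proof -
  have n: "0 < sqrt (1 + \<kappa>\<^sup>2)" by (rule norm_sqrt)
  consider "(q, c) \<in> candI \<kappa>" | "(q, c) \<in> candXWX \<kappa>" | "(q, c) \<in> candYWY \<kappa>" | "(q, c) \<in> candXWY \<kappa>"
    using c by (auto simp: candidates_def)
  then show ?thesis
  proof cases
    case 1
    then obtain \<beta> a b \<alpha> A B where K: "(\<beta>, a, b, \<alpha>, A, B) \<in> params_YXYX \<kappa>"
      and q: "q = qmul (qmul (qmul (qY (- \<beta>)) (qX a)) (qY b)) (qX (- \<alpha>))" and cc: "c = 2 * \<kappa> * \<beta> + 2 * a + 2 * \<kappa> * b + 2 * \<alpha>"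
      by (auto simp: candI_def)
    have b: "0 \<le> \<beta>" "0 \<le> a" "0 \<le> b" "0 \<le> \<alpha>" "a \<le> A" "\<alpha> \<le> A" "b \<le> B" "\<beta> \<le> B" "A \<le> pi / 2" "B \<le> pi / 2"
      and rel: "sin A * cos B = \<kappa> * (cos A * sin B)"
      and cs: "\<beta> = 0 \<and> b = B \<or> \<alpha> = 0 \<and> a = A \<or> a = A \<and> b = B" using K by (auto simp: params_YXYX_def)
    have q1: "qX 0 = (1, 0, 0, 0)" "qY 0 = (1, 0, 0, 0)" by (simp_all add: qX_def qY_def)
    \<comment> \<open>For A = 0 all letters vanish, but pattern (I) demands positive times; the
      identity is then a single X-letter of time 0 inside pattern (II).\<close>
    show ?thesis
    proof (cases "A = 0")
      case True
      then have "sin B = 0" using rel k by simp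
      then have "B = 0" using b sin_gt_zero[of B] by force
      then have z: "\<beta> = 0" "a = 0" "b = 0" "\<alpha> = 0" using True b by auto
      have sub: "is_subword [(0, e1 *\<^sub>R X)] [(pi, e1 *\<^sub>R X), (0, e1 *\<^sub>R X + (e2 * \<kappa>) *\<^sub>R Y), (pi, e1 *\<^sub>R X)]" for e1 e2
        unfolding is_subword_def by (rule exI[of _ 0], rule exI[of _ 0], rule exI[of _ 0], rule exI[of _ 0]) simp
      show ?thesis
      proof (rule that[of "[(kX 1, 0)]"])
        show "kprod \<kappa> [(kX 1, 0)] = q" unfolding q z by (simp add: kprod_def q1)
        show "\<exists>P\<in>thm21_words X Y \<kappa>. is_subword (kword \<kappa> e1 e2 [(kX 1, 0)]) P"
          by (rule bexI[OF _ pattern_W(1)[OF e order_refl]]) (simp add: kword_def sub)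
        show "\<exists>P\<in>thm21_words X Y \<kappa>. is_subword (kword \<kappa> e1 e2 (rev [(kX 1, 0)])) P"
          by (rule bexI[OF _ pattern_W(1)[OF e order_refl]]) (simp add: kword_def sub)
      qed (use cc z in auto)
    next
      case False
      then have A: "0 < A" using b by simp
      have p: "(2 * A, 2 * B, 0) \<in> paramsI \<kappa>" by (rule params_closed[OF rel A b(9) _ b(10) k]) (use b in simp)
      note pat = pattern_I[OF _ _ p]
      consider "\<beta> = 0" "b = B" | "\<alpha> = 0" "a = A" | "a = A" "b = B" using cs by blast
      then show ?thesis
      proof cases
        case 1
        show ?thesis
        proof (rule that[of "[(kX 1, a), (kY 1, b), (kX (- 1), \<alpha>)]"])
          show "kprod \<kappa> [(kX 1, a), (kY 1, b), (kX (- 1), \<alpha>)] = q" unfolding q 1 by (simp add: kprod_def q1 qmul_assoc)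
          show "\<exists>P\<in>thm21_words X Y \<kappa>. is_subword (kword \<kappa> e1 e2 [(kX 1, a), (kY 1, b), (kX (- 1), \<alpha>)]) P"
            by (rule bexI[OF _ pat(1)[OF e]]) (use b 1 in \<open>simp add: kword_def subword_4_last\<close>)
          show "\<exists>P\<in>thm21_words X Y \<kappa>. is_subword (kword \<kappa> e1 e2 (rev [(kX 1, a), (kY 1, b), (kX (- 1), \<alpha>)])) P"
            by (rule bexI[OF _ pat(2)[OF e]]) (use b 1 in \<open>simp add: kword_def subword_4_first\<close>)
        qed (use b cc 1 in auto)
      next
        case 2
        show ?thesis
        proof (rule that[of "[(kY (- 1), \<beta>), (kX 1, a), (kY 1, b)]"])
          show "kprod \<kappa> [(kY (- 1), \<beta>), (kX 1, a), (kY 1, b)] = q" unfolding q 2 by (simp add: kprod_def q1 qmul_assoc)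
          show "\<exists>P\<in>thm21_words X Y \<kappa>. is_subword (kword \<kappa> e1 e2 [(kY (- 1), \<beta>), (kX 1, a), (kY 1, b)]) P"
            by (rule bexI[OF _ pat(1)[OF e]]) (use b 2 in \<open>simp add: kword_def subword_4_first\<close>)
          show "\<exists>P\<in>thm21_words X Y \<kappa>. is_subword (kword \<kappa> e1 e2 (rev [(kY (- 1), \<beta>), (kX 1, a), (kY 1, b)])) P"
            by (rule bexI[OF _ pat(2)[OF e]]) (use b 2 in \<open>simp add: kword_def subword_4_last\<close>)
        qed (use b cc 2 in auto)
      next
        case 3
        show ?thesis
        proof (rule that[of "[(kY (- 1), \<beta>), (kX 1, a), (kY 1, b), (kX (- 1), \<alpha>)]"])
          show "kprod \<kappa> [(kY (- 1), \<beta>), (kX 1, a), (kY 1, b), (kX (- 1), \<alpha>)] = q" unfolding q by (simp add: kprod_def qmul_assoc)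
          show "\<exists>P\<in>thm21_words X Y \<kappa>. is_subword (kword \<kappa> e1 e2 [(kY (- 1), \<beta>), (kX 1, a), (kY 1, b), (kX (- 1), \<alpha>)]) P"
            by (rule bexI[OF _ pat(1)[OF e]]) (use b 3 in \<open>simp add: kword_def subword_4\<close>)
          show "\<exists>P\<in>thm21_words X Y \<kappa>. is_subword (kword \<kappa> e1 e2 (rev [(kY (- 1), \<beta>), (kX 1, a), (kY 1, b), (kX (- 1), \<alpha>)])) P"
            by (rule bexI[OF _ pat(2)[OF e]]) (use b 3 in \<open>simp add: kword_def subword_4\<close>)
        qed (use b cc 3 in auto)
      qed
    qed
  next
    case 2
    then obtain \<alpha> \<tau> \<beta> where K: "(\<alpha>, \<tau>, \<beta>) \<in> params_W" and q: "q = qmul (qmul (qX \<alpha>) (qW \<kappa> \<tau>)) (qX \<beta>)"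
      and cc: "c = 2 * \<alpha> + 2 * \<beta> + 2 * sqrt (1 + \<kappa>\<^sup>2) * \<tau>" by (auto simp: candXWX_def)
    have b: "0 \<le> \<alpha>" "\<alpha> \<le> pi / 2" "0 \<le> \<tau>" "0 \<le> \<beta>" "\<beta> \<le> pi / 2" using K by (auto simp: params_W_def)
    have t: "0 \<le> 2 * \<tau> / sqrt (1 + \<kappa>\<^sup>2)" using b n by simp
    show ?thesis
    proof (rule that[of "[(kX 1, \<alpha>), (kW, \<tau>), (kX 1, \<beta>)]"])
      show "kprod \<kappa> [(kX 1, \<alpha>), (kW, \<tau>), (kX 1, \<beta>)] = q" unfolding q by (simp add: kprod_def qmul_assoc)
      show "\<exists>P\<in>thm21_words X Y \<kappa>. is_subword (kword \<kappa> e1 e2 [(kX 1, \<alpha>), (kW, \<tau>), (kX 1, \<beta>)]) P"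
        by (rule bexI[OF _ pattern_W(1)[OF e t]]) (use b in \<open>simp add: kword_def subword_3\<close>)
      show "\<exists>P\<in>thm21_words X Y \<kappa>. is_subword (kword \<kappa> e1 e2 (rev [(kX 1, \<alpha>), (kW, \<tau>), (kX 1, \<beta>)])) P"
        by (rule bexI[OF _ pattern_W(1)[OF e t]]) (use b in \<open>simp add: kword_def subword_3\<close>)
    qed (use b cc in auto)
  next
    case 3
    then obtain \<alpha> \<tau> \<beta> where K: "(\<alpha>, \<tau>, \<beta>) \<in> params_W" and q: "q = qmul (qmul (qY \<alpha>) (qW \<kappa> \<tau>)) (qY \<beta>)"
      and cc: "c = 2 * \<kappa> * \<alpha> + 2 * \<kappa> * \<beta> + 2 * sqrt (1 + \<kappa>\<^sup>2) * \<tau>" by (auto simp: candYWY_def)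
    have b: "0 \<le> \<alpha>" "\<alpha> \<le> pi / 2" "0 \<le> \<tau>" "0 \<le> \<beta>" "\<beta> \<le> pi / 2" using K by (auto simp: params_W_def)
    have t: "0 \<le> 2 * \<tau> / sqrt (1 + \<kappa>\<^sup>2)" using b n by simp
    show ?thesis
    proof (rule that[of "[(kY 1, \<alpha>), (kW, \<tau>), (kY 1, \<beta>)]"])
      show "kprod \<kappa> [(kY 1, \<alpha>), (kW, \<tau>), (kY 1, \<beta>)] = q" unfolding q by (simp add: kprod_def qmul_assoc)
      show "\<exists>P\<in>thm21_words X Y \<kappa>. is_subword (kword \<kappa> e1 e2 [(kY 1, \<alpha>), (kW, \<tau>), (kY 1, \<beta>)]) P"
        by (rule bexI[OF _ pattern_W(2)[OF e t]]) (use b in \<open>simp add: kword_def subword_3\<close>)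
      show "\<exists>P\<in>thm21_words X Y \<kappa>. is_subword (kword \<kappa> e1 e2 (rev [(kY 1, \<alpha>), (kW, \<tau>), (kY 1, \<beta>)])) P"
        by (rule bexI[OF _ pattern_W(2)[OF e t]]) (use b in \<open>simp add: kword_def subword_3\<close>)
    qed (use b cc in auto)
  next
    case 4
    then obtain \<alpha> \<tau> \<beta> where K: "(\<alpha>, \<tau>, \<beta>) \<in> params_W" and q: "q = qmul (qmul (qX \<alpha>) (qW \<kappa> \<tau>)) (qY \<beta>)"
      and cc: "c = 2 * \<alpha> + 2 * \<kappa> * \<beta> + 2 * sqrt (1 + \<kappa>\<^sup>2) * \<tau>" by (auto simp: candXWY_def)
    have b: "0 \<le> \<alpha>" "\<alpha> \<le> pi / 2" "0 \<le> \<tau>" "0 \<le> \<beta>" "\<beta> \<le> pi / 2" using K by (auto simp: params_W_def)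
    have t: "0 \<le> 2 * \<tau> / sqrt (1 + \<kappa>\<^sup>2)" using b n by simp
    show ?thesis
    proof (rule that[of "[(kX 1, \<alpha>), (kW, \<tau>), (kY 1, \<beta>)]"])
      show "kprod \<kappa> [(kX 1, \<alpha>), (kW, \<tau>), (kY 1, \<beta>)] = q" unfolding q by (simp add: kprod_def qmul_assoc)
      show "\<exists>P\<in>thm21_words X Y \<kappa>. is_subword (kword \<kappa> e1 e2 [(kX 1, \<alpha>), (kW, \<tau>), (kY 1, \<beta>)]) P"
        by (rule bexI[OF _ pattern_W(3)[OF e t]]) (use b in \<open>simp add: kword_def subword_3\<close>)
      show "\<exists>P\<in>thm21_words X Y \<kappa>. is_subword (kword \<kappa> e1 e2 (rev [(kX 1, \<alpha>), (kW, \<tau>), (kY 1, \<beta>)])) P"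
        by (rule bexI[OF _ pattern_W(4)[OF e t]]) (use b in \<open>simp add: kword_def subword_3\<close>)
    qed (use b cc in auto)
  qed
qed

lemma candidates_realize:
  assumes c: "(qabs q0, c) \<in> candidates \<kappa>" and k: "0 < \<kappa>"
  obtains w P where "is_decomposition X Y (Mq q0) w" "word_cost X Y \<kappa> w = c" "P \<in> thm21_words X Y \<kappa>" "is_subword w P"
proof -
  obtain q where q: "qabs q0 = q" by simp
  have c': "(q, c) \<in> candidates \<kappa>" using c unfolding q .
  obtain e1 e2 :: real and rv where e: "e1 \<in> {1, -1}" "e2 \<in> {1, -1}" and
    q0: "q0 = qsign e1 e2 (if rv then qrev q else q) \<or> q0 = - qsign e1 e2 (if rv then qrev q else q)"
    by (rule qabs_unfold[OF q])
  obtain xs where xs: "list_all kok xs" "kprod \<kappa> xs = q" "sum_list (map (kcost \<kappa>) xs) = c"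
    and sub: "\<exists>P \<in> thm21_words X Y \<kappa>. is_subword (kword \<kappa> e1 e2 xs) P"
    "\<exists>P \<in> thm21_words X Y \<kappa>. is_subword (kword \<kappa> e1 e2 (rev xs)) P"
    by (rule candidates_kword[OF c' k e])
  define ys where "ys = (if rv then rev xs else xs)"
  have ys: "list_all kok ys" "sum_list (map (kcost \<kappa>) ys) = c" using xs(1,3) by (simp_all add: ys_def rev_map[symmetric])
  have prod: "kprod \<kappa> ys = (if rv then qrev q else q)" using xs(2) by (simp add: ys_def kprod_rev)
  obtain P where P: "P \<in> thm21_words X Y \<kappa>" "is_subword (kword \<kappa> e1 e2 ys) P"
    using sub by (cases rv) (auto simp: ys_def)
  note kp = kword_props[OF e k ys(1)]
  have "word_prod (kword \<kappa> e1 e2 ys) = Mq (qsign e1 e2 (if rv then qrev q else q))" using kp unfolding prod by (rule conjunct1)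
  also have "\<dots> = Mq q0" using q0
  proof
    assume "q0 = qsign e1 e2 (if rv then qrev q else q)" then show ?thesis by (simp only:)
  next
    assume "q0 = - qsign e1 e2 (if rv then qrev q else q)" then show ?thesis by (simp only: Mq_minus)
  qed
  finally have "is_decomposition X Y (Mq q0) (kword \<kappa> e1 e2 ys)" unfolding is_decomposition_def using kp by blast
  moreover have "word_cost X Y \<kappa> (kword \<kappa> e1 e2 ys) = c" unfolding kp[THEN conjunct2, THEN conjunct1] by (rule ys(2))
  ultimately show ?thesis using that P by blast
qed

end

theorem theorem2p1:
  fixes X Y :: "real^3" and \<kappa> :: real
  assumes "norm X = 1" and "norm Y = 1" and "X \<bullet> Y = 0"
    and "0 < \<kappa>" and "\<kappa> \<le> 1"
  shows "\<forall>g \<in> SO3. \<exists>w. is_optimal X Y \<kappa> g w \<and>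
           (\<exists>P \<in> thm21_words X Y \<kappa>. is_subword w P)"
proof
  interpret frame X Y using assms by unfold_locales
  note k = assms(4,5)
  fix g assume g: "g \<in> SO3"
  obtain s t r where gq: "g = Mq (qmul (qmul (qX s) (qY t)) (qX r))" using SO3_quat[OF g] .
  define q0 where "q0 = qmul (qmul (qX s) (qY t)) (qX r)"
  have gq0: "g = Mq q0" using gq by (simp only: q0_def)
  have n0: "qnorm2 q0 = 1" unfolding q0_def qnorm2_qmul by (simp add: qX_def qY_def)
  \<comment> \<open>Every decomposition of g lifts to a quaternion with the same absolute
    coordinates as \<open>q0\<close>, so the single set C of candidate costs bounds all
    decompositions at once.\<close>
  have bound: "\<exists>c. c \<le> word_cost X Y \<kappa> w \<and> (qabs q0, c) \<in> candidates \<kappa>" if "is_decomposition X Y g w" for w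
  proof -
    obtain ls where ls: "letters_ok ls" "Mq (qprod ls) = g" "lcost \<kappa> ls = word_cost X Y \<kappa> w"
      using decomposition_letters[OF \<open>is_decomposition X Y g w\<close>] .
    have "qnorm2 (qprod ls) = 1" using ls(1)
    proof (induction ls)
      case Nil show ?case by (simp add: qprod_def)
    next
      case (Cons l ls)
      obtain t a b where l: "l = (t, a, b)" by (cases l) auto
      have "a \<noteq> 0 \<or> b \<noteq> 0" "letters_ok ls" using Cons.prems by (auto simp: letters_ok_def l)
      then show ?case using Cons.IH by (simp add: qprod_def l qnorm2_qmul qnorm2_qletter)
    qed
    then have "qabs (qprod ls) = qabs q0" using Mq_inj_abs ls(2) gq0 n0 by metis
    then show ?thesis using lower_bound[OF ls(1) k] ls(3) by metis
  qed
  define C where "C = {c. (qabs q0, c) \<in> candidates \<kappa>}"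
  have "\<exists>w. is_decomposition X Y g w"
  proof -
    \<comment> \<open>A negative angle becomes a positive time with the opposite generator.\<close>
    define ls where "ls = [(\<bar>2 * s\<bar>, (if 0 \<le> s then 1 else - 1) *\<^sub>R X), (\<bar>2 * t\<bar>, (if 0 \<le> t then 1 else - 1) *\<^sub>R Y), (\<bar>2 * r\<bar>, (if 0 \<le> r then 1 else - 1) *\<^sub>R X)]"
    have x: "rot \<bar>2 * s\<bar> ((if 0 \<le> s then 1 else - 1) *\<^sub>R X) = Mq (qX s)" for s
      using rot_qletter[of "if 0 \<le> s then 1 else - 1" 0 "\<bar>2 * s\<bar>"] by (auto simp: qletter_def qX_def Let_def simp del: Mq.simps)
    have y: "rot \<bar>2 * t\<bar> ((if 0 \<le> t then 1 else - 1) *\<^sub>R Y) = Mq (qY t)" for t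
      using rot_qletter[of 0 "if 0 \<le> t then 1 else - 1" "\<bar>2 * t\<bar>"] by (auto simp: qletter_def qY_def Let_def simp del: Mq.simps)
    have "word_prod ls = g" unfolding ls_def word_prod_def gq
      by (simp add: x y Mq_mult matrix_mul_assoc del: Mq.simps)
    moreover have "X \<noteq> 0" "Y \<noteq> 0" "X \<in> span {X, Y}" "Y \<in> span {X, Y}" using nX nY by (auto simp: span_base)
    ultimately have "is_decomposition X Y g ls" unfolding is_decomposition_def ls_def by (auto simp: span_neg)
    then show ?thesis by blast
  qed
  then have "C \<noteq> {}" using bound unfolding C_def by blast
  moreover have "compact C"
  proof -
    \<comment> \<open>C is the fibre of the compact set of candidates over one endpoint, so a
      cheapest candidate exists.\<close>
    have "C = snd ` (candidates \<kappa> \<inter> ({qabs q0} \<times> UNIV))" unfolding C_def by force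
    moreover have "compact (candidates \<kappa> \<inter> ({qabs q0} \<times> UNIV))"
      by (intro compact_Int_closed compact_candidates closed_Times) auto
    ultimately show ?thesis by (simp add: compact_continuous_image continuous_on_snd)
  qed
  ultimately obtain c where c: "c \<in> C" "\<And>c'. c' \<in> C \<Longrightarrow> c \<le> c'" using compact_attains_inf[of C] by blast
  have cc: "(qabs q0, c) \<in> candidates \<kappa>" using c(1) by (simp only: C_def mem_Collect_eq)
  obtain w P where w: "is_decomposition X Y g w" "word_cost X Y \<kappa> w = c" "P \<in> thm21_words X Y \<kappa>" "is_subword w P"
    unfolding gq0 by (rule candidates_realize[OF cc k(1)])
  have "word_cost X Y \<kappa> w = Inf {word_cost X Y \<kappa> w' | w'. is_decomposition X Y g w'}"
  proof (rule cInf_eq_minimum[symmetric])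
    show "word_cost X Y \<kappa> w \<in> {word_cost X Y \<kappa> w' | w'. is_decomposition X Y g w'}" using w(1) by blast
    fix v assume "v \<in> {word_cost X Y \<kappa> w' | w'. is_decomposition X Y g w'}"
    then obtain w' where "v = word_cost X Y \<kappa> w'" "is_decomposition X Y g w'" by blast
    then show "word_cost X Y \<kappa> w \<le> v" using bound c(2) w(2) unfolding C_def by fastforce
  qed
  then show "\<exists>w. is_optimal X Y \<kappa> g w \<and> (\<exists>P \<in> thm21_words X Y \<kappa>. is_subword w P)"
    using w unfolding is_optimal_def by blast
qed

end
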